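(* Let $H$ be a $2$-connected plane graph. Then $G(L(H))$ has a rhombic strip if and only if $H$ has a Hamiltonian cycle $C=(v_1,\ldots,v_n)$ that satisfies one of the following two conditions, which are equivalent: (i) the cycle $C$ can be split into two paths $A$ and $B$ such that every $C$-chord has one endpoint on $A$ and the other endpoint on $B$; (ii) there are no three $C$-chords $(v_{i_1},v_{i_2}),(v_{i_3},v_{i_4}),(v_{i_5},v_{i_6})$ with $1\leq i_1<i_2\leq i_3<i_4\leq i_5<i_6\leq n+1$, where $v_{n+1}=v_1$.
   Context: For a plane graph $H$, $L(H)$ is the graded poset on the vertices (rank $0$), edges (rank $1$) and faces including the outer face (rank $2$) of $H$, together with a minimum $\emptyset$ (rank $-1$) and a maximum $H$ (rank $3$), ordered by inclusion; $G(L(H))$ is its cover graph. For a Hamiltonian cycle $C$ of a graph $H$, the $C$-chords are the edges of $H$ not on $C$. The cylinder is the quotient of $\mathbb{R}^2$ by $(x,y)\sim(x+1,y)$. For a graded poset with rank function $\rho$, a rhombic strip is a spanning subgraph of its cover graph embedded on the cylinder such that each vertex $x$ lies at height $\rho(x)$, edges are straight segments with no crossings, and every face of the embedding is a $4$-cycle $(a,b,c,d)$ with $\rho(a)=\rho(c)=r$, $\rho(b)=r-1$, $\rho(d)=r+1$ for some $r$.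
   Formalization: Condition (ii) is required for every choice of the starting vertex v_1 on C, not for one fixed labelling; for a fixed labelling the claim fails for the hexagon with chords v_2v_4, v_4v_6, v_6v_2. *)

theory Defs
  imports "HOL-Analysis.Analysis"
begin

section \<open>Plane graphs\<close>

text \<open>A plane graph is given by its finite set \<open>V\<close> of vertices, which are points of the plane, and
  its finite set \<open>E\<close> of edges, which are closed arcs (as point sets) meeting \<open>V\<close> exactly in their
  two end points. So \<open>e \<inter> V\<close> is the pair of end points of the edge \<open>e\<close>. Graphs are simple: the last
  conjunct excludes parallel edges, and loops are not arcs.\<close>

definition plane_graph :: "complex set \<Rightarrow> complex set set \<Rightarrow> bool" where
  "plane_graph V E \<longleftrightarrow>
     finite V \<and> finite E \<and>
     (\<forall>e\<in>E. \<exists>g. arc g \<and> path_image g = e \<and> e \<inter> V = {pathstart g, pathfinish g}) \<and>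
     (\<forall>e\<in>E. \<forall>e'\<in>E. e \<noteq> e' \<longrightarrow> e \<inter> e' \<subseteq> V \<and> e \<inter> V \<noteq> e' \<inter> V)"

definition adjacent :: "complex set \<Rightarrow> complex set set \<Rightarrow> complex \<Rightarrow> complex \<Rightarrow> bool" where
  "adjacent V E u v \<longleftrightarrow> u \<noteq> v \<and> (\<exists>e\<in>E. e \<inter> V = {u, v})"

definition connected_without :: "complex set \<Rightarrow> complex set set \<Rightarrow> complex set \<Rightarrow> bool" where
  "connected_without V E X \<longleftrightarrow>
     (\<forall>u\<in>V - X. \<forall>w\<in>V - X. (u, w) \<in> {(a, b). a \<in> V - X \<and> b \<in> V - X \<and> adjacent V E a b}\<^sup>*)"

definition two_connected :: "complex set \<Rightarrow> complex set set \<Rightarrow> bool" where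
  "two_connected V E \<longleftrightarrow>
     card V > 2 \<and> (\<forall>X. X \<subseteq> V \<and> card X < 2 \<longrightarrow> connected_without V E X)"

text \<open>The outer face is one of the components.\<close>

definition plane_faces :: "complex set \<Rightarrow> complex set set \<Rightarrow> complex set set" where
  "plane_faces V E = components (- (V \<union> \<Union>E))"


section \<open>Hamiltonian cycles and chords\<close>

definition hamiltonian_cycle :: "complex set \<Rightarrow> complex set set \<Rightarrow> complex list \<Rightarrow> bool" where
  "hamiltonian_cycle V E C \<longleftrightarrow>
     3 \<le> length C \<and> distinct C \<and> set C = V \<and>
     (\<forall>i<length C. adjacent V E (C ! i) (C ! (Suc i mod length C)))"

definition chords :: "complex set \<Rightarrow> complex set set \<Rightarrow> complex list \<Rightarrow> complex set set" where
  "chords V E C = {e \<in> E. \<not> (\<exists>i<length C. e \<inter> V = {C ! i, C ! (Suc i mod length C)})}"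

text \<open>Splitting the cycle into two paths: the paths are vertex-disjoint, nonempty (possibly
  consisting of a single vertex) and together contain all vertices of the cycle.\<close>

definition splittable :: "complex set \<Rightarrow> complex set set \<Rightarrow> complex list \<Rightarrow> bool" where
  "splittable V E C \<longleftrightarrow>
     (\<exists>k A B. rotate k C = A @ B \<and> A \<noteq> [] \<and> B \<noteq> [] \<and>
        (\<forall>e\<in>chords V E C. \<exists>a\<in>set A. \<exists>b\<in>set B. e \<inter> V = {a, b}))"

text \<open>\<open>cyc_nth C i\<close> is the vertex \<open>v\<^sub>i\<close> of \<open>C = (v\<^sub>1, \<dots>, v\<^sub>n)\<close>, counted from 1 and with
  \<open>v\<^bsub>n+1\<^esub> = v\<^sub>1\<close>.\<close>

definition cyc_nth :: "complex list \<Rightarrow> nat \<Rightarrow> complex" where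
  "cyc_nth C i = C ! ((i - 1) mod length C)"

definition three_chords_in_order :: "complex set \<Rightarrow> complex set set \<Rightarrow> complex list \<Rightarrow> bool" where
  "three_chords_in_order V E C \<longleftrightarrow>
     (\<exists>i1 i2 i3 i4 i5 i6.
        1 \<le> i1 \<and> i1 < i2 \<and> i2 \<le> i3 \<and> i3 < i4 \<and> i4 \<le> i5 \<and> i5 < i6 \<and> i6 \<le> length C + 1 \<and>
        (\<exists>e\<in>chords V E C. e \<inter> V = {cyc_nth C i1, cyc_nth C i2}) \<and>
        (\<exists>e\<in>chords V E C. e \<inter> V = {cyc_nth C i3, cyc_nth C i4}) \<and>
        (\<exists>e\<in>chords V E C. e \<inter> V = {cyc_nth C i5, cyc_nth C i6}))"

text \<open>A cycle has no distinguished first vertex, so the condition ranges over all choices of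
  \<open>v\<^sub>1\<close> on \<open>C\<close>. This matters: in the hexagon \<open>v\<^sub>1, \<dots>, v\<^sub>6\<close> with the chords \<open>v\<^sub>2 v\<^sub>4\<close>, \<open>v\<^sub>4 v\<^sub>6\<close>,
  \<open>v\<^sub>6 v\<^sub>2\<close> three chords as above are found when the numbering starts at \<open>v\<^sub>2\<close>, but not when it
  starts at \<open>v\<^sub>1\<close>.\<close>

definition no_three_chords :: "complex set \<Rightarrow> complex set set \<Rightarrow> complex list \<Rightarrow> bool" where
  "no_three_chords V E C \<longleftrightarrow> (\<forall>k. \<not> three_chords_in_order V E (rotate k C))"


section \<open>The graded poset of a plane graph\<close>

datatype cell =
    Bot_cell
  | Vertex_cell complex
  | Edge_cell "complex set"
  | Face_cell "complex set"
  | Top_cell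

text \<open>Inclusion refers to closed cells: a face is a connected component of the open complement of the
  graph, and its closure contains exactly the vertices and edges on its boundary. The maximum, which
  stands for the whole graph, is represented by the whole plane.\<close>

fun cell_points :: "cell \<Rightarrow> complex set" where
  "cell_points Bot_cell = {}"
| "cell_points (Vertex_cell v) = {v}"
| "cell_points (Edge_cell e) = e"
| "cell_points (Face_cell f) = closure f"
| "cell_points Top_cell = UNIV"

definition cell_le :: "cell \<Rightarrow> cell \<Rightarrow> bool" where
  "cell_le x y \<longleftrightarrow> cell_points x \<subseteq> cell_points y"

fun cell_rank :: "cell \<Rightarrow> int" where
  "cell_rank Bot_cell = -1"
| "cell_rank (Vertex_cell v) = 0"
| "cell_rank (Edge_cell e) = 1"
| "cell_rank (Face_cell f) = 2"
| "cell_rank Top_cell = 3"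

definition plane_cells :: "complex set \<Rightarrow> complex set set \<Rightarrow> cell set" where
  "plane_cells V E =
     {Bot_cell, Top_cell} \<union> Vertex_cell ` V \<union> Edge_cell ` E \<union> Face_cell ` plane_faces V E"


section \<open>The cylinder\<close>

text \<open>The quotient of the plane by \<open>(x, y) \<sim> (x + 1, y)\<close> is realised as the product of the unit
  circle and the line, with quotient map \<open>cyl\<close>.\<close>

definition cylinder :: "(complex \<times> real) set" where
  "cylinder = sphere 0 1 \<times> UNIV"

definition cyl :: "real \<times> real \<Rightarrow> complex \<times> real" where
  "cyl p = (cis (2 * pi * fst p), snd p)"

lemma cyl_eq_iff: "cyl p = cyl q \<longleftrightarrow> (\<exists>k::int. q = (fst p + of_int k, snd p))"
proof -
  have *: "2 * pi * fst q = 2 * pi * fst p + 2 * pi * n \<longleftrightarrow> fst q = fst p + n" for n :: int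
  proof -
    have "2 * pi * fst q = 2 * pi * fst p + 2 * pi * n \<longleftrightarrow>
          (2 * pi) * fst q = (2 * pi) * (fst p + n)"
      by (simp add: algebra_simps)
    then show ?thesis
      by simp
  qed
  have "cis (2 * pi * fst p) = cis (2 * pi * fst q) \<longleftrightarrow>
        sin (2 * pi * fst q) = sin (2 * pi * fst p) \<and> cos (2 * pi * fst q) = cos (2 * pi * fst p)"
    by (auto simp: complex_eq_iff)
  also have "\<dots> \<longleftrightarrow> (\<exists>n::int. fst q = fst p + n)"
    unfolding sin_cos_eq_iff * ..
  finally show ?thesis
    by (auto simp: cyl_def prod_eq_iff)
qed

lemma continuous_on_cyl: "continuous_on A cyl"
  unfolding cyl_def by (intro continuous_intros)

lemma cyl_polar:
  assumes "norm z = 1"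
  shows "cyl (t + Arg (z / cis (2 * pi * t)) / (2 * pi), y) = (z, y)"
proof -
  let ?w = "z / cis (2 * pi * t)"
  have "norm ?w = 1"
    using assms by (simp add: norm_divide)
  then have "cis (Arg ?w) = ?w"
    by (metis cis_Arg norm_zero zero_neq_one sgn_div_norm inverse_1 scaleR_one)
  moreover have "2 * pi * (t + Arg ?w / (2 * pi)) = 2 * pi * t + Arg ?w"
    by (simp add: field_simps)
  ultimately show ?thesis
    by (simp add: cyl_def flip: cis_mult)
qed

lemma quotient_map_cyl: "quotient_map euclidean (top_of_set cylinder) cyl"
proof (rule continuous_open_imp_quotient_map)
  have sub: "range cyl \<subseteq> cylinder"
    by (auto simp: cyl_def cylinder_def)
  then show "continuous_map euclidean (top_of_set cylinder) cyl"
    using continuous_on_cyl[of UNIV] by (auto simp: continuous_map_in_subtopology)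
  show "cyl ` topspace euclidean = topspace (top_of_set cylinder)"
  proof -
    have "w \<in> range cyl" if "w \<in> cylinder" for w
    proof -
      have "norm (fst w) = 1"
        using that by (auto simp: cylinder_def)
      from cyl_polar[OF this, of 0 "snd w"] show ?thesis
        by (metis prod.collapse rangeI)
    qed
    then show ?thesis
      using sub by auto
  qed
  show "open_map euclidean (top_of_set cylinder) cyl"
    unfolding open_map_def
  proof (intro allI impI)
    fix U :: "(real \<times> real) set"
    assume "openin euclidean U"
    then have U: "open U"
      by simp
    have "\<exists>T. open T \<and> cyl p \<in> T \<and> cylinder \<inter> T \<subseteq> cyl ` U" if p: "p \<in> U" for p
    proof -
      define g where
        "g w = (fst p + Arg (fst w / cis (2 * pi * fst p)) / (2 * pi), snd w)" for w :: "complex \<times> real"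
      have "isCont g (cyl p)"
        unfolding g_def
        by (intro continuous_intros isCont_o2[OF _ continuous_at_Arg]) (auto simp: cyl_def)
      moreover have "g (cyl p) = p"
        by (simp add: g_def cyl_def)
      ultimately obtain T where T: "open T" "cyl p \<in> T" "\<And>w. w \<in> T \<Longrightarrow> g w \<in> U"
        using U p unfolding continuous_at_open by metis
      have "w \<in> cyl ` U" if "w \<in> cylinder \<inter> T" for w
      proof -
        have "cyl (g w) = w"
          using that cyl_polar[of "fst w" "fst p" "snd w"]
          by (auto simp: g_def cylinder_def)
        then show ?thesis
          using T(3)[of w] that by (metis IntD2 imageI)
      qed
      then show ?thesis
        using T by blast
    qed
    then obtain T where T: "\<And>p. p \<in> U \<Longrightarrow> open (T p) \<and> cyl p \<in> T p \<and> cylinder \<inter> T p \<subseteq> cyl ` U"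
      by metis
    then have "cyl ` U = cylinder \<inter> (\<Union>p\<in>U. T p)"
      using sub by blast
    then show "openin (top_of_set cylinder) (cyl ` U)"
      using T by (metis open_UN openin_open_Int)
  qed
qed

text \<open>A straight segment on the cylinder is the image of a straight segment in the plane.\<close>

definition straight_segment :: "complex \<times> real \<Rightarrow> complex \<times> real \<Rightarrow> (complex \<times> real) set \<Rightarrow> bool" where
  "straight_segment u v S \<longleftrightarrow> (\<exists>p q. cyl p = u \<and> cyl q = v \<and> S = cyl ` closed_segment p q)"


section \<open>Rhombic strips\<close>

text \<open>A poset is given by its carrier \<open>P\<close> and its order relation \<open>le\<close>, and its cover graph by the
  set of its edges, which are two-element subsets of \<open>P\<close>.\<close>

definition covers :: "'a set \<Rightarrow> ('a \<Rightarrow> 'a \<Rightarrow> bool) \<Rightarrow> 'a \<Rightarrow> 'a \<Rightarrow> bool" where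
  "covers P le x y \<longleftrightarrow>
     x \<in> P \<and> y \<in> P \<and> x \<noteq> y \<and> le x y \<and> (\<forall>z\<in>P. le x z \<and> le z y \<longrightarrow> z = x \<or> z = y)"

definition cover_graph :: "'a set \<Rightarrow> ('a \<Rightarrow> 'a \<Rightarrow> bool) \<Rightarrow> 'a set set" where
  "cover_graph P le = {{x, y} | x y. covers P le x y}"

text \<open>A drawing of the graph with vertex set \<open>P\<close> and edge set \<open>G\<close> puts the vertex \<open>x\<close> at the point
  \<open>pos x\<close> of the cylinder and represents the edge \<open>e\<close> by the point set \<open>crv e\<close>.\<close>

definition straight_cylinder_embedding ::
  "'a set \<Rightarrow> 'a set set \<Rightarrow> ('a \<Rightarrow> int) \<Rightarrow> ('a \<Rightarrow> complex \<times> real) \<Rightarrow> ('a set \<Rightarrow> (complex \<times> real) set) \<Rightarrow> bool"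
where
  "straight_cylinder_embedding P G \<rho> pos crv \<longleftrightarrow>
     inj_on pos P \<and>
     (\<forall>x\<in>P. pos x \<in> cylinder \<and> snd (pos x) = of_int (\<rho> x)) \<and>
     (\<forall>x y. {x, y} \<in> G \<longrightarrow> straight_segment (pos x) (pos y) (crv {x, y})) \<and>
     (\<forall>e\<in>G. crv e \<inter> pos ` P = pos ` e) \<and>
     (\<forall>e\<in>G. \<forall>e'\<in>G. e \<noteq> e' \<longrightarrow> crv e \<inter> crv e' = pos ` (e \<inter> e'))"

text \<open>All faces of the drawing, including the two unbounded ones.\<close>

definition drawing_faces ::
  "'a set \<Rightarrow> 'a set set \<Rightarrow> ('a \<Rightarrow> complex \<times> real) \<Rightarrow> ('a set \<Rightarrow> (complex \<times> real) set) \<Rightarrow>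
   (complex \<times> real) set set" where
  "drawing_faces P G pos crv = components (cylinder - (pos ` P \<union> (\<Union>e\<in>G. crv e)))"

text \<open>The faces of a drawing of a finite graph are relatively open in the cylinder, and the cylinder is
  closed, so that \<open>closure F - F\<close> is the boundary of the face \<open>F\<close> in the cylinder.\<close>

definition rhombic_face ::
  "'a set set \<Rightarrow> ('a \<Rightarrow> int) \<Rightarrow> ('a set \<Rightarrow> (complex \<times> real) set) \<Rightarrow> (complex \<times> real) set \<Rightarrow> bool"
where
  "rhombic_face G \<rho> crv F \<longleftrightarrow>
     (\<exists>a b c d r. distinct [a, b, c, d] \<and>
        {a, b} \<in> G \<and> {b, c} \<in> G \<and> {c, d} \<in> G \<and> {d, a} \<in> G \<and>
        \<rho> a = r \<and> \<rho> c = r \<and> \<rho> b = r - 1 \<and> \<rho> d = r + 1 \<and>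
        closure F - F = crv {a, b} \<union> crv {b, c} \<union> crv {c, d} \<union> crv {d, a})"

definition has_rhombic_strip :: "'a set \<Rightarrow> ('a \<Rightarrow> 'a \<Rightarrow> bool) \<Rightarrow> ('a \<Rightarrow> int) \<Rightarrow> bool" where
  "has_rhombic_strip P le \<rho> \<longleftrightarrow>
     (\<exists>G pos crv. G \<subseteq> cover_graph P le \<and>
        straight_cylinder_embedding P G \<rho> pos crv \<and>
        (\<forall>F\<in>drawing_faces P G pos crv. rhombic_face G \<rho> crv F))"

end

theory Submission
  imports Defs
begin

text \<open>From a strip to the cycle: consecutive vertices on level 0 of a rhombic strip belong to a common
  rhombus, whose upper cell is an edge of \<open>H\<close> that joins them; these edges form a Hamiltonian cycle \<open>C\<close>. The
  zigzag between edges and faces is a closed walk in the dual graph that crosses every chord. As there are at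
  most two more faces than chords, it crosses \<open>C\<close> exactly twice, and by parity every chord
  separates the two crossed edges of \<open>C\<close>, which therefore split \<open>C\<close> into the paths \<open>A\<close> and \<open>B\<close>.

  From the cycle to a strip: the chords inside \<open>C\<close>, sorted along \<open>A\<close>, the edge from \<open>A\<close> to \<open>B\<close>, the chords
  outside \<open>C\<close>, sorted along \<open>B\<close>, and the edge from \<open>B\<close> to \<open>A\<close> are the edges crossed by a Hamiltonian cycle of
  the dual graph. Inserting the remaining edges of \<open>C\<close> yields a cyclic sequence of all edges in which
  consecutive ones share a vertex and a face. It is drawn with equidistant cells on each level.

  For the equivalence of the two conditions, choose on each side of \<open>C\<close> two disjoint inclusion-minimal arcs
  cut off by chords. If no three chords lie in order, then some edge of an arc and some edge of the
  other one can be chosen such that every chord separates them.\<close>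

section \<open>Arcs and theta curves\<close>

text \<open>Euler's formula enters only as an inequality: faces outnumber chords by at most two, by
  Janiszewski's theorem, one chord at a time. It serves both directions: it limits the crossings of
  the dual walk, and it shows that the faces met by the constructed strip are all faces. That the
  zigzag crosses every chord is not automatic, as a cell may have a single neighbour on the next
  level. A chord has just one vertex below it, since two would give consecutive vertices of
  \<open>C\<close>. So the chord and its two neighbours on level 1 share a vertex; if they also
  shared a face above, three edges at one vertex would lie on the boundary of one face, which a
  theta curve excludes. The order of the steps is forced: finiteness of the set of faces is obtained
  from a Hamiltonian cycle, and that the edges of a strip join consecutive ranks is obtained from
  finiteness. So the cycle is read off from level 0 alone, which no edge of the cover graph can
  pass. Drawings are handled in the universal cover of the cylinder, where a full turn adds 1 to the
  abscissa and cyclic orders become monotone sequences.\<close>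

lemma connected_subset_of_two_open:
  assumes "connected S" "S \<subseteq> U \<union> W" "open U" "open W" "U \<inter> W = {}" "S \<inter> U \<noteq> {}"
  shows "S \<subseteq> U"
  using assms unfolding connected_def by blast

definition arc_joins :: "complex \<Rightarrow> complex \<Rightarrow> complex set \<Rightarrow> bool" where
  "arc_joins a b S \<longleftrightarrow> (\<exists>g. arc g \<and> path_image g = S \<and> pathstart g = a \<and> pathfinish g = b)"

lemma arc_joins_sym: "arc_joins a b S \<Longrightarrow> arc_joins b a S"
  unfolding arc_joins_def by (metis arc_reversepath path_image_reversepath pathfinish_reversepath pathstart_reversepath)

lemma arc_joins_ends: "arc_joins a b S \<Longrightarrow> a \<in> S \<and> b \<in> S \<and> a \<noteq> b"
  unfolding arc_joins_def by (metis arc_distinct_ends pathstart_in_path_image pathfinish_in_path_image)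

lemma arc_joins_top:
  assumes "arc_joins a b S" shows "compact S" "closed S" "connected S"
  using assms unfolding arc_joins_def
  by (auto simp: arc_def compact_path_image closed_path_image connected_path_image)

lemma arc_joins_concat:
  assumes "arc_joins a b S" "arc_joins b c T" "S \<inter> T = {b}"
  shows "arc_joins a c (S \<union> T)"
proof -
  obtain g h where g: "arc g" "path_image g = S" "pathstart g = a" "pathfinish g = b"
    and h: "arc h" "path_image h = T" "pathstart h = b" "pathfinish h = c"
    using assms unfolding arc_joins_def by blast
  have "arc (g +++ h)" using g h assms(3) by (intro arc_join) auto
  then show ?thesis unfolding arc_joins_def using g h
    by (metis path_image_join pathfinish_join pathstart_join)
qed

lemma arc_joins_interior:
  assumes "arc_joins a b S"
  shows "connected (S - {a,b})" "S \<subseteq> closure (S - {a,b})" "S - {a,b} \<noteq> {}" "infinite S"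
proof -
  obtain g where g: "arc g" "path_image g = S" "pathstart g = a" "pathfinish g = b"
    using assms unfolding arc_joins_def by blast
  have inj: "inj_on g {0..1}" and cont: "continuous_on {0..1} g"
    using g by (auto simp: arc_def path_def)
  have eq: "S - {a,b} = g ` {0<..<1}"
  proof -
    have "{0<..<1} = {0..1} - {0,1::real}" by auto
    moreover have "g ` ({0..1} - {0,1}) = g ` {0..1} - g ` {0,1}"
      using inj by (intro inj_on_image_set_diff[of _ "{0..1}"]) auto
    ultimately show ?thesis using g by (auto simp: path_image_def pathstart_def pathfinish_def)
  qed
  show "connected (S - {a,b})" unfolding eq
    by (intro connected_continuous_image continuous_on_subset[OF cont]) auto
  have "g ` closure {0<..<1} \<subseteq> closure (g ` {0<..<1})"
    using cont by (intro image_closure_subset[OF _ closed_closure closure_subset]) auto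
  then show "S \<subseteq> closure (S - {a,b})" unfolding eq using g by (auto simp: path_image_def)
  show ne: "S - {a,b} \<noteq> {}" unfolding eq by auto
  have "infinite (g ` {0<..<1})"
    using finite_imageD[of g "{0<..<1::real}"] inj_on_subset[OF inj, of "{0<..<1}"] infinite_Ioo[of 0 "1::real"]
    by fastforce
  then show "infinite S" using eq by (metis finite_Diff)
qed

text \<open>The Jordan curve theorem for a closed curve given as two arcs with common ends, the form
  in which cycles of a graph arise here.\<close>

lemma jordan_inside_outside:
  assumes "arc_joins a b X" "arc_joins a b Y" "X \<inter> Y = {a,b}"
  defines "I \<equiv> inside (X \<union> Y)" and "U \<equiv> outside (X \<union> Y)"
  shows "open I" "open U" "connected I" "connected U" "I \<noteq> {}" "U \<noteq> {}" "I \<inter> U = {}"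
    "I \<union> U = - (X \<union> Y)" "frontier I = X \<union> Y" "frontier U = X \<union> Y"
proof -
  obtain g h where g: "arc g" "path_image g = X" "pathstart g = a" "pathfinish g = b"
    and h: "arc h" "path_image h = Y" "pathstart h = a" "pathfinish h = b"
    using assms unfolding arc_joins_def by blast
  let ?c = "g +++ reversepath h"
  have sp: "simple_path ?c"
    using g h assms(3) by (subst simple_path_join_loop_eq) (auto simp: arc_reversepath)
  have im: "path_image ?c = X \<union> Y" using g h by (simp add: path_image_join)
  have "pathfinish ?c = pathstart ?c" using g h by simp
  from Jordan_inside_outside[OF sp this] show "open I" "open U" "connected I" "connected U" "I \<noteq> {}"
    "U \<noteq> {}" "I \<inter> U = {}" "I \<union> U = - (X \<union> Y)" "frontier I = X \<union> Y" "frontier U = X \<union> Y"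
    unfolding im I_def U_def by auto
qed

definition theta_curve :: "complex \<Rightarrow> complex \<Rightarrow> complex set \<Rightarrow> complex set \<Rightarrow> complex set \<Rightarrow> bool" where
  "theta_curve a b X Y Z \<longleftrightarrow> arc_joins a b X \<and> arc_joins a b Y \<and> arc_joins a b Z \<and>
     X \<inter> Y = {a,b} \<and> X \<inter> Z = {a,b} \<and> Y \<inter> Z = {a,b}"

text \<open>Each region is listed at the position of the arc that is missing from its frontier:
  \<open>R\<close> avoids \<open>X\<close>, \<open>S\<close> avoids \<open>Y\<close> and
  \<open>T\<close> avoids \<open>Z\<close>.\<close>

definition theta_regions ::
  "complex set \<Rightarrow> complex set \<Rightarrow> complex set \<Rightarrow> complex set \<Rightarrow> complex set \<Rightarrow> complex set \<Rightarrow> bool" where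
  "theta_regions X Y Z R S T \<longleftrightarrow> open R \<and> open S \<and> open T \<and> connected R \<and> connected S \<and> connected T \<and>
     R \<noteq> {} \<and> S \<noteq> {} \<and> T \<noteq> {} \<and> R \<inter> S = {} \<and> R \<inter> T = {} \<and> S \<inter> T = {} \<and>
     R \<union> S \<union> T = - (X \<union> Y \<union> Z) \<and> frontier R = Y \<union> Z \<and> frontier S = X \<union> Z \<and> frontier T = X \<union> Y"

lemma theta_curve_rotate: "theta_curve a b X Y Z \<Longrightarrow> theta_curve a b Y Z X"
  by (auto simp: theta_curve_def Int_commute)

lemma theta_regions_rotate: "theta_regions Y Z X S T R \<Longrightarrow> theta_regions X Y Z R S T"
  unfolding theta_regions_def by (auto simp: Un_commute Int_commute Un_left_commute)

text \<open>The arc \<open>Z\<close> cuts the inside of \<open>X \<union> Y\<close> into the insides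
  of \<open>X \<union> Z\<close> and \<open>Y \<union> Z\<close>; the outside of
  \<open>X \<union> Y\<close> is the third region.\<close>

lemma theta_regions_inner:
  assumes th: "theta_curve a b X Y Z" and ne: "Z \<inter> inside (X \<union> Y) \<noteq> {}"
  shows "\<exists>R S T. theta_regions X Y Z R S T"
proof -
  obtain g h k where g: "arc g" "path_image g = X" "pathstart g = a" "pathfinish g = b"
    and h: "arc h" "path_image h = Y" "pathstart h = a" "pathfinish h = b"
    and k: "arc k" "path_image k = Z" "pathstart k = a" "pathfinish k = b"
    using th unfolding arc_joins_def theta_curve_def by blast
  have ab: "a \<noteq> b" using g arc_distinct_ends by blast
  have D: "inside (X \<union> Z) \<inter> inside (Y \<union> Z) = {}"
      "inside (X \<union> Z) \<union> inside (Y \<union> Z) \<union> (Z - {a,b}) = inside (X \<union> Y)"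
    using split_inside_simple_closed_curve[of g a b h k] g h k ab th ne
    unfolding theta_curve_def by (metis arc_imp_simple_path)+
  have t: "arc_joins a b X" "arc_joins a b Y" "arc_joins a b Z" "X \<inter> Y = {a,b}" "X \<inter> Z = {a,b}" "Y \<inter> Z = {a,b}"
    using th unfolding theta_curve_def by auto
  note XY = jordan_inside_outside[OF t(1,2,4)] and XZ = jordan_inside_outside[OF t(1,3,5)]
    and YZ = jordan_inside_outside[OF t(2,3,6)]
  have e: "{a,b} \<subseteq> X" using arc_joins_ends[OF t(1)] by blast
  have u: "- (X \<union> Y \<union> Z) = (- (X \<union> Y)) - Z" by blast
  have "inside (Y \<union> Z) \<inter> outside (X \<union> Y) = {}" "inside (X \<union> Z) \<inter> outside (X \<union> Y) = {}"
    using D XY(7) by blast+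
  moreover have "inside (Y \<union> Z) \<inter> Z = {}" "inside (X \<union> Z) \<inter> Z = {}"
    using inside_no_overlap by blast+
  moreover have "outside (X \<union> Y) \<inter> Z = {}"
  proof -
    have "Z \<subseteq> inside (X \<union> Y) \<union> X" using D(2) e by blast
    then show ?thesis using XY(7,8) by blast
  qed
  moreover have "inside (Y \<union> Z) \<union> inside (X \<union> Z) = inside (X \<union> Y) - Z"
    using D(2) calculation(3,4) inside_no_overlap[of "X \<union> Y"] e by auto
  then have "inside (Y \<union> Z) \<union> inside (X \<union> Z) \<union> outside (X \<union> Y) = - (X \<union> Y \<union> Z)"
    using calculation(5) XY(8) by blast
  ultimately have "theta_regions X Y Z (inside (Y \<union> Z)) (inside (X \<union> Z)) (outside (X \<union> Y))"
    unfolding theta_regions_def using D(1)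
    by (intro conjI XY XZ YZ) (simp_all add: Int_commute)
  then show ?thesis by blast
qed

text \<open>If none of the arcs lay inside the cycle of the other two, a point inside \<open>X \<union> Y\<close> could be
  connected to infinity in the complements of \<open>Z \<union> Y\<close> and \<open>Z \<union> X\<close>, whose intersection \<open>Z\<close> is
  connected, and so, by Janiszewski's theorem, in the complement of \<open>X \<union> Y\<close>.\<close>

lemma theta_some_inner:
  assumes th: "theta_curve a b X Y Z" and Z: "Z \<inter> inside (X \<union> Y) = {}"
  shows "X \<inter> inside (Y \<union> Z) \<noteq> {} \<or> Y \<inter> inside (Z \<union> X) \<noteq> {}"
proof (rule ccontr)
  assume n: "\<not> ?thesis"
  have t: "arc_joins a b X" "arc_joins a b Y" "arc_joins a b Z" "X \<inter> Y = {a,b}" "Z \<inter> X = {a,b}" "Y \<inter> Z = {a,b}"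
    using th unfolding theta_curve_def by auto
  note XY = jordan_inside_outside[OF t(1,2,4)] and ZX = jordan_inside_outside[OF t(3,1,5)]
    and YZ = jordan_inside_outside[OF t(2,3,6)]
  have ab: "a \<in> Z" "b \<in> Z" "a \<in> X" "b \<in> X" "a \<in> Y" "b \<in> Y"
    using t(1-3)[THEN arc_joins_ends] by auto
  let ?I = "inside (X \<union> Y)"
  have I: "connected ?I" "open ?I" "?I \<noteq> {}" "frontier ?I = X \<union> Y" by (fact XY)+
  have dis: "?I \<inter> (X \<union> Y \<union> Z) = {}" using Z inside_no_overlap by blast
  \<comment> \<open>If \<open>?I\<close> met this inside, it would be contained in it, and the
    interior of its boundary arc \<open>X\<close> would lie inside \<open>Y \<union> Z\<close>,
    against the assumption that no arc is inner.\<close>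
  have A: "?I \<inter> inside (Y \<union> Z) = {}"
  proof (rule ccontr)
    assume "?I \<inter> inside (Y \<union> Z) \<noteq> {}"
    moreover have "?I \<subseteq> inside (Y \<union> Z) \<union> outside (Y \<union> Z)" using YZ(8) dis by blast
    ultimately have "?I \<subseteq> inside (Y \<union> Z)"
      using connected_subset_of_two_open[OF I(1) _ YZ(1,2,7)] by blast
    then have "closure ?I \<subseteq> inside (Y \<union> Z) \<union> (Y \<union> Z)"
      using closure_mono[of ?I "inside (Y \<union> Z)"] closure_Un_frontier[of "inside (Y \<union> Z)"] unfolding YZ(9) by simp
    moreover have "X \<subseteq> closure ?I" using I(4) unfolding frontier_def by auto
    moreover have "(X - {a,b}) \<inter> (Y \<union> Z) = {}" using t(4-6) by auto
    ultimately have "X - {a,b} \<subseteq> inside (Y \<union> Z)" by blast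
    moreover have "X - {a,b} \<noteq> {}" by (fact arc_joins_interior[OF t(1)])
    ultimately show False using n by blast
  qed
  have B: "?I \<inter> inside (Z \<union> X) = {}"
  proof (rule ccontr)
    assume "?I \<inter> inside (Z \<union> X) \<noteq> {}"
    moreover have "?I \<subseteq> inside (Z \<union> X) \<union> outside (Z \<union> X)" using ZX(8) dis by blast
    ultimately have "?I \<subseteq> inside (Z \<union> X)"
      using connected_subset_of_two_open[OF I(1) _ ZX(1,2,7)] by blast
    then have "closure ?I \<subseteq> inside (Z \<union> X) \<union> (Z \<union> X)"
      using closure_mono[of ?I "inside (Z \<union> X)"] closure_Un_frontier[of "inside (Z \<union> X)"] unfolding ZX(9) by simp
    moreover have "Y \<subseteq> closure ?I" using I(4) unfolding frontier_def by auto
    moreover have "(Y - {a,b}) \<inter> (Z \<union> X) = {}" using t(4-6) by auto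
    ultimately have "Y - {a,b} \<subseteq> inside (Z \<union> X)" by blast
    moreover have "Y - {a,b} \<noteq> {}" by (fact arc_joins_interior[OF t(2)])
    ultimately show False using n by blast
  qed
  obtain x where x: "x \<in> ?I" using I by blast
  have bd: "bounded X" "bounded Y" "bounded Z" using t(1-3)[THEN arc_joins_top(1)] by (auto simp: compact_imp_bounded)
  \<comment> \<open>Far away there is a point outside all three closed curves.\<close>
  then have "bounded (- outside (X \<union> Y) \<union> - outside (Y \<union> Z) \<union> - outside (Z \<union> X))"
    by (simp add: cobounded_outside)
  then have "- outside (X \<union> Y) \<union> - outside (Y \<union> Z) \<union> - outside (Z \<union> X) \<noteq> UNIV"
    using not_bounded_UNIV by metis
  then obtain y where y: "y \<in> outside (X \<union> Y)" "y \<in> outside (Y \<union> Z)" "y \<in> outside (Z \<union> X)"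
    by blast
  have "x \<in> outside (Y \<union> Z)" "x \<in> outside (Z \<union> X)"
    using A B x YZ(8) ZX(8) dis by blast+
  moreover have "outside (Y \<union> Z) \<subseteq> - (Y \<union> Z)" "outside (Z \<union> X) \<subseteq> - (Z \<union> X)"
    using YZ(8) ZX(8) by blast+
  ultimately have "connected_component (- (Y \<union> Z)) x y" "connected_component (- (Z \<union> X)) x y"
    unfolding connected_component_def using y YZ(4) ZX(4) by metis+
  moreover have "(Y \<union> Z) \<inter> (Z \<union> X) = Z \<union> (X \<inter> Y)" by blast
  then have "(Y \<union> Z) \<inter> (Z \<union> X) = Z" using t(4) ab by auto
  ultimately have "connected_component (- ((Y \<union> Z) \<union> (Z \<union> X))) x y"
    using t(1-3)[THEN arc_joins_top(1)] t(1-3)[THEN arc_joins_top(2)] arc_joins_top(3)[OF t(3)]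
    by (intro Janiszewski[of "Y \<union> Z" "Z \<union> X"] compact_Un closed_Un) simp_all
  then obtain W where W: "connected W" "W \<subseteq> - ((Y \<union> Z) \<union> (Z \<union> X))" "x \<in> W" "y \<in> W"
    unfolding connected_component_def by blast
  have "W \<subseteq> ?I"
    using connected_subset_of_two_open[OF W(1) _ XY(1,2,7)] W XY(8) x by blast
  then show False using y W XY(7) by blast
qed

text \<open>One of the three arcs runs inside the closed curve of the other two; rotating the names
  makes it the third one.\<close>

theorem theta_regions_exist:
  assumes th: "theta_curve a b X Y Z"
  shows "\<exists>R S T. theta_regions X Y Z R S T"
proof -
  consider "Z \<inter> inside (X \<union> Y) \<noteq> {}" | "X \<inter> inside (Y \<union> Z) \<noteq> {}" | "Y \<inter> inside (Z \<union> X) \<noteq> {}"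
    using theta_some_inner[OF th] by blast
  then show ?thesis
    using theta_regions_inner th theta_curve_rotate theta_regions_rotate
    by (cases; metis)
qed

text \<open>Erasing \<open>Z\<close> merges the two regions that have it on their frontier and
  leaves the third one unchanged. For a chord \<open>Z\<close> of a closed curve this identifies the
  side of the curve that contains the chord and the side that does not.\<close>

lemma theta_regions_other_side:
  assumes th: "theta_curve a b X Y Z" and reg: "theta_regions X Y Z R S T"
  shows "T \<in> components (- (X \<union> Y))" "R \<union> S \<union> (Z - {a,b}) \<in> components (- (X \<union> Y))"
proof -
  have t: "arc_joins a b X" "arc_joins a b Z" "X \<inter> Y = {a,b}" "X \<inter> Z = {a,b}" "Y \<inter> Z = {a,b}"
    using th unfolding theta_curve_def by auto
  have r: "open R" "open S" "open T" "connected R" "connected S" "connected T" "R \<noteq> {}" "S \<noteq> {}" "T \<noteq> {}"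
    "R \<inter> S = {}" "R \<inter> T = {}" "S \<inter> T = {}" "R \<union> S \<union> T = - (X \<union> Y \<union> Z)"
    "frontier R = Y \<union> Z" "frontier S = X \<union> Z" "frontier T = X \<union> Y"
    using reg unfolding theta_regions_def by simp_all
  let ?W = "R \<union> S \<union> (Z - {a,b})"
  have ends: "{a,b} \<subseteq> X" using arc_joins_ends[OF t(1)] by auto
  have zz: "Z \<inter> (X \<union> Y) = {a,b}" using t by blast
  have "T \<inter> Z = {}" using r(13) by blast
  then have dj: "T \<inter> ?W = {}" using r(11,12) by blast
  have un: "- (X \<union> Y) = T \<union> ?W"
  proof -
    have "- (X \<union> Y) = - (X \<union> Y \<union> Z) \<union> (Z - {a,b})" using zz ends by auto
    then show ?thesis using r(13) by auto
  qed
  have Zi: "connected (Z - {a,b})" "Z - {a,b} \<noteq> {}" using arc_joins_interior[OF t(2)] by auto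
  have cW: "connected ?W"
  proof -
    have c: "Z - {a,b} \<subseteq> closure R" "Z - {a,b} \<subseteq> closure S" using r(14,15) by (auto simp: frontier_def)
    have c1: "connected (R \<union> (Z - {a,b}))"
      using c(1) closure_subset[of R] by (intro connected_intermediate_closure[OF r(4)]) blast+
    have c2: "connected (S \<union> (Z - {a,b}))"
      using c(2) closure_subset[of S] by (intro connected_intermediate_closure[OF r(5)]) blast+
    have "(R \<union> (Z - {a,b})) \<inter> (S \<union> (Z - {a,b})) \<noteq> {}" using Zi(2) by blast
    from connected_Un[OF c1 c2 this] have "connected ((R \<union> (Z - {a,b})) \<union> (S \<union> (Z - {a,b})))" .
    then show ?thesis by (simp add: Un_ac)
  qed
  have TT: "T \<subseteq> - (X \<union> Y)" "?W \<subseteq> - (X \<union> Y)" using un by auto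
  \<comment> \<open>The frontier of \<open>T\<close> lies on the curve, so \<open>T\<close> is
    relatively closed in the complement as well as open.\<close>
  have fr: "closure T \<inter> - (X \<union> Y) = T"
    using r(16) closure_Un_frontier[of T] TT by auto
  have maxT: "K \<subseteq> T" if K: "connected K" "K \<subseteq> - (X \<union> Y)" "T \<inter> K \<noteq> {}" for K
  proof (rule connected_subset_of_two_open[OF K(1) _ r(3)])
    show "open (- closure T)" by (intro open_Compl closed_closure)
    show "K \<subseteq> T \<union> - closure T" using K(2) fr by blast
    show "T \<inter> - closure T = {}" using closure_subset[of T] by blast
    show "K \<inter> T \<noteq> {}" using K(3) by blast
  qed
  show c: "T \<in> components (- (X \<union> Y))"
    unfolding in_components_maximal
  proof (intro conjI allI impI)
    fix K assume "K \<noteq> {} \<and> T \<subseteq> K \<and> K \<subseteq> - (X \<union> Y) \<and> connected K"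
    then show "K = T" using maxT[of K] r(9) by blast
  qed (use r TT in auto)
  show "?W \<in> components (- (X \<union> Y))"
    unfolding in_components_maximal
  proof (intro conjI allI impI)
    show "?W \<noteq> {}" using r by blast
    fix K assume K: "K \<noteq> {} \<and> ?W \<subseteq> K \<and> K \<subseteq> - (X \<union> Y) \<and> connected K"
    have "T \<inter> K = {}"
    proof (rule ccontr)
      assume "T \<inter> K \<noteq> {}"
      then have "K \<subseteq> T" using maxT K by blast
      then show False using K r(7) dj by blast
    qed
    then show "K = ?W" using K un by blast
  qed (use TT cW in auto)
qed

lemma jordan_components:
  assumes "arc_joins a b X" "arc_joins a b Y" "X \<inter> Y = {a,b}"
  shows "components (- (X \<union> Y)) = {inside (X \<union> Y), outside (X \<union> Y)}"
proof -
  note J = jordan_inside_outside[OF assms]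
  have sub: "inside (X \<union> Y) \<subseteq> - (X \<union> Y)" "outside (X \<union> Y) \<subseteq> - (X \<union> Y)" using J(8) by blast+
  have max1: "K \<subseteq> inside (X \<union> Y)" if "connected K" "K \<subseteq> - (X \<union> Y)" "K \<inter> inside (X \<union> Y) \<noteq> {}" for K
    using connected_subset_of_two_open[OF that(1) _ J(1,2,7)] that J(8) by blast
  have max2: "K \<subseteq> outside (X \<union> Y)" if "connected K" "K \<subseteq> - (X \<union> Y)" "K \<inter> outside (X \<union> Y) \<noteq> {}" for K
    using connected_subset_of_two_open[OF that(1) _ J(2,1)] that J(7,8) by blast
  have "inside (X \<union> Y) \<in> components (- (X \<union> Y))"
    unfolding in_components_maximal using J(3,5) sub(1) max1 by blast
  moreover have "outside (X \<union> Y) \<in> components (- (X \<union> Y))"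
    unfolding in_components_maximal using J(4,6) sub(2) max2 by blast
  moreover have "W \<in> {inside (X \<union> Y), outside (X \<union> Y)}" if W: "W \<in> components (- (X \<union> Y))" for W
  proof -
    have "W \<subseteq> - (X \<union> Y)" "connected W" "W \<noteq> {}"
      using W in_components_subset in_components_connected in_components_nonempty by blast+
    note W3 = this
    have "W \<inter> inside (X \<union> Y) \<noteq> {} \<or> W \<inter> outside (X \<union> Y) \<noteq> {}"
      using W3(1,3) unfolding J(8)[symmetric] by blast
    then have "W \<subseteq> inside (X \<union> Y) \<or> W \<subseteq> outside (X \<union> Y)"
      using max1[of W] max2[of W] W3 by blast
    then show ?thesis
      using W calculation components_nonoverlap[of W "- (X \<union> Y)"] in_components_nonempty
      by (metis Int_absorb1 Int_absorb2 insertCI)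
  qed
  ultimately show ?thesis by blast
qed

lemma jordan_side:
  assumes "arc_joins a b X" "arc_joins a b Y" "X \<inter> Y = {a,b}" "U \<in> components (- (X \<union> Y))"
  shows "open U" "connected U" "frontier U = X \<union> Y" "U \<subseteq> - (X \<union> Y)"
  using jordan_inside_outside[OF assms(1-3)] jordan_components[OF assms(1-3)] assms(4)
    in_components_subset[OF assms(4)] by auto

section \<open>Faces along an edge\<close>

text \<open>Two points near the interior of \<open>e\<close> and on the same side of a cycle through \<open>e\<close> lie in the same
  face, by Janiszewski's theorem applied to the cycle and the rest of the graph.\<close>

lemma same_face_along_edge:
  assumes e: "arc_joins a b e" and X: "compact X" "connected X" and eX: "e \<inter> X = {a,b}"
    and K: "closed K" "X \<subseteq> K" "K \<inter> e \<subseteq> {a,b}"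
    and U: "connected U" "U \<subseteq> - (e \<union> X)" "x \<in> U" "y \<in> U"
    and p: "p \<in> e - {a,b}" "ball p r \<inter> K = {}" "x \<in> ball p r"
    and q: "q \<in> e - {a,b}" "ball q t \<inter> K = {}" "y \<in> ball q t"
  shows "connected_component (- (K \<union> e)) x y"
proof -
  have pp: "p \<in> ball p r" "q \<in> ball q t" using p(3) q(3) by (auto intro: le_less_trans[OF zero_le_dist])
  have "(e \<union> X) \<inter> K = X" using K eX by blast
  then have con: "connected ((e \<union> X) \<inter> K)" using X(2) by simp
  have "connected_component (- (e \<union> X)) x y"
    unfolding connected_component_def using U by blast
  \<comment> \<open>Here only \<open>K\<close> has to be avoided, so one may pass from one ball to
    the other along the interior of \<open>e\<close>.\<close>
  moreover have "connected_component (- K) x y"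
  proof -
    have "ball p r \<inter> (e - {a,b}) \<noteq> {}" using p(1) pp by blast
    from connected_Un[OF connected_ball arc_joins_interior(1)[OF e] this]
    have c: "connected (ball p r \<union> (e - {a,b}))" .
    have "(ball p r \<union> (e - {a,b})) \<inter> ball q t \<noteq> {}" using q(1) pp by blast
    from connected_Un[OF c connected_ball this]
    have "connected ((ball p r \<union> (e - {a,b})) \<union> ball q t)" .
    moreover have "(ball p r \<union> (e - {a,b})) \<union> ball q t \<subseteq> - K" using p q K by blast
    ultimately show ?thesis unfolding connected_component_def using p(3) q(3) by blast
  qed
  ultimately have "connected_component (- ((e \<union> X) \<union> K)) x y"
    using arc_joins_top(1)[OF e] X(1) by (intro Janiszewski[OF _ K(1) con] compact_Un)
  moreover have "(e \<union> X) \<union> K = K \<union> e" using K by blast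
  ultimately show ?thesis by simp
qed

text \<open>Small balls around inner points of \<open>e\<close> miss the rest \<open>K\<close> of
  the graph, so only the closed curve itself can separate points in them. Hence along all of
  \<open>e\<close> there is a single face on the side \<open>U\<close>.\<close>

lemma face_along_edge:
  assumes e: "arc_joins a b e" and X: "compact X" "connected X" and eX: "e \<inter> X = {a,b}"
    and K: "closed K" "X \<subseteq> K" "K \<inter> e \<subseteq> {a,b}"
    and U: "U \<in> components (- (e \<union> X))" "e \<subseteq> frontier U"
  shows "\<exists>f\<in>components (- (K \<union> e)). f \<subseteq> U \<and> e \<subseteq> closure f"
    and "\<lbrakk>f \<in> components (- (K \<union> e)); g \<in> components (- (K \<union> e)); f \<subseteq> U; g \<subseteq> U;
      p \<in> e - {a,b}; p \<in> closure f; q \<in> e - {a,b}; q \<in> closure g\<rbrakk> \<Longrightarrow> f = g"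
proof -
  note J = in_components_connected[OF U(1)] in_components_subset[OF U(1)]
  have cl: "open (- (K \<union> e))" using K(1) arc_joins_top(2)[OF e] by auto
  have ball: "\<exists>r>0. ball p r \<inter> K = {}" if p: "p \<in> e - {a,b}" for p
  proof -
    have "p \<in> - K" using p K by blast
    then obtain r where "r > 0" "ball p r \<subseteq> - K" using open_contains_ball[of "- K"] open_Compl[OF K(1)] by blast
    then show ?thesis by blast
  qed
  have near: "\<exists>x\<in>ball p r. x \<in> U - (K \<union> e)" if p: "p \<in> e - {a,b}" and r: "r > 0" "ball p r \<inter> K = {}" for p r
  proof -
    have "p \<in> frontier U" using U(2) p by blast
    then have "p \<in> closure U" by (simp add: frontier_def)
    then obtain x where x: "x \<in> U" "dist x p < r" using r(1) unfolding closure_approachable by blast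
    then have xb: "x \<in> ball p r" by (simp add: dist_commute)
    then have "x \<in> U - (K \<union> e)" using r(2) J(2) x(1) by blast
    then show ?thesis using xb by blast
  qed
  show "\<exists>f\<in>components (- (K \<union> e)). f \<subseteq> U \<and> e \<subseteq> closure f"
  proof -
    obtain p where p: "p \<in> e - {a,b}" using arc_joins_interior(3)[OF e] by blast
    obtain r where r: "r > 0" "ball p r \<inter> K = {}" using ball[OF p] by blast
    obtain x where x: "x \<in> ball p r" "x \<in> U" "x \<in> - (K \<union> e)" using near[OF p r] by blast
    let ?f = "connected_component_set (- (K \<union> e)) x"
    have f: "?f \<in> components (- (K \<union> e))" using x by (auto simp: components_def)
    have fU: "?f \<subseteq> U"
    proof (rule components_maximal[OF U(1)])
      show "connected ?f" by simp
      show "?f \<subseteq> - (e \<union> X)" using connected_component_subset[of "- (K \<union> e)" x] K by blast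
      show "U \<inter> ?f \<noteq> {}" using x connected_component_refl[of x "- (K \<union> e)"] by blast
    qed
    have "e - {a,b} \<subseteq> closure ?f"
    proof
      fix q assume q: "q \<in> e - {a,b}"
      show "q \<in> closure ?f"
        unfolding closure_approachable
      proof (intro allI impI)
        fix d :: real assume d: "d > 0"
        obtain t where t: "t > 0" "ball q t \<inter> K = {}" using ball[OF q] by blast
        let ?t = "min t d"
        have "ball q ?t \<inter> K = {}" using t by auto
        then obtain y where y: "y \<in> ball q ?t" "y \<in> U" using near[OF q, of ?t] t d by auto
        have "connected_component (- (K \<union> e)) x y"
          by (rule same_face_along_edge[OF e X eX K J x(2) y(2) p r(2) x(1) q \<open>ball q ?t \<inter> K = {}\<close> y(1)])
        then show "\<exists>y\<in>?f. dist y q < d" using y by (intro bexI[of _ y]) (auto simp: dist_commute)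
      qed
    qed
    then have "e \<subseteq> closure ?f" using arc_joins_interior(2)[OF e] closure_minimal by blast
    then show ?thesis using f fU by blast
  qed
  assume fg: "f \<in> components (- (K \<union> e))" "g \<in> components (- (K \<union> e))" "f \<subseteq> U" "g \<subseteq> U"
    and p: "p \<in> e - {a,b}" "p \<in> closure f" and q: "q \<in> e - {a,b}" "q \<in> closure g"
  obtain r where r: "r > 0" "ball p r \<inter> K = {}" using ball[OF p(1)] by blast
  obtain t where t: "t > 0" "ball q t \<inter> K = {}" using ball[OF q(1)] by blast
  obtain x where x: "x \<in> f" "x \<in> ball p r" using p(2) r(1) unfolding closure_approachable by (auto simp: dist_commute)
  obtain y where y: "y \<in> g" "y \<in> ball q t" using q(2) t(1) unfolding closure_approachable by (auto simp: dist_commute)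
  have "connected_component (- (K \<union> e)) x y"
    using same_face_along_edge[OF e X eX K J _ _ p(1) r(2) x(2) q(1) t(2) y(2)] x y fg by blast
  then obtain W where "connected W" "W \<subseteq> - (K \<union> e)" "x \<in> W" "y \<in> W"
    unfolding connected_component_def by blast
  then show "f = g" using components_maximal fg x y components_nonoverlap
    by (metis disjoint_iff subsetD)
qed

section \<open>Adding chords to a closed curve\<close>

text \<open>Distinct chords meet only on \<open>C\<close>, so each new set
  \<open>C \<union> c\<close> meets the union built so far in exactly the connected set
  \<open>C\<close>, and Janiszewski's theorem adds one chord at a time.\<close>

lemma connected_component_add_chords:
  fixes C :: "complex set"
  assumes C: "compact C" "connected C" and fin: "finite K"
    and K: "\<And>c. c \<in> K \<Longrightarrow> compact c" "\<And>c d. \<lbrakk>c \<in> K; d \<in> K; c \<noteq> d\<rbrakk> \<Longrightarrow> c \<inter> d \<subseteq> C"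
    and xy: "connected_component (- C) x y" "\<And>c. c \<in> K \<Longrightarrow> connected_component (- (C \<union> c)) x y"
  shows "connected_component (- (C \<union> \<Union>K)) x y"
  using fin K xy(2)
proof (induction K)
  case empty then show ?case using xy by simp
next
  case (insert c K)
  have "connected_component (- (C \<union> \<Union>K)) x y"
    by (rule insert.IH) (rule insert.prems; simp)+
  moreover have "connected_component (- (C \<union> c)) x y" by (rule insert.prems) simp
  moreover have "(C \<union> c) \<inter> (C \<union> \<Union>K) = C" using insert.prems(2) insert.hyps(2) by blast
  moreover have "compact (C \<union> c)" "closed (C \<union> \<Union>K)"
  proof -
    have "closed d" if "d \<in> K" for d using that by (intro compact_imp_closed insert.prems(1)) simp
    then have "closed (\<Union>K)" using insert.hyps(1) by (intro closed_Union) auto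
    then show "closed (C \<union> \<Union>K)" using compact_imp_closed[OF C(1)] by (intro closed_Un)
    show "compact (C \<union> c)" using C(1) insert.prems(1)[of c] by (intro compact_Un) auto
  qed
  ultimately have "connected_component (- ((C \<union> c) \<union> (C \<union> \<Union>K))) x y"
    using C(2) by (intro Janiszewski[of "C \<union> c" "C \<union> \<Union>K" x y]) (simp_all only:)
  moreover have "(C \<union> c) \<union> (C \<union> \<Union>K) = C \<union> \<Union>(insert c K)" by blast
  ultimately show ?case by simp
qed

text \<open>One half of Euler's formula. A new chord \<open>c\<close> runs within a single face
  \<open>h\<close>, and the rest of \<open>h\<close> is covered by the two regions \<open>R\<close>
  and \<open>S\<close> beside the chord. Points of \<open>h\<close> in the same region are still
  connected after \<open>c\<close> is added, by Janiszewski's theorem, so \<open>h\<close> breaks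
  into at most two faces.\<close>

lemma card_faces_add_chords:
  fixes C :: "complex set"
  assumes C: "compact C" "connected C" "finite (components (- C))" and fin: "finite K"
    and K: "\<And>c. c \<in> K \<Longrightarrow> compact c" "\<And>c d. \<lbrakk>c \<in> K; d \<in> K; c \<noteq> d\<rbrakk> \<Longrightarrow> c \<inter> d \<subseteq> C"
      "\<And>c. c \<in> K \<Longrightarrow> connected (c - C) \<and> c - C \<noteq> {}"
    and two: "\<And>c. c \<in> K \<Longrightarrow> \<exists>R S W. W \<in> components (- C) \<and> c - C \<subseteq> W \<and> W - c \<subseteq> R \<union> S \<and>
       connected R \<and> connected S \<and> R \<union> S \<subseteq> - (C \<union> c)"
  shows "finite (components (- (C \<union> \<Union>K))) \<and>
     card (components (- (C \<union> \<Union>K))) \<le> card (components (- C)) + card K"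
  using fin K two
proof (induction K)
  case empty then show ?case using C by simp
next
  case (insert c K)
  let ?U = "C \<union> \<Union>K" and ?U' = "C \<union> \<Union>(insert c K)"
  have IH: "finite (components (- ?U))" "card (components (- ?U)) \<le> card (components (- C)) + card K"
    using insert by auto
  have Ueq: "(C \<union> c) \<union> ?U = ?U'" by blast
  have cl: "compact (C \<union> c)" "closed ?U"
  proof -
    have "closed d" if "d \<in> K" for d using that by (intro compact_imp_closed insert.prems(1)) simp
    then have "closed (\<Union>K)" using insert.hyps(1) by (intro closed_Union) auto
    then show "closed (C \<union> \<Union>K)" using compact_imp_closed[OF C(1)] by (intro closed_Un)
    show "compact (C \<union> c)" using C(1) insert.prems(1)[of c] by (intro compact_Un) auto
  qed
  have int: "(C \<union> c) \<inter> ?U = C" using insert.prems(2) insert.hyps(2) by blast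
  have cU: "c - C \<subseteq> - ?U" using int by blast
  obtain z where z: "z \<in> c - C" using insert.prems(3)[of c] by blast
  define h where "h = connected_component_set (- ?U) z"
  have h: "h \<in> components (- ?U)" "z \<in> h" using z cU by (auto simp: components_def h_def)
  have ch: "c - C \<subseteq> h"
    using components_maximal[OF h(1), of "c - C"] insert.prems(3)[of c] cU z h by auto
  obtain R S W where W: "W \<in> components (- C)" "c - C \<subseteq> W" "W - c \<subseteq> R \<union> S"
      "connected R" "connected S" "R \<union> S \<subseteq> - (C \<union> c)"
    using insert.prems(4)[of c] by blast
  have hW: "h \<subseteq> W"
    using components_maximal[OF W(1), of h] in_components_subset[OF h(1)] in_components_connected[OF h(1)] z h(2) W(2)
    by blast
  have same: "g = g'" if g: "g \<in> components (- ?U')" "g' \<in> components (- ?U')" "g \<subseteq> h" "g' \<subseteq> h"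
      and Q: "connected Q" "Q \<subseteq> - (C \<union> c)" "g \<inter> Q \<noteq> {}" "g' \<inter> Q \<noteq> {}" for g g' Q
  proof -
    obtain x y where xy: "x \<in> g" "x \<in> Q" "y \<in> g'" "y \<in> Q" using Q by blast
    have "connected_component (- (C \<union> c)) x y" unfolding connected_component_def using Q xy by blast
    moreover have "connected_component (- ?U) x y"
      unfolding connected_component_def using in_components_connected[OF h(1)] in_components_subset[OF h(1)] xy g by blast
    ultimately have "connected_component (- ?U') x y"
      using cl int C(2) Ueq Janiszewski[of "C \<union> c" ?U x y] by simp
    then obtain T where "connected T" "T \<subseteq> - ?U'" "x \<in> T" "y \<in> T" unfolding connected_component_def by blast
    then show ?thesis using components_maximal g xy components_nonoverlap by (metis disjoint_iff subsetD)
  qed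
  \<comment> \<open>New faces that are pieces of \<open>h\<close> and meet \<open>Q\<close>; there
    is at most one for each of \<open>R\<close> and \<open>S\<close>.\<close>
  define A where "A Q = {g \<in> components (- ?U'). g \<subseteq> h \<and> g \<inter> Q \<noteq> {}}" for Q
  have AQ: "finite (A Q) \<and> card (A Q) \<le> 1" if "connected Q" "Q \<subseteq> - (C \<union> c)" for Q
  proof -
    have "\<forall>g\<in>A Q. \<forall>g'\<in>A Q. g = g'" using same that unfolding A_def by blast
    then obtain g where "A Q \<subseteq> {g}" by (cases "A Q = {}") auto
    then show ?thesis using card_mono[of "{g}" "A Q"] finite_subset[of "A Q" "{g}"] by simp
  qed
  have sub: "components (- ?U') \<subseteq> (components (- ?U) - {h}) \<union> (A R \<union> A S)"
  proof
    fix g assume g: "g \<in> components (- ?U')"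
    have gs: "g \<subseteq> - ?U'" "connected g" "g \<noteq> {}"
      using g in_components_subset in_components_connected in_components_nonempty by blast+
    then have gU: "g \<subseteq> - ?U" by blast
    obtain x where x: "x \<in> g" using gs by blast
    define k where "k = connected_component_set (- ?U) x"
    have k: "k \<in> components (- ?U)" "x \<in> k" using x gU by (auto simp: components_def k_def)
    have gk: "g \<subseteq> k" using components_maximal[OF k(1) gs(2) gU] x k(2) by blast
    show "g \<in> (components (- ?U) - {h}) \<union> (A R \<union> A S)"
    proof (cases "k = h")
      case True
      have "x \<in> W - c" using gk True hW x gs by blast
      then have "x \<in> R \<union> S" using W by blast
      then show ?thesis using g gk True x unfolding A_def by blast
    next
      \<comment> \<open>Another old face is not met by \<open>c\<close> and remains a face.\<close>
      case False
      then have "k \<inter> h = {}" using components_nonoverlap[OF k(1) h(1)] by blast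
      then have "k \<inter> c = {}" using ch in_components_subset[OF k(1)] by blast
      then have "k \<subseteq> - ?U'" using in_components_subset[OF k(1)] by blast
      then have "k \<subseteq> g" using components_maximal[OF g in_components_connected[OF k(1)]] x k(2) by blast
      then have "g = k" using gk by blast
      then show ?thesis using k False by blast
    qed
  qed
  have fA: "finite (A R)" "finite (A S)" "card (A R) \<le> 1" "card (A S) \<le> 1" using AQ W by auto
  have "card (components (- ?U')) \<le> card ((components (- ?U) - {h}) \<union> (A R \<union> A S))"
    using sub IH fA by (intro card_mono) auto
  also have "\<dots> \<le> card (components (- ?U) - {h}) + (card (A R) + card (A S))"
    using card_Un_le[of "components (- ?U) - {h}" "A R \<union> A S"] card_Un_le[of "A R" "A S"] by linarith
  also have "\<dots> \<le> card (components (- ?U)) - 1 + 2" using fA h IH by simp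
  also have "\<dots> \<le> card (components (- C)) + card (insert c K)"
    using IH insert.hyps h(1) card_gt_0_iff[of "components (- ?U)"] by auto
  finally have "card (components (- ?U')) \<le> card (components (- C)) + card (insert c K)" .
  moreover have "finite (components (- ?U'))" using sub IH fA finite_subset by blast
  ultimately show ?case by blast
qed

section \<open>Faces and vertices of a plane graph\<close>

text \<open>Disjoint arcs intersect in the empty, hence connected, set, so by Janiszewski's theorem
  the arcs do not separate the plane jointly, as none of them does alone.\<close>

lemma connected_complement_disjoint_arcs:
  assumes "finite A" "\<And>S. S \<in> A \<Longrightarrow> \<exists>a b. arc_joins a b S" "pairwise disjnt A"
  shows "connected (- \<Union>A)"
  using assms
proof (induction A)
  case empty
  have "connected (UNIV :: complex set)" by (rule connected_UNIV)
  then show ?case by simp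
next
  case (insert S A)
  obtain a b where S: "arc_joins a b S" using insert by blast
  have "connected (- S)"
    using S connected_arc_complement[where ?'a=complex] unfolding arc_joins_def by auto
  moreover have "connected (- \<Union>A)" using insert by (auto simp: pairwise_insert)
  moreover have "S \<inter> \<Union>A = {}" using insert.prems(2) insert.hyps(2)
    by (auto simp: pairwise_insert disjnt_def)
  moreover have "closed (\<Union>A)"
    using insert arc_joins_top(2) by (intro closed_Union) blast+
  ultimately have "connected (- (S \<union> \<Union>A))"
    using arc_joins_top(1)[OF S] by (intro Janiszewski_connected) auto
  then show ?case by simp
qed

text \<open>If the closure of a face missed all vertices, its frontier would be covered by pairwise
  disjoint subarcs of the edges. Their complement is connected, so the face would contain this whole
  complement, in which all vertices lie. The lemma is used to find a vertex cell between the minimum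
  and a face cell.\<close>

lemma face_closure_meets_vertices:
  assumes pg: "plane_graph V E" and V: "V \<noteq> {}" and f: "f \<in> plane_faces V E"
  shows "closure f \<inter> V \<noteq> {}"
proof
  assume no: "closure f \<inter> V = {}"
  have fin: "finite V" "finite E" using pg by (auto simp: plane_graph_def)
  have f': "f \<in> components (- (V \<union> \<Union>E))" using f by (simp add: plane_faces_def)
  \<comment> \<open>The part of \<open>e\<close> in the closure of the face is compact and misses
    the ends, so it fits into a subarc without vertices.\<close>
  have sub: "\<exists>D a b. arc_joins a b D \<and> closure f \<inter> e \<subseteq> D \<and> D \<subseteq> e - V" if e: "e \<in> E" for e
  proof -
    obtain g where g: "arc g" "path_image g = e" "e \<inter> V = {pathstart g, pathfinish g}"
      using pg e unfolding plane_graph_def by metis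
    have cont: "continuous_on {0..1} g" and inj: "inj_on g {0..1}" using g(1) by (auto simp: arc_def path_def)
    define T where "T = {0..1} \<inter> g -` closure f"
    have "closed T" unfolding T_def by (intro continuous_closed_preimage cont) simp_all
    then have "compact ({0..1} \<inter> T)" by (intro compact_Int_closed compact_Icc)
    moreover have "{0..1} \<inter> T = T" unfolding T_def by blast
    ultimately have cT: "compact T" by simp
    have "g 0 \<in> V" "g 1 \<in> V" using g(3) unfolding pathstart_def pathfinish_def by blast+
    then have "0 \<notin> T" "1 \<notin> T" using no unfolding T_def by blast+
    moreover have "T \<subseteq> {0..1}" unfolding T_def by blast
    ultimately have "T \<subseteq> {0..1} - {0,1}" by blast
    moreover have "{0..1} - {0,1} \<subseteq> {0<..<1::real}" by auto
    ultimately have T01: "T \<subseteq> {0<..<1}" by (rule order_trans)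
    have "\<exists>u v. 0 < u \<and> u < v \<and> v < 1 \<and> T \<subseteq> {u..v}"
    proof (cases "T = {}")
      \<comment> \<open>The face does not touch this edge, so any subarc away from the ends will
        do.\<close>
      case True then show ?thesis by (intro exI[of _ "1/3"] exI[of _ "2/3"]) auto
    next
      case False
      obtain l where l: "l \<in> T" "\<And>t. t \<in> T \<Longrightarrow> l \<le> t" using compact_attains_inf[OF cT False] by blast
      obtain m where m: "m \<in> T" "\<And>t. t \<in> T \<Longrightarrow> t \<le> m" using compact_attains_sup[OF cT False] by blast
      have "0 < l" "m < 1" "l \<le> m" using l m T01 by auto
      then show ?thesis using l m by (intro exI[of _ "l/2"] exI[of _ "(m+1)/2"]) force
    qed
    then obtain u v where uv: "0 < u" "u < v" "v < 1" "T \<subseteq> {u..v}" by blast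
    have "arc (subpath u v g)" using g(1) uv by (intro arc_subpath_arc) auto
    then have "arc_joins (g u) (g v) (g ` {u..v})"
      unfolding arc_joins_def using uv by (intro exI[of _ "subpath u v g"]) (auto simp: path_image_subpath)
    moreover have "closure f \<inter> e \<subseteq> g ` {u..v}"
      using uv(4) g(2) unfolding T_def path_image_def by auto
    moreover have "g ` {u..v} \<subseteq> e - V"
    proof
      fix y assume "y \<in> g ` {u..v}"
      then obtain t where t: "t \<in> {u..v}" "y = g t" by blast
      have "y \<in> e" using t uv g(2) unfolding path_image_def by auto
      moreover have "g t \<noteq> g 0" "g t \<noteq> g 1"
        using t uv inj_onD[OF inj, of t 0] inj_onD[OF inj, of t 1] by auto
      ultimately show "y \<in> e - V" using g(3) t by (auto simp: pathstart_def pathfinish_def)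
    qed
    ultimately show ?thesis by blast
  qed
  then obtain D where D: "\<And>e. e \<in> E \<Longrightarrow> (\<exists>a b. arc_joins a b (D e)) \<and> closure f \<inter> e \<subseteq> D e \<and> D e \<subseteq> e - V"
    by metis
  have disj: "pairwise disjnt (D ` E)"
  proof (clarsimp simp: pairwise_def disjnt_def)
    fix e e' assume "e \<in> E" "e' \<in> E" "D e \<noteq> D e'"
    then have "e \<inter> e' \<subseteq> V" using pg unfolding plane_graph_def by metis
    then show "D e \<inter> D e' = {}" using D \<open>e \<in> E\<close> \<open>e' \<in> E\<close> by blast
  qed
  have con: "connected (- \<Union>(D ` E))"
    using fin D disj by (intro connected_complement_disjoint_arcs) auto
  have op: "open (- (V \<union> \<Union>E))"
  proof -
    have "closed e" if "e \<in> E" for e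
      using pg that closed_path_image arc_imp_path unfolding plane_graph_def by metis
    then have "closed (\<Union>E)" using fin by (intro closed_Union) auto
    then show ?thesis using finite_imp_closed[OF fin(1)] by (intro open_Compl closed_Un)
  qed
  have of: "open f" using open_components[OF op f'] .
  have fr: "frontier f \<subseteq> V \<union> \<Union>E"
  proof -
    have "closed (V \<union> \<Union>E)" using op by (simp only: closed_def)
    from frontier_subset_closed[OF this] frontier_of_components_subset[OF f'] show ?thesis
      unfolding frontier_complement by (rule order_trans[rotated])
  qed
  have fn: "f \<subseteq> - (V \<union> \<Union>E)" "f \<noteq> {}" using in_components_subset[OF f'] in_components_nonempty[OF f'] by auto
  have "frontier f \<subseteq> \<Union>(D ` E)"
  proof
    fix y assume y: "y \<in> frontier f"
    then have yc: "y \<in> closure f" by (auto simp: frontier_def)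
    then obtain e where "e \<in> E" "y \<in> e" using fr y no by blast
    then show "y \<in> \<Union>(D ` E)" using D yc by blast
  qed
  then have "closure f \<subseteq> f \<union> \<Union>(D ` E)" using closure_Un_frontier[of f] by blast
  then have "- \<Union>(D ` E) \<subseteq> f"
  proof (intro connected_subset_of_two_open[OF con _ of])
    show "open (- closure f)" by (intro open_Compl closed_closure)
    show "f \<inter> - closure f = {}" using closure_subset[of f] by blast
    show "- \<Union>(D ` E) \<inter> f \<noteq> {}" using fn D by blast
  qed blast
  moreover have "V \<subseteq> - \<Union>(D ` E)" using D by blast
  ultimately show False using V fn by blast
qed

section \<open>Hamiltonian plane graphs\<close>

lemma mod_eq_close:
  fixes a b n :: nat
  assumes "a mod n = b mod n" "a \<le> b" "b < a + n"
  shows "a = b"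
proof -
  have "n dvd b - a" using assms(1)[symmetric] assms(2) by (simp add: mod_eq_dvd_iff_nat)
  then show ?thesis using assms by (auto dest: dvd_imp_le)
qed

lemma image_mod_period:
  fixes f :: "nat \<Rightarrow> 'a"
  assumes "n > 0" "\<And>i. f i = f (i mod n)"
  shows "f ` {i..<i + n} = f ` {..<n}" "f ` {..<n} = range f"
proof -
  have 1: "f j \<in> f ` {i..<i + n}" for i j
  proof -
    define k where "k = i + (j + (n - i mod n)) mod n"
    have "k mod n = (i + (j + (n - i mod n))) mod n" unfolding k_def by (simp add: mod_add_right_eq)
    also have "i + (j + (n - i mod n)) = j + (i - i mod n) + n"
      using mod_less_eq_dividend[of i n] mod_less_divisor[OF assms(1), of i] by linarith
    also have "i - i mod n = n * (i div n)" by (simp add: minus_mod_eq_mult_div)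
    finally have "k mod n = j mod n" by (metis (no_types) mod_add_self2 mod_mult_self2)
    moreover have "k \<in> {i..<i + n}" using assms(1) by (simp add: k_def)
    moreover have "f j = f k" using assms(2)[of j] assms(2)[of k] calculation(1) by simp
    ultimately show ?thesis by blast
  qed
  have "f j \<in> f ` {..<n}" for j using 1[of j 0] by (simp add: lessThan_atLeast0)
  then show 2: "f ` {..<n} = range f" by blast
  show "f ` {i..<i + n} = f ` {..<n}" unfolding 2 using 1[of _ i] by blast
qed

locale ham_graph =
  fixes V :: "complex set" and E :: "complex set set" and C :: "complex list"
  assumes pg: "plane_graph V E" and ham: "hamiltonian_cycle V E C"
begin

definition n :: nat where "n = length C"

text \<open>Indices are unbounded and read modulo \<open>n\<close>, so that a path along the cycle
  may run past the last vertex without a case distinction.\<close>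

definition vx :: "nat \<Rightarrow> complex" where "vx i = C ! (i mod n)"

definition ce :: "nat \<Rightarrow> complex set" where "ce i = (SOME e. e \<in> E \<and> e \<inter> V = {vx i, vx (Suc i)})"

definition seg :: "nat \<Rightarrow> nat \<Rightarrow> complex set" where "seg i l = \<Union>(ce ` {i..<i + l})"

definition rim :: "complex set" where "rim = \<Union>(range ce)"

lemma n3: "3 \<le> n" using ham by (simp add: n_def hamiltonian_cycle_def)

lemma n_pos: "n > 0" using n3 by simp

lemma fin: "finite V" "finite E" using pg by (auto simp: plane_graph_def)

lemma vx_mod: "vx (i mod n) = vx i" by (simp add: vx_def)

lemma vx_eq: "vx i = vx j \<longleftrightarrow> i mod n = j mod n"
  using ham n_pos by (simp add: vx_def hamiltonian_cycle_def nth_eq_iff_index_eq n_def)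

lemma vx_add_n: "vx (i + n) = vx i" by (simp add: vx_eq)

lemma V_eq: "V = vx ` {..<n}" "V = range vx"
proof -
  have "V = (!) C ` {..<n}" using ham by (simp add: hamiltonian_cycle_def n_def set_conv_nth) blast
  also have "\<dots> = vx ` {..<n}" by (simp add: vx_def)
  finally show 1: "V = vx ` {..<n}" .
  then show "V = range vx" using image_mod_period(2)[OF n_pos, of vx] vx_mod by simp
qed

lemma vx_in: "vx i \<in> V" using V_eq by blast

lemma edge_unique: "e \<in> E \<Longrightarrow> e' \<in> E \<Longrightarrow> e \<inter> V = e' \<inter> V \<Longrightarrow> e = e'"
  using pg unfolding plane_graph_def by meson

lemma edge_inter: "e \<in> E \<Longrightarrow> e' \<in> E \<Longrightarrow> e \<noteq> e' \<Longrightarrow> e \<inter> e' \<subseteq> V"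
  using pg unfolding plane_graph_def by meson

lemma edges_inter: "S \<subseteq> E \<Longrightarrow> T \<subseteq> E \<Longrightarrow> S \<inter> T = {} \<Longrightarrow> \<Union>S \<inter> \<Union>T \<subseteq> V"
  using edge_inter by blast

lemma edge_arc:
  assumes "e \<in> E" "e \<inter> V = {a, b}" "a \<noteq> b" shows "arc_joins a b e"
proof -
  obtain g where g: "arc g" "path_image g = e" "e \<inter> V = {pathstart g, pathfinish g}"
    using assms pg unfolding plane_graph_def by meson
  then have "arc_joins (pathstart g) (pathfinish g) e" unfolding arc_joins_def by blast
  then show ?thesis using g(3) assms(2,3) arc_joins_sym by (metis doubleton_eq_iff)
qed

lemma edge_ends:
  assumes "e \<in> E" obtains a b where "a \<noteq> b" "e \<inter> V = {a, b}" "arc_joins a b e"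
proof -
  obtain g where g: "arc g" "path_image g = e" "e \<inter> V = {pathstart g, pathfinish g}"
    using assms pg unfolding plane_graph_def by meson
  then have "arc_joins (pathstart g) (pathfinish g) e" unfolding arc_joins_def by blast
  then show ?thesis using that g(3) arc_joins_ends by blast
qed

lemma edge_compact: "e \<in> E \<Longrightarrow> compact e" "e \<in> E \<Longrightarrow> closed e" "e \<in> E \<Longrightarrow> connected e"
  using edge_ends arc_joins_top by metis+

lemma ce: "ce i \<in> E" "ce i \<inter> V = {vx i, vx (Suc i)}"
proof -
  have "i mod n < length C" using n_pos by (simp add: n_def)
  then have "adjacent V E (C ! (i mod n)) (C ! (Suc (i mod n) mod length C))"
    using ham unfolding hamiltonian_cycle_def by blast
  then have "\<exists>e. e \<in> E \<and> e \<inter> V = {vx i, vx (Suc i)}"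
    unfolding adjacent_def vx_def n_def[symmetric] by (auto simp: mod_Suc_eq)
  then have "ce i \<in> E \<and> ce i \<inter> V = {vx i, vx (Suc i)}"
    unfolding ce_def by (rule someI_ex)
  then show "ce i \<in> E" "ce i \<inter> V = {vx i, vx (Suc i)}" by auto
qed

lemma vx_Suc_neq: "vx i \<noteq> vx (Suc i)"
  using mod_eq_close[of i n "Suc i"] n3 by (auto simp: vx_eq)

lemma ce_arc: "arc_joins (vx i) (vx (Suc i)) (ce i)"
  using edge_arc ce vx_Suc_neq by blast

lemma ce_eq_iff: "ce i = ce j \<longleftrightarrow> i mod n = j mod n"
proof
  assume "ce i = ce j"
  then have "{vx i, vx (Suc i)} = {vx j, vx (Suc j)}" using ce by metis
  then consider "vx i = vx j" | "vx i = vx (Suc j)" "vx j = vx (Suc i)"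
    by (auto simp: doubleton_eq_iff)
  then show "i mod n = j mod n"
  proof cases
    case 2
    then have "vx (Suc (Suc i)) = vx (Suc j)" unfolding vx_eq by (metis mod_Suc_eq)
    then have "(i + 2) mod n = i mod n" using 2 by (simp add: vx_eq)
    then have "i = i + 2" using mod_eq_close[of i n "i+2"] n3 by simp
    then show ?thesis by simp
  qed (simp add: vx_eq)
next
  assume "i mod n = j mod n"
  then have "vx i = vx j" "vx (Suc i) = vx (Suc j)" unfolding vx_eq by (metis mod_Suc_eq)+
  then have "ce i \<inter> V = ce j \<inter> V" using ce by metis
  then show "ce i = ce j" using edge_unique ce by blast
qed

lemma ce_mod: "ce (i mod n) = ce i" by (simp add: ce_eq_iff)

lemma ce_range: "range ce = ce ` {i..<i + n}"
  using image_mod_period[OF n_pos, of ce] ce_mod by metis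

lemma ce_inj: "inj_on ce {i..<i + n}"
proof (rule inj_onI)
  fix j k assume *: "j \<in> {i..<i+n}" "k \<in> {i..<i+n}" "ce j = ce k"
  then have m: "j mod n = k mod n" by (simp add: ce_eq_iff)
  show "j = k"
    using mod_eq_close[OF m] mod_eq_close[OF m[symmetric]] * by (cases "j \<le> k") auto
qed

lemma rim_seg: "rim = seg i n"
  unfolding rim_def seg_def ce_range[of i] ..

lemma seg_add: "seg i (k + l) = seg i k \<union> seg (i + k) l"
proof -
  have "{i..<i + (k + l)} = {i..<i+k} \<union> {i+k..<i+k+l}" by auto
  then show ?thesis unfolding seg_def by (simp add: image_Un)
qed

lemma seg_split: "l \<le> n \<Longrightarrow> rim = seg i l \<union> seg (i + l) (n - l)"
  using rim_seg[of i] seg_add[of i l "n - l"] by simp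

lemma seg_Suc0: "seg i (Suc 0) = ce i" by (simp add: seg_def)

lemma seg_V: "seg i l \<inter> V \<subseteq> vx ` {i..i + l}"
  using ce(2) by (force simp: seg_def)

lemma seg_ends: "l > 0 \<Longrightarrow> vx i \<in> seg i l" "l > 0 \<Longrightarrow> vx (i + l) \<in> seg i l"
proof -
  assume l: "l > 0"
  have "vx i \<in> ce i" using ce(2)[of i] by blast
  then show "vx i \<in> seg i l" unfolding seg_def using l by force
  have "vx (i + l) \<in> ce (i + l - 1)" using ce(2)[of "i + l - 1"] l by (simp) blast
  moreover have "i + l - 1 \<in> {i..<i+l}" using l by auto
  ultimately show "vx (i + l) \<in> seg i l" unfolding seg_def by blast
qed

lemma seg_inter:
  assumes "k + l \<le> n"
  shows "seg i k \<inter> seg (i + k) l \<subseteq> vx ` {i..i + k} \<inter> vx ` {i + k..i + k + l}"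
proof -
  have "{i..<i+k} \<inter> {i+k..<i+k+l} = {}" by auto
  moreover have "{i..<i+k} \<subseteq> {i..<i+n}" "{i+k..<i+k+l} \<subseteq> {i..<i+n}" using assms by auto
  ultimately have "ce ` {i..<i+k} \<inter> ce ` {i+k..<i+k+l} = {}"
    using inj_on_image_Int[OF ce_inj[of i], of "{i..<i+k}" "{i+k..<i+k+l}"] by simp
  then have "seg i k \<inter> seg (i + k) l \<subseteq> V"
    unfolding seg_def using ce by (intro edges_inter) auto
  then show ?thesis using seg_V[of i k] seg_V[of "i + k" l] by blast
qed

lemma vx_image_inter:
  assumes "k + l < n" shows "vx ` {i..i + k} \<inter> vx ` {i + k..i + k + l} \<subseteq> {vx (i + k)}"
proof
  fix y assume "y \<in> vx ` {i..i + k} \<inter> vx ` {i + k..i + k + l}"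
  then obtain a b where ab: "a \<in> {i..i+k}" "b \<in> {i+k..i+k+l}" "y = vx a" "y = vx b" by blast
  then have "a mod n = b mod n" by (simp add: vx_eq)
  then have "a = b" using mod_eq_close[of a n b] ab assms by auto
  then show "y \<in> {vx (i + k)}" using ab by auto
qed

lemma arc_seg: "0 < l \<Longrightarrow> l < n \<Longrightarrow> arc_joins (vx i) (vx (i + l)) (seg i l)"
proof (induction l)
  case (Suc l)
  show ?case
  proof (cases "l = 0")
    case True then show ?thesis using ce_arc by (simp add: seg_Suc0)
  next
    case False
    have 1: "seg i (Suc l) = seg i l \<union> ce (i + l)" using seg_add[of i l 1] by (simp add: seg_Suc0)
    have "seg i l \<inter> seg (i + l) 1 \<subseteq> {vx (i + l)}"
      by (rule order_trans[OF seg_inter vx_image_inter]) (use Suc.prems in auto)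
    moreover have "vx (i + l) \<in> seg i l" using seg_ends False by simp
    moreover have "vx (i + l) \<in> ce (i + l)" using ce(2)[of "i + l"] by blast
    ultimately have "seg i l \<inter> ce (i + l) = {vx (i + l)}" by (auto simp: seg_Suc0)
    then show ?thesis
      using arc_joins_concat[OF Suc.IH ce_arc[of "i + l"]] False Suc.prems 1 by simp
  qed
qed simp

lemma seg_compl_inter:
  assumes "0 < l" "l < n"
  shows "seg i l \<inter> seg (i + l) (n - l) = {vx i, vx (i + l)}"
proof
  show "seg i l \<inter> seg (i + l) (n - l) \<subseteq> {vx i, vx (i + l)}"
  proof
    fix y assume "y \<in> seg i l \<inter> seg (i + l) (n - l)"
    then have "y \<in> vx ` {i..i + l} \<inter> vx ` {i + l..i + l + (n - l)}" using seg_inter[of l "n - l" i] assms by auto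
    then obtain a b where ab: "a \<in> {i..i+l}" "b \<in> {i+l..i+n}" "y = vx a" "y = vx b" using assms by auto
    then have m: "a mod n = b mod n" by (simp add: vx_eq)
    show "y \<in> {vx i, vx (i + l)}"
    proof (cases "b < a + n")
      case True
      then have "a = b" using mod_eq_close[OF m] ab by auto
      then show ?thesis using ab by auto
    next
      case False
      then have "a = i" using ab by auto
      then show ?thesis using ab by auto
    qed
  qed
  have "vx (i + l + (n - l)) = vx i" using assms vx_add_n[of i] by simp
  then show "{vx i, vx (i + l)} \<subseteq> seg i l \<inter> seg (i + l) (n - l)"
    using seg_ends[of l i] seg_ends[of "n - l" "i + l"] assms by auto
qed

lemma arc_seg_compl:
  assumes "0 < l" "l < n" shows "arc_joins (vx i) (vx (i + l)) (seg (i + l) (n - l))"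
proof -
  have "arc_joins (vx (i + l)) (vx (i + l + (n - l))) (seg (i + l) (n - l))"
    using assms by (intro arc_seg) auto
  moreover have "vx (i + l + (n - l)) = vx i" using assms vx_add_n[of i] by simp
  ultimately show ?thesis using arc_joins_sym by simp
qed

abbreviation "chd \<equiv> chords V E C"

lemma chd_eq: "chd = E - range ce"
proof -
  have "(\<exists>i<length C. e \<inter> V = {C ! i, C ! (Suc i mod length C)}) \<longleftrightarrow> e \<in> range ce" if e: "e \<in> E" for e
  proof
    assume "\<exists>i<length C. e \<inter> V = {C ! i, C ! (Suc i mod length C)}"
    then obtain i where "i < n" "e \<inter> V = {vx i, vx (Suc i)}" by (auto simp: vx_def n_def)
    then have "e = ce i" using edge_unique[OF e ce(1)] ce(2) by simp
    then show "e \<in> range ce" by blast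
  next
    assume "e \<in> range ce"
    then obtain i where "e = ce i" by blast
    then have "e = ce (i mod n)" by (simp add: ce_mod)
    then have "e \<inter> V = {C ! (i mod n), C ! (Suc (i mod n) mod n)}"
      using ce(2)[of "i mod n"] n_pos by (simp add: vx_def)
    moreover have "i mod n < length C" using n_pos by (simp add: n_def)
    ultimately show "\<exists>i<length C. e \<inter> V = {C ! i, C ! (Suc i mod length C)}"
      unfolding n_def by blast
  qed
  then show ?thesis unfolding chords_def by blast
qed

lemma chdE: "c \<in> chd \<Longrightarrow> c \<in> E" by (simp add: chd_eq)

lemma fin_chd: "finite chd" using fin by (simp add: chd_eq)

lemma chord_ends:
  assumes "c \<in> chd" obtains i l where "i < n" "i + l < n" "1 < l" "l < n - 1" "c \<inter> V = {vx i, vx (i + l)}"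
proof -
  obtain a b where ab: "a \<noteq> b" "c \<inter> V = {a, b}" using edge_ends chdE[OF assms] by metis
  then have "a \<in> V" "b \<in> V" by auto
  then obtain i j where ij: "i < n" "j < n" "a = vx i" "b = vx j" using V_eq by blast
  have "\<exists>i j. i < n \<and> j < n \<and> i < j \<and> c \<inter> V = {vx i, vx j}"
  proof (cases "i < j")
    case True then show ?thesis using ab ij by blast
  next
    case False
    then have "j < i" using ab ij by (metis linorder_neqE_nat)
    then show ?thesis using ab ij by (metis insert_commute)
  qed
  then obtain i j where ij: "i < n" "j < n" "i < j" "c \<inter> V = {vx i, vx j}" by blast
  have "j \<noteq> Suc i"
  proof
    assume "j = Suc i"
    then have "c = ce i" using edge_unique[OF chdE[OF assms] ce(1)] ij ce(2) by simp
    then show False using assms chd_eq by blast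
  qed
  moreover have "\<not> (i = 0 \<and> j = n - 1)"
  proof
    assume "i = 0 \<and> j = n - 1"
    then have "c \<inter> V = {vx (Suc (n - 1)), vx (n - 1)}" using ij n_pos vx_add_n[of 0] by simp
    then have "c = ce (n - 1)"
      using edge_unique[OF chdE[OF assms] ce(1)] ce(2)[of "n - 1"] by (simp add: insert_commute)
    then show False using assms chd_eq by blast
  qed
  ultimately have "1 < j - i" "j - i < n - 1" "i + (j - i) = j" using ij(1-3) by linarith+
  then show ?thesis using that[of i "j - i"] ij by simp
qed

lemma chord_rim:
  assumes "c \<in> chd" shows "c \<inter> rim = c \<inter> V"
proof
  have "c \<in> E" "c \<notin> range ce" using assms chd_eq by blast+
  then have "\<Union>{c} \<inter> \<Union>(range ce) \<subseteq> V" using ce(1) by (intro edges_inter) blast+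
  then show "c \<inter> rim \<subseteq> c \<inter> V" unfolding rim_def by simp
  have "V \<subseteq> rim" unfolding rim_def using V_eq(2) ce(2) by blast
  then show "c \<inter> V \<subseteq> c \<inter> rim" by blast
qed

lemma chord_theta:
  assumes c: "c \<in> chd" "c \<inter> V = {vx i, vx (i + l)}" and l: "0 < l" "l < n"
  shows "theta_curve (vx i) (vx (i + l)) (seg i l) (seg (i + l) (n - l)) c"
proof -
  have rim: "rim = seg i l \<union> seg (i + l) (n - l)" using seg_split l by simp
  have ne: "vx i \<noteq> vx (i + l)" using arc_joins_ends[OF arc_seg[OF l]] by blast
  have c1: "c \<inter> (seg i l \<union> seg (i + l) (n - l)) = {vx i, vx (i + l)}"
    using chord_rim[OF c(1)] c(2) rim by simp
  have "vx i \<in> seg i l \<inter> seg (i + l) (n - l)" "vx (i + l) \<in> seg i l \<inter> seg (i + l) (n - l)"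
    using seg_compl_inter[OF l] by auto
  then have "seg i l \<inter> c = {vx i, vx (i + l)}" "seg (i + l) (n - l) \<inter> c = {vx i, vx (i + l)}"
    using c1 by blast+
  then show ?thesis
    unfolding theta_curve_def
    using arc_seg[OF l] arc_seg_compl[OF l] seg_compl_inter[OF l] edge_arc[OF chdE[OF c(1)] c(2) ne] by simp
qed

lemma graph_eq: "V \<union> \<Union>E = rim \<union> \<Union>chd"
proof -
  have "V \<subseteq> rim" unfolding rim_def using V_eq(2) ce(2) by blast
  moreover have "E = range ce \<union> chd" using chd_eq ce by blast
  then have "\<Union>E = rim \<union> \<Union>chd" unfolding rim_def by (metis Union_Un_distrib)
  ultimately show ?thesis by blast
qed

abbreviation "faces \<equiv> plane_faces V E"

lemma faces_eq: "faces = components (- (rim \<union> \<Union>chd))"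
  by (simp only: plane_faces_def graph_eq)

lemma rim_jordan:
  "arc_joins (vx i) (vx (i + 1)) (seg i 1)" "arc_joins (vx i) (vx (i + 1)) (seg (i + 1) (n - 1))"
  "seg i 1 \<inter> seg (i + 1) (n - 1) = {vx i, vx (i + 1)}" "rim = seg i 1 \<union> seg (i + 1) (n - 1)"
  using arc_seg[of 1 i] arc_seg_compl[of 1 i] seg_compl_inter[of 1 i] seg_split[of 1 i] n3 by auto

lemma rim_top: "compact rim" "connected rim"
proof -
  show "compact rim" unfolding rim_jordan(4)[of 0]
    by (intro compact_Un arc_joins_top(1)[OF rim_jordan(1)] arc_joins_top(1)[OF rim_jordan(2)])
  show "connected rim" unfolding rim_jordan(4)[of 0]
    by (intro connected_Un arc_joins_top(3)[OF rim_jordan(1)] arc_joins_top(3)[OF rim_jordan(2)])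
       (use rim_jordan(3)[of 0] in blast)
qed

lemma components_rim: "components (- rim) = {inside rim, outside rim}"
  unfolding rim_jordan(4)[of 0] by (rule jordan_components[OF rim_jordan(1-3)])

lemma rim_in_out: "inside rim \<noteq> {}" "outside rim \<noteq> {}" "inside rim \<inter> outside rim = {}"
  "inside rim \<union> outside rim = - rim" "open (inside rim)" "open (outside rim)"
  "connected (inside rim)" "connected (outside rim)"
  using jordan_inside_outside[OF rim_jordan(1-3)[of 0]] unfolding rim_jordan(4)[of 0, symmetric] by auto

lemma chord_inter: "c \<in> chd \<Longrightarrow> d \<in> chd \<Longrightarrow> c \<noteq> d \<Longrightarrow> c \<inter> d \<subseteq> rim"
  using edge_inter[OF chdE chdE, of c d] V_eq(2) ce(2) unfolding rim_def by blast

lemma chord_interior: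
  assumes "c \<in> chd" "c \<inter> V = {a, b}" "a \<noteq> b"
  shows "c - rim = c - {a, b}" "connected (c - rim)" "c - rim \<noteq> {}"
proof -
  show 1: "c - rim = c - {a, b}" using chord_rim[OF assms(1)] assms(2) by blast
  show "connected (c - rim)" "c - rim \<noteq> {}"
    unfolding 1 using arc_joins_interior[OF edge_arc[OF chdE[OF assms(1)] assms(2,3)]] by auto
qed

text \<open>By the Jordan curve theorem the cycle alone has two faces, and each chord adds at most
  one; the two regions beside it come from the theta curve that it forms with the two paths of the
  cycle.\<close>

theorem card_faces_le: "finite faces" "card faces \<le> card chd + 2"
proof -
  have "finite (components (- (rim \<union> \<Union>chd))) \<and> card (components (- (rim \<union> \<Union>chd))) \<le> card (components (- rim)) + card chd"
  proof (rule card_faces_add_chords[OF rim_top])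
    show "finite (components (- rim))" by (simp add: components_rim)
    show "finite chd" by (rule fin_chd)
    fix c assume c: "c \<in> chd"
    show "compact c" using edge_compact chdE[OF c] by blast
    show "c \<inter> d \<subseteq> rim" if "d \<in> chd" "c \<noteq> d" for d using chord_inter c that by blast
    obtain i l where il: "i < n" "i + l < n" "1 < l" "l < n - 1" "c \<inter> V = {vx i, vx (i + l)}" using chord_ends[OF c] .
    have l: "0 < l" "l < n" using il by auto
    have th: "theta_curve (vx i) (vx (i + l)) (seg i l) (seg (i + l) (n - l)) c" by (rule chord_theta[OF c il(5) l])
    then obtain R S T where r: "theta_regions (seg i l) (seg (i + l) (n - l)) c R S T" using theta_regions_exist by blast
    have ne: "vx i \<noteq> vx (i + l)" using arc_joins_ends[OF arc_seg[OF l]] by blast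
    show "connected (c - rim) \<and> c - rim \<noteq> {}" using chord_interior[OF c il(5) ne] by blast
    have rim: "seg i l \<union> seg (i + l) (n - l) = rim" using seg_split l by simp
    \<comment> \<open>The side of the cycle on which the chord runs; the third region
      \<open>T\<close> is the other side.\<close>
    let ?W = "R \<union> S \<union> (c - {vx i, vx (i + l)})"
    have "?W \<in> components (- rim)" using theta_regions_other_side(2)[OF th r] rim by simp
    moreover have "c - rim \<subseteq> ?W" using chord_interior(1)[OF c il(5) ne] by blast
    moreover have "?W - c \<subseteq> R \<union> S" by blast
    moreover have "connected R" "connected S" using r unfolding theta_regions_def by auto
    moreover have "R \<union> S \<subseteq> - (rim \<union> c)" using r unfolding theta_regions_def rim by blast
    ultimately show "\<exists>R S W. W \<in> components (- rim) \<and> c - rim \<subseteq> W \<and> W - c \<subseteq> R \<union> S \<and>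
       connected R \<and> connected S \<and> R \<union> S \<subseteq> - (rim \<union> c)" by blast
  qed
  moreover have "card (components (- rim)) = 2"
  proof -
    have "inside rim \<noteq> outside rim" using rim_in_out(1,3) by blast
    then show ?thesis unfolding components_rim by simp
  qed
  ultimately show "finite faces" "card faces \<le> card chd + 2" by (auto simp: faces_eq)
qed

end

context ham_graph
begin

section \<open>Cycles and the faces along their edges\<close>

text \<open>The last conjunct says that the cycle minus an edge is still a connected set through
  both ends of this edge, which is what \<open>face_along_edge\<close> demands of
  \<open>X\<close>.\<close>

definition is_cycle :: "complex set set \<Rightarrow> bool" where
  "is_cycle T \<longleftrightarrow> T \<subseteq> E \<and>
     (\<exists>a b P Q. arc_joins a b P \<and> arc_joins a b Q \<and> P \<inter> Q = {a,b} \<and> \<Union>T = P \<union> Q) \<and>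
     (\<forall>e\<in>T. connected (\<Union>(T - {e})) \<and> e \<inter> V \<subseteq> \<Union>(T - {e}))"

lemma connected_seg: "l < n \<Longrightarrow> connected (seg i l)"
  using arc_joins_top(3)[OF arc_seg[of l i]] by (cases "l = 0") (auto simp: seg_def)

lemma seg_remove:
  assumes "k \<in> {i..<i + l}" "l \<le> n"
  shows "ce ` {i..<i + l} - {ce k} = ce ` {i..<k} \<union> ce ` {Suc k..<i + l}"
proof -
  have s: "{i..<i + l} - {k} \<subseteq> {i..<i + n}" "{k} \<subseteq> {i..<i + n}" using assms by auto
  have "ce ` {i..<i + l} - ce ` {k} = ce ` ({i..<i + l} - {k})"
    using inj_on_image_set_diff[OF ce_inj s] by simp
  also have "{i..<i + l} - {k} = {i..<k} \<union> {Suc k..<i + l}" using assms by auto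
  finally show ?thesis by (simp add: image_Un)
qed

lemma cycle_rim: "is_cycle (range ce)"
  unfolding is_cycle_def
proof (intro conjI ballI)
  show "range ce \<subseteq> E" using ce(1) by blast
  show "\<exists>a b P Q. arc_joins a b P \<and> arc_joins a b Q \<and> P \<inter> Q = {a, b} \<and> \<Union> (range ce) = P \<union> Q"
    using rim_jordan[of 0] unfolding rim_def by blast
  fix e assume "e \<in> range ce"
  then obtain k where k: "e = ce k" by blast
  have "range ce - {e} = ce ` {Suc k..<k + n}"
    unfolding ce_range[of k] k using seg_remove[of k k n] n_pos by simp
  then have U: "\<Union>(range ce - {e}) = seg (Suc k) (n - 1)" unfolding seg_def using n_pos by simp
  show "connected (\<Union>(range ce - {e}))" unfolding U using connected_seg n_pos by simp
  have "vx (Suc k + (n - 1)) = vx k" using n_pos vx_add_n[of k] by simp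
  then show "e \<inter> V \<subseteq> \<Union>(range ce - {e})"
    unfolding U unfolding k ce(2) using seg_ends[of "n - 1" "Suc k"] n3 by simp
qed

lemma cycle_chord:
  assumes c: "c \<in> chd" "c \<inter> V = {vx i, vx (i + l)}" and l: "0 < l" "l < n"
  shows "is_cycle (insert c (ce ` {i..<i + l}))"
  unfolding is_cycle_def
proof (intro conjI ballI)
  let ?T = "insert c (ce ` {i..<i + l})"
  have cn: "c \<notin> range ce" "c \<in> E" using c(1) chd_eq by blast+
  show "?T \<subseteq> E" using cn ce(1) by blast
  have th: "theta_curve (vx i) (vx (i + l)) (seg i l) (seg (i + l) (n - l)) c" by (rule chord_theta[OF c l])
  have "\<Union>?T = seg i l \<union> c" by (simp add: seg_def Un_commute)
  then show "\<exists>a b P Q. arc_joins a b P \<and> arc_joins a b Q \<and> P \<inter> Q = {a, b} \<and> \<Union> ?T = P \<union> Q"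
    using th unfolding theta_curve_def by blast
  fix e assume e: "e \<in> ?T"
  have vc: "vx i \<in> c" "vx (i + l) \<in> c" using c(2) by blast+
  have "connected (\<Union>(?T - {e})) \<and> e \<inter> V \<subseteq> \<Union>(?T - {e})"
  proof (cases "e = c")
    case True
    have "?T - {e} = ce ` {i..<i + l}" using True cn by blast
    then have "\<Union>(?T - {e}) = seg i l" by (simp add: seg_def)
    then show ?thesis using connected_seg l c(2) seg_ends[of l i] True by simp
  next
    case False
    then obtain k where k: "e = ce k" "k \<in> {i..<i + l}" using e by blast
    have "?T - {e} = insert c (ce ` {i..<i + l} - {e})" using False by blast
    also have "\<dots> = insert c (ce ` {i..<k} \<union> ce ` {Suc k..<i + l})"
      unfolding k(1) using seg_remove[OF k(2)] l by simp
    finally have "\<Union>(?T - {e}) = c \<union> \<Union>(ce ` {i..<k}) \<union> \<Union>(ce ` {Suc k..<i + l})" by auto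
    then have U: "\<Union>(?T - {e}) = (c \<union> seg i (k - i)) \<union> seg (Suc k) (i + l - Suc k)"
      unfolding seg_def using k(2) by simp
    have 1: "connected (c \<union> seg i (k - i))"
    proof (cases "k = i")
      case True then show ?thesis using edge_compact cn by (simp add: seg_def)
    next
      case False
      then have "vx i \<in> seg i (k - i)" using k(2) by (intro seg_ends) auto
      then show ?thesis
        using vc edge_compact(3)[OF cn(2)] connected_seg[of "k - i" i] k(2) l by (intro connected_Un) auto
    qed
    have "connected ((c \<union> seg i (k - i)) \<union> seg (Suc k) (i + l - Suc k))"
    proof (cases "Suc k = i + l")
      case True then show ?thesis using 1 by (simp add: seg_def)
    next
      case False
      then have "vx (Suc k + (i + l - Suc k)) \<in> seg (Suc k) (i + l - Suc k)" using k(2) by (intro seg_ends) auto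
      then have "vx (i + l) \<in> seg (Suc k) (i + l - Suc k)" using k(2) by simp
      then have "(c \<union> seg i (k - i)) \<inter> seg (Suc k) (i + l - Suc k) \<noteq> {}" using vc by blast
      moreover have "connected (seg (Suc k) (i + l - Suc k))" using k(2) l by (intro connected_seg) auto
      ultimately show ?thesis using connected_Un[OF 1] by blast
    qed
    moreover have "vx k \<in> c \<union> seg i (k - i)"
      using vc seg_ends(2)[of "k - i" i] k(2) by (cases "k = i") auto
    moreover have "vx (Suc k) \<in> c \<union> seg (Suc k) (i + l - Suc k)"
      using vc seg_ends(1)[of "i + l - Suc k" "Suc k"] k(2) by (cases "Suc k = i + l") auto
    ultimately show ?thesis unfolding U unfolding k(1) ce(2) by blast
  qed
  then show "connected (\<Union>(?T - {e}))" "e \<inter> V \<subseteq> \<Union>(?T - {e})" by blast+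
qed

lemma cycle_sides:
  assumes "is_cycle T"
  obtains U W where "components (- \<Union>T) = {U, W}" "U \<inter> W = {}" "U \<noteq> {}" "W \<noteq> {}" "open U" "open W"
    "frontier U = \<Union>T" "frontier W = \<Union>T"
proof -
  obtain a b P Q where *: "arc_joins a b P" "arc_joins a b Q" "P \<inter> Q = {a,b}" "\<Union>T = P \<union> Q"
    using assms unfolding is_cycle_def by blast
  show ?thesis
    using that[of "inside (\<Union>T)" "outside (\<Union>T)"] jordan_components[OF *(1-3)] jordan_inside_outside[OF *(1-3)]
    unfolding *(4) by blast
qed

lemma cycle_side:
  assumes "is_cycle T" "U \<in> components (- \<Union>T)"
  shows "open U" "connected U" "frontier U = \<Union>T" "U \<subseteq> - \<Union>T"
proof -
  obtain a b P Q where *: "arc_joins a b P" "arc_joins a b Q" "P \<inter> Q = {a,b}" "\<Union>T = P \<union> Q"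
    using assms unfolding is_cycle_def by blast
  show "open U" "connected U" "frontier U = \<Union>T" "U \<subseteq> - \<Union>T"
    using jordan_side[OF *(1-3)] assms(2) unfolding *(4) by blast+
qed

lemma face_props:
  assumes "f \<in> faces" shows "connected f" "f \<noteq> {}" "f \<subseteq> - (V \<union> \<Union>E)"
  using assms in_components_connected in_components_nonempty in_components_subset
  unfolding plane_faces_def by blast+

lemma face_disjoint: "f \<in> faces \<Longrightarrow> g \<in> faces \<Longrightarrow> f \<inter> g \<noteq> {} \<Longrightarrow> f = g"
  unfolding plane_faces_def using components_nonoverlap by blast

lemma face_in_side:
  assumes "f \<in> faces" "T \<subseteq> E"
  shows "\<exists>U\<in>components (- \<Union>T). f \<subseteq> U"
  using face_props[OF assms(1)] assms(2) exists_component_superset[of f "- \<Union>T"] by blast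

lemma cycle_edge_aux:
  assumes T: "is_cycle T" "e \<in> T" and ab: "e \<inter> V = {a, b}"
  defines "X \<equiv> \<Union>(T - {e})" and "K \<equiv> V \<union> \<Union>(E - {e})"
  shows "compact X" "connected X" "e \<inter> X = {a,b}" "closed K" "X \<subseteq> K" "K \<inter> e \<subseteq> {a,b}" "e \<union> X = \<Union>T" "K \<union> e = V \<union> \<Union>E"
proof -
  have TE: "T \<subseteq> E" and con: "connected X" and ends: "e \<inter> V \<subseteq> X" using T unfolding is_cycle_def X_def by blast+
  have eE: "e \<in> E" using TE T by blast
  show "connected X" by (rule con)
  have "finite (T - {e})" using TE fin finite_subset by blast
  then show "compact X" unfolding X_def using edge_compact(1) TE by (intro compact_Union) auto
  have "finite (E - {e})" using fin by blast
  then have "closed (\<Union>(E - {e}))" using edge_compact(2) by (intro closed_Union) auto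
  then show "closed K" unfolding K_def using finite_imp_closed[OF fin(1)] by (intro closed_Un)
  have d: "e' \<inter> e \<subseteq> V" if "e' \<in> E - {e}" for e' using that eE edge_inter[of e' e] by blast
  then have "e \<inter> X \<subseteq> e \<inter> V" unfolding X_def using TE by blast
  then show "e \<inter> X = {a,b}" using ends ab by blast
  show "X \<subseteq> K" unfolding X_def K_def using TE by blast
  show "K \<inter> e \<subseteq> {a,b}" unfolding K_def using d ab by blast
  show "e \<union> X = \<Union>T" unfolding X_def using T(2) by blast
  show "K \<union> e = V \<union> \<Union>E" unfolding K_def using eE by blast
qed

lemma cycle_face:
  assumes T: "is_cycle T" "e \<in> T" and U: "U \<in> components (- \<Union>T)"
  shows "\<exists>f\<in>faces. f \<subseteq> U \<and> e \<subseteq> closure f"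
    and "\<lbrakk>f \<in> faces; g \<in> faces; f \<subseteq> U; g \<subseteq> U; e \<subseteq> closure f; e \<subseteq> closure g\<rbrakk> \<Longrightarrow> f = g"
proof -
  have "e \<in> E" using T unfolding is_cycle_def by blast
  then obtain a b where ab: "a \<noteq> b" "e \<inter> V = {a, b}" "arc_joins a b e" using edge_ends by metis
  note A = cycle_edge_aux[OF T ab(2)]
  have U': "U \<in> components (- (e \<union> \<Union>(T - {e})))" "e \<subseteq> frontier U"
    unfolding A(7) cycle_side(3)[OF T(1) U] using U T(2) by blast+
  note F = face_along_edge[OF ab(3) A(1-6) U', unfolded A(8), folded plane_faces_def]
  show "\<exists>f\<in>faces. f \<subseteq> U \<and> e \<subseteq> closure f" by (rule F(1))
  assume *: "f \<in> faces" "g \<in> faces" "f \<subseteq> U" "g \<subseteq> U" "e \<subseteq> closure f" "e \<subseteq> closure g"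
  obtain p where "p \<in> e - {a,b}" using arc_joins_interior(3)[OF ab(3)] by blast
  then show "f = g" using F(2)[OF *(1-4), of p p] *(5,6) by blast
qed

text \<open>At an edge of the cycle the two faces lie on different sides, as each side has only one
  face along that edge. The interior of any other edge lies within one open side, and so do both
  faces that touch it. Changes of side along a walk in the dual graph are thereby counted by the
  crossed edges of the cycle.\<close>

lemma face_flip:
  assumes T: "is_cycle T" and U: "U \<in> components (- \<Union>T)" and e: "e \<in> E"
    and f: "f \<in> faces" "e \<subseteq> closure f" and g: "g \<in> faces" "e \<subseteq> closure g" and ne: "f \<noteq> g"
  shows "(f \<subseteq> U \<longleftrightarrow> g \<subseteq> U) \<longleftrightarrow> e \<notin> T"
proof -
  have TE: "T \<subseteq> E" using T unfolding is_cycle_def by blast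
  obtain U1 U2 where UU: "components (- \<Union>T) = {U1, U2}" using cycle_sides[OF T] by metis
  have disj: "\<not> (h \<subseteq> U \<and> h \<subseteq> W)" if "h \<in> faces" "W \<in> components (- \<Union>T)" "W \<noteq> U" for h W
    using face_props(2)[OF that(1)] components_nonoverlap[OF U that(2)] that(3) by blast
  show ?thesis
  proof (cases "e \<in> T")
    case True
    have u: "False" if "W \<in> components (- \<Union>T)" "f \<subseteq> W" "g \<subseteq> W" for W
      using cycle_face(2)[OF T True that(1) f(1) g(1) that(2,3) f(2) g(2)] ne by blast
    obtain Uf where Uf: "Uf \<in> components (- \<Union>T)" "f \<subseteq> Uf" using face_in_side[OF f(1) TE] by blast
    obtain Ug where Ug: "Ug \<in> components (- \<Union>T)" "g \<subseteq> Ug" using face_in_side[OF g(1) TE] by blast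
    have "Uf \<noteq> Ug" using u Uf Ug by blast
    then have "Uf = U \<and> Ug \<noteq> U \<or> Uf \<noteq> U \<and> Ug = U" using Uf(1) Ug(1) U unfolding UU by auto
    then show ?thesis using True Uf Ug disj f(1) g(1) by blast
  next
    case False
    obtain a b where ab: "a \<noteq> b" "e \<inter> V = {a, b}" "arc_joins a b e" using edge_ends[OF e] by metis
    let ?i = "e - {a,b}"
    have i: "connected ?i" "?i \<noteq> {}" using arc_joins_interior[OF ab(3)] by blast+
    have "?i \<subseteq> - \<Union>T"
    proof -
      have "e \<inter> t \<subseteq> V" if "t \<in> T" for t using edge_inter[OF e, of t] that TE False by blast
      then show ?thesis using ab(2) by blast
    qed
    then obtain W where W: "W \<in> components (- \<Union>T)" "?i \<subseteq> W"
      using exists_component_superset[of ?i "- \<Union>T"] i by blast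
    have "h \<subseteq> W" if h: "h \<in> faces" "e \<subseteq> closure h" for h
    proof -
      have "W \<inter> closure h \<noteq> {}" using W(2) i(2) h(2) by blast
      then have "W \<inter> h \<noteq> {}" using cycle_side(1)[OF T W(1)] open_Int_closure_eq_empty by blast
      then show ?thesis
        using components_maximal[OF W(1) face_props(1)[OF h(1)]] face_props(3)[OF h(1)] TE by blast
    qed
    then have "f \<subseteq> W" "g \<subseteq> W" using f g by blast+
    then show ?thesis using False disj[OF f(1) W(1)] disj[OF g(1) W(1)] by blast
  qed
qed

section \<open>Three edges at a vertex, crossing chords\<close>

lemma edge_seg_inter:
  assumes e: "e \<in> E" "e \<inter> V = {vx i, vx (i + a)}" and pq: "0 < p" "p + q < n"
  shows "e \<inter> seg (i + p) q \<subseteq> {vx (i + a)} \<inter> vx ` {i + p..i + p + q}"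
proof -
  have no: "vx i \<notin> vx ` {i + p..i + p + q}"
  proof
    assume "vx i \<in> vx ` {i + p..i + p + q}"
    then obtain k where k: "k \<in> {i + p..i + p + q}" "i mod n = k mod n" unfolding vx_eq image_iff by blast
    then show False using mod_eq_close[OF k(2)] pq by auto
  qed
  have "e \<notin> ce ` {i + p..<i + p + q}"
  proof
    assume "e \<in> ce ` {i + p..<i + p + q}"
    then obtain k where k: "k \<in> {i + p..<i + p + q}" "e = ce k" by blast
    then have "vx i \<in> {vx k, vx (Suc k)}" using ce(2)[of k] e(2) by auto
    then show False using no k(1) by auto
  qed
  then have "\<Union>{e} \<inter> \<Union>(ce ` {i + p..<i + p + q}) \<subseteq> V" using e(1) ce(1) by (intro edges_inter) auto
  then have "e \<inter> seg (i + p) q \<subseteq> e \<inter> V \<inter> vx ` {i + p..i + p + q}"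
    using seg_V[of "i + p" q] unfolding seg_def by auto
  then show ?thesis unfolding e(2) using no by blast
qed

lemma theta_region_closure:
  assumes r: "theta_regions X Y Z R S T"
  shows "closure R = R \<union> Y \<union> Z" "closure S = S \<union> X \<union> Z" "closure T = T \<union> X \<union> Y"
    "R \<inter> (X \<union> Y \<union> Z) = {}" "S \<inter> (X \<union> Y \<union> Z) = {}" "T \<inter> (X \<union> Y \<union> Z) = {}"
  using r closure_Un_frontier[of R] closure_Un_frontier[of S] closure_Un_frontier[of T]
  unfolding theta_regions_def by (simp_all add: Un_assoc) blast+

lemma connected_in_theta_region:
  assumes r: "theta_regions X Y Z R S T" and K: "connected K" "K \<noteq> {}" "K \<subseteq> - (X \<union> Y \<union> Z)"
  shows "K \<subseteq> R \<or> K \<subseteq> S \<or> K \<subseteq> T"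
proof -
  have o: "open R" "open S" "open T" and d: "R \<inter> S = {}" "R \<inter> T = {}" "S \<inter> T = {}"
    and u: "R \<union> S \<union> T = - (X \<union> Y \<union> Z)"
    using r unfolding theta_regions_def by simp_all
  have KU: "K \<subseteq> R \<union> S \<union> T" using K(3) u by simp
  then consider "K \<inter> R \<noteq> {}" | "K \<inter> S \<noteq> {}" | "K \<inter> T \<noteq> {}" using K(2) by blast
  then show ?thesis
  proof cases
    case 1 then show ?thesis
      using connected_subset_of_two_open[OF K(1), of R "S \<union> T"] KU o d by blast
  next
    case 2 then show ?thesis
      using connected_subset_of_two_open[OF K(1), of S "R \<union> T"] KU o d by blast
  next
    case 3 then show ?thesis
      using connected_subset_of_two_open[OF K(1), of T "R \<union> S"] KU o d by blast
  qed
qed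

text \<open>Prolonged along the cycle to the far end of the middle edge \<open>e2\<close>, the edges
  \<open>e1\<close> and \<open>e3\<close> form a theta curve with \<open>e2\<close>. A region of a
  theta curve has only two of the three arcs on its frontier, so its closure misses inner points of
  one of the three edges.\<close>

lemma no_three_edges_ordered:
  assumes e: "e1 \<in> E" "e2 \<in> E" "e3 \<in> E"
    "e1 \<inter> V = {vx i, vx (i + a1)}" "e2 \<inter> V = {vx i, vx (i + a2)}" "e3 \<inter> V = {vx i, vx (i + a3)}"
    and a: "0 < a1" "a1 < a2" "a2 < a3" "a3 < n"
    and f: "f \<in> faces" "e1 \<subseteq> closure f" "e2 \<subseteq> closure f" "e3 \<subseteq> closure f"
  shows False
proof -
  define A where "A = seg (i + a1) (a2 - a1)"
  define B where "B = seg (i + a2) (a3 - a2)"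
  have neq: "vx (i + p) \<noteq> vx (i + q)" if "p < q" "q < n" for p q
    using mod_eq_close[of "i + p" n "i + q"] that by (auto simp: vx_eq)
  have v: "vx i \<noteq> vx (i + a1)" "vx i \<noteq> vx (i + a2)" "vx i \<noteq> vx (i + a3)" "vx (i + a1) \<noteq> vx (i + a2)"
    "vx (i + a1) \<noteq> vx (i + a3)" "vx (i + a2) \<noteq> vx (i + a3)"
    using neq[of 0 a1] neq[of 0 a2] neq[of 0 a3] neq[of a1 a2] neq[of a1 a3] neq[of a2 a3] a by auto
  have arcA: "arc_joins (vx (i + a1)) (vx (i + a2)) A" using arc_seg[of "a2 - a1" "i + a1"] a by (simp add: A_def)
  have arcB: "arc_joins (vx (i + a3)) (vx (i + a2)) B"
    using arc_seg[of "a3 - a2" "i + a2"] a arc_joins_sym by (simp add: B_def)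
  have arcs: "arc_joins (vx i) (vx (i + a1)) e1" "arc_joins (vx i) (vx (i + a2)) e2" "arc_joins (vx i) (vx (i + a3)) e3"
    using edge_arc e v by blast+
  have nin: "vx (i + p) \<notin> vx ` {i + q..i + r}" if "p < q \<or> r < p" "p < n" "r < n" for p q r
  proof
    assume "vx (i + p) \<in> vx ` {i + q..i + r}"
    then obtain k where k: "k \<in> {i + q..i + r}" "(i + p) mod n = k mod n" unfolding vx_eq image_iff by blast
    then show False using mod_eq_close[OF k(2)] mod_eq_close[OF k(2)[symmetric]] that by auto
  qed
  have e1A: "e1 \<inter> A \<subseteq> {vx (i + a1)}" using edge_seg_inter[OF e(1,4), of a1 "a2 - a1"] a by (auto simp: A_def)
  have e2A: "e2 \<inter> A \<subseteq> {vx (i + a2)}" using edge_seg_inter[OF e(2,5), of a1 "a2 - a1"] a by (auto simp: A_def)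
  have e3A: "e3 \<inter> A \<subseteq> {}"
    using edge_seg_inter[OF e(3,6), of a1 "a2 - a1"] nin[of a3 a1 a2] a by (auto simp: A_def)
  have e1B: "e1 \<inter> B \<subseteq> {}"
    using edge_seg_inter[OF e(1,4), of a2 "a3 - a2"] nin[of a1 a2 a3] a by (auto simp: B_def)
  have e2B: "e2 \<inter> B \<subseteq> {vx (i + a2)}" using edge_seg_inter[OF e(2,5), of a2 "a3 - a2"] a by (auto simp: B_def)
  have e3B: "e3 \<inter> B \<subseteq> {vx (i + a3)}" using edge_seg_inter[OF e(3,6), of a2 "a3 - a2"] a by (auto simp: B_def)
  have "seg (i + a1) (a2 - a1) \<inter> seg (i + a1 + (a2 - a1)) (a3 - a2) \<subseteq> {vx (i + a1 + (a2 - a1))}"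
    by (rule order_trans[OF seg_inter vx_image_inter]) (use a in auto)
  then have AB: "A \<inter> B \<subseteq> {vx (i + a2)}" using a by (simp add: A_def B_def)
  have ees: "e1 \<inter> e2 \<subseteq> {vx i}" "e1 \<inter> e3 \<subseteq> {vx i}" "e2 \<inter> e3 \<subseteq> {vx i}"
  proof -
    have d: "e \<inter> e' \<subseteq> {vx i}" if "e \<in> E" "e' \<in> E" "e \<inter> V = {vx i, x}" "e' \<inter> V = {vx i, y}" "x \<noteq> y" for e e' x y
    proof -
      have "x \<noteq> vx i \<or> y \<noteq> vx i" using that by blast
      then have "e \<noteq> e'" using that by auto
      then have "e \<inter> e' \<subseteq> (e \<inter> V) \<inter> (e' \<inter> V)" using edge_inter[of e e'] that by blast
      then show ?thesis unfolding that(3,4) using that(5) by blast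
    qed
    show "e1 \<inter> e2 \<subseteq> {vx i}" by (rule d[OF e(1,2,4,5) v(4)])
    show "e1 \<inter> e3 \<subseteq> {vx i}" by (rule d[OF e(1,3,4,6) v(5)])
    show "e2 \<inter> e3 \<subseteq> {vx i}" by (rule d[OF e(2,3,5,6) v(6)])
  qed
  have mem: "vx i \<in> e1" "vx i \<in> e2" "vx i \<in> e3" "vx (i + a1) \<in> e1" "vx (i + a2) \<in> e2" "vx (i + a3) \<in> e3"
    "vx (i + a1) \<in> A" "vx (i + a2) \<in> A" "vx (i + a2) \<in> B" "vx (i + a3) \<in> B"
    using e(4-6) arc_joins_ends[OF arcA] arc_joins_ends[OF arcB] by blast+
  let ?X = "e1 \<union> A" and ?Y = e2 and ?Z = "e3 \<union> B"
  have X: "arc_joins (vx i) (vx (i + a2)) ?X" using e1A mem by (intro arc_joins_concat[OF arcs(1) arcA]) blast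
  have Z: "arc_joins (vx i) (vx (i + a2)) ?Z" using e3B mem by (intro arc_joins_concat[OF arcs(3) arcB]) blast
  have XY: "?X \<inter> ?Y = {vx i, vx (i + a2)}" using ees(1) e2A mem by blast
  have XZ: "?X \<inter> ?Z = {vx i, vx (i + a2)}" using ees(2) e1B e3A AB mem by blast
  have YZ: "?Y \<inter> ?Z = {vx i, vx (i + a2)}" using ees(3) e2B mem by blast
  have "theta_curve (vx i) (vx (i + a2)) ?X ?Y ?Z" unfolding theta_curve_def using X Z arcs(2) XY XZ YZ by blast
  then obtain R S T where r: "theta_regions ?X ?Y ?Z R S T" using theta_regions_exist by blast
  note cl = theta_region_closure[OF r]
  have "A \<subseteq> \<Union>E" "B \<subseteq> \<Union>E" unfolding A_def B_def seg_def using ce(1) by blast+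
  then have "f \<subseteq> - (?X \<union> ?Y \<union> ?Z)" using face_props(3)[OF f(1)] e(1-3) by blast
  then consider "f \<subseteq> R" | "f \<subseteq> S" | "f \<subseteq> T" using connected_in_theta_region[OF r] face_props(1,2)[OF f(1)] by blast
  then show False
  proof cases
    case 1
    obtain p where p: "p \<in> e1 - {vx i, vx (i + a1)}" using arc_joins_interior(3)[OF arcs(1)] by blast
    have "p \<in> R \<union> ?Y \<union> ?Z" using p f(2) closure_mono[OF 1] cl(1) by blast
    moreover have "p \<notin> R" using p cl(4) by blast
    ultimately have "p \<in> {vx i, vx (i + a2)}" using XY XZ p by blast
    then have "p \<in> e1 \<inter> V" using p vx_in by blast
    then show False using p e(4) by blast
  next
    case 2
    obtain p where p: "p \<in> e2 - {vx i, vx (i + a2)}" using arc_joins_interior(3)[OF arcs(2)] by blast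
    have "p \<in> S \<union> ?X \<union> ?Z" using p f(3) closure_mono[OF 2] cl(2) by blast
    moreover have "p \<notin> S" using p cl(5) by blast
    ultimately show False using XY YZ p by blast
  next
    case 3
    obtain p where p: "p \<in> e3 - {vx i, vx (i + a3)}" using arc_joins_interior(3)[OF arcs(3)] by blast
    have "p \<in> T \<union> ?X \<union> ?Y" using p f(4) closure_mono[OF 3] cl(3) by blast
    moreover have "p \<notin> T" using p cl(6) by blast
    ultimately have "p \<in> {vx i, vx (i + a2)}" using YZ XZ p by blast
    then have "p \<in> e3 \<inter> V" using p vx_in by blast
    then show False using p e(6) by blast
  qed
qed

text \<open>The three edges are sorted by the position of their far ends along the cycle, counted
  from \<open>v\<close>.\<close>

theorem no_three_edges:
  assumes e: "e1 \<in> E" "e2 \<in> E" "e3 \<in> E" "e1 \<noteq> e2" "e1 \<noteq> e3" "e2 \<noteq> e3"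
    and v: "v \<in> V" "v \<in> e1" "v \<in> e2" "v \<in> e3"
    and f: "f \<in> faces" "e1 \<subseteq> closure f" "e2 \<subseteq> closure f" "e3 \<subseteq> closure f"
  shows False
proof -
  obtain i where i: "v = vx i" using v V_eq by blast
  have "\<exists>a. 0 < a \<and> a < n \<and> e \<inter> V = {vx i, vx (i + a)}" if e: "e \<in> E" "v \<in> e" for e
  proof -
    obtain x y where xy: "x \<noteq> y" "e \<inter> V = {x, y}" using edge_ends e by metis
    then have "v = x \<or> v = y" using e v by blast
    then obtain u where u: "u \<noteq> v" "e \<inter> V = {v, u}" using xy by (metis insert_commute)
    then have "u \<in> V" by blast
    then have "u \<in> vx ` {i..<i + n}" using V_eq(1) image_mod_period(1)[OF n_pos, of vx i] vx_mod by simp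
    then obtain k where k: "k \<in> {i..<i+n}" "u = vx k" by blast
    moreover have "k \<noteq> i" using u k i by auto
    ultimately show ?thesis using u i by (intro exI[of _ "k - i"]) auto
  qed
  then obtain a1 a2 a3 where a: "0 < a1" "a1 < n" "e1 \<inter> V = {vx i, vx (i + a1)}"
    "0 < a2" "a2 < n" "e2 \<inter> V = {vx i, vx (i + a2)}" "0 < a3" "a3 < n" "e3 \<inter> V = {vx i, vx (i + a3)}"
    using e(1-3) v by meson
  have "a1 \<noteq> a2" "a1 \<noteq> a3" "a2 \<noteq> a3" using edge_unique e a(3,6,9) by metis+
  then consider "a1 < a2 \<and> a2 < a3" | "a1 < a3 \<and> a3 < a2" | "a2 < a1 \<and> a1 < a3" | "a2 < a3 \<and> a3 < a1"
    | "a3 < a1 \<and> a1 < a2" | "a3 < a2 \<and> a2 < a1" by linarith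
  then show False
    by cases (use no_three_edges_ordered[of _ _ _ i] e(1-3) a f in meson)+
qed

text \<open>The ends of \<open>d\<close> lie inside the two different paths between the ends of
  \<open>c\<close>. Each of the two regions beside \<open>c\<close> has only one of these paths on
  its frontier, so \<open>d\<close> cannot run in either and must lie on the other side of the
  cycle.\<close>

lemma chord_crossing:
  assumes c: "c \<in> chd" "c \<inter> V = {vx i, vx (i + l)}" and d: "d \<in> chd" "d \<inter> V = {vx (i + p), vx (i + q)}"
    and pq: "0 < p" "p < l" "l < q" "q < n"
    and W: "W \<in> components (- rim)" "c - rim \<subseteq> W" "d - rim \<subseteq> W"
  shows False
proof -
  have l: "0 < l" "l < n" using pq by auto
  let ?X = "seg i l" and ?Y = "seg (i + l) (n - l)"
  have th: "theta_curve (vx i) (vx (i + l)) ?X ?Y c" by (rule chord_theta[OF c l])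
  then obtain R S T where r: "theta_regions ?X ?Y c R S T" using theta_regions_exist by blast
  note cl = theta_region_closure[OF r]
  have rim: "?X \<union> ?Y = rim" using seg_split l by simp
  have neq: "vx (i + a) \<noteq> vx (i + b)" if "a < b" "b < n" for a b
    using mod_eq_close[of "i + a" n "i + b"] that by (auto simp: vx_eq)
  have ne: "vx i \<noteq> vx (i + l)" "vx (i + p) \<noteq> vx (i + q)" "vx (i + p) \<noteq> vx i" "vx (i + p) \<noteq> vx (i + l)"
     "vx (i + q) \<noteq> vx i" "vx (i + q) \<noteq> vx (i + l)"
    using neq[of 0 l] neq[of p q] neq[of 0 p] neq[of p l] neq[of 0 q] neq[of l q] pq by auto
  have pX: "vx (i + p) \<in> ?X"
    using seg_ends(2)[of p i] seg_add[of i p "l - p"] pq by simp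
  have qY: "vx (i + q) \<in> ?Y"
    using seg_ends(2)[of "q - l" "i + l"] seg_add[of "i + l" "q - l" "n - q"] pq by simp
  note di = chord_interior[OF d ne(2)]
  have cd: "c \<noteq> d"
  proof
    assume "c = d"
    then have "vx (i + p) \<in> {vx i, vx (i + l)}" using c(2) d(2) by auto
    then show False using ne by blast
  qed
  have "d - rim \<subseteq> - (?X \<union> ?Y \<union> c)" using chord_inter[OF c(1) d(1) cd] rim by blast
  then have "d - rim \<subseteq> R \<or> d - rim \<subseteq> S \<or> d - rim \<subseteq> T"
    using connected_in_theta_region[OF r di(2,3)] by blast
  moreover have "d \<subseteq> closure (d - rim)"
    unfolding di(1) using arc_joins_interior(2)[OF edge_arc[OF chdE[OF d(1)] d(2) ne(2)]] .
  then have dcl: "vx (i + p) \<in> closure (d - rim)" "vx (i + q) \<in> closure (d - rim)" using d(2) by blast+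
  have t: "?X \<inter> ?Y = {vx i, vx (i + l)}" "?X \<inter> c = {vx i, vx (i + l)}" "?Y \<inter> c = {vx i, vx (i + l)}"
    using th unfolding theta_curve_def by auto
  have "vx (i + p) \<notin> R \<union> ?Y \<union> c" using pX t ne cl(4) by blast
  then have "\<not> d - rim \<subseteq> R" using closure_mono[of "d - rim" R] dcl(1) cl(1) by blast
  moreover have "vx (i + q) \<notin> S \<union> ?X \<union> c" using qY t ne cl(5) by blast
  then have "\<not> d - rim \<subseteq> S" using closure_mono[of "d - rim" S] dcl(2) cl(2) by blast
  ultimately have dT: "d - rim \<subseteq> T" by blast
  have "T \<in> components (- rim)" using theta_regions_other_side(1)[OF th r] rim by simp
  then have "W = T" using components_nonoverlap[OF W(1)] dT W(3) di(3) by blast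
  then have "c - rim \<subseteq> T" using W(2) by simp
  then show False using cl(6) chord_interior(3)[OF c ne(1)] by blast
qed

text \<open>Chords on the other side separate nothing within \<open>W\<close>, as \<open>W\<close>
  avoids them. For the chords on this side connectedness is assumed one chord at a time, and
  \<open>connected_component_add_chords\<close> combines these assumptions.\<close>

lemma same_faceI:
  assumes f: "f \<in> faces" "g \<in> faces" and W: "W \<in> components (- rim)" "f \<subseteq> W" "g \<subseteq> W"
    and Q: "\<And>c. \<lbrakk>c \<in> chd; c - rim \<subseteq> W\<rbrakk> \<Longrightarrow> \<exists>Q. connected Q \<and> Q \<subseteq> - (rim \<union> c) \<and> f \<subseteq> Q \<and> g \<subseteq> Q"
  shows "f = g"
proof -
  obtain x y where xy: "x \<in> f" "y \<in> g" using face_props(2)[OF f(1)] face_props(2)[OF f(2)] by blast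
  have Wp: "connected W" "W \<subseteq> - rim"
    by (rule in_components_connected[OF W(1)], rule in_components_subset[OF W(1)])
  have "connected_component (- (rim \<union> \<Union>chd)) x y"
  proof (rule connected_component_add_chords[OF rim_top fin_chd])
    show "compact c" if "c \<in> chd" for c using edge_compact(1) chdE that by blast
    show "c \<inter> d \<subseteq> rim" if "c \<in> chd" "d \<in> chd" "c \<noteq> d" for c d using chord_inter that by blast
    show "connected_component (- rim) x y"
      unfolding connected_component_def using Wp W xy by blast
    fix c assume c: "c \<in> chd"
    show "connected_component (- (rim \<union> c)) x y"
    proof (cases "c - rim \<subseteq> W")
      case True
      then show ?thesis using Q[OF c True] xy unfolding connected_component_def by blast
    next
      case False
      obtain a b where ab: "a \<noteq> b" "c \<inter> V = {a, b}" using edge_ends chdE[OF c] by metis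
      note ci = chord_interior[OF c ab(2,1)]
      have "W \<inter> (c - rim) = {}" using components_maximal[OF W(1) ci(2)] False by blast
      then have "W \<subseteq> - (rim \<union> c)" using Wp by blast
      then show ?thesis unfolding connected_component_def using Wp W xy by blast
    qed
  qed
  then obtain K where "connected K" "K \<subseteq> - (rim \<union> \<Union>chd)" "x \<in> K" "y \<in> K" unfolding connected_component_def by blast
  then have "K \<subseteq> f" "K \<subseteq> g" using components_maximal f xy unfolding faces_eq by blast+
  then show ?thesis using face_disjoint[OF f] \<open>x \<in> K\<close> by blast
qed

end

lemma add_mod_cancel: "((i::nat) + m) mod n = (j + m) mod n \<longleftrightarrow> i mod n = j mod n"
proof (induction i j rule: linorder_wlog)
  case (le i j)
  then show ?case
    using mod_eq_dvd_iff_nat[of "i + m" "j + m" n] mod_eq_dvd_iff_nat[of i j n] by (auto simp: eq_commute)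
qed (simp add: eq_commute)

context ham_graph
begin

section \<open>Equivalence of the two conditions\<close>

text \<open>The index form of a splitting: \<open>A\<close> occupies the \<open>l\<close> positions
  from \<open>k\<close> on.\<close>

definition cut_at :: "nat \<Rightarrow> nat \<Rightarrow> bool" where
  "cut_at k l \<longleftrightarrow> 0 < l \<and> l < n \<and>
     (\<forall>c\<in>chd. \<exists>a\<in>{k..<k + l}. \<exists>b\<in>{k + l..<k + n}. c \<inter> V = {vx a, vx b})"

lemma rotate_nth: "t < n \<Longrightarrow> rotate k C ! t = vx (k + t)"
  by (simp add: nth_rotate n_def vx_def)

lemma image_shift: "f ` {k..<k + (l::nat)} = (\<lambda>t. f (k + t)) ` {..<l}"
proof -
  have "{k..<k + l} = (+) k ` {..<l}" by (simp add: lessThan_atLeast0 add.commute)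
  then show ?thesis by (simp add: image_image)
qed

lemma splittable_iff: "splittable V E C \<longleftrightarrow> (\<exists>k l. cut_at k l)"
proof
  assume "splittable V E C"
  then obtain k A B where AB: "rotate k C = A @ B" "A \<noteq> []" "B \<noteq> []"
     "\<forall>e\<in>chd. \<exists>a\<in>set A. \<exists>b\<in>set B. e \<inter> V = {a, b}" unfolding splittable_def by blast
  have len: "length A + length B = n" using arg_cong[OF AB(1), of length] by (simp add: n_def)
  let ?l = "length A"
  have A: "A ! t = vx (k + t)" if "t < ?l" for t
    using rotate_nth[of t k] that len AB(1) by (simp add: nth_append)
  have B: "B ! t = vx (k + ?l + t)" if "t < length B" for t
    using rotate_nth[of "?l + t" k] that len AB(1) by (simp add: nth_append add.assoc)
  have "set A = (!) A ` {..<?l}" by (auto simp: set_conv_nth)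
  also have "\<dots> = (\<lambda>t. vx (k + t)) ` {..<?l}" using A by (intro image_cong) auto
  finally have sA: "set A = vx ` {k..<k + ?l}" unfolding image_shift .
  have "set B = (!) B ` {..<length B}" by (auto simp: set_conv_nth)
  also have "\<dots> = (\<lambda>t. vx (k + ?l + t)) ` {..<length B}" using B by (intro image_cong) auto
  finally have "set B = vx ` {k + ?l..<k + ?l + length B}" unfolding image_shift .
  then have sB: "set B = vx ` {k + ?l..<k + n}" using len by (simp add: add.assoc)
  have "0 < ?l" "0 < length B" using AB(2,3) by simp_all
  then have "0 < ?l" "?l < n" using len by linarith+
  then have "cut_at k ?l" using AB(4) unfolding cut_at_def sA sB by simp
  then show "\<exists>k l. cut_at k l" by blast
next
  assume "\<exists>k l. cut_at k l"
  then obtain k l where c: "cut_at k l" by blast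
  then have l: "0 < l" "l < n" unfolding cut_at_def by auto
  let ?A = "take l (rotate k C)" and ?B = "drop l (rotate k C)"
  have ln: "length (rotate k C) = n" by (simp add: n_def)
  have A: "vx a \<in> set ?A" if "a \<in> {k..<k + l}" for a
  proof -
    have "?A ! (a - k) = vx a" "a - k < length ?A" using that l ln rotate_nth[of "a - k" k] by auto
    then show ?thesis by (metis nth_mem)
  qed
  have B: "vx a \<in> set ?B" if "a \<in> {k + l..<k + n}" for a
  proof -
    have "?B ! (a - k - l) = vx a" "a - k - l < length ?B" using that l ln rotate_nth[of "a - k" k] by auto
    then show ?thesis by (metis nth_mem)
  qed
  have "?A \<noteq> []" "?B \<noteq> []" using l ln by auto
  moreover have "\<forall>e\<in>chd. \<exists>a\<in>set ?A. \<exists>b\<in>set ?B. e \<inter> V = {a, b}"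
    using c A B unfolding cut_at_def by meson
  moreover have "rotate k C = ?A @ ?B" by simp
  ultimately show "splittable V E C" unfolding splittable_def by blast
qed

definition chord_at :: "nat \<Rightarrow> nat \<Rightarrow> bool" where
  "chord_at s t \<longleftrightarrow> (\<exists>c\<in>chd. c \<inter> V = {vx s, vx t})"

lemma chords_rotate: "chords V E (rotate k C) = chd"
proof -
  have "(\<exists>i<length (rotate k C). e \<inter> V = {rotate k C ! i, rotate k C ! (Suc i mod length (rotate k C))})
     \<longleftrightarrow> (\<exists>j. e \<inter> V = {vx j, vx (Suc j)})" for e
  proof -
    have "(\<exists>i<n. e \<inter> V = {rotate k C ! i, rotate k C ! (Suc i mod n)}) \<longleftrightarrow> (\<exists>i<n. e \<inter> V = {vx (k + i), vx (Suc (k + i))})"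
    proof -
      have "rotate k C ! i = vx (k + i) \<and> rotate k C ! (Suc i mod n) = vx (Suc (k + i))" if "i < n" for i
      proof -
        have "rotate k C ! (Suc i mod n) = vx (k + Suc i mod n)" using n_pos by (intro rotate_nth) simp
        also have "\<dots> = vx (Suc (k + i))" unfolding vx_eq by (simp add: mod_add_right_eq)
        finally show ?thesis using rotate_nth[OF that] by simp
      qed
      then show ?thesis by (metis (no_types, lifting))
    qed
    also have "\<dots> \<longleftrightarrow> (\<exists>j. e \<inter> V = {vx j, vx (Suc j)})"
    proof
      assume "\<exists>j. e \<inter> V = {vx j, vx (Suc j)}"
      then obtain j where j: "e \<inter> V = {vx j, vx (Suc j)}" by blast
      have "(\<lambda>i. {vx i, vx (Suc i)}) ` {k..<k + n} = range (\<lambda>i. {vx i, vx (Suc i)})"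
      proof -
        have "{vx i, vx (Suc i)} = {vx (i mod n), vx (Suc (i mod n))}" for i
        proof -
          have "vx (Suc (i mod n)) = vx (Suc i)" by (simp add: vx_eq mod_Suc_eq)
          then show ?thesis by (simp add: vx_mod)
        qed
        then show ?thesis
          using image_mod_period(1)[where f = "\<lambda>i. {vx i, vx (Suc i)}" and i = k, OF n_pos]
            image_mod_period(2)[where f = "\<lambda>i. {vx i, vx (Suc i)}", OF n_pos] by metis
      qed
      then obtain i where "i \<in> {k..<k + n}" "{vx j, vx (Suc j)} = {vx i, vx (Suc i)}" by (metis (no_types, lifting) imageE rangeI)
      then show "\<exists>i<n. e \<inter> V = {vx (k + i), vx (Suc (k + i))}" using j by (intro exI[of _ "i - k"]) auto
    qed blast
    finally show ?thesis by (simp add: n_def)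
  qed
  moreover have "(\<exists>i<length C. e \<inter> V = {C ! i, C ! (Suc i mod length C)}) \<longleftrightarrow> (\<exists>j. e \<inter> V = {vx j, vx (Suc j)})" for e
  proof
    assume "\<exists>j. e \<inter> V = {vx j, vx (Suc j)}"
    then obtain j where j: "e \<inter> V = {vx j, vx (Suc j)}" by blast
    have "j mod n < length C" using n_pos by (simp add: n_def)
    moreover have "vx j = C ! (j mod n)" "vx (Suc j) = C ! (Suc (j mod n) mod length C)"
      by (auto simp: vx_def n_def mod_Suc_eq)
    ultimately show "\<exists>i<length C. e \<inter> V = {C ! i, C ! (Suc i mod length C)}" using j by metis
  next
    assume "\<exists>i<length C. e \<inter> V = {C ! i, C ! (Suc i mod length C)}"
    then obtain i where i: "i < length C" "e \<inter> V = {C ! i, C ! (Suc i mod length C)}" by blast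
    then have "vx i = C ! i" "vx (Suc i) = C ! (Suc i mod length C)" by (simp_all add: vx_def n_def)
    then show "\<exists>j. e \<inter> V = {vx j, vx (Suc j)}" using i(2) by metis
  qed
  ultimately show ?thesis unfolding chords_def by simp
qed

text \<open>With unbounded indices the choice of the first vertex becomes the choice of a window
  from \<open>k\<close> to \<open>k + n\<close>.\<close>

lemma three_chords_rotate:
  "three_chords_in_order V E (rotate k C) \<longleftrightarrow>
    (\<exists>s1 t1 s2 t2 s3 t3. k \<le> s1 \<and> s1 < t1 \<and> t1 \<le> s2 \<and> s2 < t2 \<and> t2 \<le> s3 \<and> s3 < t3 \<and> t3 \<le> k + n \<and>
      chord_at s1 t1 \<and> chord_at s2 t2 \<and> chord_at s3 t3)"
proof -
  have cyc: "cyc_nth (rotate k C) i = vx (k + i - 1)" if "1 \<le> i" for i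
  proof -
    have "(i - 1) mod n < n" using n_pos by simp
    then have "cyc_nth (rotate k C) i = vx (k + (i - 1) mod n)"
      unfolding cyc_nth_def using rotate_nth by (simp add: n_def)
    also have "\<dots> = vx (k + (i - 1))" by (simp add: vx_eq mod_add_right_eq)
    finally show ?thesis using that by simp
  qed
  show ?thesis
  proof
    assume "three_chords_in_order V E (rotate k C)"
    then obtain i1 i2 i3 i4 i5 i6 where i: "1 \<le> i1" "i1 < i2" "i2 \<le> i3" "i3 < i4" "i4 \<le> i5" "i5 < i6" "i6 \<le> n + 1"
        and c: "\<exists>e\<in>chd. e \<inter> V = {cyc_nth (rotate k C) i1, cyc_nth (rotate k C) i2}"
         "\<exists>e\<in>chd. e \<inter> V = {cyc_nth (rotate k C) i3, cyc_nth (rotate k C) i4}"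
         "\<exists>e\<in>chd. e \<inter> V = {cyc_nth (rotate k C) i5, cyc_nth (rotate k C) i6}"
      unfolding three_chords_in_order_def chords_rotate length_rotate n_def[symmetric]
      by (elim exE conjE) (rule that, assumption+)
    have c': "chord_at (k + i1 - 1) (k + i2 - 1)" "chord_at (k + i3 - 1) (k + i4 - 1)" "chord_at (k + i5 - 1) (k + i6 - 1)"
      using c i by (simp_all add: chord_at_def cyc)
    have q: "k \<le> k + i1 - 1" "k + i1 - 1 < k + i2 - 1" "k + i2 - 1 \<le> k + i3 - 1" "k + i3 - 1 < k + i4 - 1"
      "k + i4 - 1 \<le> k + i5 - 1" "k + i5 - 1 < k + i6 - 1" "k + i6 - 1 \<le> k + n"
      using i by linarith+
    show "\<exists>s1 t1 s2 t2 s3 t3. k \<le> s1 \<and> s1 < t1 \<and> t1 \<le> s2 \<and> s2 < t2 \<and> t2 \<le> s3 \<and> s3 < t3 \<and> t3 \<le> k + n \<and>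
      chord_at s1 t1 \<and> chord_at s2 t2 \<and> chord_at s3 t3"
      by (intro exI conjI, rule q(1), rule q(2), rule q(3), rule q(4), rule q(5), rule q(6), rule q(7), rule c'(1), rule c'(2), rule c'(3))
  next
    assume "\<exists>s1 t1 s2 t2 s3 t3. k \<le> s1 \<and> s1 < t1 \<and> t1 \<le> s2 \<and> s2 < t2 \<and> t2 \<le> s3 \<and> s3 < t3 \<and> t3 \<le> k + n \<and>
      chord_at s1 t1 \<and> chord_at s2 t2 \<and> chord_at s3 t3"
    then obtain s1 t1 s2 t2 s3 t3 where i: "k \<le> s1" "s1 < t1" "t1 \<le> s2" "s2 < t2" "t2 \<le> s3" "s3 < t3" "t3 \<le> k + n"
      "chord_at s1 t1" "chord_at s2 t2" "chord_at s3 t3" by (elim exE conjE) (rule that, assumption+)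
    have e: "cyc_nth (rotate k C) (s - k + 1) = vx s" if "k \<le> s" for s using cyc[of "s - k + 1"] that by simp
    have le: "k \<le> t1" "k \<le> s2" "k \<le> t2" "k \<le> s3" "k \<le> t3" using i by linarith+
    have c: "\<exists>e\<in>chd. e \<inter> V = {cyc_nth (rotate k C) (s1 - k + 1), cyc_nth (rotate k C) (t1 - k + 1)}"
      "\<exists>e\<in>chd. e \<inter> V = {cyc_nth (rotate k C) (s2 - k + 1), cyc_nth (rotate k C) (t2 - k + 1)}"
      "\<exists>e\<in>chd. e \<inter> V = {cyc_nth (rotate k C) (s3 - k + 1), cyc_nth (rotate k C) (t3 - k + 1)}"
      using i(8-10) unfolding chord_at_def e[OF i(1)] e[OF le(1)] e[OF le(2)] e[OF le(3)] e[OF le(4)] e[OF le(5)] .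
    have q: "1 \<le> s1 - k + 1" "s1 - k + 1 < t1 - k + 1" "t1 - k + 1 \<le> s2 - k + 1" "s2 - k + 1 < t2 - k + 1"
      "t2 - k + 1 \<le> s3 - k + 1" "s3 - k + 1 < t3 - k + 1" "t3 - k + 1 \<le> n + 1"
      using i(1-7) by linarith+
    show "three_chords_in_order V E (rotate k C)"
      unfolding three_chords_in_order_def chords_rotate length_rotate n_def[symmetric]
      by (intro exI conjI, rule q(1), rule q(2), rule q(3), rule q(4), rule q(5), rule q(6), rule q(7), rule c(1), rule c(2), rule c(3))
  qed
qed

text \<open>Pigeonhole: only two edges of the cycle join \<open>A\<close> and \<open>B\<close>, and
  the path between the ends of a chord contains one of them, whereas three chords in order would
  span three paths without a common edge.\<close>

lemma splittable_imp_no_three: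
  assumes "splittable V E C" shows "no_three_chords V E C"
  unfolding no_three_chords_def
proof (intro allI notI)
  fix k0 assume "three_chords_in_order V E (rotate k0 C)"
  then obtain s1 t1 s2 t2 s3 t3 where st0: "k0 \<le> s1" "s1 < t1" "t1 \<le> s2" "s2 < t2" "t2 \<le> s3" "s3 < t3" "t3 \<le> k0 + n"
    and ch: "chord_at s1 t1" "chord_at s2 t2" "chord_at s3 t3"
    unfolding three_chords_rotate by (elim exE conjE) (rule that, assumption+)
  have st: "s1 < t1" "t1 \<le> s2" "s2 < t2" "t2 \<le> s3" "s3 < t3" "t3 \<le> s1 + n" using st0 by linarith+
  obtain k l where cut: "cut_at k l" using assms splittable_iff by blast
  then have l: "0 < l" "l < n" unfolding cut_at_def by auto
  \<comment> \<open>Position of the index \<open>i\<close> counted from \<open>k\<close>; adding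
    \<open>n - k mod n\<close> replaces the subtraction of \<open>k\<close> in the natural numbers.
    The two edges between \<open>A\<close> and \<open>B\<close> start at the positions
    \<open>l - 1\<close> and \<open>n - 1\<close>.\<close>
  define w where "w i = (i + (n - k mod n)) mod n" for i
  have w_cong: "w i = w j \<longleftrightarrow> i mod n = j mod n" for i j
    unfolding w_def by (rule add_mod_cancel)
  have w_k: "w (k + x) = x mod n" for x
  proof -
    have "k mod n \<le> k" "k mod n \<le> n" using n_pos by (auto simp: less_imp_le)
    then have "k + x + (n - k mod n) = x + n * (k div n) + n"
      using minus_mod_eq_mult_div[of k n] by linarith
    then have "w (k + x) = (x + n * (k div n) + n) mod n" unfolding w_def by (simp only:)
    then show ?thesis by simp
  qed
  \<comment> \<open>A path that avoids both cut edges stays within \<open>A\<close> or within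
    \<open>B\<close>, but the ends of a chord lie in different parts.\<close>
  have change: "\<exists>i\<in>{s..<t}. w i = l - 1 \<or> w i = n - 1" if st': "s < t" "chord_at s t" for s t
  proof (rule ccontr)
    assume no: "\<not> ?thesis"
    have same: "w (s + d) < l \<longleftrightarrow> w s < l" if "s + d \<le> t" for d
      using that
    proof (induction d)
      case (Suc d)
      have "s + d \<in> {s..<t}" using Suc.prems by simp
      then have "w (s + d) \<noteq> l - 1" "w (s + d) \<noteq> n - 1" using no by blast+
      moreover have "w (s + Suc d) = (if Suc (w (s + d)) = n then 0 else Suc (w (s + d)))"
        unfolding w_def by (simp add: mod_Suc)
      ultimately have "w (s + Suc d) < l \<longleftrightarrow> w (s + d) < l" using l by auto
      moreover have "w (s + d) < l \<longleftrightarrow> w s < l" using Suc by simp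
      ultimately show ?case by blast
    qed simp
    obtain c where c: "c \<in> chd" "c \<inter> V = {vx s, vx t}" using st'(2) unfolding chord_at_def by blast
    have "\<exists>a\<in>{k..<k + l}. \<exists>b\<in>{k + l..<k + n}. c \<inter> V = {vx a, vx b}"
      using cut c(1) unfolding cut_at_def by simp
    then obtain a b where ab: "a \<in> {k..<k + l}" "b \<in> {k + l..<k + n}" "c \<inter> V = {vx a, vx b}" by blast
    have "w a < l" "\<not> w b < l" using w_k[of "a - k"] w_k[of "b - k"] ab l by auto
    moreover have "(w s = w a \<and> w t = w b) \<or> (w s = w b \<and> w t = w a)"
      using ab(3) c(2) unfolding w_cong by (auto simp: doubleton_eq_iff vx_eq)
    ultimately show False using same[of "t - s"] st'(1) by auto
  qed
  obtain i1 where i1: "i1 \<in> {s1..<t1}" "w i1 = l - 1 \<or> w i1 = n - 1" using change st ch by blast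
  obtain i2 where i2: "i2 \<in> {s2..<t2}" "w i2 = l - 1 \<or> w i2 = n - 1" using change st ch by blast
  obtain i3 where i3: "i3 \<in> {s3..<t3}" "w i3 = l - 1 \<or> w i3 = n - 1" using change st ch by blast
  have "w i1 = w i2 \<or> w i2 = w i3 \<or> w i1 = w i3" using i1 i2 i3 by auto
  then show False
    using mod_eq_close[of i1 n i2] mod_eq_close[of i2 n i3] mod_eq_close[of i1 n i3] i1(1) i2(1) i3(1) st
    unfolding w_cong by auto
qed

end

section \<open>Arcs cut off by chords and the choice of the two cut edges\<close>

context ham_graph
begin

text \<open>An arc of \<open>C\<close> is encoded by the set of indices of its edges.\<close>

definition carc :: "nat \<Rightarrow> nat \<Rightarrow> nat set" where
  "carc s l = (\<lambda>j. (s + j) mod n) ` {..<l}"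

text \<open>The arc of \<open>m\<close> edges that starts with edge \<open>p\<close>, for indices
  below \<open>n\<close>: the last disjunct is the part that wraps around past
  \<open>n\<close>.\<close>

definition base_arc :: "nat \<Rightarrow> nat \<Rightarrow> nat set" where
  "base_arc p m = {x. x < n \<and> (p \<le> x \<and> x < p + m \<or> x + n < p + m)}"

lemma carc_cong: "s mod n = s' mod n \<Longrightarrow> carc s l = carc s' l"
  unfolding carc_def by (metis mod_add_left_eq)

lemma carc_shift:
  assumes "p < n" "m \<le> n" shows "carc (s + p) m = (\<lambda>x. (s + x) mod n) ` base_arc p m"
proof (intro subset_antisym subsetI)
  fix y assume "y \<in> carc (s + p) m"
  then obtain j where j: "j < m" "y = (s + p + j) mod n" unfolding carc_def by blast
  show "y \<in> (\<lambda>x. (s + x) mod n) ` base_arc p m"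
  proof (cases "p + j < n")
    case True then show ?thesis using j by (intro image_eqI[of _ _ "p + j"]) (auto simp: base_arc_def add.assoc)
  next
    case False
    have "s + p + j = s + (p + j - n) + n" using False by linarith
    then have "y = (s + (p + j - n)) mod n" unfolding j(2) by (simp only: mod_add_self2)
    then show ?thesis using j False assms by (intro image_eqI[of _ _ "p + j - n"]) (auto simp: base_arc_def)
  qed
next
  fix y assume "y \<in> (\<lambda>x. (s + x) mod n) ` base_arc p m"
  then obtain x where x: "x \<in> base_arc p m" "y = (s + x) mod n" by blast
  show "y \<in> carc (s + p) m"
  proof (cases "p \<le> x \<and> x < p + m")
    case True then show ?thesis using x unfolding carc_def by (intro image_eqI[of _ _ "x - p"]) auto
  next
    case False
    then have "x + n < p + m" using x by (auto simp: base_arc_def)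
    then have e: "s + p + (x + n - p) = s + x + n" "x + n - p < m" using assms by linarith+
    have "y = (s + p + (x + n - p)) mod n" unfolding e(1) x(2) by (simp only: mod_add_self2)
    then show ?thesis using e(2) unfolding carc_def by (intro image_eqI[of _ _ "x + n - p"]) auto
  qed
qed

lemma inj_shift: "inj_on (\<lambda>x. (s + x) mod n) {..<n}"
proof (rule inj_onI)
  fix x y assume *: "x \<in> {..<n}" "y \<in> {..<n}" "(s + x) mod n = (s + y) mod n"
  show "x = y"
    using mod_eq_close[OF *(3)] mod_eq_close[OF *(3)[symmetric]] * by (cases "x \<le> y") auto
qed

lemma carc_full: "carc s n = {..<n}"
proof -
  have "carc s n = (\<lambda>i. i mod n) ` {s..<s + n}" unfolding carc_def image_shift ..
  also have "\<dots> = (\<lambda>i. i mod n) ` {..<n}" by (rule image_mod_period(1)[OF n_pos]) simp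
  finally show ?thesis by simp
qed

lemma carc_compl: "l \<le> n \<Longrightarrow> l > 0 \<Longrightarrow> carc (s + l) (n - l) = {..<n} - carc s l"
proof -
  assume l: "l \<le> n" "l > 0"
  have "{..<n} - carc s l = (\<lambda>x. (s + x) mod n) ` {..<n} - (\<lambda>x. (s + x) mod n) ` {..<l}"
    using carc_full[of s] unfolding carc_def by simp
  also have "\<dots> = (\<lambda>x. (s + x) mod n) ` ({..<n} - {..<l})"
  proof (rule inj_on_image_set_diff[OF inj_shift, symmetric])
    show "{..<n} - {..<l} \<subseteq> {..<n}" "{..<l} \<subseteq> {..<n}" using l by auto
  qed
  also have "{..<n} - {..<l} = {l..<l + (n - l)}" using l by auto
  also have "(\<lambda>x. (s + x) mod n) ` \<dots> = carc (s + l) (n - l)"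
    unfolding carc_def image_shift by (simp add: add.assoc)
  finally show ?thesis by simp
qed

definition chord_arc :: "complex set \<Rightarrow> nat set \<Rightarrow> bool" where
  "chord_arc W S \<longleftrightarrow> (\<exists>s l c. 0 < l \<and> l < n \<and> c \<in> chd \<and> c - rim \<subseteq> W \<and> c \<inter> V = {vx s, vx (s + l)} \<and> S = carc s l)"

lemma chord_arc_compl: "chord_arc W S \<Longrightarrow> chord_arc W ({..<n} - S)"
proof -
  assume "chord_arc W S"
  then obtain s l c where *: "0 < l" "l < n" "c \<in> chd" "c - rim \<subseteq> W" "c \<inter> V = {vx s, vx (s + l)}" "S = carc s l"
    unfolding chord_arc_def by blast
  have "vx (s + l + (n - l)) = vx s" using * vx_add_n[of s] by simp
  then have "c \<inter> V = {vx (s + l), vx (s + l + (n - l))}" using * by auto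
  then show ?thesis
    unfolding chord_arc_def using * carc_compl[of l s]
    by (intro exI[of _ "s + l"] exI[of _ "n - l"] exI[of _ c]) auto
qed

lemma chord_arc_sub: "chord_arc W S \<Longrightarrow> S \<subseteq> {..<n} \<and> S \<noteq> {}"
  unfolding chord_arc_def carc_def using n_pos by auto

lemma chord_arc_based:
  assumes "chord_arc W S"
  obtains p m c where "p < n" "0 < m" "m < n" "c \<in> chd" "c - rim \<subseteq> W" "c \<inter> V = {vx (b + p), vx (b + p + m)}"
    "S = carc (b + p) m"
proof -
  obtain s l c where *: "0 < l" "l < n" "c \<in> chd" "c - rim \<subseteq> W" "c \<inter> V = {vx s, vx (s + l)}" "S = carc s l"
    using assms unfolding chord_arc_def by blast
  have "s mod n \<in> (\<lambda>x. (b + x) mod n) ` {..<n}" using carc_full[of b] n_pos unfolding carc_def by simp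
  then obtain p where p: "p < n" "(b + p) mod n = s mod n" by auto
  then have "vx s = vx (b + p)" "vx (s + l) = vx (b + p + l)"
    unfolding vx_eq using mod_add_cong[OF p(2) refl[of "l mod n"]] by auto
  then show ?thesis using that[of p l c] p * carc_cong[OF p(2)] by simp
qed

text \<open>Seen from the start of the first arc, the other two do not wrap around, since they would
  contain its first edge. Read in order, the three arcs then belong to three chords in
  order.\<close>

lemma three_disjoint_arcs:
  assumes A: "chord_arc W1 S1" "chord_arc W2 S2" "chord_arc W3 S3"
    and d: "S1 \<inter> S2 = {}" "S1 \<inter> S3 = {}" "S2 \<inter> S3 = {}"
  shows "\<not> no_three_chords V E C"
proof -
  obtain s l c where 1: "0 < l" "l < n" "c \<in> chd" "c \<inter> V = {vx s, vx (s + l)}" "S1 = carc s l"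
    using A(1) unfolding chord_arc_def by blast
  have S1: "S1 = (\<lambda>x. (s + x) mod n) ` {..<l}" using 1 by (simp add: carc_def)
  let ?\<phi> = "\<lambda>x. (s + x) mod n"
  have base: "\<exists>p m. l \<le> p \<and> 0 < m \<and> p + m \<le> n \<and> chord_at (s + p) (s + p + m) \<and> S = ?\<phi> ` {p..<p+m}"
    if S: "chord_arc W S" "S1 \<inter> S = {}" for W S
  proof -
    obtain p m c where p: "p < n" "0 < m" "m < n" "c \<in> chd" "c \<inter> V = {vx (s + p), vx (s + p + m)}" "S = carc (s + p) m"
      using chord_arc_based[OF S(1), of s] by metis
    have Sb: "S = ?\<phi> ` base_arc p m" using carc_shift p by simp
    have "?\<phi> ` {..<l} \<inter> ?\<phi> ` base_arc p m = ?\<phi> ` ({..<l} \<inter> base_arc p m)"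
      using 1 by (intro inj_on_image_Int[OF inj_shift, symmetric]) (auto simp: base_arc_def)
    then have "{..<l} \<inter> base_arc p m = {}" using S(2) S1 Sb by simp
    moreover have "p \<in> base_arc p m" using p by (simp add: base_arc_def)
    moreover have "0 \<in> base_arc p m" if "n < p + m" using that p by (simp add: base_arc_def)
    moreover have "0 \<in> {..<l}" using 1 by simp
    ultimately have "p \<notin> {..<l}" "\<not> n < p + m" by blast+
    then have "l \<le> p" "p + m \<le> n" by simp_all
    moreover from this have "base_arc p m = {p..<p+m}" by (auto simp: base_arc_def)
    ultimately show ?thesis using p Sb unfolding chord_at_def by blast
  qed
  obtain p2 m2 where 2: "l \<le> p2" "0 < m2" "p2 + m2 \<le> n" "chord_at (s + p2) (s + p2 + m2)" "S2 = ?\<phi> ` {p2..<p2+m2}"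
    using base[OF A(2) d(1)] by blast
  obtain p3 m3 where 3: "l \<le> p3" "0 < m3" "p3 + m3 \<le> n" "chord_at (s + p3) (s + p3 + m3)" "S3 = ?\<phi> ` {p3..<p3+m3}"
    using base[OF A(3) d(2)] by blast
  have c1: "chord_at s (s + l)" using 1 chord_at_def by blast
  have "?\<phi> ` {p2..<p2+m2} \<inter> ?\<phi> ` {p3..<p3+m3} = ?\<phi> ` ({p2..<p2+m2} \<inter> {p3..<p3+m3})"
    using 2 3 by (intro inj_on_image_Int[OF inj_shift, symmetric]) auto
  then have "{p2..<p2+m2} \<inter> {p3..<p3+m3} = {}" using d(3) 2(5) 3(5) by simp
  then have "max p2 p3 \<notin> {p2..<p2+m2} \<inter> {p3..<p3+m3}" by simp
  then have "p2 + m2 \<le> p3 \<or> p3 + m3 \<le> p2" using 2(2) 3(2) by auto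
  then have "three_chords_in_order V E (rotate s C)"
  proof
    assume "p2 + m2 \<le> p3"
    then have "s \<le> s \<and> s < s + l \<and> s + l \<le> s + p2 \<and> s + p2 < s + p2 + m2 \<and> s + p2 + m2 \<le> s + p3 \<and>
        s + p3 < s + p3 + m3 \<and> s + p3 + m3 \<le> s + n"
      using 1(1) 2(1-3) 3(2,3) by linarith
    then show ?thesis unfolding three_chords_rotate using c1 2(4) 3(4) by blast
  next
    assume "p3 + m3 \<le> p2"
    then have "s \<le> s \<and> s < s + l \<and> s + l \<le> s + p3 \<and> s + p3 < s + p3 + m3 \<and> s + p3 + m3 \<le> s + p2 \<and>
        s + p2 < s + p2 + m2 \<and> s + p2 + m2 \<le> s + n"
      using 1(1) 3(1-3) 2(2,3) by linarith
    then show ?thesis unfolding three_chords_rotate using c1 3(4) 2(4) by blast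
  qed
  then show ?thesis unfolding no_three_chords_def by blast
qed

text \<open>Chords on the same side do not cross, so the arcs of two of them are nested, disjoint,
  or jointly cover the cycle.\<close>

lemma same_side_arcs:
  assumes A: "chord_arc W S" "chord_arc W S'" and W: "W \<in> components (- rim)"
  shows "S \<subseteq> S' \<or> S' \<subseteq> S \<or> S \<inter> S' = {} \<or> {..<n} - S \<subseteq> S'"
proof -
  obtain s l c where 1: "0 < l" "l < n" "c \<in> chd" "c - rim \<subseteq> W" "c \<inter> V = {vx s, vx (s + l)}" "S = carc s l"
    using A(1) unfolding chord_arc_def by blast
  obtain p m d where 2: "p < n" "0 < m" "m < n" "d \<in> chd" "d - rim \<subseteq> W" "d \<inter> V = {vx (s + p), vx (s + p + m)}" "S' = carc (s + p) m"
    using chord_arc_based[OF A(2), of s] by metis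
  let ?\<phi> = "\<lambda>x. (s + x) mod n"
  have S: "S = ?\<phi> ` {..<l}" "S' = ?\<phi> ` base_arc p m" "{..<n} - S = ?\<phi> ` {l..<n}"
  proof -
    show "S = ?\<phi> ` {..<l}" unfolding 1(6) carc_def ..
    show "S' = ?\<phi> ` base_arc p m" unfolding 2(7) using 2(1,3) by (intro carc_shift) simp_all
    have "{..<n} - S = carc (s + l) (n - l)" unfolding 1(6) using 1(1,2) by (intro carc_compl[symmetric]) simp_all
    also have "\<dots> = ?\<phi> ` base_arc l (n - l)" using 1(1,2) by (intro carc_shift) simp_all
    also have "base_arc l (n - l) = {l..<n}"
    proof (intro set_eqI)
      fix x show "x \<in> base_arc l (n - l) \<longleftrightarrow> x \<in> {l..<n}" using 1(1,2) unfolding base_arc_def by auto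
    qed
    finally show "{..<n} - S = ?\<phi> ` {l..<n}" .
  qed
  \<comment> \<open>The two ways in which the arcs could cross: the second one starts within the
    first and ends beyond it, or it starts beyond it, wraps around and ends within.\<close>
  have x1: "\<not> (0 < p \<and> p < l \<and> l < p + m \<and> p + m < n)"
  proof
    assume h: "0 < p \<and> p < l \<and> l < p + m \<and> p + m < n"
    have d: "d \<inter> V = {vx (s + p), vx (s + (p + m))}" using 2(6) unfolding add.assoc .
    show False by (rule chord_crossing[OF 1(3,5) 2(4) d _ _ _ _ W 1(4) 2(5)]) (use h in simp_all)
  qed
  have x2: "\<not> (0 < p + m - n \<and> p + m - n < l \<and> l < p \<and> n < p + m)"
  proof
    assume h: "0 < p + m - n \<and> p + m - n < l \<and> l < p \<and> n < p + m"
    have "s + p + m = s + (p + m - n) + n" using h by linarith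
    then have "vx (s + p + m) = vx (s + (p + m - n))" using vx_add_n[of "s + (p + m - n)"] by (simp only:)
    then have d: "d \<inter> V = {vx (s + (p + m - n)), vx (s + p)}" using 2(6) by (simp only: insert_commute)
    show False by (rule chord_crossing[OF 1(3,5) 2(4) d _ _ _ _ W 1(4) 2(5)]) (use h 2(1) in simp_all)
  qed
  have "{..<l} \<subseteq> base_arc p m \<or> base_arc p m \<subseteq> {..<l} \<or> {..<l} \<inter> base_arc p m = {} \<or> {l..<n} \<subseteq> base_arc p m"
  proof (cases "p < l")
    case True
    consider "p + m \<le> l" | "p = 0" "l < p + m" | "n \<le> p + m" using x1 True by linarith
    then show ?thesis
    proof cases
      case 1
      then have "base_arc p m \<subseteq> {..<l}" using \<open>l < n\<close> unfolding base_arc_def by auto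
      then show ?thesis by blast
    next
      case 2
      then have "{..<l} \<subseteq> base_arc p m" using \<open>l < n\<close> unfolding base_arc_def by auto
      then show ?thesis by blast
    next
      case 3
      then have "{l..<n} \<subseteq> base_arc p m" using True unfolding base_arc_def by auto
      then show ?thesis by blast
    qed
  next
    case False
    consider "p + m \<le> n" | "p = l" "n < p + m" | "l + n \<le> p + m" using x2 False by linarith
    then show ?thesis
    proof cases
      case 1
      then have "{..<l} \<inter> base_arc p m = {}" using False unfolding base_arc_def by auto
      then show ?thesis by blast
    next
      case 2
      then have "{l..<n} \<subseteq> base_arc p m" unfolding base_arc_def by auto
      then show ?thesis by blast
    next
      case 3
      then have "{..<l} \<subseteq> base_arc p m" using \<open>l < n\<close> unfolding base_arc_def by auto
      then show ?thesis by blast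
    qed
  qed
  then consider "{..<l} \<subseteq> base_arc p m" | "base_arc p m \<subseteq> {..<l}" | "{..<l} \<inter> base_arc p m = {}"
    | "{l..<n} \<subseteq> base_arc p m" by blast
  then show ?thesis
  proof cases
    case 1
    then have "S \<subseteq> S'" unfolding S(1,2) by (rule image_mono)
    then show ?thesis by simp
  next
    case 2
    then have "S' \<subseteq> S" unfolding S(1,2) by (rule image_mono)
    then show ?thesis by simp
  next
    case 3
    have "{..<l} \<subseteq> {..<n}" "base_arc p m \<subseteq> {..<n}" using \<open>l < n\<close> by (auto simp: base_arc_def)
    from inj_on_image_Int[OF inj_shift this] 3 have "S \<inter> S' = {}" unfolding S(1,2) by simp
    then show ?thesis by simp
  next
    case 4
    then have "{..<n} - S \<subseteq> S'" unfolding S(2,3) by (rule image_mono)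
    then show ?thesis by simp
  qed
qed

text \<open>Take a minimal arc \<open>I\<close> and a minimal arc \<open>J\<close> in its
  complement. By minimality and \<open>same_side_arcs\<close> any arc \<open>K\<close> contains or
  misses each of them. If \<open>K\<close> contained both, then \<open>I\<close>, \<open>J\<close>
  and the complement of \<open>K\<close> would be three disjoint arcs; if it missed both,
  \<open>I\<close>, \<open>J\<close> and \<open>K\<close> would be.\<close>

lemma separating_pair_side:
  assumes W: "W \<in> components (- rim)" and no: "no_three_chords V E C" and ne: "chord_arc W S"
  shows "\<exists>I J. chord_arc W I \<and> chord_arc W J \<and> I \<inter> J = {} \<and>
    (\<forall>K. chord_arc W K \<longrightarrow> I \<subseteq> K \<and> J \<inter> K = {} \<or> J \<subseteq> K \<and> I \<inter> K = {})"
proof -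
  have "\<exists>I. chord_arc W I \<and> I \<subseteq> S \<and> (\<forall>J. chord_arc W J \<and> J \<subseteq> I \<longrightarrow> J = I)" if S: "chord_arc W S" for S
  proof -
    have "{K. chord_arc W K \<and> K \<subseteq> S} \<subseteq> Pow {..<n}" using chord_arc_sub[of W] by blast
    from finite_subset[OF this] have "finite {K. chord_arc W K \<and> K \<subseteq> S}" by simp
    moreover have "{K. chord_arc W K \<and> K \<subseteq> S} \<noteq> {}" using S by blast
    ultimately obtain I where "I \<in> {K. chord_arc W K \<and> K \<subseteq> S}" "\<forall>J\<in>{K. chord_arc W K \<and> K \<subseteq> S}. J \<subseteq> I \<longrightarrow> I = J"
      using finite_has_minimal[of "{K. chord_arc W K \<and> K \<subseteq> S}"] by metis
    moreover from this have "\<forall>J. chord_arc W J \<and> J \<subseteq> I \<longrightarrow> J = I" by blast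
    ultimately show ?thesis by blast
  qed
  note mini = this
  obtain I where I: "chord_arc W I" "\<And>J. chord_arc W J \<Longrightarrow> J \<subseteq> I \<Longrightarrow> J = I" using mini[OF ne] by blast
  obtain J where J: "chord_arc W J" "J \<subseteq> {..<n} - I" "\<And>K. chord_arc W K \<Longrightarrow> K \<subseteq> J \<Longrightarrow> K = J"
    using mini[OF chord_arc_compl[OF I(1)]] by blast
  have dich: "M \<subseteq> K \<or> M \<inter> K = {}" if M: "chord_arc W M" "\<And>L. chord_arc W L \<Longrightarrow> L \<subseteq> M \<Longrightarrow> L = M" and K: "chord_arc W K" for M K
    using same_side_arcs[OF K M(1) W] M(2)[OF K] M(2)[OF chord_arc_compl[OF K]] by blast
  have IJ: "I \<inter> J = {}" using J(2) by blast
  have "I \<subseteq> K \<and> J \<inter> K = {} \<or> J \<subseteq> K \<and> I \<inter> K = {}" if K: "chord_arc W K" for K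
  proof -
    have "\<not> (I \<subseteq> K \<and> J \<subseteq> K)"
      using three_disjoint_arcs[OF I(1) J(1) chord_arc_compl[OF K] IJ] no by blast
    moreover have "\<not> (I \<inter> K = {} \<and> J \<inter> K = {})"
      using three_disjoint_arcs[OF I(1) J(1) K IJ] no by blast
    ultimately show ?thesis using dich[OF I K] dich[OF J(1,3) K] by blast
  qed
  then show ?thesis using I(1) J(1) IJ by blast
qed

text \<open>Both sides of the cycle have to be served by the same two edges \<open>p\<close> and
  \<open>q\<close>. In the table of the intersections of \<open>I1\<close>, \<open>J1\<close> with
  \<open>I2\<close>, \<open>J2\<close> no row and no column is empty, as this would give three
  disjoint arcs; hence one of the two diagonals consists of nonempty sets, from which
  \<open>p\<close> and \<open>q\<close> are taken.\<close>

lemma separating_pair: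
  assumes no: "no_three_chords V E C"
  shows "\<exists>p<n. \<exists>q<n. p \<noteq> q \<and> (\<forall>W\<in>components (- rim). \<forall>K. chord_arc W K \<longrightarrow> (p \<in> K) \<noteq> (q \<in> K))"
proof -
  obtain W1 W2 where WW: "components (- rim) = {W1, W2}" using components_rim by blast
  have good: "(p \<in> K) \<noteq> (q \<in> K)"
    if "\<forall>K. chord_arc W K \<longrightarrow> I \<subseteq> K \<and> J \<inter> K = {} \<or> J \<subseteq> K \<and> I \<inter> K = {}" "chord_arc W K"
      "p \<in> I \<and> q \<in> J \<or> p \<in> J \<and> q \<in> I" for W I J K p q
    using that by blast
  have ex: "\<exists>I J. I \<subseteq> {..<n} \<and> J \<subseteq> {..<n} \<and> I \<noteq> {} \<and> J \<noteq> {} \<and> I \<inter> J = {} \<and>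
     (\<forall>K. chord_arc W K \<longrightarrow> I \<subseteq> K \<and> J \<inter> K = {} \<or> J \<subseteq> K \<and> I \<inter> K = {}) \<and>
     (chord_arc W I \<and> chord_arc W J \<or> (\<forall>K. \<not> chord_arc W K))" if W: "W \<in> {W1, W2}" for W
  proof (cases "\<exists>S. chord_arc W S")
    case True
    then obtain S where S: "chord_arc W S" by blast
    have "W \<in> components (- rim)" using W WW by simp
    from separating_pair_side[OF this no S] obtain I J where "chord_arc W I \<and> chord_arc W J \<and> I \<inter> J = {} \<and>
      (\<forall>K. chord_arc W K \<longrightarrow> I \<subseteq> K \<and> J \<inter> K = {} \<or> J \<subseteq> K \<and> I \<inter> K = {})" by metis
    moreover from this have "I \<subseteq> {..<n} \<and> I \<noteq> {}" "J \<subseteq> {..<n} \<and> J \<noteq> {}"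
      using chord_arc_sub[of W I] chord_arc_sub[of W J] by blast+
    ultimately show ?thesis by metis
  next
    case False
    \<comment> \<open>Placeholders for a side without chords, on which every pair separates.\<close>
    moreover have "{0} \<subseteq> {..<n}" "{1} \<subseteq> {..<n}" "{0::nat} \<noteq> {}" "{1::nat} \<noteq> {}" "{0::nat} \<inter> {1} = {}"
      using n3 by simp_all
    ultimately show ?thesis by metis
  qed
  obtain I1 J1 where 1: "I1 \<subseteq> {..<n}" "J1 \<subseteq> {..<n}" "I1 \<noteq> {}" "J1 \<noteq> {}" "I1 \<inter> J1 = {}"
     "\<forall>K. chord_arc W1 K \<longrightarrow> I1 \<subseteq> K \<and> J1 \<inter> K = {} \<or> J1 \<subseteq> K \<and> I1 \<inter> K = {}"
     "chord_arc W1 I1 \<and> chord_arc W1 J1 \<or> (\<forall>K. \<not> chord_arc W1 K)" using ex[of W1] by blast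
  obtain I2 J2 where 2: "I2 \<subseteq> {..<n}" "J2 \<subseteq> {..<n}" "I2 \<noteq> {}" "J2 \<noteq> {}" "I2 \<inter> J2 = {}"
     "\<forall>K. chord_arc W2 K \<longrightarrow> I2 \<subseteq> K \<and> J2 \<inter> K = {} \<or> J2 \<subseteq> K \<and> I2 \<inter> K = {}"
     "chord_arc W2 I2 \<and> chord_arc W2 J2 \<or> (\<forall>K. \<not> chord_arc W2 K)" using ex[of W2] by blast
  have fin: ?thesis if pq: "p < n" "q < n" "p \<noteq> q"
      "(\<forall>K. \<not> chord_arc W1 K) \<or> p \<in> I1 \<and> q \<in> J1 \<or> p \<in> J1 \<and> q \<in> I1"
      "(\<forall>K. \<not> chord_arc W2 K) \<or> p \<in> I2 \<and> q \<in> J2 \<or> p \<in> J2 \<and> q \<in> I2" for p q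
  proof -
    have "(p \<in> K) \<noteq> (q \<in> K)" if "chord_arc W1 K" for K using good[OF 1(6) that] pq(4) that by metis
    moreover have "(p \<in> K) \<noteq> (q \<in> K)" if "chord_arc W2 K" for K using good[OF 2(6) that] pq(5) that by metis
    ultimately have "\<forall>W\<in>{W1, W2}. \<forall>K. chord_arc W K \<longrightarrow> (p \<in> K) \<noteq> (q \<in> K)" by simp
    then show ?thesis using pq(1-3) unfolding WW by metis
  qed
  show ?thesis
  proof (cases "\<forall>K. \<not> chord_arc W1 K")
    case True
    obtain p q where pq: "p \<in> I2" "q \<in> J2" using 2 by blast
    then have "p < n" "q < n" "p \<noteq> q" using 2(1,2,5) by auto
    then show ?thesis using fin[of p q] True pq by simp
  next
    case N1: False
    show ?thesis
    proof (cases "\<forall>K. \<not> chord_arc W2 K")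
      case True
      obtain p q where pq: "p \<in> I1" "q \<in> J1" using 1 by blast
      then have "p < n" "q < n" "p \<noteq> q" using 1(1,2,5) by auto
      then show ?thesis using fin[of p q] True pq by simp
    next
      case False
      then have c: "chord_arc W1 I1" "chord_arc W1 J1" "chord_arc W2 I2" "chord_arc W2 J2" using N1 1 2 by blast+
      have "I1 \<inter> I2 \<noteq> {} \<or> J1 \<inter> I2 \<noteq> {}"
        using three_disjoint_arcs[OF c(1,2,3) 1(5)] no by blast
      moreover have "I1 \<inter> J2 \<noteq> {} \<or> J1 \<inter> J2 \<noteq> {}"
        using three_disjoint_arcs[OF c(1,2,4) 1(5)] no by blast
      moreover have "I1 \<inter> I2 \<noteq> {} \<or> I1 \<inter> J2 \<noteq> {}"
        using three_disjoint_arcs[OF c(3,4,1) 2(5)] no by blast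
      moreover have "J1 \<inter> I2 \<noteq> {} \<or> J1 \<inter> J2 \<noteq> {}"
        using three_disjoint_arcs[OF c(3,4,2) 2(5)] no by blast
      ultimately consider "I1 \<inter> I2 \<noteq> {}" "J1 \<inter> J2 \<noteq> {}" | "I1 \<inter> J2 \<noteq> {}" "J1 \<inter> I2 \<noteq> {}"
        by argo
      then show ?thesis
      proof cases
        case 1
        then obtain p q where "p \<in> I1" "p \<in> I2" "q \<in> J1" "q \<in> J2" by blast
        moreover from this have "p < n" "q < n" "p \<noteq> q" using \<open>I1 \<inter> J1 = {}\<close> \<open>I1 \<subseteq> {..<n}\<close> \<open>J1 \<subseteq> {..<n}\<close> by auto
        ultimately show ?thesis using fin[of p q] by simp
      next
        case 2
        then obtain p q where "p \<in> I1" "p \<in> J2" "q \<in> J1" "q \<in> I2" by blast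
        moreover from this have "p < n" "q < n" "p \<noteq> q" using \<open>I1 \<inter> J1 = {}\<close> \<open>I1 \<subseteq> {..<n}\<close> \<open>J1 \<subseteq> {..<n}\<close> by auto
        ultimately show ?thesis using fin[of p q] by simp
      qed
    qed
  qed
qed

text \<open>Removing the edges \<open>ce p\<close> and \<open>ce q\<close> leaves the paths with
  indices \<open>p + 1\<close> to \<open>q\<close> and \<open>q + 1\<close> to \<open>p + n\<close>.
  A chord joins these two paths if exactly one of the removed edges lies between its ends.\<close>

lemma cut_atI:
  assumes pq: "p < q" "q < n"
    and sep: "\<And>c i j. \<lbrakk>c \<in> chd; i < j; j < n; c \<inter> V = {vx i, vx j}\<rbrakk> \<Longrightarrow> (p \<in> {i..<j}) \<noteq> (q \<in> {i..<j})"
  shows "cut_at (Suc p) (q - p)"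
  unfolding cut_at_def
proof (intro conjI ballI)
  fix c assume c: "c \<in> chd"
  obtain i l where il: "i < n" "i + l < n" "1 < l" "l < n - 1" "c \<inter> V = {vx i, vx (i + l)}" using chord_ends[OF c] .
  let ?j = "i + l"
  have s: "(p \<in> {i..<?j}) \<noteq> (q \<in> {i..<?j})" using sep[OF c _ il(2,5)] il by simp
  show "\<exists>a\<in>{Suc p..<Suc p + (q - p)}. \<exists>b\<in>{Suc p + (q - p)..<Suc p + n}. c \<inter> V = {vx a, vx b}"
  proof (cases "p \<in> {i..<?j}")
    case True
    then have "?j \<in> {Suc p..<Suc p + (q - p)}" "i + n \<in> {Suc p + (q - p)..<Suc p + n}" using s pq by auto
    moreover have "c \<inter> V = {vx ?j, vx (i + n)}" using il(5) vx_add_n by auto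
    ultimately show ?thesis by blast
  next
    case False
    then have "i \<in> {Suc p..<Suc p + (q - p)}" "?j \<in> {Suc p + (q - p)..<Suc p + n}" using s pq il by auto
    then show ?thesis using il(5) by blast
  qed
qed (use pq in auto)

lemma no_three_imp_splittable:
  assumes no: "no_three_chords V E C" shows "splittable V E C"
proof -
  obtain p q where pq: "p < n" "q < n" "p \<noteq> q"
    and sep: "\<And>W K. W \<in> components (- rim) \<Longrightarrow> chord_arc W K \<Longrightarrow> (p \<in> K) \<noteq> (q \<in> K)"
    using separating_pair[OF no] by metis
  have s: "(p \<in> {i..<j}) \<noteq> (q \<in> {i..<j})" if c: "c \<in> chd" "i < j" "j < n" "c \<inter> V = {vx i, vx j}" for c i j
  proof -
    have ne: "vx i \<noteq> vx j" using mod_eq_close[of i n j] c by (auto simp: vx_eq)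
    note ci = chord_interior[OF c(1,4) ne]
    have "c - rim \<subseteq> - rim" by blast
    then obtain W where W: "W \<in> components (- rim)" "c - rim \<subseteq> W"
      using exists_component_superset[of "c - rim" "- rim"] ci by blast
    have "carc i (j - i) = {i..<j}"
    proof -
      have "carc i (j - i) = (\<lambda>x. x mod n) ` {i..<i + (j - i)}" unfolding carc_def image_shift ..
      also have "\<dots> = {i..<j}" using c by auto
      finally show ?thesis .
    qed
    then have "chord_arc W {i..<j}"
      unfolding chord_arc_def using c W by (intro exI[of _ i] exI[of _ "j - i"] exI[of _ c]) auto
    then show ?thesis using sep W by blast
  qed
  show ?thesis
  proof (cases "p < q")
    case True
    then show ?thesis using cut_atI[of p q] s pq splittable_iff by blast
  next
    case False
    then have "q < p" using pq by simp
    then show ?thesis using cut_atI[of q p] s pq splittable_iff by blast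
  qed
qed

theorem splittable_iff_no_three: "splittable V E C \<longleftrightarrow> no_three_chords V E C"
  using splittable_imp_no_three no_three_imp_splittable by blast

end

lemma cyl_pair_eq: "cyl (u, h) = cyl (u', h') \<longleftrightarrow> h = h' \<and> (\<exists>k::int. u' = u + of_int k)"
  unfolding cyl_eq_iff by auto

section \<open>Periodic sets of reals\<close>

lemma periodic_shift:
  fixes X :: "real set"
  assumes per: "\<And>x. x + 1 \<in> X \<longleftrightarrow> x \<in> X"
  shows "x + of_int k \<in> X \<longleftrightarrow> x \<in> X"
proof (induction k rule: int_induct[where k = 0])
  case (step1 i)
  then show ?case using per[of "x + of_int i"] by (simp add: add.assoc)
next
  case (step2 i)
  then show ?case using per[of "x + of_int (i - 1)"] by simp
qed simp

text \<open>The points of a drawing on a circle lift to a set of reals of period 1. Its nonnegative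
  elements are listed in increasing order, \<open>N\<close> of them per turn, which turns cyclic
  neighbourhood into succession.\<close>

lemma periodic_enumeration:
  fixes X :: "real set"
  assumes per: "\<And>x. x + 1 \<in> X \<longleftrightarrow> x \<in> X" and fin: "finite (X \<inter> {0..<1})" and ne: "X \<noteq> {}"
  obtains e :: "nat \<Rightarrow> real" and N where "N > 0" "N = card (X \<inter> {0..<1})" "strict_mono e" "\<And>j. e (j + N) = e j + 1"
    "\<And>j. e j \<in> X" "\<And>x. x \<in> X \<Longrightarrow> 0 \<le> x \<Longrightarrow> \<exists>j. x = e j" "e ` {..<N} = X \<inter> {0..<1}"
proof -
  define L where "L = sorted_list_of_set (X \<inter> {0..<1})"
  define N where "N = length L"
  have L: "set L = X \<inter> {0..<1}" "sorted_wrt (<) L" unfolding L_def using fin by (simp_all add: strict_sorted_list_of_set)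
  obtain x where x: "x \<in> X" using ne by blast
  have "x + of_int (- \<lfloor>x\<rfloor>) \<in> X" using periodic_shift[OF per, of x "- \<lfloor>x\<rfloor>"] x by simp
  moreover have "x + of_int (- \<lfloor>x\<rfloor>) \<in> {0..<1}" by (simp; linarith)
  ultimately have "x + of_int (- \<lfloor>x\<rfloor>) \<in> set L" unfolding L(1) by (rule IntI)
  then have "set L \<noteq> {}" by auto
  then have N: "N > 0" by (simp add: N_def)
  define e where "e j = L ! (j mod N) + real (j div N)" for j
  have nth: "L ! i \<in> X \<inter> {0..<1}" if "i < N" for i using that L(1) nth_mem unfolding N_def by metis
  have lt: "e j < e (Suc j)" for j
  proof (cases "Suc (j mod N) = N")
    case True
    then have "Suc j mod N = 0" "Suc j div N = Suc (j div N)" by (simp_all add: mod_Suc div_Suc)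
    then show ?thesis using nth[of "j mod N"] nth[of 0] N by (simp add: e_def)
  next
    case False
    then have *: "Suc j mod N = Suc (j mod N)" "Suc j div N = j div N" by (simp_all add: mod_Suc div_Suc)
    have "Suc (j mod N) < N" using False N mod_less_divisor[of N j] by linarith
    then have "L ! (j mod N) < L ! Suc (j mod N)" using L(2) unfolding N_def sorted_wrt_iff_nth_less by simp
    then show ?thesis using * by (simp add: e_def)
  qed
  have 1: "strict_mono e" using lt by (simp add: strict_mono_Suc_iff)
  have 2: "e (j + N) = e j + 1" for j using N by (simp add: e_def)
  have 3: "e j \<in> X" for j
    using nth[of "j mod N"] N periodic_shift[OF per, of "L ! (j mod N)" "int (j div N)"] by (simp add: e_def)
  have 4: "\<exists>j. x = e j" if x: "x \<in> X" "0 \<le> x" for x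
  proof -
    define k where "k = nat \<lfloor>x\<rfloor>"
    have k: "real k = of_int \<lfloor>x\<rfloor>" using x by (simp add: k_def)
    have "x + of_int (- \<lfloor>x\<rfloor>) \<in> X" using periodic_shift[OF per, of x "- \<lfloor>x\<rfloor>"] x by simp
    moreover have "x + of_int (- \<lfloor>x\<rfloor>) \<in> {0..<1}" by (simp; linarith)
    ultimately have "x - real k \<in> set L" using L k by simp
    then obtain i where i: "i < N" "L ! i = x - real k" unfolding in_set_conv_nth N_def by blast
    then have "e (i + k * N) = x" by (simp add: e_def)
    then show ?thesis by metis
  qed
  have "e ` {..<N} = (!) L ` {..<N}" by (intro image_cong) (simp_all add: e_def)
  also have "\<dots> = set L" unfolding N_def by (auto simp: set_conv_nth)
  finally have 5: "e ` {..<N} = X \<inter> {0..<1}" using L by simp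
  have "N = card (X \<inter> {0..<1})" unfolding N_def L_def by simp
  then show ?thesis using that N 1 2 3 4 5 by blast
qed

lemma periodic_next:
  fixes X :: "real set"
  assumes per: "\<And>x. x + 1 \<in> X \<longleftrightarrow> x \<in> X" and fin: "finite (X \<inter> {0..<1})" and u: "u \<in> X"
  obtains w where "w \<in> X" "u < w" "w \<le> u + 1" "\<And>x. u < x \<Longrightarrow> x < w \<Longrightarrow> x \<notin> X"
proof -
  let ?Y = "X \<inter> {u<..u + 1}"
  have "?Y \<subseteq> (\<lambda>(x, k). x + of_int k) ` ((X \<inter> {0..<1}) \<times> {\<lfloor>u\<rfloor>..\<lfloor>u\<rfloor> + 2})"
  proof
    fix x assume x: "x \<in> ?Y"
    have "x + of_int (- \<lfloor>x\<rfloor>) \<in> X" using periodic_shift[OF per, of x "- \<lfloor>x\<rfloor>"] x by simp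
    moreover have "x + of_int (- \<lfloor>x\<rfloor>) \<in> {0..<1}" by (simp; linarith)
    moreover have "\<lfloor>x\<rfloor> \<in> {\<lfloor>u\<rfloor>..\<lfloor>u\<rfloor> + 2}" using x by (simp; linarith)
    ultimately show "x \<in> (\<lambda>(x, k). x + of_int k) ` ((X \<inter> {0..<1}) \<times> {\<lfloor>u\<rfloor>..\<lfloor>u\<rfloor> + 2})"
      by (intro image_eqI[of _ _ "(x + of_int (- \<lfloor>x\<rfloor>), \<lfloor>x\<rfloor>)"]) auto
  qed
  moreover have "finite ((\<lambda>(x, k). x + real_of_int k) ` ((X \<inter> {0..<1}) \<times> {\<lfloor>u\<rfloor>..\<lfloor>u\<rfloor> + 2}))"
    using fin by (intro finite_imageI finite_cartesian_product) auto
  ultimately have f: "finite ?Y" by (rule finite_subset)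
  have ne: "u + 1 \<in> ?Y" using u per by simp
  define w where "w = Min ?Y"
  have "w \<in> ?Y" unfolding w_def using f ne by (intro Min_in) auto
  moreover have "x \<notin> X" if "u < x" "x < w" for x
  proof
    assume "x \<in> X"
    then have "x \<in> ?Y" using that \<open>w \<in> ?Y\<close> by simp
    then show False using Min_le[OF f] that(2) unfolding w_def by fastforce
  qed
  ultimately show ?thesis by (intro that[of w]) simp_all
qed

section \<open>Drawings whose faces are rhombi\<close>

definition rhombus :: "'a set set \<Rightarrow> ('a \<Rightarrow> int) \<Rightarrow> 'a \<Rightarrow> 'a \<Rightarrow> 'a \<Rightarrow> 'a \<Rightarrow> int \<Rightarrow> bool" where
  "rhombus G \<rho> a b c d r \<longleftrightarrow> distinct [a, b, c, d] \<and>
     {a, b} \<in> G \<and> {b, c} \<in> G \<and> {c, d} \<in> G \<and> {d, a} \<in> G \<and>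
     \<rho> a = r \<and> \<rho> c = r \<and> \<rho> b = r - 1 \<and> \<rho> d = r + 1"

text \<open>Of the cover graph only the rise of rank along edges is kept; that the rise is exactly 1
  follows later from the rhombic faces.\<close>

locale rhombic_drawing =
  fixes P :: "'a set" and G :: "'a set set" and \<rho> :: "'a \<Rightarrow> int"
    and pos :: "'a \<Rightarrow> complex \<times> real" and crv :: "'a set \<Rightarrow> (complex \<times> real) set"
  assumes emb: "straight_cylinder_embedding P G \<rho> pos crv"
    and rh: "\<And>F. F \<in> drawing_faces P G pos crv \<Longrightarrow> rhombic_face G \<rho> crv F"
    and edges: "\<And>g. g \<in> G \<Longrightarrow> \<exists>x\<in>P. \<exists>y\<in>P. \<rho> x < \<rho> y \<and> g = {x, y}"
begin

definition D :: "(complex \<times> real) set" where "D = pos ` P \<union> (\<Union>e\<in>G. crv e)"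

lemmas emb_facts = emb[unfolded straight_cylinder_embedding_def]

lemma pos_inj: "x \<in> P \<Longrightarrow> y \<in> P \<Longrightarrow> pos x = pos y \<Longrightarrow> x = y"
  using emb_facts[THEN conjunct1] by (rule inj_onD)

lemma pos_height: "x \<in> P \<Longrightarrow> snd (pos x) = of_int (\<rho> x)"
  using emb_facts[THEN conjunct2, THEN conjunct1] by simp

lemma pos_cyl: assumes "x \<in> P" obtains u where "pos x = cyl (u, of_int (\<rho> x))"
proof -
  have c: "pos x \<in> cylinder" using emb_facts[THEN conjunct2, THEN conjunct1] assms by simp
  then have "norm (fst (pos x)) = 1" by (auto simp: cylinder_def)
  from cyl_polar[OF this, of 0 "snd (pos x)"]
  have "pos x = cyl (0 + Arg (fst (pos x) / cis (2 * pi * 0)) / (2 * pi), of_int (\<rho> x))"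
    using pos_height[OF assms] by (metis prod.collapse)
  then show ?thesis using that by blast
qed

lemma crv_straight: "{x, y} \<in> G \<Longrightarrow> straight_segment (pos x) (pos y) (crv {x, y})"
  using emb_facts[THEN conjunct2, THEN conjunct2, THEN conjunct1] by simp

lemma crv_verts: "e \<in> G \<Longrightarrow> crv e \<inter> pos ` P = pos ` e"
  using emb_facts[THEN conjunct2, THEN conjunct2, THEN conjunct2, THEN conjunct1] by simp

lemma crv_inter: "e \<in> G \<Longrightarrow> e' \<in> G \<Longrightarrow> e \<noteq> e' \<Longrightarrow> crv e \<inter> crv e' = pos ` (e \<inter> e')"
  using emb_facts[THEN conjunct2, THEN conjunct2, THEN conjunct2, THEN conjunct2] by simp

lemma edge_sub: "g \<in> G \<Longrightarrow> g \<subseteq> P" using edges[of g] by auto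

lemma crv_unique:
  assumes "g \<in> G" "g' \<in> G" "z \<in> crv g" "z \<in> crv g'" "z \<notin> pos ` P" shows "g = g'"
proof (rule ccontr)
  assume "g \<noteq> g'"
  from crv_inter[OF assms(1,2) this] have "z \<in> pos ` (g \<inter> g')" using assms(3,4) by blast
  then show False using assms(5) edge_sub[OF assms(1)] by blast
qed

text \<open>A horizontal open arc that avoids the drawing is connected and hence lies in one face;
  its ends then lie on the boundary of this face, which is a single rhombus. The adjacencies of a
  strip are obtained from such arcs.\<close>

lemma arc_face:
  assumes x: "x1 < x2" "\<And>x. x1 < x \<Longrightarrow> x < x2 \<Longrightarrow> cyl (x, h) \<notin> D" and D: "cyl (x1, h) \<in> D" "cyl (x2, h) \<in> D"
  obtains a b c d r where "rhombus G \<rho> a b c d r"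
    "cyl (x1, h) \<in> crv {a, b} \<union> crv {b, c} \<union> crv {c, d} \<union> crv {d, a}"
    "cyl (x2, h) \<in> crv {a, b} \<union> crv {b, c} \<union> crv {c, d} \<union> crv {d, a}"
proof -
  let ?c = "\<lambda>x. cyl (x, h)"
  let ?A = "?c ` {x1<..<x2}"
  have cont: "continuous_on S ?c" for S
    by (intro continuous_on_compose2[OF continuous_on_cyl[of UNIV]] continuous_intros) auto
  have con: "connected ?A" by (intro connected_continuous_image cont connected_Ioo)
  have sub: "?A \<subseteq> cylinder - D" using x(2) by (auto simp: cyl_def cylinder_def)
  have "?A \<noteq> {}" using x(1) by simp
  then obtain F where F: "F \<in> components (cylinder - D)" "?A \<subseteq> F"
    using exists_component_superset[of ?A "cylinder - D"] con sub by blast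
  then have "F \<in> drawing_faces P G pos crv" by (simp add: drawing_faces_def D_def)
  then obtain a b c d r where r: "rhombus G \<rho> a b c d r"
      "closure F - F = crv {a, b} \<union> crv {b, c} \<union> crv {c, d} \<union> crv {d, a}"
    using rh unfolding rhombic_face_def rhombus_def by metis
  have "?c ` closure {x1<..<x2} \<subseteq> closure ?A"
    by (intro image_closure_subset[OF cont closed_closure closure_subset])
  also have "\<dots> \<subseteq> closure F" by (rule closure_mono[OF F(2)])
  finally have cl: "?c x1 \<in> closure F" "?c x2 \<in> closure F" using x(1) by auto
  have "F \<subseteq> cylinder - D" using in_components_subset[OF F(1)] .
  then have "?c x1 \<notin> F" "?c x2 \<notin> F" using D by blast+
  then show ?thesis using that[OF r(1)] cl r(2) by blast
qed

lemma edge_lift: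
  assumes g: "{x, y} \<in> G" "\<rho> x < \<rho> y"
  shows "\<exists>p q. cyl (p, of_int (\<rho> x)) = pos x \<and> cyl (q, of_int (\<rho> y)) = pos y \<and>
    crv {x, y} = (\<lambda>s. cyl (p + s * (q - p), of_int (\<rho> x) + s * (of_int (\<rho> y) - of_int (\<rho> x)))) ` {0..1}"
proof -
  have "straight_segment (pos x) (pos y) (crv {x, y})" by (rule crv_straight[OF g(1)])
  then obtain u v where uv: "cyl u = pos x" "cyl v = pos y" "crv {x, y} = cyl ` closed_segment u v"
    unfolding straight_segment_def by blast
  have xy: "x \<in> P" "y \<in> P" using edge_sub[OF g(1)] by auto
  obtain p hp q hq where pq: "u = (p, hp)" "v = (q, hq)" by (cases u, cases v)
  have h: "hp = of_int (\<rho> x)" "hq = of_int (\<rho> y)"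
    using uv(1,2)[symmetric] pos_height[OF xy(1)] pos_height[OF xy(2)] pq by (simp_all add: cyl_def)
  have "closed_segment u v = (\<lambda>s. (p + s * (q - p), hp + s * (hq - hp))) ` {0..1}"
    unfolding closed_segment_image_interval pq by (intro image_cong) (auto simp: algebra_simps)
  then have "crv {x, y} = (\<lambda>s. cyl (p + s * (q - p), hp + s * (hq - hp))) ` {0..1}"
    unfolding uv(3) by (simp add: image_image)
  then show ?thesis using uv(1,2) unfolding pq h by blast
qed

definition lifted_edge :: "'a set \<Rightarrow> 'a \<Rightarrow> 'a \<Rightarrow> real \<Rightarrow> real \<Rightarrow> bool" where
  "lifted_edge g x y p q \<longleftrightarrow> x \<in> P \<and> y \<in> P \<and> \<rho> x < \<rho> y \<and> g = {x, y} \<and>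
     cyl (p, of_int (\<rho> x)) = pos x \<and> cyl (q, of_int (\<rho> y)) = pos y \<and>
     crv g = (\<lambda>s. cyl (p + s * (q - p), of_int (\<rho> x) + s * (of_int (\<rho> y) - of_int (\<rho> x)))) ` {0..1}"

lemma lifts_exist: "\<exists>lo hi p q. \<forall>g\<in>G. lifted_edge g (lo g) (hi g) (p g) (q g)"
proof -
  have "\<exists>x y p q. lifted_edge g x y p q" if g: "g \<in> G" for g
  proof -
    obtain x y where xy: "x \<in> P" "y \<in> P" "\<rho> x < \<rho> y" "g = {x, y}" using edges[OF g] by auto
    have "{x, y} \<in> G" using g xy(4) by simp
    from edge_lift[OF this xy(3)] obtain p q where "cyl (p, of_int (\<rho> x)) = pos x" "cyl (q, of_int (\<rho> y)) = pos y"
      "crv {x, y} = (\<lambda>s. cyl (p + s * (q - p), of_int (\<rho> x) + s * (of_int (\<rho> y) - of_int (\<rho> x)))) ` {0..1}" by blast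
    then have "lifted_edge g x y p q" unfolding lifted_edge_def xy(4) using xy(1-3) by simp
    then show ?thesis by blast
  qed
  then show ?thesis by metis
qed

text \<open>A rhombus has only two corners of the same rank, so the two ends of a gap on the level
  are opposite corners and have the other two corners as common neighbours.\<close>

lemma level_neighbours:
  assumes lev: "\<And>u. cyl (u, of_int r) \<in> D \<Longrightarrow> cyl (u, of_int r) \<in> pos ` P"
    and x: "x1 < x2" "\<And>x. x1 < x \<Longrightarrow> x < x2 \<Longrightarrow> cyl (x, of_int r) \<notin> D"
    and ac: "a \<in> P" "c \<in> P" "a \<noteq> c" "pos a = cyl (x1, of_int r)" "pos c = cyl (x2, of_int r)"
  obtains b d where "\<rho> b = r - 1" "\<rho> d = r + 1" "{a, b} \<in> G" "{c, b} \<in> G" "{a, d} \<in> G" "{c, d} \<in> G"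
proof -
  have rk: "\<rho> a = r" "\<rho> c = r" using pos_height[OF ac(1)] pos_height[OF ac(2)] ac(4,5) by (auto simp: cyl_def)
  have "cyl (x1, of_int r) \<in> D" "cyl (x2, of_int r) \<in> D" using ac unfolding D_def by (metis UnCI imageI)+
  from arc_face[OF x this] obtain a' b' c' d' s where R: "rhombus G \<rho> a' b' c' d' s"
    "pos a \<in> crv {a', b'} \<union> crv {b', c'} \<union> crv {c', d'} \<union> crv {d', a'}"
    "pos c \<in> crv {a', b'} \<union> crv {b', c'} \<union> crv {c', d'} \<union> crv {d', a'}"
    unfolding ac(4,5) by metis
  have G: "{a', b'} \<in> G" "{b', c'} \<in> G" "{c', d'} \<in> G" "{d', a'} \<in> G" using R(1) by (auto simp: rhombus_def)
  have mem: "x \<in> e" if "x \<in> P" "e \<in> G" "pos x \<in> crv e" for x e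
  proof -
    have "pos x \<in> pos ` e" using crv_verts[OF that(2)] that(1,3) by blast
    then show ?thesis using pos_inj[OF that(1)] edge_sub[OF that(2)] by blast
  qed
  have "a \<in> {a', b', c', d'}" using R(2) mem[OF ac(1)] G by blast
  moreover have "c \<in> {a', b', c', d'}" using R(3) mem[OF ac(2)] G by blast
  ultimately have "a = a' \<and> c = c' \<or> a = c' \<and> c = a'" "r = s" using R(1) rk ac(3) unfolding rhombus_def by auto
  then show ?thesis using that[of b' d'] R(1) by (auto simp: rhombus_def insert_commute)
qed

end

locale lifted_drawing = rhombic_drawing P G \<rho> pos crv
  for P :: "'a set" and G \<rho> pos crv +
  fixes lo hi :: "'a set \<Rightarrow> 'a" and p q :: "'a set \<Rightarrow> real"
  assumes lifts: "\<And>g. g \<in> G \<Longrightarrow> lifted_edge g (lo g) (hi g) (p g) (q g)"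
    and finG: "finite G"
begin

lemmas lift = lifts[unfolded lifted_edge_def]

lemma lift_lo: "g \<in> G \<Longrightarrow> lo g \<in> P" and lift_hi: "g \<in> G \<Longrightarrow> hi g \<in> P"
  and lift_less: "g \<in> G \<Longrightarrow> \<rho> (lo g) < \<rho> (hi g)"
  and lift_p: "g \<in> G \<Longrightarrow> cyl (p g, of_int (\<rho> (lo g))) = pos (lo g)"
  and lift_q: "g \<in> G \<Longrightarrow> cyl (q g, of_int (\<rho> (hi g))) = pos (hi g)"
  by (drule lift, elim conjE, assumption)+

lemma lift_eq: "g \<in> G \<Longrightarrow> {lo g, hi g} = g"
  by (drule lift, elim conjE, erule sym)

lemma lo_hi: assumes "{x, y} \<in> G" "\<rho> x < \<rho> y" shows "lo {x, y} = x" "hi {x, y} = y"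
proof -
  have "{lo {x, y}, hi {x, y}} = {x, y}" by (rule lift_eq[OF assms(1)])
  then have "lo {x, y} = x \<and> hi {x, y} = y \<or> lo {x, y} = y \<and> hi {x, y} = x" unfolding doubleton_eq_iff .
  then show "lo {x, y} = x" "hi {x, y} = y" using lift_less[OF assms(1)] assms(2) by auto
qed

text \<open>Abscissa at height \<open>h\<close> of one fixed lift of the edge \<open>g\<close>; the
  other lifts differ from it by integers.\<close>

definition xat :: "'a set \<Rightarrow> real \<Rightarrow> real" where
  "xat g h = p g + (h - of_int (\<rho> (lo g))) / (of_int (\<rho> (hi g)) - of_int (\<rho> (lo g))) * (q g - p g)"

lemma crv_mem:
  assumes g: "g \<in> G"
  shows "cyl (u, h) \<in> crv g \<longleftrightarrow> of_int (\<rho> (lo g)) \<le> h \<and> h \<le> of_int (\<rho> (hi g)) \<and> (\<exists>k::int. u = xat g h + of_int k)"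
proof -
  let ?l = "of_int (\<rho> (lo g)) :: real" and ?h = "of_int (\<rho> (hi g)) :: real"
  have lt: "?l < ?h" using lift_less[OF g] by simp
  have c: "crv g = (\<lambda>s. cyl (p g + s * (q g - p g), ?l + s * (?h - ?l))) ` {0..1}"
    by (rule lift[OF g, THEN conjunct2, THEN conjunct2, THEN conjunct2, THEN conjunct2, THEN conjunct2, THEN conjunct2])
  show ?thesis
  proof
    assume "cyl (u, h) \<in> crv g"
    then obtain s where s: "0 \<le> s" "s \<le> 1" "cyl (u, h) = cyl (p g + s * (q g - p g), ?l + s * (?h - ?l))" unfolding c by auto
    then have h: "h = ?l + s * (?h - ?l)" and "\<exists>k::int. p g + s * (q g - p g) = u + of_int k" unfolding cyl_pair_eq by auto
    then obtain k :: int where k: "p g + s * (q g - p g) = u + of_int k" by blast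
    have s': "(h - ?l) / (?h - ?l) = s" using h lt by simp
    define w where "w = s * (?h - ?l)"
    have "w \<le> 1 * (?h - ?l)" unfolding w_def using s lt by (intro mult_right_mono) auto
    moreover have "0 \<le> w" unfolding w_def using s lt by simp
    moreover have hw: "h = ?l + w" using h by (simp add: w_def)
    ultimately have "?l \<le> ?l + w" "?l + w \<le> ?h" by simp_all
    then have "?l \<le> h" "h \<le> ?h" unfolding hw .
    moreover have "u = xat g h + of_int (- k)" using k unfolding xat_def s' by simp
    ultimately show "?l \<le> h \<and> h \<le> ?h \<and> (\<exists>k::int. u = xat g h + of_int k)" by blast
  next
    assume "?l \<le> h \<and> h \<le> ?h \<and> (\<exists>k::int. u = xat g h + of_int k)"
    then obtain k :: int where h: "?l \<le> h" "h \<le> ?h" and k: "u = xat g h + of_int k" by blast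
    define s where "s = (h - ?l) / (?h - ?l)"
    have s: "0 \<le> s" "s \<le> 1" using h lt by (auto simp: s_def)
    have "h = ?l + s * (?h - ?l)" using lt by (simp add: s_def)
    moreover have "xat g h = p g + s * (q g - p g)" by (simp add: xat_def s_def)
    ultimately have "cyl (u, h) = cyl (p g + s * (q g - p g), ?l + s * (?h - ?l))"
      unfolding cyl_pair_eq k by (intro conjI exI[of _ "- k"]) auto
    then show "cyl (u, h) \<in> crv g" unfolding c using s by auto
  qed
qed

definition X :: "real \<Rightarrow> real set" where "X h = {u. cyl (u, h) \<in> D}"

lemma X_per: "x + 1 \<in> X h \<longleftrightarrow> x \<in> X h"
proof -
  have "cyl (x + 1, h) = cyl (x, h)" unfolding cyl_pair_eq by (intro conjI exI[of _ "-1"]) auto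
  then show ?thesis by (simp add: X_def)
qed

text \<open>Between two levels the drawing is inspected at half-integral height, where it consists
  of inner points of edges only.\<close>

lemma mid_not_vertex: "cyl (u, of_int r + 1/2) \<notin> pos ` P"
proof
  assume "cyl (u, of_int r + 1/2) \<in> pos ` P"
  then obtain x where "x \<in> P" "pos x = cyl (u, of_int r + 1/2)" by auto
  then have "of_int (\<rho> x) = (of_int r + 1/2 :: real)" using pos_height[of x] by (simp add: cyl_def)
  then have "of_int (2 * \<rho> x) = (of_int (2 * r + 1) :: real)" by simp
  then have "2 * \<rho> x = 2 * r + 1" by (simp only: of_int_eq_iff)
  then show False by presburger
qed

lemma X_mid:
  assumes "u \<in> X (of_int r + 1/2)"
  obtains g k where "g \<in> G" "u = xat g (of_int r + 1/2) + of_int (k::int)" "\<rho> (lo g) \<le> r" "r + 1 \<le> \<rho> (hi g)"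
proof -
  let ?h = "of_int r + 1/2 :: real"
  have "cyl (u, ?h) \<in> D" using assms by (simp add: X_def)
  then obtain g where g: "g \<in> G" "cyl (u, ?h) \<in> crv g" using mid_not_vertex unfolding D_def by blast
  then have *: "of_int (\<rho> (lo g)) \<le> ?h" "?h \<le> of_int (\<rho> (hi g))" "\<exists>k::int. u = xat g ?h + of_int k"
    using crv_mem[OF g(1)] by blast+
  have "\<rho> (lo g) \<le> r" "r + 1 \<le> \<rho> (hi g)" using *(1,2) by linarith+
  then show ?thesis using that g(1) *(3) by blast
qed

lemma X_mid_fin: "finite (X (of_int r + 1/2) \<inter> {0..<1})"
proof (rule finite_subset)
  let ?h = "of_int r + 1/2 :: real"
  show "X ?h \<inter> {0..<1} \<subseteq> (\<lambda>g. frac (xat g ?h)) ` G"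
  proof
    fix u assume u: "u \<in> X ?h \<inter> {0..<1}"
    then obtain g k where g: "g \<in> G" "u = xat g ?h + of_int (k::int)" using X_mid by blast
    have "frac u = u" using u by (simp add: frac_eq)
    then have "u = frac (xat g ?h)" unfolding g(2) by (simp add: frac_def)
    then show "u \<in> (\<lambda>g. frac (xat g ?h)) ` G" using g(1) by blast
  qed
  show "finite ((\<lambda>g. frac (xat g ?h)) ` G)" using finG by simp
qed

lemma consecutive_rhombus:
  fixes u w :: real and r :: int
  defines "h \<equiv> of_int r + 1/2 :: real"
  assumes g: "g \<in> G" "cyl (u, h) \<in> crv g" and g': "g' \<in> G" "cyl (w, h) \<in> crv g'"
    and uw: "u < w" "\<And>x. u < x \<Longrightarrow> x < w \<Longrightarrow> x \<notin> X h"
  obtains a b c d s where "rhombus G \<rho> a b c d s" "g \<in> {{a,b},{b,c},{c,d},{d,a}}" "g' \<in> {{a,b},{b,c},{c,d},{d,a}}"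
proof -
  have D: "cyl (u, h) \<in> D" "cyl (w, h) \<in> D" using g g' unfolding D_def by blast+
  have no: "cyl (x, h) \<notin> D" if "u < x" "x < w" for x using uw(2)[OF that] by (simp add: X_def)
  obtain a b c d s where R: "rhombus G \<rho> a b c d s"
    "cyl (u, h) \<in> crv {a, b} \<union> crv {b, c} \<union> crv {c, d} \<union> crv {d, a}"
    "cyl (w, h) \<in> crv {a, b} \<union> crv {b, c} \<union> crv {c, d} \<union> crv {d, a}"
    using arc_face[OF uw(1) no D] by metis
  have G: "{a, b} \<in> G" "{b, c} \<in> G" "{c, d} \<in> G" "{d, a} \<in> G" using R(1) by (auto simp: rhombus_def)
  have nv: "cyl (u, h) \<notin> pos ` P" "cyl (w, h) \<notin> pos ` P" unfolding h_def by (rule mid_not_vertex)+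
  have "\<exists>e\<in>{{a,b},{b,c},{c,d},{d,a}}. cyl (u, h) \<in> crv e" "\<exists>e\<in>{{a,b},{b,c},{c,d},{d,a}}. cyl (w, h) \<in> crv e"
    using R(2,3) by auto
  then obtain e e' where e: "e \<in> {{a,b},{b,c},{c,d},{d,a}}" "cyl (u, h) \<in> crv e"
    "e' \<in> {{a,b},{b,c},{c,d},{d,a}}" "cyl (w, h) \<in> crv e'" by blast
  have "e \<in> G" "e' \<in> G" using e(1,3) G by auto
  then have "g = e" "g' = e'" using crv_unique[OF g(1) _ g(2) e(2) nv(1)] crv_unique[OF g'(1) _ g'(2) e(4) nv(2)] by auto
  then show ?thesis using that R(1) e by blast
qed

text \<open>Every edge borders a face: the gap from a point of the edge at half-integral height to
  the next point of the drawing lies in one, so the edge is a side of a rhombus, along which the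
  rank changes by 1.\<close>

lemma edge_rank:
  assumes g: "g \<in> G" shows "\<rho> (hi g) = \<rho> (lo g) + 1"
proof -
  let ?h = "of_int (\<rho> (lo g)) + 1/2 :: real"
  define u where "u = xat g ?h"
  have lt: "\<rho> (lo g) + 1 \<le> \<rho> (hi g)" using lift_less[OF g] by simp
  then have "of_int (\<rho> (lo g) + 1) \<le> (of_int (\<rho> (hi g)) :: real)" by (simp only: of_int_le_iff)
  then have "?h \<le> of_int (\<rho> (hi g))" by simp
  then have u: "cyl (u, ?h) \<in> crv g" unfolding crv_mem[OF g] u_def by (intro conjI exI[of _ 0]) auto
  then have "u \<in> X ?h" using g by (auto simp: X_def D_def)
  from periodic_next[OF X_per X_mid_fin this] obtain w where w: "w \<in> X ?h" "u < w" "\<And>x. u < x \<Longrightarrow> x < w \<Longrightarrow> x \<notin> X ?h" by metis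
  obtain g' where g': "g' \<in> G" "cyl (w, ?h) \<in> crv g'"
    using w(1) mid_not_vertex unfolding X_def D_def by blast
  obtain a b c d s where R: "rhombus G \<rho> a b c d s" "g \<in> {{a,b},{b,c},{c,d},{d,a}}"
    using consecutive_rhombus[OF g u g' w(2,3)] by metis
  have G4: "{b, a} \<in> G" "{b, c} \<in> G" "{c, d} \<in> G" "{a, d} \<in> G"
    and rk: "\<rho> b = s - 1" "\<rho> a = s" "\<rho> c = s" "\<rho> d = s + 1"
    using R(1) by (simp_all add: rhombus_def insert_commute)
  have "g \<in> {{b,a},{b,c},{c,d},{a,d}}" using R(2) by (simp add: insert_commute)
  then show ?thesis
    using lo_hi[OF G4(1)] lo_hi[OF G4(2)] lo_hi[OF G4(3)] lo_hi[OF G4(4)] rk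
    by (elim insertE emptyE) simp_all
qed

lemma xat_mid: "g \<in> G \<Longrightarrow> \<rho> (lo g) = r \<Longrightarrow> xat g (of_int r + 1/2) = (p g + q g) / 2"
  using edge_rank[of g] by (simp add: xat_def field_simps)

text \<open>The horizontal distance of two lifted edges is affine in the height. Positive in the
  middle and negative at one end, it would vanish strictly between the levels, where different edges
  do not meet.\<close>

lemma no_crossing:
  assumes g: "g \<in> G" "g' \<in> G" "\<rho> (lo g) = r" "\<rho> (lo g') = r"
    and lt: "(p g + q g) / 2 + of_int k < (p g' + q g') / 2 + of_int k'"
  shows "p g + of_int k \<le> p g' + of_int k' \<and> q g + of_int k \<le> q g' + of_int k'"
proof (rule ccontr)
  assume n: "\<not> ?thesis"
  define a where "a = (p g' + of_int k') - (p g + of_int k)"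
  define b where "b = (q g' + of_int k') - (q g + of_int k)"
  have ab: "a + b > 0" "a < 0 \<or> b < 0" using lt n by (auto simp: a_def b_def field_simps)
  have r1: "\<rho> (hi g) = r + 1" "\<rho> (hi g') = r + 1" using edge_rank g by auto
  \<comment> \<open>The zero of the affine function with value \<open>a\<close> at the lower and
    \<open>b\<close> at the upper level.\<close>
  define s where "s = a / (a - b)"
  have s: "0 < s" "s < 1" "a + s * (b - a) = 0"
  proof -
    have "a \<noteq> b" using ab by auto
    then show "a + s * (b - a) = 0" by (simp add: s_def field_simps)
    show "0 < s" "s < 1" using ab by (auto simp: s_def divide_simps)
  qed
  let ?h = "of_int r + s :: real"
  have x: "xat g ?h = p g + s * (q g - p g)" "xat g' ?h = p g' + s * (q g' - p g')" using g r1 by (simp_all add: xat_def)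
  have eq: "xat g ?h + of_int k = xat g' ?h + of_int k'"
    using s(3) unfolding x a_def b_def by (simp add: algebra_simps)
  define u where "u = xat g ?h + of_int k"
  have "cyl (u, ?h) \<in> crv g" unfolding crv_mem[OF g(1)] u_def using g r1 s by auto
  moreover have "cyl (u, ?h) \<in> crv g'" unfolding crv_mem[OF g(2)] u_def using eq g r1 s by auto
  moreover have "cyl (u, ?h) \<notin> pos ` P"
  proof
    assume "cyl (u, ?h) \<in> pos ` P"
    then obtain x where "x \<in> P" "pos x = cyl (u, ?h)" by auto
    then have "of_int (\<rho> x) = ?h" using pos_height[of x] by (simp add: cyl_def)
    then have "of_int r < (of_int (\<rho> x) :: real)" "of_int (\<rho> x) < (of_int (r + 1) :: real)" using s(1,2) by simp_all
    then have "r < \<rho> x" "\<rho> x < r + 1" by (simp_all only: of_int_less_iff)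
    then show False by simp
  qed
  ultimately have "g = g'" using crv_unique[OF g(1,2)] by blast
  then show False using ab by (auto simp: a_def b_def)
qed

text \<open>The edges between two levels are listed by their abscissae at half height. Neighbours in
  this list are sides of one rhombus between the same two levels, so they share exactly one end; as
  edges do not cross, the ends advance monotonically and the list is a lattice path. The edges
  \<open>g1\<close> to \<open>g4\<close> provide two cells on either level, which excludes that an
  end makes a full turn within one step.\<close>

theorem strip_sequence:
  fixes r :: int
  assumes lo2: "g1 \<in> G" "g2 \<in> G" "\<rho> (lo g1) = r" "\<rho> (lo g2) = r" "lo g1 \<noteq> lo g2"
    and hi2: "g3 \<in> G" "g4 \<in> G" "\<rho> (lo g3) = r" "\<rho> (lo g4) = r" "hi g3 \<noteq> hi g4"
  obtains N :: nat and \<alpha> \<beta> :: "nat \<Rightarrow> 'a" and A B :: "nat \<Rightarrow> real" where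
    "N > 0"
    "\<And>j. \<alpha> j \<in> P \<and> \<beta> j \<in> P \<and> {\<alpha> j, \<beta> j} \<in> G \<and> \<rho> (\<alpha> j) = r \<and> \<rho> (\<beta> j) = r + 1"
    "\<And>j. cyl (A j, of_int r) = pos (\<alpha> j)" "\<And>j. cyl (B j, of_int (r + 1)) = pos (\<beta> j)"
    "\<And>j. A (j + N) = A j + 1" "\<And>j. B (j + N) = B j + 1" "\<And>j. \<alpha> (j + N) = \<alpha> j" "\<And>j. \<beta> (j + N) = \<beta> j"
    "\<And>j. A j = A (Suc j) \<and> \<alpha> j = \<alpha> (Suc j) \<and> B j < B (Suc j) \<and> \<beta> j \<noteq> \<beta> (Suc j) \<or>
          A j < A (Suc j) \<and> \<alpha> j \<noteq> \<alpha> (Suc j) \<and> B j = B (Suc j) \<and> \<beta> j = \<beta> (Suc j)"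
    "\<And>x y. {x, y} \<in> G \<Longrightarrow> \<rho> x = r \<Longrightarrow> \<rho> y = r + 1 \<Longrightarrow> \<exists>j<N. x = \<alpha> j \<and> y = \<beta> j"
    "\<And>i j. \<alpha> i = \<alpha> j \<Longrightarrow> \<beta> i = \<beta> j \<Longrightarrow> i mod N = j mod N"
proof -
  let ?h = "of_int r + 1/2 :: real"
  let ?mid = "\<lambda>g. (p g + q g) / 2"
  have memX: "?mid g + of_int (k::int) \<in> X ?h" if g: "g \<in> G" "\<rho> (lo g) = r" for g k
  proof -
    have "cyl (?mid g + of_int k, ?h) \<in> crv g"
      unfolding crv_mem[OF g(1)] xat_mid[OF g] using g edge_rank[OF g(1)] by auto
    then show ?thesis using g(1) by (auto simp: X_def D_def)
  qed
  have crvX: "cyl (?mid g + of_int (k::int), ?h) \<in> crv g" if g: "g \<in> G" "\<rho> (lo g) = r" for g k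
    unfolding crv_mem[OF g(1)] xat_mid[OF g] using g edge_rank[OF g(1)] by auto
  have ne: "X ?h \<noteq> {}" using memX lo2 by blast
  obtain m :: "nat \<Rightarrow> real" and N where "N > 0" "N = card (X ?h \<inter> {0..<1})" "strict_mono m" "\<And>j. m (j + N) = m j + 1"
    "\<And>j. m j \<in> X ?h" "\<And>x. x \<in> X ?h \<Longrightarrow> 0 \<le> x \<Longrightarrow> \<exists>j. x = m j" "m ` {..<N} = X ?h \<inter> {0..<1}"
    by (rule periodic_enumeration[OF X_per X_mid_fin ne]) (rule that; assumption)
  note N = this(1,3-)
  have "\<exists>g k. g \<in> G \<and> \<rho> (lo g) = r \<and> m j = ?mid g + of_int (k::int)" for j
  proof -
    obtain g k where g: "g \<in> G" "m j = xat g ?h + of_int (k::int)" "\<rho> (lo g) \<le> r" "r + 1 \<le> \<rho> (hi g)" using X_mid[OF N(4)] by blast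
    then have "\<rho> (lo g) = r" using edge_rank[OF g(1)] by simp
    then show ?thesis using g xat_mid by auto
  qed
  note ex = this
  define \<gamma> where "\<gamma> j = (SOME g. \<exists>k. g \<in> G \<and> \<rho> (lo g) = r \<and> m j = ?mid g + of_int (k::int))" for j
  define \<kappa> where "\<kappa> j = (SOME k. \<gamma> j \<in> G \<and> \<rho> (lo (\<gamma> j)) = r \<and> m j = ?mid (\<gamma> j) + of_int (k::int))" for j
  have "\<exists>k. \<gamma> j \<in> G \<and> \<rho> (lo (\<gamma> j)) = r \<and> m j = ?mid (\<gamma> j) + of_int (k::int)" for j
    unfolding \<gamma>_def by (rule someI_ex[OF ex])
  from someI_ex[OF this] have "\<gamma> j \<in> G \<and> \<rho> (lo (\<gamma> j)) = r \<and> m j = ?mid (\<gamma> j) + of_int (\<kappa> j)" for j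
    unfolding \<kappa>_def .
  then have gk: "\<And>j. \<gamma> j \<in> G" "\<And>j. \<rho> (lo (\<gamma> j)) = r" "\<And>j. m j = ?mid (\<gamma> j) + of_int (\<kappa> j :: int)" by blast+
  have uniq: "g = g' \<and> k = k'" if "g \<in> G" "g' \<in> G" "\<rho> (lo g) = r" "\<rho> (lo g') = r" "?mid g + of_int (k::int) = ?mid g' + of_int k'" for g g' k k'
  proof -
    have "cyl (?mid g' + of_int k', ?h) \<in> crv g" using crvX[OF that(1,3), of k] unfolding that(5) .
    then have "g = g'" using crv_unique[OF that(1,2) _ crvX[OF that(2,4), of k']] mid_not_vertex by simp
    then show ?thesis using that(5) by simp
  qed
  define \<alpha> where "\<alpha> j = lo (\<gamma> j)" for j
  define \<beta> where "\<beta> j = hi (\<gamma> j)" for j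
  define A where "A j = p (\<gamma> j) + of_int (\<kappa> j)" for j
  define B where "B j = q (\<gamma> j) + of_int (\<kappa> j)" for j
  have per: "\<gamma> (j + N) = \<gamma> j \<and> \<kappa> (j + N) = \<kappa> j + 1" for j
  proof -
    have "?mid (\<gamma> (j + N)) + of_int (\<kappa> (j + N)) = ?mid (\<gamma> j) + of_int (\<kappa> j + 1)"
      using N(3)[of j] gk(3)[of j] gk(3)[of "j + N"] by simp
    then show ?thesis using uniq[OF gk(1) gk(1) gk(2) gk(2)] by blast
  qed
  have c1: "\<alpha> j \<in> P \<and> \<beta> j \<in> P \<and> {\<alpha> j, \<beta> j} \<in> G \<and> \<rho> (\<alpha> j) = r \<and> \<rho> (\<beta> j) = r + 1" for j
    unfolding \<alpha>_def \<beta>_def lift_eq[OF gk(1)] edge_rank[OF gk(1)] gk(2)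
    using lift_lo[OF gk(1)] lift_hi[OF gk(1)] gk(1) by simp
  have shift: "cyl (x + of_int k, y) = cyl (x, y)" for x y and k :: int
    unfolding cyl_pair_eq by (intro conjI exI[of _ "- k"]) auto
  have c2: "cyl (A j, of_int r) = pos (\<alpha> j)" "cyl (B j, of_int (r + 1)) = pos (\<beta> j)" for j
    using lift_p[OF gk(1)[of j]] lift_q[OF gk(1)[of j]] unfolding A_def B_def \<alpha>_def \<beta>_def shift edge_rank[OF gk(1)] gk(2) .
  have c3: "A (j + N) = A j + 1" "B (j + N) = B j + 1" "\<alpha> (j + N) = \<alpha> j" "\<beta> (j + N) = \<beta> j" for j
    using per[of j] unfolding A_def B_def \<alpha>_def \<beta>_def by simp_all
  have mono1: "A j \<le> A (Suc j) \<and> B j \<le> B (Suc j)" for j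
  proof -
    have "m j < m (Suc j)" using N(2) by (simp add: strict_mono_Suc_iff)
    then show ?thesis using no_crossing[OF gk(1) gk(1) gk(2) gk(2)] unfolding gk(3) A_def B_def by blast
  qed
  have Am: "A i \<le> A j" "B i \<le> B j" if "i \<le> j" for i j
    using lift_Suc_mono_le[of A] lift_Suc_mono_le[of B] mono1 that by blast+
  have hit: "\<exists>j. \<gamma> j = g" if g: "g \<in> G" "\<rho> (lo g) = r" for g
  proof -
    define k where "k = - \<lfloor>?mid g\<rfloor>"
    have "0 \<le> ?mid g + of_int k" using of_int_floor_le[of "?mid g"] unfolding k_def of_int_minus by linarith
    then obtain j where j: "?mid g + of_int k = m j" using N(5)[OF memX[OF g]] by blast
    then show ?thesis using uniq[OF g(1) gk(1) g(2) gk(2)] unfolding gk(3) by blast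
  qed
  have hitN: "\<exists>j<N. \<gamma> j = g" if g: "g \<in> G" "\<rho> (lo g) = r" for g
  proof -
    obtain j where j: "\<gamma> j = g" using hit[OF g] by blast
    have "\<gamma> (i + k * N) = \<gamma> i" for i k
    proof (induction k)
      case (Suc k)
      have "i + Suc k * N = (i + k * N) + N" by simp
      then show ?case using per[of "i + k * N"] Suc by metis
    qed simp
    from this[of "j mod N" "j div N"] have "\<gamma> (j mod N) = g" using j by simp
    then show ?thesis using N(1) mod_less_divisor by blast
  qed
  have ne2: "\<exists>i j. \<alpha> i \<noteq> \<alpha> j" "\<exists>i j. \<beta> i \<noteq> \<beta> j"
  proof -
    obtain i1 i2 i3 i4 where "\<gamma> i1 = g1" "\<gamma> i2 = g2" "\<gamma> i3 = g3" "\<gamma> i4 = g4"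
      using hit[OF lo2(1,3)] hit[OF lo2(2,4)] hit[OF hi2(1,3)] hit[OF hi2(2,4)] by auto
    then have "\<alpha> i1 \<noteq> \<alpha> i2" "\<beta> i3 \<noteq> \<beta> i4" using lo2(5) hi2(5) unfolding \<alpha>_def \<beta>_def by auto
    then show "\<exists>i j. \<alpha> i \<noteq> \<alpha> j" "\<exists>i j. \<beta> i \<noteq> \<beta> j" by blast+
  qed
  have reduce: "\<exists>j'\<ge>i. j' < i + N \<and> \<gamma> j' = \<gamma> j" for i j
  proof -
    have per': "\<gamma> (l mod N) = \<gamma> l" for l
    proof -
      have "\<gamma> (i + k * N) = \<gamma> i" for i k
      proof (induction k)
        case (Suc k)
        have "i + Suc k * N = (i + k * N) + N" by simp
        then show ?case using per[of "i + k * N"] Suc by metis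
      qed simp
      from this[of "l mod N" "l div N"] show ?thesis by simp
    qed
    have "\<gamma> j \<in> \<gamma> ` {i..<i + N}"
      using image_mod_period(1)[OF N(1), of \<gamma> i] image_mod_period(2)[OF N(1), of \<gamma>] per' by simp
    then show ?thesis by auto
  qed
  have intA: "\<alpha> i = \<alpha> j" if "A j = A i + of_int k" for i j and k :: int
  proof (rule pos_inj)
    show "pos (\<alpha> i) = pos (\<alpha> j)" unfolding c2(1)[symmetric] that shift ..
  qed (use c1 in simp_all)
  have intB: "\<beta> i = \<beta> j" if "B j = B i + of_int k" for i j and k :: int
  proof (rule pos_inj)
    show "pos (\<beta> i) = pos (\<beta> j)" unfolding c2(2)[symmetric] that shift ..
  qed (use c1 in simp_all)
  have intA': "\<exists>k::int. A j = A i + of_int k" if "\<alpha> i = \<alpha> j" for i j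
  proof -
    have "cyl (A i, of_int r) = cyl (A j, of_int r)" unfolding c2(1) that ..
    then show ?thesis unfolding cyl_pair_eq by blast
  qed
  have intB': "\<exists>k::int. B j = B i + of_int k" if "\<beta> i = \<beta> j" for i j
  proof -
    have "cyl (B i, of_int (r + 1)) = cyl (B j, of_int (r + 1))" unfolding c2(2) that ..
    then show ?thesis unfolding cyl_pair_eq by blast
  qed
  \<comment> \<open>The lift of a repeated cell could only move by a whole turn. The lower ends
    would then not move during the remainder of the period, and all of them would be the same
    cell.\<close>
  have stepA: "A j = A (Suc j)" if "\<alpha> j = \<alpha> (Suc j)" for j
  proof (rule ccontr)
    assume n: "A j \<noteq> A (Suc j)"
    obtain k :: int where k: "A (Suc j) = A j + of_int k" using intA'[OF \<open>\<alpha> j = \<alpha> (Suc j)\<close>] by blast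
    have "A (Suc j) \<le> A j + 1" using Am(1)[of "Suc j" "j + N"] N(1) c3(1)[of j] by simp
    then have "k = 1" using k n mono1[of j] by auto
    then have top: "A (Suc j) = A (j + N)" using k c3(1) by simp
    have "\<alpha> i = \<alpha> (Suc j)" for i
    proof -
      obtain i' where i': "Suc j \<le> i'" "i' < Suc j + N" "\<gamma> i' = \<gamma> i" using reduce[of "Suc j" i] by blast
      have "A i' = A (Suc j)" using Am(1)[of "Suc j" i'] Am(1)[of i' "j + N"] i' top by linarith
      then show ?thesis using intA[of "Suc j" i' 0] i'(3) unfolding \<alpha>_def by simp
    qed
    then show False using ne2(1) by metis
  qed
  have stepB: "B j = B (Suc j)" if "\<beta> j = \<beta> (Suc j)" for j
  proof (rule ccontr)
    assume n: "B j \<noteq> B (Suc j)"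
    obtain k :: int where k: "B (Suc j) = B j + of_int k" using intB'[OF \<open>\<beta> j = \<beta> (Suc j)\<close>] by blast
    have "B (Suc j) \<le> B j + 1" using Am(2)[of "Suc j" "j + N"] N(1) c3(2)[of j] by simp
    then have "k = 1" using k n mono1[of j] by auto
    then have top: "B (Suc j) = B (j + N)" using k c3(2) by simp
    have "\<beta> i = \<beta> (Suc j)" for i
    proof -
      obtain i' where i': "Suc j \<le> i'" "i' < Suc j + N" "\<gamma> i' = \<gamma> i" using reduce[of "Suc j" i] by blast
      have "B i' = B (Suc j)" using Am(2)[of "Suc j" i'] Am(2)[of i' "j + N"] i' top by linarith
      then show ?thesis using intB[of "Suc j" i' 0] i'(3) unfolding \<beta>_def by simp
    qed
    then show False using ne2(2) by metis
  qed
  have N2: "N \<ge> 2"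
  proof (rule ccontr)
    assume "\<not> N \<ge> 2"
    then have "N = 1" using N(1) by simp
    then have "\<gamma> j = \<gamma> 0" for j using reduce[of 0 j] by (auto simp: less_Suc_eq)
    then show False using ne2(1) unfolding \<alpha>_def by metis
  qed
  \<comment> \<open>The midpoints at two occurrences of an edge differ by an integer
    \<open>k\<close>, and \<open>k\<close> turns are exactly \<open>k * N\<close> places of the
    list.\<close>
  have inj: "i mod N = j mod N" if "\<gamma> i = \<gamma> j" "i \<le> j" for i j
  proof -
    have d: "m j = m i + of_int (\<kappa> j - \<kappa> i)" using gk(3)[of i] gk(3)[of j] that by simp
    have mm: "m i \<le> m j" using N(2) that(2) by (simp add: strict_mono_less_eq)
    then have "0 \<le> \<kappa> j - \<kappa> i" using d by simp
    then obtain k where k: "\<kappa> j - \<kappa> i = int k" using nonneg_int_cases by blast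
    have "m (i + k * N) = m i + real k"
    proof (induction k)
      case (Suc k)
      have e: "i + Suc k * N = (i + k * N) + N" by simp
      show ?case unfolding e N(3) Suc.IH by simp
    qed simp
    then have "m (i + k * N) = m j" using d k by simp
    then have "i + k * N = j" using N(2) by (simp add: strict_mono_eq)
    then show ?thesis by auto
  qed
  have step: "A j = A (Suc j) \<and> \<alpha> j = \<alpha> (Suc j) \<and> B j < B (Suc j) \<and> \<beta> j \<noteq> \<beta> (Suc j) \<or>
          A j < A (Suc j) \<and> \<alpha> j \<noteq> \<alpha> (Suc j) \<and> B j = B (Suc j) \<and> \<beta> j = \<beta> (Suc j)" for j
  proof -
    have mlt: "m j < m (Suc j)" using N(2) by (simp add: strict_mono_Suc_iff)
    have no: "x \<notin> X ?h" if x: "m j < x" "x < m (Suc j)" for x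
    proof
      assume "x \<in> X ?h"
      moreover have "0 \<le> m 0" using N(1,6) by auto
      then have "0 \<le> x" using x(1) N(2) strict_mono_less_eq[OF N(2), of 0 j] by simp
      ultimately obtain i where "x = m i" using N(5) by blast
      then have "j < i" "i < Suc j" using x strict_mono_less[OF N(2)] by auto
      then show False by simp
    qed
    obtain a b c d s where R: "rhombus G \<rho> a b c d s" "\<gamma> j \<in> {{a,b},{b,c},{c,d},{d,a}}" "\<gamma> (Suc j) \<in> {{a,b},{b,c},{c,d},{d,a}}"
      using consecutive_rhombus[OF gk(1) crvX[OF gk(1) gk(2), of j "\<kappa> j", folded gk(3)] gk(1)
        crvX[OF gk(1) gk(2), of "Suc j" "\<kappa> (Suc j)", folded gk(3)] mlt no] by metis
    have neg: "\<gamma> j \<noteq> \<gamma> (Suc j)"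
    proof
      assume "\<gamma> j = \<gamma> (Suc j)"
      then have "j mod N = Suc j mod N" using inj[of j "Suc j"] by simp
      then show False using mod_eq_close[of j N "Suc j"] N2 by simp
    qed
    have rk: "\<rho> b = s - 1" "\<rho> a = s" "\<rho> c = s" "\<rho> d = s + 1" and dst: "a \<noteq> c" "a \<noteq> b" "b \<noteq> c" "c \<noteq> d" "d \<noteq> a" "b \<noteq> d"
      using R(1) by (auto simp: rhombus_def)
    have G4: "{a, b} \<in> G" "{b, c} \<in> G" "{c, d} \<in> G" "{d, a} \<in> G" using R(1) by (auto simp: rhombus_def)
    have G4': "{b, a} \<in> G" "{a, d} \<in> G" using G4(1,4) by (simp_all add: insert_commute)
    have L: "lo {a, b} = b \<and> hi {a, b} = a" "lo {b, c} = b \<and> hi {b, c} = c" "lo {c, d} = c \<and> hi {c, d} = d" "lo {d, a} = a \<and> hi {d, a} = d"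
      using lo_hi[OF G4'(1)] lo_hi[OF G4(2)] lo_hi[OF G4(3)] lo_hi[OF G4'(2)] rk by (simp_all add: insert_commute)
    have r2: "\<rho> (lo (\<gamma> j)) = \<rho> (lo (\<gamma> (Suc j)))" using gk(2) by simp
    \<comment> \<open>The two lower sides of a rhombus share its bottom, the two upper sides its
      top.\<close>
    have "\<alpha> j = \<alpha> (Suc j) \<and> \<beta> j \<noteq> \<beta> (Suc j) \<or> \<alpha> j \<noteq> \<alpha> (Suc j) \<and> \<beta> j = \<beta> (Suc j)"
      using R(2,3) neg r2 L rk dst unfolding \<alpha>_def \<beta>_def by (elim insertE emptyE) simp_all
    then show ?thesis
    proof
      assume *: "\<alpha> j = \<alpha> (Suc j) \<and> \<beta> j \<noteq> \<beta> (Suc j)"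
      then have "B j \<noteq> B (Suc j)" using intB[of "Suc j" j 0] by auto
      then show ?thesis using * stepA mono1[of j] by auto
    next
      assume *: "\<alpha> j \<noteq> \<alpha> (Suc j) \<and> \<beta> j = \<beta> (Suc j)"
      then have "A j \<noteq> A (Suc j)" using intA[of "Suc j" j 0] by auto
      then show ?thesis using * stepB mono1[of j] by auto
    qed
  qed
  have surj: "\<exists>j<N. x = \<alpha> j \<and> y = \<beta> j" if xy: "{x, y} \<in> G" "\<rho> x = r" "\<rho> y = r + 1" for x y
  proof -
    have l: "lo {x, y} = x" "hi {x, y} = y" using lo_hi[OF xy(1)] xy(2,3) by auto
    then obtain j where "j < N" "\<gamma> j = {x, y}" using hitN[OF xy(1)] xy(2) by auto
    then show ?thesis using l unfolding \<alpha>_def \<beta>_def by auto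
  qed
  have inj': "i mod N = j mod N" if "\<alpha> i = \<alpha> j" "\<beta> i = \<beta> j" for i j
  proof -
    have "{lo (\<gamma> i), hi (\<gamma> i)} = {lo (\<gamma> j), hi (\<gamma> j)}" using that unfolding \<alpha>_def \<beta>_def by (simp only:)
    then have g: "\<gamma> i = \<gamma> j" unfolding lift_eq[OF gk(1)] .
    show ?thesis
    proof (cases "i \<le> j")
      case True show ?thesis by (rule inj[OF g True])
    next
      case False
      then have "j \<le> i" by simp
      from inj[OF g[symmetric] this] show ?thesis by (rule sym)
    qed
  qed
  show ?thesis by (rule that[of N \<alpha> \<beta> A B, OF N(1) c1 c2 c3 step surj inj'])
qed

end

section \<open>From a rhombic strip to a Hamiltonian cycle\<close>

context rhombic_drawing
begin

lemma edge_height: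
  assumes g: "{x, y} \<in> G" "\<rho> x < \<rho> y" "cyl (u, h) \<in> crv {x, y}"
  shows "cyl (u, h) \<in> pos ` P \<or> of_int (\<rho> x) < h \<and> h < of_int (\<rho> y)"
proof -
  obtain p q where pq: "cyl (p, of_int (\<rho> x)) = pos x" "cyl (q, of_int (\<rho> y)) = pos y"
    "crv {x, y} = (\<lambda>s. cyl (p + s * (q - p), of_int (\<rho> x) + s * (of_int (\<rho> y) - of_int (\<rho> x)))) ` {0..1}"
    using edge_lift[OF g(1,2)] by blast
  obtain s where s: "0 \<le> s" "s \<le> 1"
    "cyl (u, h) = cyl (p + s * (q - p), of_int (\<rho> x) + s * (of_int (\<rho> y) - of_int (\<rho> x)))"
    using g(3) unfolding pq(3) by auto
  have xy: "x \<in> P" "y \<in> P" using edge_sub[OF g(1)] by auto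
  show ?thesis
  proof (cases "s = 0 \<or> s = 1")
    case True
    then have "cyl (u, h) = pos x \<or> cyl (u, h) = pos y" using s(3) pq(1,2) by auto
    then show ?thesis using xy by auto
  next
    case False
    then have s': "0 < s" "s < 1" using s by auto
    have h: "h = of_int (\<rho> x) + s * (of_int (\<rho> y) - of_int (\<rho> x))" using s(3) unfolding cyl_pair_eq by simp
    have d: "0 < of_int (\<rho> y) - (of_int (\<rho> x) :: real)" using g(2) by simp
    have "0 < s * (of_int (\<rho> y) - of_int (\<rho> x))" using s' d by simp
    moreover have "s * (of_int (\<rho> y) - of_int (\<rho> x)) < 1 * (of_int (\<rho> y) - of_int (\<rho> x))"
      using s' d by (intro mult_strict_right_mono)
    ultimately show ?thesis unfolding h by simp
  qed
qed

definition level :: "int \<Rightarrow> bool" where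
  "level r \<longleftrightarrow> (\<forall>u. cyl (u, of_int r) \<in> D \<longrightarrow> cyl (u, of_int r) \<in> pos ` P)"

text \<open>The cells of a level are listed around the cylinder by lifting to the line. Consecutive
  ones bound a gap free of the drawing, so they have a common neighbour on either adjacent level;
  with at least two cells consecutive ones differ.\<close>

lemma level_cycle:
  assumes lev: "level r" and fin: "finite {x \<in> P. \<rho> x = r}" and two: "2 \<le> card {x \<in> P. \<rho> x = r}"
  obtains e :: "nat \<Rightarrow> real" and c :: "nat \<Rightarrow> 'a" where
    "strict_mono e" "\<And>j. e (j + card {x \<in> P. \<rho> x = r}) = e j + 1"
    "\<And>j. pos (c j) = cyl (e j, of_int r)" "\<And>j. c j \<in> P \<and> \<rho> (c j) = r" "\<And>x. x \<in> P \<Longrightarrow> \<rho> x = r \<Longrightarrow> \<exists>j. x = c j"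
    "\<And>i j. c i = c j \<longleftrightarrow> i mod card {x \<in> P. \<rho> x = r} = j mod card {x \<in> P. \<rho> x = r}"
    "\<And>j x. e j < x \<Longrightarrow> x < e (Suc j) \<Longrightarrow> cyl (x, of_int r) \<notin> pos ` P"
    "\<And>j. \<exists>b d. \<rho> b = r - 1 \<and> \<rho> d = r + 1 \<and> {c j, b} \<in> G \<and> {c (Suc j), b} \<in> G \<and> {c j, d} \<in> G \<and> {c (Suc j), d} \<in> G"
proof -
  define R where "R = {x \<in> P. \<rho> x = r}"
  define Y where "Y = {u. cyl (u, of_int r) \<in> pos ` P}"
  have shift: "cyl (x + of_int k, y) = cyl (x, y)" for x y and k :: int
    unfolding cyl_pair_eq by (intro conjI exI[of _ "- k"]) auto
  have per: "x + 1 \<in> Y \<longleftrightarrow> x \<in> Y" for x using shift[of x 1] by (simp add: Y_def)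
  have YR: "\<exists>x\<in>R. pos x = cyl (u, of_int r)" if uY: "u \<in> Y" for u
  proof -
    obtain x where x: "x \<in> P" "cyl (u, of_int r) = pos x" using uY by (auto simp: Y_def)
    have "of_int (\<rho> x) = (of_int r :: real)" using pos_height[OF x(1)] x(2)[symmetric] by (simp add: cyl_def)
    then show ?thesis using x by (intro bexI[of _ x]) (simp_all add: R_def)
  qed
  define cell where "cell u = (SOME x. x \<in> R \<and> pos x = cyl (u, of_int r))" for u
  have cell: "cell u \<in> R \<and> pos (cell u) = cyl (u, of_int r)" if "u \<in> Y" for u
  proof -
    have "\<exists>x. x \<in> R \<and> pos x = cyl (u, of_int r)" using YR[OF that] by blast
    then show ?thesis unfolding cell_def by (rule someI_ex)
  qed
  \<comment> \<open>Each cell of the level has exactly one lift in the half-open unit interval, so a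
    turn has as many places as the level has cells.\<close>
  have bij: "bij_betw cell (Y \<inter> {0..<1}) R"
    unfolding bij_betw_def
  proof
    show "inj_on cell (Y \<inter> {0..<1})"
    proof (rule inj_onI)
      fix u v assume u: "u \<in> Y \<inter> {0..<1}" and v: "v \<in> Y \<inter> {0..<1}" and eq: "cell u = cell v"
      have "cyl (u, of_int r) = cyl (v, of_int r :: real)" using cell[of u] cell[of v] u v eq by simp
      then obtain k :: int where k: "v = u + of_int k" unfolding cyl_pair_eq by blast
      have "-1 < (of_int k :: real)" "(of_int k :: real) < 1" using u v k by auto
      then have "k = 0" by linarith
      then show "u = v" using k by simp
    qed
    show "cell ` (Y \<inter> {0..<1}) = R"
    proof (intro subset_antisym subsetI)
      fix x assume "x \<in> cell ` (Y \<inter> {0..<1})" then show "x \<in> R" using cell by blast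
    next
      fix x assume x: "x \<in> R"
      then have xP: "x \<in> P" "\<rho> x = r" by (simp_all add: R_def)
      obtain u where u: "pos x = cyl (u, of_int r)" using pos_cyl[OF xP(1)] xP(2) by metis
      define v where "v = u + of_int (- \<lfloor>u\<rfloor>)"
      have v: "pos x = cyl (v, of_int r)" unfolding v_def shift u ..
      have "0 \<le> v" "v < 1" unfolding v_def by (simp, simp add: floor_correct, linarith)
      moreover have vY: "v \<in> Y" using v xP(1) unfolding Y_def by (metis imageI mem_Collect_eq)
      moreover have "cell v = x" using cell[OF vY] v pos_inj[of "cell v" x] xP(1) by (simp add: R_def)
      ultimately show "x \<in> cell ` (Y \<inter> {0..<1})" by force
    qed
  qed
  have finY: "finite (Y \<inter> {0..<1})" using bij_betw_finite[OF bij] fin by (simp add: R_def)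
  have cardY: "card (Y \<inter> {0..<1}) = card R" by (rule bij_betw_same_card[OF bij])
  have "Y \<inter> {0..<1} \<noteq> {}" using cardY two unfolding R_def[symmetric] by auto
  then have neY: "Y \<noteq> {}" by blast
  obtain e :: "nat \<Rightarrow> real" and N where "N > 0" "N = card (Y \<inter> {0..<1})" "strict_mono e" "\<And>j. e (j + N) = e j + 1"
    "\<And>j. e j \<in> Y" "\<And>x. x \<in> Y \<Longrightarrow> 0 \<le> x \<Longrightarrow> \<exists>j. x = e j" "e ` {..<N} = Y \<inter> {0..<1}"
    by (rule periodic_enumeration[OF per finY neY]) (rule that; assumption)
  note N = this
  have NR: "N = card R" using N(2) cardY by simp
  define c where "c j = cell (e j)" for j
  have c: "c j \<in> P" "\<rho> (c j) = r" "pos (c j) = cyl (e j, of_int r)" for j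
    using cell[OF N(5)[of j]] by (simp_all add: c_def R_def)
  have sm: "e i < e j \<longleftrightarrow> i < j" for i j using strict_mono_less[OF N(3)] .
  have e_mult: "e (i + k * N) = e i + real k" for i k
  proof (induction k)
    case (Suc k)
    have q: "i + Suc k * N = (i + k * N) + N" by simp
    show ?case unfolding q N(4) Suc.IH by simp
  qed simp
  have c_eq1: "c i = c j" if "i mod N = j mod N" for i j
  proof -
    have "pos (c i) = pos (c (i mod N))" for i
    proof -
      have "e i = e (i mod N) + of_int (int (i div N))" using e_mult[of "i mod N" "i div N"] by simp
      then show ?thesis unfolding c(3) using shift by metis
    qed
    from this[of i] this[of j] that have "pos (c i) = pos (c j)" by simp
    then show ?thesis using pos_inj c(1) by blast
  qed
  have c_eq2: "i mod N = j mod N" if "c i = c j" "i \<le> j" for i j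
  proof -
    have "cyl (e i, of_int r :: real) = cyl (e j, of_int r)" using c(3)[of i] c(3)[of j] that by simp
    then obtain k :: int where k: "e j = e i + of_int k" unfolding cyl_pair_eq by blast
    have "e i \<le> e j" using strict_mono_less_eq[OF N(3)] that by simp
    then have "0 \<le> k" using k by simp
    then obtain l where l: "k = int l" using nonneg_int_cases by blast
    have "e j = e (i + l * N)" using k l e_mult by simp
    then have "j = i + l * N" using strict_mono_eq[OF N(3)] by simp
    then show ?thesis by simp
  qed
  have c_eq: "c i = c j \<longleftrightarrow> i mod N = j mod N" for i j
  proof
    assume eq: "c i = c j"
    show "i mod N = j mod N"
    proof (cases "i \<le> j")
      case True show ?thesis by (rule c_eq2[OF eq True])
    next
      case False
      then have "j \<le> i" by simp
      from c_eq2[OF eq[symmetric] this] show ?thesis by (rule sym)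
    qed
  qed (rule c_eq1)
  have no: "cyl (x, of_int r) \<notin> pos ` P" if x: "e j < x" "x < e (Suc j)" for j x
  proof
    assume "cyl (x, of_int r) \<in> pos ` P"
    then have xY: "x \<in> Y" by (simp add: Y_def)
    have "e 0 \<in> Y \<inter> {0..<1}" using N(1,7) by auto
    then have "0 \<le> e 0" by simp
    also have "e 0 \<le> e j" using strict_mono_less_eq[OF N(3)] by simp
    finally have "0 \<le> x" using x by simp
    then obtain i where i: "x = e i" using N(6)[OF xY] by blast
    have "j < i" "i < Suc j" using x unfolding i sm .
    then show False by simp
  qed
  have hit: "\<exists>j. x = c j" if x: "x \<in> P" "\<rho> x = r" for x
  proof -
    have "x \<in> cell ` (Y \<inter> {0..<1})" using bij x unfolding bij_betw_def R_def by simp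
    then obtain j where "x = cell (e j)" unfolding N(7)[symmetric] by blast
    then show ?thesis unfolding c_def by blast
  qed
  have nb: "\<exists>b d. \<rho> b = r - 1 \<and> \<rho> d = r + 1 \<and> {c j, b} \<in> G \<and> {c (Suc j), b} \<in> G \<and> {c j, d} \<in> G \<and> {c (Suc j), d} \<in> G" for j
  proof -
    have ne: "c j \<noteq> c (Suc j)"
    proof
      assume "c j = c (Suc j)"
      then have "j mod N = Suc j mod N" using c_eq by simp
      from mod_eq_close[OF this] show False using two NR unfolding R_def by simp
    qed
    have lv: "cyl (u, of_int r) \<in> pos ` P" if "cyl (u, of_int r) \<in> D" for u using lev that unfolding level_def by simp
    have no': "cyl (x, of_int r) \<notin> D" if "e j < x" "x < e (Suc j)" for x using no[OF that] lv by blast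
    have "e j < e (Suc j)" using sm by simp
    from level_neighbours[OF lv this no' c(1) c(1) ne c(3) c(3)] show ?thesis by metis
  qed
  have cc: "c j \<in> P \<and> \<rho> (c j) = r" for j using c(1,2) by simp
  show ?thesis
    by (rule that[of e c, folded R_def, folded NR, OF N(3,4) c(3) cc hit c_eq no nb])
qed

end

section \<open>Ranks and covers in the poset of cells\<close>

context
  fixes V :: "complex set" and E :: "complex set set"
  assumes pg: "plane_graph V E"
begin

lemma edge_not_small: assumes "e \<in> E" shows "infinite e" "e \<noteq> {}"
proof -
  obtain g where "arc g" "path_image g = e" using pg assms unfolding plane_graph_def by meson
  then have "arc_joins (pathstart g) (pathfinish g) e" unfolding arc_joins_def by blast
  then show "infinite e" by (rule arc_joins_interior)
  then show "e \<noteq> {}" by auto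
qed

lemma face_facts:
  assumes "f \<in> plane_faces V E" shows "open f" "f \<noteq> {}" "f \<inter> V = {}" "f \<inter> \<Union>E = {}"
proof -
  have f: "f \<in> components (- (V \<union> \<Union>E))" using assms by (simp add: plane_faces_def)
  have cl: "closed e" if eE: "e \<in> E" for e
  proof -
    obtain g where "arc g" "path_image g = e" using pg eE unfolding plane_graph_def by meson
    then show ?thesis using closed_path_image arc_imp_path by blast
  qed
  have fin: "finite V" "finite E" using pg by (auto simp: plane_graph_def)
  have "closed (\<Union>E)" using fin(2) cl by (intro closed_Union) auto
  then have "open (- (V \<union> \<Union>E))" using finite_imp_closed[OF fin(1)] by (intro open_Compl closed_Un)
  then show "open f" using open_components f by blast
  show "f \<noteq> {}" by (rule in_components_nonempty[OF f])
  show "f \<inter> V = {}" "f \<inter> \<Union>E = {}" using in_components_subset[OF f] by auto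
qed

lemma face_closure_eq:
  assumes "f \<in> plane_faces V E" "g \<in> plane_faces V E" "closure f \<subseteq> closure g" shows "f = g"
proof -
  note F = face_facts[OF assms(1)]
  have "f \<inter> closure g \<noteq> {}" using F(2) closure_subset[of f] assms(3) by blast
  then have "f \<inter> g \<noteq> {}" using open_Int_closure_eq_empty[OF F(1)] by blast
  then show ?thesis using assms(1,2) components_nonoverlap unfolding plane_faces_def by metis
qed

text \<open>\<open>Top_cell\<close> is exempt as the lower element because its point set, the whole
  plane, may also be the closure of a face, for instance when the graph is a tree.\<close>

lemma cell_le_rank:
  assumes x: "x \<in> plane_cells V E" and y: "y \<in> plane_cells V E" and le: "cell_le x y" "x \<noteq> y" and r: "x \<noteq> Top_cell"
  shows "cell_rank x < cell_rank y"
proof -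
  have sub: "cell_points x \<subseteq> cell_points y" using le by (simp add: cell_le_def)
  show ?thesis
  proof (cases x)
    case Bot_cell
    then show ?thesis using le(2) by (cases y) auto
  next
    case (Vertex_cell v)
    then show ?thesis using le(2) sub by (cases y) auto
  next
    case (Edge_cell e)
    then have e: "e \<in> E" using x by (auto simp: plane_cells_def)
    show ?thesis
    proof (cases y)
      case (Vertex_cell w)
      then have "e \<subseteq> {w}" using sub Edge_cell by simp
      then show ?thesis using edge_not_small(1)[OF e] finite_subset by blast
    next
      case (Edge_cell e')
      then have e': "e' \<in> E" "e \<noteq> e'" "e \<subseteq> e'" using y sub le(2) \<open>x = Edge_cell e\<close> by (auto simp: plane_cells_def)
      then have "e \<inter> e' \<subseteq> V" using pg e unfolding plane_graph_def by meson
      then have "finite e" using e'(3) pg finite_subset[of e V] unfolding plane_graph_def by blast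
      then show ?thesis using edge_not_small(1)[OF e] by simp
    qed (use Edge_cell sub edge_not_small(2)[OF e] in auto)
  next
    case (Face_cell f)
    then have f: "f \<in> plane_faces V E" using x by (auto simp: plane_cells_def)
    note F = face_facts[OF f]
    show ?thesis
    proof (cases y)
      case Bot_cell
      then show ?thesis using sub Face_cell F(2) by auto
    next
      case (Vertex_cell w)
      then have "w \<in> V" using y by (auto simp: plane_cells_def)
      moreover have "f \<subseteq> {w}" using sub Face_cell Vertex_cell closure_subset[of f] by auto
      ultimately show ?thesis using F(2,3) by blast
    next
      case (Edge_cell e)
      then have "e \<in> E" using y by (auto simp: plane_cells_def)
      moreover have "f \<subseteq> e" using sub Face_cell Edge_cell closure_subset[of f] by auto
      ultimately show ?thesis using F(2,4) by blast
    next
      case (Face_cell g)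
      then have "g \<in> plane_faces V E" using y by (auto simp: plane_cells_def)
      then have "f = g" using face_closure_eq[OF f] sub Face_cell \<open>x = Face_cell f\<close> by simp
      then show ?thesis using le(2) Face_cell \<open>x = Face_cell f\<close> by simp
    qed (use Face_cell in simp)
  next
    case Top_cell
    then show ?thesis using r by simp
  qed
qed

lemma cover_edge:
  assumes "g \<in> cover_graph (plane_cells V E) cell_le"
  obtains x y where "x \<in> plane_cells V E" "y \<in> plane_cells V E" "g = {x, y}" "cell_rank x < cell_rank y"
    "covers (plane_cells V E) cell_le x y \<or> y = Top_cell"
proof -
  obtain x y where xy: "g = {x, y}" "covers (plane_cells V E) cell_le x y" using assms by (auto simp: cover_graph_def)
  then have c: "x \<in> plane_cells V E" "y \<in> plane_cells V E" "cell_le x y" "x \<noteq> y" by (auto simp: covers_def)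
  show ?thesis
  proof (cases "x = Top_cell")
    case True
    then have "cell_rank y < cell_rank x" using c(4) by (cases y) auto
    then show ?thesis using that[of y x] c xy True by (simp add: insert_commute)
  next
    case False
    then show ?thesis using that[of x y] c xy cell_le_rank[OF c(1-4)] by simp
  qed
qed

text \<open>Every cell of positive rank has a vertex in its point set, so a vertex cell lies
  strictly between the minimum and that cell. Thus no drawn edge passes level 0, before anything
  else is known about the ranks joined by edges of the strip.\<close>

lemma no_edge_across_zero:
  assumes g: "g \<in> cover_graph (plane_cells V E) cell_le" "g = {x, y}" "cell_rank x < 0" "0 < cell_rank y" and V: "V \<noteq> {}"
  shows False
proof -
  obtain x' y' where xy': "x' \<in> plane_cells V E" "y' \<in> plane_cells V E" "g = {x', y'}" "cell_rank x' < cell_rank y'"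
    "covers (plane_cells V E) cell_le x' y' \<or> y' = Top_cell" by (rule cover_edge[OF g(1)])
  have "x = x' \<and> y = y'" using xy'(3,4) g(2-4) by (auto simp: doubleton_eq_iff)
  then have xy: "x \<in> plane_cells V E" "y \<in> plane_cells V E" using xy' by auto
  have x: "x = Bot_cell" using g(3) by (cases x) auto
  have cov: "covers (plane_cells V E) cell_le x y \<or> covers (plane_cells V E) cell_le y x"
    using g(1) unfolding cover_graph_def g(2) by (auto simp: doubleton_eq_iff)
  have "\<exists>v\<in>V. v \<in> cell_points y"
  proof (cases y)
    case (Edge_cell e)
    then have "e \<in> E" using xy by (auto simp: plane_cells_def)
    then obtain s t where "e \<inter> V = {s, t}" using pg unfolding plane_graph_def by meson
    then show ?thesis using Edge_cell by auto
  next
    case (Face_cell f)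
    then have "f \<in> plane_faces V E" using xy by (auto simp: plane_cells_def)
    then show ?thesis using face_closure_meets_vertices[OF pg V] Face_cell by auto
  qed (use V g(4) in auto)
  then obtain v where v: "v \<in> V" "v \<in> cell_points y" by blast
  have nle: "\<not> cell_le y x" using v(2) x by (auto simp: cell_le_def)
  then have "covers (plane_cells V E) cell_le x y" using cov by (auto simp: covers_def)
  moreover have "Vertex_cell v \<in> plane_cells V E" using v by (simp add: plane_cells_def)
  moreover have "cell_le x (Vertex_cell v)" "cell_le (Vertex_cell v) y" using x v by (auto simp: cell_le_def)
  ultimately have "Vertex_cell v = x \<or> Vertex_cell v = y" unfolding covers_def by blast
  then show False using x g(4) by auto
qed

lemma cover_vertex_edge:
  assumes "{Vertex_cell v, Edge_cell e} \<in> cover_graph (plane_cells V E) cell_le" shows "v \<in> V" "e \<in> E" "v \<in> e"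
proof -
  have c: "covers (plane_cells V E) cell_le (Vertex_cell v) (Edge_cell e) \<or> covers (plane_cells V E) cell_le (Edge_cell e) (Vertex_cell v)"
    using assms unfolding cover_graph_def by (auto simp: doubleton_eq_iff)
  then have "Vertex_cell v \<in> plane_cells V E" "Edge_cell e \<in> plane_cells V E" by (auto simp: covers_def)
  then show "v \<in> V" and e: "e \<in> E" by (auto simp: plane_cells_def)
  have "\<not> e \<subseteq> {v}" using edge_not_small(1)[OF e] finite_subset by blast
  then show "v \<in> e" using c by (auto simp: covers_def cell_le_def)
qed

lemma cover_edge_face:
  assumes "{Edge_cell e, Face_cell f} \<in> cover_graph (plane_cells V E) cell_le" shows "e \<in> E" "f \<in> plane_faces V E" "e \<subseteq> closure f"
proof -
  have c: "covers (plane_cells V E) cell_le (Edge_cell e) (Face_cell f) \<or> covers (plane_cells V E) cell_le (Face_cell f) (Edge_cell e)"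
    using assms unfolding cover_graph_def by (auto simp: doubleton_eq_iff)
  then have "Face_cell f \<in> plane_cells V E" "Edge_cell e \<in> plane_cells V E" by (auto simp: covers_def)
  then show f: "f \<in> plane_faces V E" and e: "e \<in> E" by (auto simp: plane_cells_def)
  have "\<not> closure f \<subseteq> e" using face_facts[OF f] e closure_subset[of f] by blast
  then show "e \<subseteq> closure f" using c by (auto simp: covers_def cell_le_def)
qed

lemma rank_cells:
  "{x \<in> plane_cells V E. cell_rank x = 0} = Vertex_cell ` V"
  "{x \<in> plane_cells V E. cell_rank x = 1} = Edge_cell ` E"
  "{x \<in> plane_cells V E. cell_rank x = 2} = Face_cell ` plane_faces V E"
  by (auto simp: plane_cells_def)

end

text \<open>\<open>e0\<close> lists lifts of the vertex cells in the order of \<open>C\<close>: the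
  cycle is the one read off from level 0.\<close>

locale strip_drawing = lifted_drawing "plane_cells V E" G cell_rank pos crv lo hi p q + ham_graph V E C
  for V :: "complex set" and E :: "complex set set" and C :: "complex list"
    and G :: "cell set set" and pos :: "cell \<Rightarrow> complex \<times> real" and crv :: "cell set \<Rightarrow> (complex \<times> real) set"
    and lo hi :: "cell set \<Rightarrow> cell" and p q :: "cell set \<Rightarrow> real" +
  fixes e0 :: "nat \<Rightarrow> real"
  assumes Gcov: "G \<subseteq> cover_graph (plane_cells V E) cell_le"
    and e0: "\<And>j. pos (Vertex_cell (vx j)) = cyl (e0 j, 0)" "strict_mono e0" "\<And>j. e0 (j + n) = e0 j + 1"
begin

lemma all_levels: "level r"
  unfolding level_def
proof (intro allI impI)
  fix u assume "cyl (u, of_int r) \<in> D"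
  then consider "cyl (u, of_int r) \<in> pos ` plane_cells V E" | g where "g \<in> G" "cyl (u, of_int r) \<in> crv g"
    unfolding D_def by blast
  then show "cyl (u, of_int r) \<in> pos ` plane_cells V E"
  proof cases
    case 2
    have eq: "{lo g, hi g} = g" by (rule lift_eq[OF 2(1)])
    have "cyl (u, of_int r) \<in> pos ` plane_cells V E \<or> of_int (cell_rank (lo g)) < (of_int r :: real) \<and> (of_int r :: real) < of_int (cell_rank (hi g))"
      using edge_height[of "lo g" "hi g" u "of_int r"] lift_less[OF 2(1)] 2 unfolding eq by simp
    then show ?thesis using edge_rank[OF 2(1)] by auto
  qed
qed

lemma vertex_edge: "{Vertex_cell v, Edge_cell e} \<in> G \<Longrightarrow> v \<in> V \<and> e \<in> E \<and> v \<in> e"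
  using cover_vertex_edge[OF pg] Gcov by blast

lemma edge_face: "{Edge_cell e, Face_cell f} \<in> G \<Longrightarrow> e \<in> E \<and> f \<in> faces \<and> e \<subseteq> closure f"
  using cover_edge_face[OF pg] Gcov by blast

lemma rank0: "x \<in> plane_cells V E \<Longrightarrow> cell_rank x = 0 \<Longrightarrow> \<exists>v\<in>V. x = Vertex_cell v"
  and rank1: "x \<in> plane_cells V E \<Longrightarrow> cell_rank x = 1 \<Longrightarrow> \<exists>e\<in>E. x = Edge_cell e"
  and rank2: "x \<in> plane_cells V E \<Longrightarrow> cell_rank x = 2 \<Longrightarrow> \<exists>f\<in>faces. x = Face_cell f"
  using rank_cells[OF pg] by blast+

lemma G_cells: "{x, y} \<in> G \<Longrightarrow> x \<in> plane_cells V E \<and> y \<in> plane_cells V E"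
  using edge_sub by blast

lemma card_E: "n \<le> card E"
proof -
  have "card (ce ` {0..<n}) = n" using card_image[OF ce_inj[of 0]] by simp
  moreover have "ce ` {0..<n} \<subseteq> E" using ce(1) by blast
  ultimately show ?thesis using card_mono[OF fin(2)] by metis
qed

lemma two_faces: "\<exists>f g. f \<in> faces \<and> g \<in> faces \<and> f \<subseteq> inside rim \<and> g \<subseteq> outside rim"
proof -
  have r: "\<Union>(range ce) = rim" by (simp add: rim_def)
  have "inside rim \<in> components (- \<Union>(range ce))" "outside rim \<in> components (- \<Union>(range ce))" unfolding r components_rim by auto
  from cycle_face(1)[OF cycle_rim rangeI[of ce 0] this(1)] cycle_face(1)[OF cycle_rim rangeI[of ce 0] this(2)]
  show ?thesis by blast
qed

lemma card_faces_ge: "2 \<le> card faces"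
proof -
  obtain f g where fg: "f \<in> faces" "g \<in> faces" "f \<subseteq> inside rim" "g \<subseteq> outside rim" using two_faces by blast
  then have "f \<noteq> g" using face_props(2)[OF fg(1)] rim_in_out(3) by blast
  then have "card {f, g} = 2" by simp
  moreover have "{f, g} \<subseteq> faces" using fg by simp
  ultimately show ?thesis using card_mono[OF card_faces_le(1)] by metis
qed

lemma ranks_card:
  "finite {x \<in> plane_cells V E. cell_rank x = 0}" "card {x \<in> plane_cells V E. cell_rank x = 0} = n"
  "finite {x \<in> plane_cells V E. cell_rank x = 1}" "card {x \<in> plane_cells V E. cell_rank x = 1} = card E"
  "finite {x \<in> plane_cells V E. cell_rank x = 2}" "card {x \<in> plane_cells V E. cell_rank x = 2} = card faces"
proof -
  have "card V = n" using ham distinct_card unfolding hamiltonian_cycle_def n_def by metis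
  then show "card {x \<in> plane_cells V E. cell_rank x = 0} = n"
    unfolding rank_cells[OF pg] by (subst card_image) (auto simp: inj_on_def)
  show "card {x \<in> plane_cells V E. cell_rank x = 1} = card E" "card {x \<in> plane_cells V E. cell_rank x = 2} = card faces"
    unfolding rank_cells[OF pg] by (subst card_image; auto simp: inj_on_def)+
  show "finite {x \<in> plane_cells V E. cell_rank x = 0}" "finite {x \<in> plane_cells V E. cell_rank x = 1}"
    "finite {x \<in> plane_cells V E. cell_rank x = 2}"
    unfolding rank_cells[OF pg] using fin card_faces_le(1) by auto
qed

lemma neighbours:
  assumes "x \<in> plane_cells V E" "cell_rank x = r" "r \<in> {0, 1, 2}"
  shows "\<exists>b d. cell_rank b = r - 1 \<and> cell_rank d = r + 1 \<and> {x, b} \<in> G \<and> {x, d} \<in> G"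
proof -
  have f: "finite {x \<in> plane_cells V E. cell_rank x = r}" "2 \<le> card {x \<in> plane_cells V E. cell_rank x = r}"
    using assms(3) ranks_card n3 card_E card_faces_ge by auto
  obtain c :: "nat \<Rightarrow> cell" where "\<And>x. x \<in> plane_cells V E \<Longrightarrow> cell_rank x = r \<Longrightarrow> \<exists>j. x = c j"
    "\<And>j. \<exists>b d. cell_rank b = r - 1 \<and> cell_rank d = r + 1 \<and> {c j, b} \<in> G \<and> {c (Suc j), b} \<in> G \<and> {c j, d} \<in> G \<and> {c (Suc j), d} \<in> G"
    by (rule level_cycle[OF all_levels f]) (rule that; assumption)
  then show ?thesis using assms(1,2) by metis
qed

text \<open>\<open>strip_sequence\<close> applies because each of the levels 0, 1 and 2 has two
  cells and every cell on them has neighbours on both adjacent levels.\<close>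

lemma strip:
  assumes r: "r = 0 \<or> r = 1"
  obtains N :: nat and \<alpha> \<beta> :: "nat \<Rightarrow> cell" and A B :: "nat \<Rightarrow> real" where
    "N > 0"
    "\<And>j. \<alpha> j \<in> plane_cells V E \<and> \<beta> j \<in> plane_cells V E \<and> {\<alpha> j, \<beta> j} \<in> G \<and> cell_rank (\<alpha> j) = r \<and> cell_rank (\<beta> j) = r + 1"
    "\<And>j. cyl (A j, of_int r) = pos (\<alpha> j)" "\<And>j. cyl (B j, of_int (r + 1)) = pos (\<beta> j)"
    "\<And>j. A (j + N) = A j + 1" "\<And>j. B (j + N) = B j + 1" "\<And>j. \<alpha> (j + N) = \<alpha> j" "\<And>j. \<beta> (j + N) = \<beta> j"
    "\<And>j. A j = A (Suc j) \<and> \<alpha> j = \<alpha> (Suc j) \<and> B j < B (Suc j) \<and> \<beta> j \<noteq> \<beta> (Suc j) \<or>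
          A j < A (Suc j) \<and> \<alpha> j \<noteq> \<alpha> (Suc j) \<and> B j = B (Suc j) \<and> \<beta> j = \<beta> (Suc j)"
    "\<And>x y. {x, y} \<in> G \<Longrightarrow> cell_rank x = r \<Longrightarrow> cell_rank y = r + 1 \<Longrightarrow> \<exists>j<N. x = \<alpha> j \<and> y = \<beta> j"
    "\<And>i j. \<alpha> i = \<alpha> j \<Longrightarrow> \<beta> i = \<beta> j \<Longrightarrow> i mod N = j mod N"
proof -
  have two: "\<exists>x y. x \<noteq> y \<and> x \<in> plane_cells V E \<and> y \<in> plane_cells V E \<and> cell_rank x = s \<and> cell_rank y = s" if s: "s \<in> {0, 1, 2}" for s
  proof -
    have "2 \<le> card {x \<in> plane_cells V E. cell_rank x = s}" using s ranks_card n3 card_E card_faces_ge by auto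
    then have "\<not> card {x \<in> plane_cells V E. cell_rank x = s} \<le> Suc 0" by simp
    moreover have "finite {x \<in> plane_cells V E. cell_rank x = s}" using s ranks_card by auto
    ultimately show ?thesis using card_le_Suc0_iff_eq[of "{x \<in> plane_cells V E. cell_rank x = s}"] by auto
  qed
  obtain x y where xy: "x \<noteq> y" "x \<in> plane_cells V E" "y \<in> plane_cells V E" "cell_rank x = r" "cell_rank y = r" using two[of r] r by auto
  obtain z w where zw: "z \<noteq> w" "z \<in> plane_cells V E" "w \<in> plane_cells V E" "cell_rank z = r + 1" "cell_rank w = r + 1" using two[of "r + 1"] r by auto
  obtain x' where x': "{x, x'} \<in> G" "cell_rank x' = r + 1" using neighbours[OF xy(2,4)] r by auto
  obtain y' where y': "{y, y'} \<in> G" "cell_rank y' = r + 1" using neighbours[OF xy(3,5)] r by auto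
  obtain z' where z': "{z, z'} \<in> G" "cell_rank z' = r" using neighbours[OF zw(2,4)] r by auto
  obtain w' where w': "{w, w'} \<in> G" "cell_rank w' = r" using neighbours[OF zw(3,5)] r by auto
  have zz: "{z', z} \<in> G" "{w', w} \<in> G" using z'(1) w'(1) by (simp_all add: insert_commute)
  have l: "lo {x, x'} = x" "lo {y, y'} = y" "lo {z', z} = z'" "lo {w', w} = w'" "hi {z', z} = z" "hi {w', w} = w"
    using lo_hi[OF x'(1)] lo_hi[OF y'(1)] lo_hi[OF zz(1)] lo_hi[OF zz(2)] xy zw x' y' z' w' by simp_all
  have ss: "cell_rank (lo {x, x'}) = r" "cell_rank (lo {y, y'}) = r" "lo {x, x'} \<noteq> lo {y, y'}"
    "cell_rank (lo {z', z}) = r" "cell_rank (lo {w', w}) = r" "hi {z', z} \<noteq> hi {w', w}"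
    unfolding l using xy zw z' w' by simp_all
  show ?thesis
    by (rule strip_sequence[OF x'(1) y'(1) ss(1-3) zz ss(4-6)]) (rule that; assumption)
qed

lemma steps_mono:
  fixes A :: "nat \<Rightarrow> real"
  assumes "\<And>j. A j = A (Suc j) \<or> A j < A (Suc j)" shows "i \<le> j \<Longrightarrow> A i \<le> A j"
proof -
  have "A j \<le> A (Suc j)" for j using assms[of j] by auto
  then show "i \<le> j \<Longrightarrow> A i \<le> A j" by (rule lift_Suc_mono_le)
qed

text \<open>If the same cell has two different neighbours in a strip, then some step of the strip sequence
  passes from one neighbour to the next along this cell.\<close>

lemma step_at_cell:
  fixes \<alpha> \<beta> :: "nat \<Rightarrow> cell" and A B :: "nat \<Rightarrow> real" and N :: nat
  assumes pos: "\<And>j. cyl (B j, h) = pos (\<beta> j)" and per: "\<And>j. B (j + N) = B j + 1" "\<And>j. \<alpha> (j + N) = \<alpha> j" "\<And>j. \<beta> (j + N) = \<beta> j"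
    and step: "\<And>j. A j = A (Suc j) \<and> \<alpha> j = \<alpha> (Suc j) \<and> B j < B (Suc j) \<and> \<beta> j \<noteq> \<beta> (Suc j) \<or>
          A j < A (Suc j) \<and> \<alpha> j \<noteq> \<alpha> (Suc j) \<and> B j = B (Suc j) \<and> \<beta> j = \<beta> (Suc j)"
    and ij: "\<beta> i = \<beta> j" "\<alpha> i \<noteq> \<alpha> j"
  shows "\<exists>a. \<beta> a = \<beta> i \<and> \<beta> (Suc a) = \<beta> i \<and> A a < A (Suc a)"
proof -
  have main: "\<exists>a. \<beta> a = \<beta> i \<and> \<beta> (Suc a) = \<beta> i \<and> A a < A (Suc a)" if ij: "\<beta> i = \<beta> j" "\<alpha> i \<noteq> \<alpha> j" "B i \<le> B j" for i j
  proof -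
    have perk: "B (i + k * N) = B i + real k \<and> \<alpha> (i + k * N) = \<alpha> i \<and> \<beta> (i + k * N) = \<beta> i" for k
    proof (induction k)
      case (Suc k)
      have e: "i + Suc k * N = (i + k * N) + N" by simp
      show ?case unfolding e per using Suc by simp
    qed simp
    have "cyl (B i, h) = cyl (B j, h)" unfolding pos ij(1) ..
    then obtain k :: int where k: "B j = B i + of_int k" unfolding cyl_pair_eq by blast
    then have "0 \<le> k" using ij(3) by simp
    then obtain l where l: "k = int l" using nonneg_int_cases by blast
    \<comment> \<open>Full turns are added until both indices refer to the same lift of the common
      cell. By monotonicity that lift does not change in between.\<close>
    define i' where "i' = i + l * N"
    have i': "B i' = B j" "\<alpha> i' = \<alpha> i" "\<beta> i' = \<beta> i" using perk[of l] k l by (simp_all add: i'_def)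
    define a where "a = min i' j"
    define b where "b = max i' j"
    have "i' \<noteq> j" using i'(2) ij(2) by auto
    then have ab: "a < b" "B a = B b" "\<beta> a = \<beta> i" unfolding a_def b_def using i' ij(1) by (auto simp: min_def max_def)
    have Bm: "B x \<le> B y" if "x \<le> y" for x y using steps_mono[of B x y] step that by blast
    have "B (Suc a) = B a" using Bm[of a "Suc a"] Bm[of "Suc a" b] ab by simp
    then have "A a < A (Suc a)" "\<beta> a = \<beta> (Suc a)" using step[of a] by auto
    then show ?thesis using ab(3) by auto
  qed
  show ?thesis
  proof (cases "B i \<le> B j")
    case True then show ?thesis using main[OF ij] by blast
  next
    case False
    then show ?thesis using main[of j i] ij by auto
  qed
qed

text \<open>If the edge cell had two vertex neighbours, some step of the strip would move from one
  vertex to another along it. Such a step cannot skip a vertex of level 0, as each of them occurs in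
  the monotone sequence; so its vertices are consecutive on \<open>C\<close> and the edge would be
  an edge of \<open>C\<close>.\<close>

lemma chord_one_vertex:
  assumes e: "e \<in> chd" and uv: "{Vertex_cell u, Edge_cell e} \<in> G" "{Vertex_cell v, Edge_cell e} \<in> G"
  shows "u = v"
proof (rule ccontr)
  assume ne: "u \<noteq> v"
  obtain N :: nat and \<alpha> \<beta> :: "nat \<Rightarrow> cell" and A B :: "nat \<Rightarrow> real" where
    "N > 0"
    "\<And>j. \<alpha> j \<in> plane_cells V E \<and> \<beta> j \<in> plane_cells V E \<and> {\<alpha> j, \<beta> j} \<in> G \<and> cell_rank (\<alpha> j) = 0 \<and> cell_rank (\<beta> j) = 0 + 1"
    "\<And>j. cyl (A j, of_int 0) = pos (\<alpha> j)" "\<And>j. cyl (B j, of_int (0 + 1)) = pos (\<beta> j)"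
    "\<And>j. A (j + N) = A j + 1" "\<And>j. B (j + N) = B j + 1" "\<And>j. \<alpha> (j + N) = \<alpha> j" "\<And>j. \<beta> (j + N) = \<beta> j"
    "\<And>j. A j = A (Suc j) \<and> \<alpha> j = \<alpha> (Suc j) \<and> B j < B (Suc j) \<and> \<beta> j \<noteq> \<beta> (Suc j) \<or>
          A j < A (Suc j) \<and> \<alpha> j \<noteq> \<alpha> (Suc j) \<and> B j = B (Suc j) \<and> \<beta> j = \<beta> (Suc j)"
    "\<And>x y. {x, y} \<in> G \<Longrightarrow> cell_rank x = 0 \<Longrightarrow> cell_rank y = 0 + 1 \<Longrightarrow> \<exists>j<N. x = \<alpha> j \<and> y = \<beta> j"
    "\<And>i j. \<alpha> i = \<alpha> j \<Longrightarrow> \<beta> i = \<beta> j \<Longrightarrow> i mod N = j mod N"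
    by (rule strip[of 0, OF disjI1[OF refl]]) (rule that; assumption)
  note S = this
  obtain i where i: "Vertex_cell u = \<alpha> i" "Edge_cell e = \<beta> i" using S(10)[OF uv(1)] by auto
  obtain j where j: "Vertex_cell v = \<alpha> j" "Edge_cell e = \<beta> j" using S(10)[OF uv(2)] by auto
  have "\<beta> i = \<beta> j" using i(2) j(2) by simp
  moreover have "\<alpha> i \<noteq> \<alpha> j" unfolding i(1)[symmetric] j(1)[symmetric] using ne by simp
  ultimately obtain a where a: "\<beta> a = Edge_cell e" "\<beta> (Suc a) = Edge_cell e" "A a < A (Suc a)"
    using step_at_cell[OF S(4,6,7,8,9)] unfolding i(2) by blast
  have Am: "A x \<le> A y" if "x \<le> y" for x y using steps_mono[of A x y] S(9) that by blast
  have perA: "A (x + k * N) = A x + real k \<and> \<beta> (x + k * N) = \<beta> x" for x k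
  proof (induction k)
    case (Suc k)
    have q: "x + Suc k * N = (x + k * N) + N" by simp
    show ?case unfolding q S(5,8) using Suc by simp
  qed simp
  have vert: "\<exists>v\<in>V. \<alpha> j = Vertex_cell v" for j using rank0 S(2)[of j] by blast
  have posA: "\<exists>k m. \<alpha> j = Vertex_cell (vx k) \<and> A j = e0 k + of_int (m::int)" for j
  proof -
    obtain k where k: "\<alpha> j = Vertex_cell (vx k)" using vert[of j] V_eq(2) by auto
    have "cyl (e0 k, of_int 0) = cyl (A j, of_int 0)" unfolding S(3) k by (simp add: e0(1))
    then show ?thesis using k unfolding cyl_pair_eq by blast
  qed
  have e0k: "e0 (x + k * n) = e0 x + real k" for x k
  proof (induction k)
    case (Suc k)
    have q: "x + Suc k * n = (x + k * n) + n" by simp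
    show ?case unfolding q e0(3) Suc.IH by simp
  qed simp
  have vxk: "vx (x + k * n) = vx x" for x k by (simp add: vx_eq)
  have high: "\<exists>k. \<alpha> j = Vertex_cell (vx k) \<and> A j = e0 k" if ge: "e0 0 \<le> A j" for j
  proof -
    obtain k m where km: "\<alpha> j = Vertex_cell (vx k)" "A j = e0 k + of_int m" using posA by blast
    have "e0 k = e0 (k mod n) + real (k div n)" using e0k[of "k mod n" "k div n"] by simp
    then have Aj: "A j = e0 (k mod n) + of_int (m + int (k div n))" using km by simp
    have "e0 (k mod n) < e0 (0 + n)" using strict_mono_less[OF e0(2), of "k mod n" "0 + n"] n_pos by simp
    then have "e0 (k mod n) < e0 0 + 1" unfolding e0(3) .
    then have "-1 < (of_int (m + int (k div n)) :: real)" using ge Aj by linarith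
    then have "0 \<le> m + int (k div n)" by linarith
    then obtain l where l: "m + int (k div n) = int l" using nonneg_int_cases by blast
    have "A j = e0 (k mod n + l * n)" using Aj l e0k by simp
    moreover have "vx (k mod n + l * n) = vx k" unfolding vxk by (rule vx_mod)
    ultimately show ?thesis using km(1) by metis
  qed
  obtain k0 m0 where "A a = e0 k0 + of_int m0" using posA by blast
  \<comment> \<open>\<open>e0\<close> covers only lifts from \<open>e0 0\<close> on, so the step is
    moved by full turns beyond this point.\<close>
  define a' where "a' = a + nat \<lceil>e0 0 - A a\<rceil> * N"
  have a'1: "e0 0 \<le> A a'"
  proof -
    have "e0 0 - A a \<le> real (nat \<lceil>e0 0 - A a\<rceil>)" by linarith
    then show ?thesis using perA[of a] unfolding a'_def by simp
  qed
  have Sa: "Suc a' = Suc a + nat \<lceil>e0 0 - A a\<rceil> * N" by (simp add: a'_def)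
  have a'2: "\<beta> a' = Edge_cell e" "\<beta> (Suc a') = Edge_cell e" "A a' < A (Suc a')"
    using perA[of a] perA[of "Suc a"] a unfolding Sa unfolding a'_def by simp_all
  obtain k where k: "\<alpha> a' = Vertex_cell (vx k)" "A a' = e0 k" using high[OF a'1] by blast
  have "e0 0 \<le> A (Suc a')" using a'1 a'2(3) by simp
  from high[OF this] obtain i' where i': "\<alpha> (Suc a') = Vertex_cell (vx i')" "A (Suc a') = e0 i'" by blast
  have "e0 k < e0 i'" using a'2(3) k i' by simp
  then have ki: "k < i'" using strict_mono_less[OF e0(2)] by simp
  have "i' = Suc k"
  proof (rule ccontr)
    assume "i' \<noteq> Suc k"
    then have "Suc k < i'" using ki by simp
    then have lt: "e0 k < e0 (Suc k)" "e0 (Suc k) < e0 i'" using strict_mono_less[OF e0(2)] by simp_all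
    have "Vertex_cell (vx (Suc k)) \<in> plane_cells V E" using vx_in by (simp add: plane_cells_def)
    from neighbours[OF this, of 0] obtain d where d: "{Vertex_cell (vx (Suc k)), d} \<in> G" "cell_rank d = 1" by auto
    then obtain j1 where j1: "\<alpha> j1 = Vertex_cell (vx (Suc k))" using S(10)[OF d(1)] by auto
    have "cyl (e0 (Suc k), of_int 0) = cyl (A j1, of_int 0)" unfolding S(3) j1 by (simp add: e0(1))
    then obtain m :: int where m: "A j1 = e0 (Suc k) + of_int m" unfolding cyl_pair_eq by blast
    \<comment> \<open>The skipped vertex and the step are brought to the same turn: depending on the
      sign of \<open>m\<close> the one or the other is shifted.\<close>
    define t where "t = nat m"
    define j2 where "j2 = j1 + nat (- m) * N"
    have j2: "A j2 = e0 (Suc k) + real t" using perA[of j1 "nat (- m)"] m unfolding j2_def t_def by (cases "m \<ge> 0") simp_all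
    have s1: "A (a' + t * N) = e0 k + real t" using perA[of a' t] k by simp
    have s2: "A (Suc (a' + t * N)) = e0 i' + real t" using perA[of "Suc a'" t] i' by simp
    show False
    proof (cases "j2 \<le> a' + t * N")
      case True
      then show False using Am[OF True] j2 s1 lt by simp
    next
      case False
      then have "Suc (a' + t * N) \<le> j2" by simp
      from Am[OF this] show False using j2 s2 lt by simp
    qed
  qed
  then have i'2: "\<alpha> (Suc a') = Vertex_cell (vx (Suc k))" using i' by simp
  have "{Vertex_cell (vx k), Edge_cell e} \<in> G" "{Vertex_cell (vx (Suc k)), Edge_cell e} \<in> G"
    using S(2)[of a'] S(2)[of "Suc a'"] unfolding k(1) i'2 a'2 by simp_all
  then have ve: "vx k \<in> e" "vx (Suc k) \<in> e" using vertex_edge by blast+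
  obtain x y where xy: "e \<inter> V = {x, y}" using edge_ends[OF chdE[OF e]] by metis
  have "vx k \<in> {x, y}" "vx (Suc k) \<in> {x, y}" unfolding xy[symmetric] using ve vx_in by simp_all
  then have "{x, y} = {vx k, vx (Suc k)}" using vx_Suc_neq[of k] by auto
  then have "e \<inter> V = {vx k, vx (Suc k)}" using xy by simp
  then have "e = ce k" using edge_unique[OF chdE[OF e] ce(1)] ce(2) by simp
  then show False using e chd_eq by blast
qed

text \<open>On level 1 the chord shares a vertex and a face with its left neighbour, and likewise
  with the right one. The vertices coincide by \<open>chord_one_vertex\<close>; equal faces would
  give three edges at a vertex on the boundary of one face.\<close>

lemma chord_two_faces:
  assumes e: "e \<in> chd"
  shows "\<exists>f g. f \<noteq> g \<and> {Edge_cell e, Face_cell f} \<in> G \<and> {Edge_cell e, Face_cell g} \<in> G"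
proof -
  let ?m = "card {x \<in> plane_cells V E. cell_rank x = 1}"
  have m3: "3 \<le> ?m" using ranks_card(4) card_E n3 by simp
  have two: "2 \<le> ?m" using m3 by simp
  obtain x0 :: "nat \<Rightarrow> real" and c where c: "strict_mono x0" "\<And>j. x0 (j + ?m) = x0 j + 1"
    "\<And>j. pos (c j) = cyl (x0 j, of_int 1)" "\<And>j. c j \<in> plane_cells V E \<and> cell_rank (c j) = 1"
    "\<And>x. x \<in> plane_cells V E \<Longrightarrow> cell_rank x = 1 \<Longrightarrow> \<exists>j. x = c j" "\<And>i j. c i = c j \<longleftrightarrow> i mod ?m = j mod ?m"
    "\<And>j x. x0 j < x \<Longrightarrow> x < x0 (Suc j) \<Longrightarrow> cyl (x, of_int 1) \<notin> pos ` plane_cells V E"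
    "\<And>j. \<exists>b d. cell_rank b = 1 - 1 \<and> cell_rank d = 1 + 1 \<and> {c j, b} \<in> G \<and> {c (Suc j), b} \<in> G \<and> {c j, d} \<in> G \<and> {c (Suc j), d} \<in> G"
    by (rule level_cycle[OF all_levels ranks_card(3) two]) (rule that; assumption)
  have "Edge_cell e \<in> plane_cells V E" using chdE[OF e] by (simp add: plane_cells_def)
  then obtain j0 where "Edge_cell e = c j0" using c(5)[of "Edge_cell e"] by auto
  \<comment> \<open>One turn is added so that the cell has a predecessor in the list.\<close>
  then have "c (j0 + ?m) = Edge_cell e" using c(6) by simp
  then have "c (Suc (j0 + ?m - 1)) = Edge_cell e" using m3 by simp
  then obtain j where j: "c (Suc j) = Edge_cell e" by blast
  obtain e1 where e1: "e1 \<in> E" "c j = Edge_cell e1" using rank1 c(4) by blast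
  obtain e3 where e3: "e3 \<in> E" "c (Suc (Suc j)) = Edge_cell e3" using rank1 c(4) by blast
  have ne: "c j \<noteq> c (Suc j)" "c (Suc j) \<noteq> c (Suc (Suc j))" "c j \<noteq> c (Suc (Suc j))"
    unfolding c(6) using mod_eq_close[of j ?m "Suc j"] mod_eq_close[of "Suc j" ?m "Suc (Suc j)"] mod_eq_close[of j ?m "Suc (Suc j)"] m3 by auto
  have ee: "e1 \<noteq> e" "e \<noteq> e3" "e1 \<noteq> e3" using ne unfolding e1(2) e3(2) j by auto
  have nb: "\<exists>v f. {Edge_cell x, Vertex_cell v} \<in> G \<and> {Edge_cell y, Vertex_cell v} \<in> G \<and> {Edge_cell x, Face_cell f} \<in> G \<and> {Edge_cell y, Face_cell f} \<in> G"
    if xy: "c i = Edge_cell x" "c (Suc i) = Edge_cell y" for i x y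
  proof -
    obtain b d where bd: "cell_rank b = 0" "cell_rank d = 2" "{c i, b} \<in> G" "{c (Suc i), b} \<in> G" "{c i, d} \<in> G" "{c (Suc i), d} \<in> G"
      using c(8)[of i] by auto
    obtain v where "b = Vertex_cell v" using rank0 G_cells[OF bd(3)] bd(1) by blast
    moreover obtain f where "d = Face_cell f" using rank2 G_cells[OF bd(5)] bd(2) by blast
    ultimately show ?thesis using bd xy by auto
  qed
  obtain v f where vf: "{Edge_cell e1, Vertex_cell v} \<in> G" "{Edge_cell e, Vertex_cell v} \<in> G" "{Edge_cell e1, Face_cell f} \<in> G" "{Edge_cell e, Face_cell f} \<in> G"
    using nb[OF e1(2) j] by blast
  obtain w g where wg: "{Edge_cell e, Vertex_cell w} \<in> G" "{Edge_cell e3, Vertex_cell w} \<in> G" "{Edge_cell e, Face_cell g} \<in> G" "{Edge_cell e3, Face_cell g} \<in> G"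
    using nb[OF j e3(2)] by blast
  have vw: "v = w" using chord_one_vertex[OF e] vf(2) wg(1) by (simp add: insert_commute)
  have "f \<noteq> g"
  proof
    assume fg: "f = g"
    have v1: "v \<in> V \<and> v \<in> e1" using vertex_edge[of v e1] vf(1) by (simp add: insert_commute)
    have v2: "v \<in> e" using vertex_edge[of v e] vf(2) by (simp add: insert_commute)
    have v3: "v \<in> e3" using vertex_edge[of w e3] wg(2) vw by (simp add: insert_commute)
    show False
      by (rule no_three_edges[OF e1(1) chdE[OF e] e3(1) ee(1) ee(3) ee(2)])
        (use v1 v2 v3 edge_face[OF vf(3)] edge_face[OF vf(4)] edge_face[OF wg(4)] fg in auto)
  qed
  then show ?thesis using vf(4) wg(3) by blast
qed

end

lemma even_changes: "even (card {j. j < M \<and> s j \<noteq> s (Suc j)}) \<longleftrightarrow> (s M = (s 0 :: bool))"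
proof (induction M)
  case (Suc M)
  have fin: "finite {j. j < M \<and> s j \<noteq> s (Suc j)}" by simp
  show ?case
  proof (cases "s M = s (Suc M)")
    case True
    then have "{j. j < Suc M \<and> s j \<noteq> s (Suc j)} = {j. j < M \<and> s j \<noteq> s (Suc j)}" by (auto simp: less_Suc_eq)
    then show ?thesis using Suc True by simp
  next
    case False
    then have "{j. j < Suc M \<and> s j \<noteq> s (Suc j)} = insert M {j. j < M \<and> s j \<noteq> s (Suc j)}" by (auto simp: less_Suc_eq)
    then have "card {j. j < Suc M \<and> s j \<noteq> s (Suc j)} = Suc (card {j. j < M \<and> s j \<noteq> s (Suc j)})" using fin by simp
    then show ?thesis using Suc False by auto
  qed
qed simp

context strip_drawing
begin

text \<open>The strip between edges and faces is a closed walk in the dual graph that crosses every chord.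
  By the bound on the number of faces it crosses \<open>C\<close> exactly twice, and by parity it
  crosses every cycle formed by a chord and a path of \<open>C\<close> an even number of times.\<close>

theorem strip_splittable: "splittable V E C"
proof (cases "chd = {}")
  case True
  have "cut_at 0 1" unfolding cut_at_def using True n3 by simp
  then show ?thesis using splittable_iff by blast
next
  case chne: False
  obtain N :: nat and \<alpha> \<beta> :: "nat \<Rightarrow> cell" and A B :: "nat \<Rightarrow> real" where
    "N > 0"
    "\<And>j. \<alpha> j \<in> plane_cells V E \<and> \<beta> j \<in> plane_cells V E \<and> {\<alpha> j, \<beta> j} \<in> G \<and> cell_rank (\<alpha> j) = 1 \<and> cell_rank (\<beta> j) = 1 + 1"
    "\<And>j. cyl (A j, of_int 1) = pos (\<alpha> j)" "\<And>j. cyl (B j, of_int (1 + 1)) = pos (\<beta> j)"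
    "\<And>j. A (j + N) = A j + 1" "\<And>j. B (j + N) = B j + 1" "\<And>j. \<alpha> (j + N) = \<alpha> j" "\<And>j. \<beta> (j + N) = \<beta> j"
    "\<And>j. A j = A (Suc j) \<and> \<alpha> j = \<alpha> (Suc j) \<and> B j < B (Suc j) \<and> \<beta> j \<noteq> \<beta> (Suc j) \<or>
          A j < A (Suc j) \<and> \<alpha> j \<noteq> \<alpha> (Suc j) \<and> B j = B (Suc j) \<and> \<beta> j = \<beta> (Suc j)"
    "\<And>x y. {x, y} \<in> G \<Longrightarrow> cell_rank x = 1 \<Longrightarrow> cell_rank y = 1 + 1 \<Longrightarrow> \<exists>j<N. x = \<alpha> j \<and> y = \<beta> j"
    "\<And>i j. \<alpha> i = \<alpha> j \<Longrightarrow> \<beta> i = \<beta> j \<Longrightarrow> i mod N = j mod N"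
    by (rule strip[of 1, OF disjI2[OF refl]]) (rule that; assumption)
  note S = this
  have "\<exists>e. \<alpha> j = Edge_cell e" for j using rank1 S(2)[of j] by blast
  then obtain ed where ed: "\<And>j. \<alpha> j = Edge_cell (ed j)" by metis
  have "\<exists>f. \<beta> j = Face_cell f" for j using rank2 S(2)[of j] by fastforce
  then obtain fc where fc: "\<And>j. \<beta> j = Face_cell (fc j)" by metis
  have inc: "ed j \<in> E" "fc j \<in> faces" "ed j \<subseteq> closure (fc j)" for j
    using edge_face[of "ed j" "fc j"] S(2)[of j] unfolding ed fc by blast+
  have step: "ed j = ed (Suc j) \<and> B j < B (Suc j) \<and> fc j \<noteq> fc (Suc j) \<or> B j = B (Suc j) \<and> fc j = fc (Suc j)" for j
    using S(9)[of j] unfolding ed fc by auto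
  have Bm: "B x \<le> B y" if "x \<le> y" for x y using steps_mono[of B x y] S(9) that by blast
  have per: "ed (x + k * N) = ed x \<and> fc (x + k * N) = fc x \<and> B (x + k * N) = B x + real k" for x k
  proof (induction k)
    case (Suc k)
    have q: "x + Suc k * N = (x + k * N) + N" by simp
    have "ed (y + N) = ed y" "fc (y + N) = fc y" for y using S(7)[of y] S(8)[of y] unfolding ed fc by simp_all
    then show ?case unfolding q S(6) using Suc by simp
  qed simp
  \<comment> \<open>The steps of one turn at which the walk changes its face; step \<open>j\<close>
    crosses the edge \<open>ed j\<close>.\<close>
  define T where "T = {j. j < N \<and> B j < B (Suc j)}"
  have finT: "finite T" unfolding T_def by simp
  \<comment> \<open>A face is left at most once per turn, since its lifts are whole turns apart.
    Hence there are at most as many crossings as faces.\<close>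
  have injT: "inj_on fc T"
  proof -
    have *: False if ij: "i \<in> T" "j \<in> T" "fc i = fc j" "i < j" for i j
    proof -
      have "cyl (B i, of_int (1 + 1)) = cyl (B j, of_int (1 + 1))" unfolding S(4) fc ij(3) ..
      then obtain k :: int where k: "B j = B i + of_int k" unfolding cyl_pair_eq by blast
      have "B i < B (Suc i)" "B (Suc i) \<le> B j" using ij Bm[of "Suc i" j] by (auto simp: T_def)
      then have "0 < k" using k by simp
      have "B j < B (Suc j)" "B (Suc j) \<le> B (i + N)" using ij Bm[of "Suc j" "i + N"] by (auto simp: T_def)
      then have "B j < B i + 1" using S(6) by simp
      then show False using k \<open>0 < k\<close> by simp
    qed
    show ?thesis
    proof (rule inj_onI)
      fix i j assume "i \<in> T" "j \<in> T" "fc i = fc j"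
      then show "i = j" using *[of i j] *[of j i] by (metis linorder_neqE_nat)
    qed
  qed
  have "fc ` T \<subseteq> faces" using inc(2) by blast
  then have "card T \<le> card faces" using card_image[OF injT] card_mono[OF card_faces_le(1)] by metis
  then have cardT: "card T \<le> card chd + 2" using card_faces_le(2) by simp
  have side: "{j. j < N \<and> (fc j \<subseteq> U) \<noteq> (fc (Suc j) \<subseteq> U)} = {j \<in> T. ed j \<in> Z}"
    if Z: "is_cycle Z" "U \<in> components (- \<Union>Z)" for Z U
  proof -
    have "(fc j \<subseteq> U) \<noteq> (fc (Suc j) \<subseteq> U) \<longleftrightarrow> B j < B (Suc j) \<and> ed j \<in> Z" for j
    proof (cases "B j < B (Suc j)")
      case True
      then have *: "ed j = ed (Suc j)" "fc j \<noteq> fc (Suc j)" using step[of j] by auto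
      have "ed j \<subseteq> closure (fc (Suc j))" using inc(3)[of "Suc j"] *(1) by simp
      from face_flip[OF Z inc(1)[of j] inc(2)[of j] inc(3)[of j] inc(2)[of "Suc j"] this *(2)] show ?thesis using True by blast
    next
      case False
      then have "fc j = fc (Suc j)" using step[of j] by auto
      then show ?thesis using False by simp
    qed
    then show ?thesis unfolding T_def by blast
  qed
  have ev: "even (card {j \<in> T. ed j \<in> Z})" if Z: "is_cycle Z" for Z
  proof -
    obtain U W where "components (- \<Union>Z) = {U, W}" using cycle_sides[OF Z] by metis
    then have U: "U \<in> components (- \<Union>Z)" by simp
    have "fc N = fc 0" using per[of 0 1] by simp
    then have "even (card {j. j < N \<and> (fc j \<subseteq> U) \<noteq> (fc (Suc j) \<subseteq> U)})"
      using even_changes[of N "\<lambda>j. fc j \<subseteq> U"] by simp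
    then show ?thesis unfolding side[OF Z U] .
  qed
  \<comment> \<open>A chord has two neighbours among the faces, so \<open>step_at_cell\<close>, with
    the two levels exchanged, yields a step across it.\<close>
  have hit: "\<exists>j\<in>T. ed j = c" if c: "c \<in> chd" for c
  proof -
    obtain f g where fg: "f \<noteq> g" "{Edge_cell c, Face_cell f} \<in> G" "{Edge_cell c, Face_cell g} \<in> G"
      using chord_two_faces[OF c] by blast
    obtain i where i: "Edge_cell c = \<alpha> i" "Face_cell f = \<beta> i" using S(10)[OF fg(2)] by auto
    obtain j where j: "Edge_cell c = \<alpha> j" "Face_cell g = \<beta> j" using S(10)[OF fg(3)] by auto
    have st: "B j = B (Suc j) \<and> \<beta> j = \<beta> (Suc j) \<and> A j < A (Suc j) \<and> \<alpha> j \<noteq> \<alpha> (Suc j) \<or>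
          B j < B (Suc j) \<and> \<beta> j \<noteq> \<beta> (Suc j) \<and> A j = A (Suc j) \<and> \<alpha> j = \<alpha> (Suc j)" for j
      using S(9)[of j] by argo
    have "\<alpha> i = \<alpha> j" using i(1) j(1) by simp
    moreover have "\<beta> i \<noteq> \<beta> j" unfolding i(2)[symmetric] j(2)[symmetric] using fg(1) by simp
    ultimately obtain a where a: "\<alpha> a = Edge_cell c" "B a < B (Suc a)"
      using step_at_cell[OF S(3,5,8,7) st] unfolding i(1) by blast
    define k where "k = a div N"
    have am: "a = a mod N + k * N" "Suc a = Suc (a mod N) + k * N" by (simp_all add: k_def)
    have "B (a mod N) < B (Suc (a mod N))"
      using a(2) per[of "a mod N" k] per[of "Suc (a mod N)" k] unfolding am[symmetric] by simp
    moreover have "ed (a mod N) = c" using per[of "a mod N" k] a(1) unfolding am(1)[symmetric] ed by simp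
    ultimately show ?thesis using S(1) by (intro bexI[of _ "a mod N"]) (simp_all add: T_def)
  qed
  define tC where "tC = card {j \<in> T. ed j \<in> range ce}"
  define t where "t c = card {j \<in> T. ed j = c}" for c
  have t1: "1 \<le> t c" if "c \<in> chd" for c
  proof -
    have "{j \<in> T. ed j = c} \<noteq> {}" using hit[OF that] by blast
    then have "0 < t c" unfolding t_def using finT by (simp add: card_gt_0_iff)
    then show ?thesis by simp
  qed
  have "T = {j \<in> T. ed j \<in> range ce} \<union> (\<Union>c\<in>chd. {j \<in> T. ed j = c})"
    using inc(1) chd_eq by blast
  then have "card T = card ({j \<in> T. ed j \<in> range ce} \<union> (\<Union>c\<in>chd. {j \<in> T. ed j = c}))" by simp
  also have "\<dots> = tC + card (\<Union>c\<in>chd. {j \<in> T. ed j = c})"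
    unfolding tC_def using finT fin_chd chd_eq by (intro card_Un_disjoint) auto
  also have "card (\<Union>c\<in>chd. {j \<in> T. ed j = c}) = (\<Sum>c\<in>chd. t c)"
    unfolding t_def using finT fin_chd by (intro card_UN_disjoint) auto
  finally have cT: "card T = tC + (\<Sum>c\<in>chd. t c)" .
  have sum_ge: "card chd \<le> (\<Sum>c\<in>chd. t c)" using sum_mono[of chd "\<lambda>_. 1" t] t1 by simp
  have r: "\<Union>(range ce) = rim" by (simp add: rim_def)
  have tC_even: "even tC" unfolding tC_def by (rule ev[OF cycle_rim])
  \<comment> \<open>Without crossing the cycle the walk would stay on one side of it, but it visits
    all faces.\<close>
  have "tC \<noteq> 0"
  proof
    assume "tC = 0"
    then have e0: "{j \<in> T. ed j \<in> range ce} = {}" unfolding tC_def using finT by simp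
    have U: "inside rim \<in> components (- \<Union>(range ce))" unfolding r components_rim by simp
    have nochange: "j < N \<Longrightarrow> (fc j \<subseteq> inside rim) = (fc (Suc j) \<subseteq> inside rim)" for j
      using side[OF cycle_rim U] unfolding e0 by blast
    have const: "j \<le> N \<Longrightarrow> (fc j \<subseteq> inside rim) = (fc 0 \<subseteq> inside rim)" for j
      by (induction j) (use nochange in auto)
    have all: "\<exists>j<N. fc j = f" if f: "f \<in> faces" for f
    proof -
      have "Face_cell f \<in> plane_cells V E" using f by (simp add: plane_cells_def)
      from neighbours[OF this, of 2] obtain b where b: "{Face_cell f, b} \<in> G" "cell_rank b = 1" by auto
      have "{b, Face_cell f} \<in> G" using b(1) by (simp add: insert_commute)
      from S(10)[OF this] b(2) obtain j where "j < N" "Face_cell f = \<beta> j" by auto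
      then show ?thesis unfolding fc by blast
    qed
    obtain f g where fg: "f \<in> faces" "g \<in> faces" "f \<subseteq> inside rim" "g \<subseteq> outside rim" using two_faces by blast
    obtain i where i: "i < N" "fc i = f" using all[OF fg(1)] by blast
    obtain j where j: "j < N" "fc j = g" using all[OF fg(2)] by blast
    have "g \<subseteq> inside rim" using const[of i] const[of j] i j fg(3) by simp
    then show False using fg(4) face_props(2)[OF fg(2)] rim_in_out(3) by blast
  qed
  then have "2 \<le> tC" using tC_even by (metis One_nat_def Suc_leI even_zero le_neq_implies_less neq0_conv odd_one numeral_2_eq_2)
  \<comment> \<open>Every chord is crossed at least once and \<open>C\<close> at least twice, while
    there are at most two more crossings than chords; so all bounds are attained.\<close>
  then have tC2: "tC = 2" and sumt: "(\<Sum>c\<in>chd. t c) = card chd" using cT cardT sum_ge by linarith+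
  have tc: "t c = 1" if c: "c \<in> chd" for c
  proof (rule ccontr)
    assume "t c \<noteq> 1"
    then have "1 < t c" using t1[OF c] by simp
    then have "(\<Sum>c\<in>chd. 1) < (\<Sum>c\<in>chd. t c)" using c t1 by (intro sum_strict_mono_ex1[OF fin_chd]) auto
    then show False using sumt by simp
  qed
  obtain j1 j2 where jj: "{j \<in> T. ed j \<in> range ce} = {j1, j2}" "j1 \<noteq> j2"
    using tC2 unfolding tC_def card_2_iff by blast
  have ex: "\<exists>p<n. ed j = ce p" if "ed j \<in> range ce" for j
  proof -
    have "ed j \<in> ce ` {0..<0 + n}" using that ce_range[of 0] by simp
    then show ?thesis by auto
  qed
  have "ed j1 \<in> range ce" "ed j2 \<in> range ce" using jj(1) by blast+
  then obtain p q where pq: "p < n" "ed j1 = ce p" "q < n" "ed j2 = ce q" using ex by metis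
  have sep: "(p \<in> {i..<j}) \<noteq> (q \<in> {i..<j})" if c: "c \<in> chd" "i < j" "j < n" "c \<inter> V = {vx i, vx j}" for c i j
  proof -
    let ?Z = "insert c (ce ` {i..<i + (j - i)})"
    have cyc: "is_cycle ?Z" by (rule cycle_chord[OF c(1)]) (use c in auto)
    have cn: "c \<notin> range ce" using c(1) chd_eq by blast
    let ?K = "{k \<in> T. ed k \<in> ce ` {i..<j}}"
    have "{k \<in> T. ed k \<in> ?Z} = {k \<in> T. ed k = c} \<union> ?K" using c by auto
    moreover have "{k \<in> T. ed k = c} \<inter> ?K = {}" using cn by auto
    ultimately have "card {k \<in> T. ed k \<in> ?Z} = t c + card ?K" unfolding t_def using finT by (simp add: card_Un_disjoint)
    \<comment> \<open>The cycle formed by the chord and a path of \<open>C\<close> is crossed an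
      even number of times, exactly once of them at the chord.\<close>
    then have odd: "odd (card ?K)" using ev[OF cyc] tc[OF c(1)] by simp
    have K: "?K = {k \<in> {j1, j2}. ed k \<in> ce ` {i..<j}}" unfolding jj(1)[symmetric] by auto
    have m: "ce k \<in> ce ` {i..<j} \<longleftrightarrow> k \<in> {i..<j}" if "k < n" for k
    proof (rule inj_on_image_mem_iff[OF ce_inj[of 0]])
      show "k \<in> {0..<0 + n}" using that by simp
      show "{i..<j} \<subseteq> {0..<0 + n}" using c(3) by auto
    qed
    have K1: "ed j1 \<in> ce ` {i..<j} \<longleftrightarrow> p \<in> {i..<j}" unfolding pq(2) by (rule m[OF pq(1)])
    have K2: "ed j2 \<in> ce ` {i..<j} \<longleftrightarrow> q \<in> {i..<j}" unfolding pq(4) by (rule m[OF pq(3)])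
    show ?thesis
    proof
      assume eq: "(p \<in> {i..<j}) = (q \<in> {i..<j})"
      show False
      proof (cases "p \<in> {i..<j}")
        case True
        then have z: "?K = {j1, j2}" unfolding K using K1 K2 eq by blast
        show False using odd jj(2) unfolding z by simp
      next
        case False
        then have z: "?K = {}" unfolding K using K1 K2 eq by blast
        show False using odd unfolding z by simp
      qed
    qed
  qed
  \<comment> \<open>A chord would have to separate the edge \<open>ce p\<close> from itself.\<close>
  have pneq: "p \<noteq> q"
  proof
    assume "p = q"
    obtain c where c: "c \<in> chd" using chne by blast
    obtain i l where "i < n" "i + l < n" "1 < l" "l < n - 1" "c \<inter> V = {vx i, vx (i + l)}" using chord_ends[OF c] .
    then show False using sep[OF c, of i "i + l"] \<open>p = q\<close> by auto
  qed
  show ?thesis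
  proof (cases "p < q")
    case True
    have "cut_at (Suc p) (q - p)" by (rule cut_atI[OF True pq(3) sep])
    then show ?thesis using splittable_iff by blast
  next
    case False
    then have qp: "q < p" using pneq by simp
    have "cut_at (Suc q) (p - q)" by (rule cut_atI[OF qp pq(1)]) (rule sep[symmetric])
    then show ?thesis using splittable_iff by blast
  qed
qed

end

theorem rhombic_strip_imp_splittable:
  assumes pg: "plane_graph V E" and V3: "card V > 2"
    and hs: "has_rhombic_strip (plane_cells V E) cell_le cell_rank"
  shows "\<exists>C. hamiltonian_cycle V E C \<and> splittable V E C"
proof -
  obtain G pos crv where G: "G \<subseteq> cover_graph (plane_cells V E) cell_le"
    "straight_cylinder_embedding (plane_cells V E) G cell_rank pos crv"
    "\<forall>F\<in>drawing_faces (plane_cells V E) G pos crv. rhombic_face G cell_rank crv F"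
    using hs unfolding has_rhombic_strip_def by blast
  have Vne: "V \<noteq> {}" using V3 by auto
  interpret rhombic_drawing "plane_cells V E" G cell_rank pos crv
  proof
    show "straight_cylinder_embedding (plane_cells V E) G cell_rank pos crv" by (rule G(2))
    show "rhombic_face G cell_rank crv F" if "F \<in> drawing_faces (plane_cells V E) G pos crv" for F using G(3) that by blast
    show "\<exists>x\<in>plane_cells V E. \<exists>y\<in>plane_cells V E. cell_rank x < cell_rank y \<and> g = {x, y}" if "g \<in> G" for g
      using cover_edge[OF pg, of g] G(1) that by blast
  qed
  have lev: "level 0"
    unfolding level_def
  proof (intro allI impI)
    fix u assume "cyl (u, of_int 0) \<in> D"
    then consider "cyl (u, of_int 0) \<in> pos ` plane_cells V E" | g where "g \<in> G" "cyl (u, of_int 0) \<in> crv g"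
      unfolding D_def by blast
    then show "cyl (u, of_int 0) \<in> pos ` plane_cells V E"
    proof cases
      case 2
      obtain x y where xy: "x \<in> plane_cells V E" "y \<in> plane_cells V E" "cell_rank x < cell_rank y" "g = {x, y}"
        using edges[OF 2(1)] by blast
      have "cyl (u, of_int 0) \<in> pos ` plane_cells V E \<or> of_int (cell_rank x) < (of_int 0 :: real) \<and> (of_int 0 :: real) < of_int (cell_rank y)"
        using edge_height[of x y u "of_int 0"] 2 xy by simp
      moreover have "\<not> (cell_rank x < 0 \<and> 0 < cell_rank y)"
        using no_edge_across_zero[OF pg _ xy(4) _ _ Vne] G(1) 2(1) by blast
      ultimately show ?thesis unfolding of_int_less_iff by blast
    qed
  qed
  have finV: "finite V" using pg by (simp add: plane_graph_def)
  have R0: "{x \<in> plane_cells V E. cell_rank x = 0} = Vertex_cell ` V" by (rule rank_cells[OF pg])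
  have cR: "card {x \<in> plane_cells V E. cell_rank x = 0} = card V"
    unfolding R0 by (intro card_image) (simp add: inj_on_def)
  have f0: "finite {x \<in> plane_cells V E. cell_rank x = 0}" unfolding R0 using finV by simp
  have two: "2 \<le> card {x \<in> plane_cells V E. cell_rank x = 0}" unfolding cR using V3 by simp
  define N where "N = card V"
  obtain e0 :: "nat \<Rightarrow> real" and c where c0: "strict_mono e0" "\<And>j. e0 (j + card {x \<in> plane_cells V E. cell_rank x = 0}) = e0 j + 1"
    "\<And>j. pos (c j) = cyl (e0 j, of_int 0)" "\<And>j. c j \<in> plane_cells V E \<and> cell_rank (c j) = 0"
    "\<And>x. x \<in> plane_cells V E \<Longrightarrow> cell_rank x = 0 \<Longrightarrow> \<exists>j. x = c j"
    "\<And>i j. c i = c j \<longleftrightarrow> i mod card {x \<in> plane_cells V E. cell_rank x = 0} = j mod card {x \<in> plane_cells V E. cell_rank x = 0}"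
    "\<And>j x. e0 j < x \<Longrightarrow> x < e0 (Suc j) \<Longrightarrow> cyl (x, of_int 0) \<notin> pos ` plane_cells V E"
    "\<And>j. \<exists>b d. cell_rank b = 0 - 1 \<and> cell_rank d = 0 + 1 \<and> {c j, b} \<in> G \<and> {c (Suc j), b} \<in> G \<and> {c j, d} \<in> G \<and> {c (Suc j), d} \<in> G"
    by (rule level_cycle[OF lev f0 two]) (rule that; assumption)
  note c = c0[unfolded cR, folded N_def]
  have N3: "3 \<le> N" using V3 by (simp add: N_def)
  have "\<exists>v. v \<in> V \<and> c j = Vertex_cell v" for j using c(4)[of j] R0 by blast
  then obtain w where w: "\<And>j. w j \<in> V" "\<And>j. c j = Vertex_cell (w j)" by metis
  have weq: "w i = w j \<longleftrightarrow> i mod N = j mod N" for i j using c(6)[of i j] unfolding w(2) by simp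
  define C where "C = map w [0..<N]"
  have len: "length C = N" by (simp add: C_def)
  have nth: "C ! i = w i" if "i < N" for i using that by (simp add: C_def)
  have ham: "hamiltonian_cycle V E C"
    unfolding hamiltonian_cycle_def
  proof (intro conjI allI impI)
    show "3 \<le> length C" using N3 len by simp
    show "distinct C" unfolding C_def distinct_map by (simp add: inj_on_def weq)
    show "set C = V"
    proof (intro subset_antisym subsetI)
      fix v assume "v \<in> set C" then show "v \<in> V" using w(1) by (auto simp: C_def)
    next
      fix v assume "v \<in> V"
      then have "Vertex_cell v \<in> {x \<in> plane_cells V E. cell_rank x = 0}" unfolding R0 by simp
      then obtain j where "Vertex_cell v = c j" using c(5)[of "Vertex_cell v"] by auto
      then have "v = w (j mod N)" using weq[of j "j mod N"] unfolding w(2) by simp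
      then show "v \<in> set C" using N3 by (simp add: C_def)
    qed
    fix i assume i: "i < length C"
    obtain d where d: "cell_rank d = 1" "{c i, d} \<in> G" "{c (Suc i), d} \<in> G" using c(8)[of i] by auto
    have "d \<in> {x \<in> plane_cells V E. cell_rank x = 1}" using edge_sub[OF d(2)] d(1) by blast
    then obtain e where e: "d = Edge_cell e" "e \<in> E" unfolding rank_cells[OF pg] by blast
    have in_e: "w i \<in> e" "w (Suc i) \<in> e"
      using cover_vertex_edge[OF pg, of "w i" e] cover_vertex_edge[OF pg, of "w (Suc i)" e] d G(1) unfolding w(2) e(1) by blast+
    have ne: "w i \<noteq> w (Suc i)" unfolding weq using mod_eq_close[of i N "Suc i"] N3 by auto
    obtain s t where st: "e \<inter> V = {s, t}" using pg e(2) unfolding plane_graph_def by meson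
    have "w i \<in> {s, t}" "w (Suc i) \<in> {s, t}" unfolding st[symmetric] using in_e w(1) by simp_all
    then have "{s, t} = {w i, w (Suc i)}" using ne by auto
    then have "adjacent V E (w i) (w (Suc i))" unfolding adjacent_def using e(2) st ne by auto
    moreover have "w (Suc i) = w (Suc i mod N)" unfolding weq by simp
    moreover have "Suc i mod N < N" using N3 by simp
    ultimately show "adjacent V E (C ! i) (C ! (Suc i mod length C))" using i nth len by simp
  qed
  interpret ham_graph V E C using pg ham by unfold_locales
  have nN: "n = N" by (simp add: n_def len)
  have vxw: "vx j = w j" for j
  proof -
    have "vx j = w (j mod N)" unfolding vx_def nN using nth N3 by simp
    then show ?thesis using weq[of "j mod N" j] by simp
  qed
  \<comment> \<open>The cycle just found makes the set of faces finite, and only now do the lemmas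
    on lifted drawings become available.\<close>
  have "finite (plane_cells V E)" unfolding plane_cells_def using fin card_faces_le(1) by simp
  moreover have "G \<subseteq> Pow (plane_cells V E)" using edge_sub by blast
  ultimately have finG: "finite G" using finite_subset by blast
  obtain lo hi p q where L: "\<forall>g\<in>G. lifted_edge g (lo g) (hi g) (p g) (q g)" using lifts_exist by blast
  have "strip_drawing V E C G pos crv lo hi p q e0"
  proof unfold_locales
    show "lifted_edge g (lo g) (hi g) (p g) (q g)" if "g \<in> G" for g using L that by blast
    show "finite G" by (rule finG)
    show "G \<subseteq> cover_graph (plane_cells V E) cell_le" by (rule G(1))
    show "pos (Vertex_cell (vx j)) = cyl (e0 j, 0)" for j using c(3)[of j] unfolding w(2) vxw by simp
    show "strict_mono e0" by (rule c(1))
    show "e0 (j + n) = e0 j + 1" for j unfolding nN by (rule c(2))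
  qed
  from strip_drawing.strip_splittable[OF this] ham show ?thesis by blast
qed

section \<open>The covering map of the cylinder\<close>

lemma cyl_shift: "cyl (x + of_int k, y) = cyl (x, y)"
  unfolding cyl_eq_iff by (intro exI[of _ "- k"]) simp

lemma cyl_range: "cyl z \<in> cylinder"
  by (simp add: cyl_def cylinder_def)

lemma cylinder_cyl: assumes "z \<in> cylinder" obtains x y where "z = cyl (x, y)"
proof -
  have "norm (fst z) = 1" using assms by (auto simp: cylinder_def)
  from cyl_polar[OF this, of 0 "snd z"] show ?thesis using that by (metis prod.collapse)
qed

text \<open>The preimage of the image of \<open>U\<close> is the union of its integer translates,
  which is open; as \<open>cyl\<close> is a quotient map, the image is open in the cylinder.\<close>

lemma openin_cyl_image:
  assumes "open U" shows "openin (top_of_set cylinder) (cyl ` U)"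
proof -
  have sub: "cyl ` U \<subseteq> topspace (top_of_set cylinder)" using cyl_range by auto
  have "{z. cyl z \<in> cyl ` U} = (\<Union>k::int. (\<lambda>z. (of_int k, 0) + z) ` U)"
  proof (intro set_eqI iffI)
    fix z assume "z \<in> {z. cyl z \<in> cyl ` U}"
    then obtain w where w: "w \<in> U" "cyl w = cyl z" by auto
    then obtain k :: int where "z = (fst w + of_int k, snd w)" unfolding cyl_eq_iff by blast
    then have "z = (of_int k, 0) + w" by (simp add: prod_eq_iff)
    then show "z \<in> (\<Union>k::int. (\<lambda>z. (of_int k, 0) + z) ` U)" using w(1) by blast
  next
    fix z assume "z \<in> (\<Union>k::int. (\<lambda>z. (of_int k, 0) + z) ` U)"
    then obtain k :: int and w where w: "w \<in> U" "z = (of_int k, 0) + w" by blast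
    then have "cyl w = cyl z" unfolding cyl_eq_iff by (intro exI[of _ k]) (simp add: prod_eq_iff)
    then show "z \<in> {z. cyl z \<in> cyl ` U}" using w(1) by (metis imageI mem_Collect_eq)
  qed
  moreover have "open (\<Union>k::int. (\<lambda>z. (of_int k, 0 :: real) + z) ` U)" using assms by (intro open_UN ballI open_translation)
  ultimately have "openin euclidean {z \<in> topspace euclidean. cyl z \<in> cyl ` U}" by simp
  then show ?thesis using quotient_map_cyl sub unfolding quotient_map_def by blast
qed

section \<open>Faces bounded by two graphs\<close>

text \<open>The region between the graphs of \<open>l\<close> and \<open>u\<close> over an open interval that ends where the two
  graphs meet, or is unbounded on a side where the region wraps around the cylinder.\<close>

lemma face_between_graphs:
  fixes l u :: "real \<Rightarrow> real" and a b :: real and jl ju :: bool and D F :: "(complex \<times> real) set"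
  defines "J \<equiv> {y. (\<not> jl \<longrightarrow> a < y) \<and> (\<not> ju \<longrightarrow> y < b)}"
  defines "R \<equiv> {(x, y). y \<in> J \<and> l y < x \<and> x < u y}"
  defines "Bd \<equiv> cyl ` ((\<lambda>y. (l y, y)) ` {a..b} \<union> (\<lambda>y. (u y, y)) ` {a..b})"
  assumes ab: "a < b" and cont: "continuous_on UNIV l" "continuous_on UNIV u"
    and lu: "\<And>y. y \<in> J \<Longrightarrow> l y < u y"
    and ends: "\<not> jl \<Longrightarrow> l a = u a" "\<not> ju \<Longrightarrow> l b = u b"
    and wide: "\<And>y. jl \<Longrightarrow> y < a \<Longrightarrow> 1 < u y - l y" "\<And>y. ju \<Longrightarrow> b < y \<Longrightarrow> 1 < u y - l y"
    and D: "cyl ` R \<inter> D = {}" "Bd \<subseteq> D"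
    and F: "F \<in> components (cylinder - D)" "F \<inter> cyl ` R \<noteq> {}"
  shows "closure F - F = Bd"
proof -
  let ?Q = "cyl ` R"
  have J: "open J"
  proof -
    have "J = (if jl then UNIV else {a<..}) \<inter> (if ju then UNIV else {..<b})" unfolding J_def by auto
    then show ?thesis by auto
  qed
  have Jc: "connected J"
  proof -
    have "J = (if jl then UNIV else {a<..}) \<inter> (if ju then UNIV else {..<b})" unfolding J_def by auto
    also have "\<dots> = (if jl then (if ju then UNIV else {..<b}) else (if ju then {a<..} else {a<..<b}))" by auto
    finally show ?thesis by (simp add: connected_UNIV split: if_splits)
  qed
  have c1: "continuous_on S (\<lambda>z. l (snd z))" "continuous_on S (\<lambda>z. u (snd z))" for S :: "(real \<times> real) set"
    by (intro continuous_on_compose2[OF cont(1)] continuous_on_compose2[OF cont(2)] continuous_intros; simp)+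
  have oR: "open R"
  proof -
    have "R = (UNIV \<times> J) \<inter> ({z. l (snd z) < fst z} \<inter> {z. fst z < u (snd z)})" unfolding R_def by auto
    moreover have "open {z :: real \<times> real. l (snd z) < fst z}" "open {z :: real \<times> real. fst z < u (snd z)}"
      by (intro open_Collect_less c1 continuous_intros)+
    ultimately show ?thesis using J by (auto intro!: open_Int open_Times)
  qed
  \<comment> \<open>Straightens the region to a product, which gives its connectedness and the
    compactness of the closed part \<open>M\<close>.\<close>
  define \<phi> where "\<phi> z = (l (snd z) + fst z * (u (snd z) - l (snd z)), snd z)" for z :: "real \<times> real"
  have c\<phi>: "continuous_on S \<phi>" for S unfolding \<phi>_def by (intro continuous_intros c1)
  have R\<phi>: "R = \<phi> ` ({0<..<1} \<times> J)"
  proof (intro set_eqI iffI)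
    fix z assume "z \<in> R"
    then obtain x y where z: "z = (x, y)" "y \<in> J" "l y < x" "x < u y" unfolding R_def by auto
    have d: "0 < u y - l y" using lu[OF z(2)] by simp
    have "z = \<phi> ((x - l y) / (u y - l y), y)" unfolding \<phi>_def z using d by simp
    moreover have "(x - l y) / (u y - l y) \<in> {0<..<1}" using d z by simp
    ultimately show "z \<in> \<phi> ` ({0<..<1} \<times> J)" using z(2) by blast
  next
    fix z assume "z \<in> \<phi> ` ({0<..<1} \<times> J)"
    then obtain s y where z: "0 < s" "s < 1" "y \<in> J" "z = (l y + s * (u y - l y), y)" unfolding \<phi>_def by auto
    have d: "0 < u y - l y" using lu[OF z(3)] by simp
    have "0 < s * (u y - l y)" "s * (u y - l y) < 1 * (u y - l y)" using z d by (simp, intro mult_strict_right_mono)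
    then show "z \<in> R" unfolding R_def z(4) using z(3) by simp
  qed
  have cR: "connected R" unfolding R\<phi>
    by (intro connected_continuous_image c\<phi> connected_Times connected_Ioo Jc)
  have cQ: "connected ?Q" by (intro connected_continuous_image continuous_on_cyl cR)
  have oQ: "openin (top_of_set cylinder) ?Q" by (rule openin_cyl_image[OF oR])
  have Qsub: "?Q \<subseteq> cylinder - D" using D(1) cyl_range by auto
  \<comment> \<open>An unbounded end is truncated one unit beyond the end of the boundary curves.
    What is cut off is a closed half-cylinder, collected in \<open>A\<close>, so that closedness of
    \<open>?Q \<union> Bd\<close> reduces to the compact image of \<open>M\<close> and to
    \<open>A\<close>.\<close>
  define lo where "lo = (if jl then a - 1 else a)"
  define hi where "hi = (if ju then b + 1 else b)"
  have le: "l y \<le> u y" if "lo \<le> y" "y \<le> hi" for y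
  proof (cases "y \<in> J")
    case True then show ?thesis using lu by fastforce
  next
    case False
    then have "\<not> jl \<and> y \<le> a \<or> \<not> ju \<and> b \<le> y" unfolding J_def by auto
    then have "\<not> jl \<and> y = a \<or> \<not> ju \<and> y = b" using that unfolding lo_def hi_def by auto
    then show ?thesis using ends by auto
  qed
  define M where "M = {(x, y). lo \<le> y \<and> y \<le> hi \<and> l y \<le> x \<and> x \<le> u y}"
  have M\<phi>: "M = \<phi> ` ({0..1} \<times> {lo..hi})"
  proof (intro set_eqI iffI)
    fix z assume "z \<in> M"
    then obtain x y where z: "z = (x, y)" "lo \<le> y" "y \<le> hi" "l y \<le> x" "x \<le> u y" unfolding M_def by auto
    define s where "s = (if u y = l y then 0 else (x - l y) / (u y - l y))"
    have d: "0 \<le> u y - l y" using z by simp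
    have "s \<in> {0..1}" unfolding s_def using d z by (auto simp: divide_le_eq_1)
    moreover have "z = \<phi> (s, y)" unfolding \<phi>_def s_def z using z by auto
    ultimately show "z \<in> \<phi> ` ({0..1} \<times> {lo..hi})" using z by auto
  next
    fix z assume "z \<in> \<phi> ` ({0..1} \<times> {lo..hi})"
    then obtain s y where z: "0 \<le> s" "s \<le> 1" "lo \<le> y" "y \<le> hi" "z = (l y + s * (u y - l y), y)" unfolding \<phi>_def by auto
    have d: "0 \<le> u y - l y" using le[OF z(3,4)] by simp
    have "0 \<le> s * (u y - l y)" "s * (u y - l y) \<le> 1 * (u y - l y)" using z d by (simp, intro mult_right_mono)
    then show "z \<in> M" unfolding M_def z(5) using z(3,4) by simp
  qed
  have "compact M" unfolding M\<phi> by (intro compact_continuous_image c\<phi> compact_Times compact_Icc)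
  then have "compact (cyl ` M)" by (intro compact_continuous_image continuous_on_cyl)
  then have clM: "closed (cyl ` M)" by (rule compact_imp_closed)
  define A where "A = (sphere (0::complex) 1 \<times> {y. jl \<and> y \<le> a - 1}) \<union> (sphere (0::complex) 1 \<times> {y. ju \<and> b + 1 \<le> y})"
  have clA: "closed A"
  proof -
    have "closed {y. jl \<and> y \<le> a - 1}" by (cases jl) (simp_all add: atMost_def[symmetric])
    moreover have "closed {y. ju \<and> b + 1 \<le> y}" by (cases ju) (simp_all add: atLeast_def[symmetric])
    ultimately show ?thesis unfolding A_def by (intro closed_Un closed_Times closed_sphere)
  qed
  \<comment> \<open>Where the gap between the graphs is wider than 1, it covers a whole
    circle.\<close>
  have full: "cyl (x, y) \<in> ?Q" if y: "jl \<and> y < a \<or> ju \<and> b < y" for x y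
  proof -
    have yJ: "y \<in> J" using y ab unfolding J_def by auto
    have w: "1 < u y - l y" using y wide by blast
    define k where "k = \<lfloor>l y - x\<rfloor> + 1"
    have "l y - x < of_int k" "of_int k \<le> l y - x + 1" unfolding k_def by linarith+
    then have "l y < x + of_int k" "x + of_int k < u y" using w by linarith+
    then have "(x + of_int k, y) \<in> R" unfolding R_def using yJ by simp
    then show ?thesis using cyl_shift[of x k y] by (metis imageI)
  qed
  have eq: "?Q \<union> Bd = cyl ` M \<union> A"
  proof (intro subset_antisym subsetI)
    fix z assume "z \<in> ?Q \<union> Bd"
    then show "z \<in> cyl ` M \<union> A"
    proof
      assume "z \<in> ?Q"
      then obtain x y where z: "z = cyl (x, y)" "y \<in> J" "l y < x" "x < u y" unfolding R_def by auto
      show ?thesis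
      proof (cases "lo \<le> y \<and> y \<le> hi")
        case True
        then have "(x, y) \<in> M" unfolding M_def using z by simp
        then show ?thesis using z(1) by blast
      next
        case False
        then have "jl \<and> y \<le> a - 1 \<or> ju \<and> b + 1 \<le> y" using z(2) unfolding J_def lo_def hi_def by (auto split: if_splits)
        then have "z \<in> A" unfolding A_def z(1) cyl_def by auto
        then show ?thesis by blast
      qed
    next
      assume "z \<in> Bd"
      then obtain y where y: "a \<le> y" "y \<le> b" "z = cyl (l y, y) \<or> z = cyl (u y, y)" unfolding Bd_def by auto
      have "lo \<le> y" "y \<le> hi" using y unfolding lo_def hi_def by auto
      then have "(l y, y) \<in> M" "(u y, y) \<in> M" unfolding M_def using le by auto
      then show ?thesis using y(3) by blast
    qed
  next
    fix z assume "z \<in> cyl ` M \<union> A"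
    then show "z \<in> ?Q \<union> Bd"
    proof
      assume "z \<in> cyl ` M"
      then obtain x y where z: "z = cyl (x, y)" "lo \<le> y" "y \<le> hi" "l y \<le> x" "x \<le> u y" unfolding M_def by auto
      show ?thesis
      proof (cases "jl \<and> y < a \<or> ju \<and> b < y")
        case True then show ?thesis using full z(1) by blast
      next
        case False
        then have yab: "a \<le> y" "y \<le> b" using z(2,3) unfolding lo_def hi_def by (auto split: if_splits)
        show ?thesis
        proof (cases "x = l y \<or> x = u y")
          case True then show ?thesis using z(1) yab unfolding Bd_def by auto
        next
          case F: False
          then have lt: "l y < x" "x < u y" using z by auto
          have "y \<in> J"
          proof (rule ccontr)
            assume "y \<notin> J"
            then have "\<not> jl \<and> y = a \<or> \<not> ju \<and> y = b" using yab unfolding J_def by auto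
            then show False using ends lt by auto
          qed
          then have "(x, y) \<in> R" unfolding R_def using lt by simp
          then show ?thesis using z(1) by blast
        qed
      qed
    next
      assume "z \<in> A"
      then have *: "z \<in> cylinder" "jl \<and> snd z < a \<or> ju \<and> b < snd z" unfolding A_def cylinder_def by auto
      obtain x y where "z = cyl (x, y)" using cylinder_cyl[OF *(1)] .
      then show ?thesis using full[of y x] *(2) by (auto simp: cyl_def)
    qed
  qed
  have clQ: "closed (?Q \<union> Bd)" unfolding eq using clM clA by (rule closed_Un)
  have lim: "(l y, y) \<in> closure R \<and> (u y, y) \<in> closure R" if yJ: "y \<in> J" for y
  proof -
    let ?g = "\<lambda>s. \<phi> (s, y)"
    have "continuous_on UNIV ?g" by (intro continuous_on_compose2[OF c\<phi>[of UNIV]] continuous_intros) simp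
    then have "?g ` closure {0<..<1} \<subseteq> closure (?g ` {0<..<1})"
      by (intro image_closure_subset[OF _ closed_closure closure_subset]) (rule continuous_on_subset, auto)
    also have "\<dots> \<subseteq> closure R" unfolding R\<phi> using yJ by (intro closure_mono) auto
    finally have "?g 0 \<in> closure R" "?g 1 \<in> closure R" by auto
    then show ?thesis by (simp add: \<phi>_def)
  qed
  have clJ: "{a..b} \<subseteq> closure J"
  proof -
    have "{a<..<b} \<subseteq> J" unfolding J_def by auto
    then have "closure {a<..<b} \<subseteq> closure J" by (rule closure_mono)
    then show ?thesis using ab by simp
  qed
  have lim2: "(l y, y) \<in> closure R \<and> (u y, y) \<in> closure R" if y: "y \<in> {a..b}" for y
  proof -
    have cc: "continuous_on (closure J) (\<lambda>y. (l y, y))" "continuous_on (closure J) (\<lambda>y. (u y, y))"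
      by (intro continuous_on_Pair continuous_on_subset[OF cont(1)] continuous_on_subset[OF cont(2)] continuous_on_id; simp)+
    have "(\<lambda>y. (l y, y)) ` closure J \<subseteq> closure R" "(\<lambda>y. (u y, y)) ` closure J \<subseteq> closure R"
      by (rule image_closure_subset[OF cc(1) closed_closure], use lim in blast)
         (rule image_closure_subset[OF cc(2) closed_closure], use lim in blast)
    then show ?thesis using clJ y by blast
  qed
  have BdQ: "Bd \<subseteq> closure ?Q"
  proof -
    have "cyl ` closure R \<subseteq> closure ?Q"
      by (intro image_closure_subset[OF continuous_on_cyl closed_closure closure_subset])
    then show ?thesis unfolding Bd_def using lim2 by blast
  qed
  have cloQ: "closure ?Q = ?Q \<union> Bd"
    using clQ BdQ closure_subset[of ?Q] by (intro subset_antisym closure_minimal) auto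
  have Fsub: "F \<subseteq> cylinder - D" "connected F" using in_components_subset[OF F(1)] in_components_connected[OF F(1)] by auto
  have "?Q \<subseteq> F" using components_maximal[OF F(1) cQ Qsub] F(2) by blast
  \<comment> \<open>\<open>?Q\<close> is open in \<open>F\<close>, and closed in it because its
    closure adds only points of the drawing.\<close>
  moreover have "F \<subseteq> ?Q"
  proof -
    obtain T where T: "open T" "?Q = cylinder \<inter> T" using oQ by (auto simp: openin_open)
    have "openin (top_of_set F) (F \<inter> ?Q)"
      unfolding openin_open using T Fsub(1) by (intro exI[of _ T]) auto
    moreover have "closedin (top_of_set F) (F \<inter> ?Q)"
      unfolding closedin_closed
    proof (intro exI[of _ "?Q \<union> Bd"] conjI clQ)
      show "F \<inter> ?Q = F \<inter> (?Q \<union> Bd)" using D(2) Fsub(1) by blast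
    qed
    ultimately have "F \<inter> ?Q = {} \<or> F \<inter> ?Q = F" using Fsub(2) unfolding connected_clopen by blast
    then show ?thesis using F(2) by blast
  qed
  ultimately have FQ: "F = ?Q" by blast
  have "Bd \<inter> ?Q = {}" using D by blast
  then show ?thesis unfolding FQ cloQ by blast
qed

lemma int_switch:
  fixes Pr :: "int \<Rightarrow> bool"
  assumes "Pr s" "\<not> Pr s'" "s \<le> s'" shows "\<exists>t. Pr t \<and> \<not> Pr (t + 1)"
proof (rule ccontr)
  assume n: "\<not> ?thesis"
  have "Pr t" if "s \<le> t" for t using that
  proof (induction t rule: int_ge_induct)
    case base show ?case by (rule assms(1))
  next
    case (step t) then show ?case using n by blast
  qed
  then show False using assms by blast
qed

lemma periodic_int:
  fixes f :: "int \<Rightarrow> 'a::ring_1"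
  assumes "\<And>t. f (t + N) = f t + c" shows "f (t + k * N) = f t + of_int k * c"
proof (induction k rule: int_induct[where k = 0])
  case (step1 i)
  then show ?case using assms[of "t + i * N"] by (simp add: algebra_simps)
next
  case (step2 i)
  then show ?case using assms[of "t + (i - 1) * N"] by (simp add: algebra_simps)
qed simp

lemma glued_graph:
  fixes c m d :: real and f g :: "real \<Rightarrow> 'b"
  defines "h \<equiv> \<lambda>y. if y \<le> m then f y else g y"
  assumes "c \<le> m" "m \<le> d" "f m = g m"
  shows "(\<lambda>y. (h y, y)) ` {c..d} = (\<lambda>y. (f y, y)) ` {c..m} \<union> (\<lambda>y. (g y, y)) ` {m..d}"
proof (intro subset_antisym subsetI)
  fix z assume "z \<in> (\<lambda>y. (h y, y)) ` {c..d}"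
  then obtain y where y: "c \<le> y" "y \<le> d" "z = (h y, y)" by auto
  show "z \<in> (\<lambda>y. (f y, y)) ` {c..m} \<union> (\<lambda>y. (g y, y)) ` {m..d}"
  proof (cases "y \<le> m")
    case True then have "z = (f y, y)" "y \<in> {c..m}" using y unfolding h_def by auto
    then show ?thesis by blast
  next
    case False then have "z = (g y, y)" "y \<in> {m..d}" using y unfolding h_def by auto
    then show ?thesis by blast
  qed
next
  fix z assume "z \<in> (\<lambda>y. (f y, y)) ` {c..m} \<union> (\<lambda>y. (g y, y)) ` {m..d}"
  then show "z \<in> (\<lambda>y. (h y, y)) ` {c..d}"
  proof
    assume "z \<in> (\<lambda>y. (f y, y)) ` {c..m}"
    then obtain y where y: "c \<le> y" "y \<le> m" "z = (f y, y)" by auto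
    then have "z = (h y, y)" "y \<in> {c..d}" using assms unfolding h_def by auto
    then show ?thesis by blast
  next
    assume "z \<in> (\<lambda>y. (g y, y)) ` {m..d}"
    then obtain y where y: "m \<le> y" "y \<le> d" "z = (g y, y)" by auto
    have "h y = g y" using y assms(4) unfolding h_def by (cases "y = m") auto
    then have "z = (h y, y)" "y \<in> {c..d}" using y assms(2) by auto
    then show ?thesis by blast
  qed
qed

lemma int_between: assumes "1 < b - (a::real)" shows "\<exists>k::int. a < x + of_int k \<and> x + of_int k < b"
proof -
  let ?k = "\<lfloor>a - x\<rfloor> + 1"
  have "a - x < of_int ?k" "of_int ?k \<le> a - x + 1" by linarith+
  then show ?thesis using assms by (intro exI[of _ ?k]) linarith
qed

section \<open>Constructing a rhombic strip from lattice paths\<close>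

text \<open>The cells of rank \<open>r\<close> are placed at equal distances on the circle at height \<open>r\<close>, and
  \<open>cell r j\<close> is the one at abscissa \<open>j / cnt r\<close>. The edges between the heights \<open>r\<close> and \<open>r + 1\<close> are given
  by the monotone lattice path \<open>t \<mapsto> (p r t, q r t)\<close>, whose entries are the indices of the two end points.\<close>

locale lattice_strip =
  fixes P :: "'a set" and K :: "'a set set" and \<rho> :: "'a \<Rightarrow> int" and cell :: "int \<Rightarrow> int \<Rightarrow> 'a"
    and cnt :: "int \<Rightarrow> int" and p q :: "int \<Rightarrow> int \<Rightarrow> int" and per :: "int \<Rightarrow> int"
  assumes cell: "r \<in> {-1..3} \<Longrightarrow> cell r j \<in> P \<and> \<rho> (cell r j) = r"
    and cell_surj: "x \<in> P \<Longrightarrow> \<exists>r\<in>{-1..3}. \<exists>j. x = cell r j"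
    and cell_eq: "r \<in> {-1..3} \<Longrightarrow> cell r i = cell r j \<longleftrightarrow> (\<exists>k. i = j + k * cnt r)"
    and cnt_ends: "cnt (-1) = 1" "cnt 3 = 1"
    and cnt_mid: "r \<in> {0..2} \<Longrightarrow> 2 \<le> cnt r"
    and strand: "r \<in> {-1..2} \<Longrightarrow> {cell r (p r t), cell (r + 1) (q r t)} \<in> K"
    and per: "r \<in> {-1..2} \<Longrightarrow> 0 < per r"
      "r \<in> {-1..2} \<Longrightarrow> p r (t + per r) = p r t + cnt r"
      "r \<in> {-1..2} \<Longrightarrow> q r (t + per r) = q r t + cnt (r + 1)"
    and steps: "r \<in> {-1..2} \<Longrightarrow> p r (t + 1) - p r t \<in> {0, 1}" "r \<in> {-1..2} \<Longrightarrow> q r (t + 1) - q r t \<in> {0, 1}"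
    and step_mid: "r \<in> {0, 1} \<Longrightarrow> p r (t + 1) = p r t \<or> q r (t + 1) = q r t"
    and step_ends: "q (-1) (t + 1) = q (-1) t + 1" "p 2 (t + 1) = p 2 t + 1"
    and simple: "r \<in> {-1..2} \<Longrightarrow> p r t = p r t' + i * cnt r \<Longrightarrow> q r t = q r t' + j * cnt (r + 1) \<Longrightarrow> i = j"
begin

definition X :: "int \<Rightarrow> int \<Rightarrow> real" where "X r j = of_int j / of_int (cnt r)"

text \<open>Abscissa of the strand \<open>t\<close> at height \<open>y\<close>. The affine formula
  is also used outside the two heights, to bound the regions that reach to infinity.\<close>

definition L :: "int \<Rightarrow> int \<Rightarrow> real \<Rightarrow> real" where
  "L r t y = X r (p r t) + (y - of_int r) * (X (r + 1) (q r t) - X r (p r t))"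

definition strand_edge :: "int \<Rightarrow> int \<Rightarrow> 'a set" where "strand_edge r t = {cell r (p r t), cell (r + 1) (q r t)}"

definition strand_curve :: "int \<Rightarrow> int \<Rightarrow> (complex \<times> real) set" where
  "strand_curve r t = (\<lambda>y. cyl (L r t y, y)) ` {of_int r..of_int r + 1}"

definition G :: "'a set set" where "G = {strand_edge r t | r t. r \<in> {-1..2}}"

definition pos :: "'a \<Rightarrow> complex \<times> real" where
  "pos x = cyl (X (\<rho> x) (SOME j. x = cell (\<rho> x) j), of_int (\<rho> x))"

text \<open>Strands that represent the same edge differ by whole turns and have the same curve, so
  the union avoids choosing one of them.\<close>

definition crv :: "'a set \<Rightarrow> (complex \<times> real) set" where
  "crv e = \<Union>{strand_curve r t | r t. r \<in> {-1..2} \<and> e = strand_edge r t}"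

lemma cnt_pos: assumes "r \<in> {-1..3}" shows "0 < cnt r"
proof -
  have "r = -1 \<or> r = 3 \<or> r \<in> {0..2}" using assms by auto
  then show ?thesis using cnt_ends cnt_mid[of r] by auto
qed

lemma X_shift: "r \<in> {-1..3} \<Longrightarrow> X r (j + k * cnt r) = X r j + of_int k"
  using cnt_pos[of r] by (simp add: X_def add_divide_distrib)

lemma X_mono: "r \<in> {-1..3} \<Longrightarrow> X r i \<le> X r j \<longleftrightarrow> i \<le> j"
  using cnt_pos[of r] by (simp add: X_def divide_le_cancel)

lemma X_eq: "r \<in> {-1..3} \<Longrightarrow> X r i = X r j \<longleftrightarrow> i = j"
  using cnt_pos[of r] by (simp add: X_def)

lemma pos_cell: assumes r: "r \<in> {-1..3}" shows "pos (cell r j) = cyl (X r j, of_int r)"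
proof -
  let ?i = "SOME i. cell r j = cell r i"
  have "cell r j = cell r ?i" by (rule someI[of _ j]) simp
  then obtain k where k: "j = ?i + k * cnt r" using cell_eq[OF r] by blast
  have "X r j = X r ?i + of_int k" using X_shift[OF r, of ?i k] k by simp
  moreover have "pos (cell r j) = cyl (X r ?i, of_int r)" unfolding pos_def using cell[OF r, of j] by simp
  ultimately show ?thesis using cyl_shift[of "X r ?i" k] by simp
qed

lemma pos_cell_eq:
  assumes r: "r \<in> {-1..3}" and x: "x \<in> P" "pos x = cyl (X r j, of_int r)" shows "x = cell r j"
proof -
  obtain s i where s: "s \<in> {-1..3}" "x = cell s i" using cell_surj[OF x(1)] by blast
  have e: "cyl (X s i, of_int s) = cyl (X r j, of_int r)" using x(2) pos_cell[OF s(1), of i] s(2) by simp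
  then have sr: "s = r" unfolding cyl_pair_eq by simp
  from e obtain k :: int where "X r j = X r i + of_int k" unfolding cyl_pair_eq sr by blast
  then have "j = i + k * cnt r" using X_shift[OF r, of i k] X_eq[OF r, of j "i + k * cnt r"] by simp
  then have "i = j + (- k) * cnt r" by simp
  then show ?thesis unfolding s(2) sr using cell_eq[OF r] by blast
qed

lemma L_ends: "L r t (of_int r) = X r (p r t)" "L r t (of_int r + 1) = X (r + 1) (q r t)"
  unfolding L_def by simp_all

lemma L_convex: "L r t y = (1 - (y - of_int r)) * X r (p r t) + (y - of_int r) * X (r + 1) (q r t)"
  unfolding L_def by (simp add: algebra_simps)

lemma pq_shift: assumes "r \<in> {-1..2}"
  shows "p r (t + k * per r) = p r t + k * cnt r" "q r (t + k * per r) = q r t + k * cnt (r + 1)"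
  using periodic_int[of "p r" "per r" "cnt r" t k] periodic_int[of "q r" "per r" "cnt (r + 1)" t k] per[OF assms] by simp_all

lemma L_shift: assumes r: "r \<in> {-1..2}" shows "L r (t + k * per r) y = L r t y + of_int k"
proof -
  have r': "r \<in> {-1..3}" "r + 1 \<in> {-1..3}" using r by auto
  show ?thesis unfolding L_convex pq_shift[OF r] X_shift[OF r'(1)] X_shift[OF r'(2)] by (simp add: algebra_simps)
qed

lemma pq_mono: assumes r: "r \<in> {-1..2}" and t: "t \<le> t'" shows "p r t \<le> p r t'" "q r t \<le> q r t'"
proof -
  have "p r t \<le> p r t' \<and> q r t \<le> q r t'" using t
  proof (induction t' rule: int_ge_induct)
    case (step t')
    have "p r t' \<le> p r (t' + 1)" "q r t' \<le> q r (t' + 1)" using steps(1,2)[OF r, of t'] by auto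
    then show ?case using step.IH by linarith
  qed simp
  then show "p r t \<le> p r t'" "q r t \<le> q r t'" by auto
qed

lemma L_mono: assumes r: "r \<in> {-1..2}" and t: "t \<le> t'" and y: "of_int r \<le> y" "y \<le> of_int r + 1"
  shows "L r t y \<le> L r t' y"
proof -
  have r': "r \<in> {-1..3}" "r + 1 \<in> {-1..3}" using r by auto
  have "X r (p r t) \<le> X r (p r t')" "X (r + 1) (q r t) \<le> X (r + 1) (q r t')"
    using pq_mono[OF r t] X_mono[OF r'(1)] X_mono[OF r'(2)] by simp_all
  then show ?thesis unfolding L_convex using y by (intro add_mono mult_left_mono) auto
qed

text \<open>\<open>L\<close> is a convex combination of the two ends with positive weights at inner
  heights, and both ends are monotone in \<open>t\<close>; so equality there forces equality of
  both.\<close>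

lemma L_strict: assumes r: "r \<in> {-1..2}" and t: "t \<le> t'" and y: "of_int r < y" "y < of_int r + 1"
  and eq: "L r t y = L r t' y" shows "p r t = p r t' \<and> q r t = q r t'"
proof -
  have r': "r \<in> {-1..3}" "r + 1 \<in> {-1..3}" using r by auto
  have le: "X r (p r t) \<le> X r (p r t')" "X (r + 1) (q r t) \<le> X (r + 1) (q r t')"
    using pq_mono[OF r t] X_mono[OF r'(1)] X_mono[OF r'(2)] by simp_all
  have a: "(1 - (y - of_int r)) * X r (p r t) \<le> (1 - (y - of_int r)) * X r (p r t')"
    "(y - of_int r) * X (r + 1) (q r t) \<le> (y - of_int r) * X (r + 1) (q r t')"
    using le y by (intro mult_left_mono; simp)+
  have "(1 - (y - of_int r)) * X r (p r t) = (1 - (y - of_int r)) * X r (p r t')"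
    "(y - of_int r) * X (r + 1) (q r t) = (y - of_int r) * X (r + 1) (q r t')"
    using eq a unfolding L_convex by linarith+
  then have "X r (p r t) = X r (p r t')" "X (r + 1) (q r t) = X (r + 1) (q r t')" using y by auto
  then show ?thesis using X_eq[OF r'(1)] X_eq[OF r'(2)] by simp
qed

lemma strand_edge_G: "r \<in> {-1..2} \<Longrightarrow> strand_edge r t \<in> G" unfolding G_def by blast

lemma strand_edge_sub: "r \<in> {-1..2} \<Longrightarrow> strand_edge r t \<subseteq> P" unfolding strand_edge_def using cell[of r] cell[of "r + 1"] by auto

text \<open>By the assumption \<open>simple\<close> two strands between the same cells wind equally,
  hence they are translates by whole turns and not two different drawings of one edge.\<close>

lemma strand_edge_eqD:
  assumes r: "r \<in> {-1..2}" "r' \<in> {-1..2}" and eq: "strand_edge r t = strand_edge r' t'"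
  shows "r = r' \<and> (\<exists>k. p r t = p r t' + k * cnt r \<and> q r t = q r t' + k * cnt (r + 1))"
proof -
  have c: "\<rho> (cell s j) = s" if "s \<in> {-1..3}" for s j using cell[OF that] by simp
  have h: "r \<in> {-1..3}" "r + 1 \<in> {-1..3}" "r' \<in> {-1..3}" "r' + 1 \<in> {-1..3}" using r by auto
  from eq have "(cell r (p r t) = cell r' (p r' t') \<and> cell (r + 1) (q r t) = cell (r' + 1) (q r' t'))
    \<or> (cell r (p r t) = cell (r' + 1) (q r' t') \<and> cell (r + 1) (q r t) = cell r' (p r' t'))"
    unfolding strand_edge_def doubleton_eq_iff .
  then have *: "r = r' \<and> cell r (p r t) = cell r (p r t') \<and> cell (r + 1) (q r t) = cell (r + 1) (q r t')"
  proof
    assume a: "cell r (p r t) = cell r' (p r' t') \<and> cell (r + 1) (q r t) = cell (r' + 1) (q r' t')"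
    have "r = r'" using a c[OF h(1), of "p r t"] c[OF h(3), of "p r' t'"] by simp
    then show ?thesis using a by simp
  next
    assume a: "cell r (p r t) = cell (r' + 1) (q r' t') \<and> cell (r + 1) (q r t) = cell r' (p r' t')"
    have "r = r' + 1" using a c[OF h(1), of "p r t"] c[OF h(4), of "q r' t'"] by simp
    moreover have "r + 1 = r'" using a c[OF h(2), of "q r t"] c[OF h(3), of "p r' t'"] by simp
    ultimately show ?thesis by simp
  qed
  obtain i j where ij: "p r t = p r t' + i * cnt r" "q r t = q r t' + j * cnt (r + 1)"
    using * cell_eq[OF h(1)] cell_eq[OF h(2)] by blast
  have "i = j" by (rule simple[OF r(1) ij])
  then show ?thesis using * ij by blast
qed

lemma strand_curve_shift:
  assumes r: "r \<in> {-1..2}" and k: "p r t = p r t' + k * cnt r" "q r t = q r t' + k * cnt (r + 1)"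
  shows "strand_curve r t = strand_curve r t'" "strand_edge r t = strand_edge r t'"
proof -
  have r': "r \<in> {-1..3}" "r + 1 \<in> {-1..3}" using r by auto
  have "L r t y = L r t' y + of_int k" for y
    unfolding L_convex k X_shift[OF r'(1)] X_shift[OF r'(2)] by (simp add: algebra_simps)
  then show "strand_curve r t = strand_curve r t'" unfolding strand_curve_def by (simp add: cyl_shift)
  have "cell r (p r t) = cell r (p r t')" "cell (r + 1) (q r t) = cell (r + 1) (q r t')"
    using k cell_eq[OF r'(1)] cell_eq[OF r'(2)] by blast+
  then show "strand_edge r t = strand_edge r t'" unfolding strand_edge_def by simp
qed

lemma crv_strand_edge: assumes r: "r \<in> {-1..2}" shows "crv (strand_edge r t) = strand_curve r t"
proof -
  have "strand_curve r' t' = strand_curve r t" if r': "r' \<in> {-1..2}" and e: "strand_edge r t = strand_edge r' t'" for r' t'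
  proof -
    obtain k where "r = r'" "p r t = p r t' + k * cnt r" "q r t = q r t' + k * cnt (r + 1)" using strand_edge_eqD[OF r r' e] by blast
    then show ?thesis using strand_curve_shift(1)[OF r] by simp
  qed
  then have "{strand_curve r' t' | r' t'. r' \<in> {-1..2} \<and> strand_edge r t = strand_edge r' t'} = {strand_curve r t}" using r by blast
  then show ?thesis unfolding crv_def by simp
qed

lemma strand_curve_segment:
  "strand_curve r t = cyl ` closed_segment (X r (p r t), of_int r) (X (r + 1) (q r t), of_int r + 1)"
proof -
  have "closed_segment (X r (p r t), of_int r :: real) (X (r + 1) (q r t), of_int r + 1)
     = (\<lambda>s. (L r t (of_int r + s), of_int r + s)) ` {0..1}"
    unfolding closed_segment_image_interval L_def by (intro image_cong refl) (simp add: algebra_simps)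
  moreover have "{of_int r..of_int r + 1 :: real} = (\<lambda>s. of_int r + s) ` {0..1}" by simp
  ultimately show ?thesis unfolding strand_curve_def by (simp add: image_image del: image_add_atLeastAtMost)
qed

lemma strand_curve_vertex:
  assumes r: "r \<in> {-1..2}" and z: "z \<in> strand_curve r t" "z \<in> pos ` P" shows "z \<in> pos ` strand_edge r t"
proof -
  have h: "r \<in> {-1..3}" "r + 1 \<in> {-1..3}" using r by auto
  obtain y where y: "of_int r \<le> y" "y \<le> of_int r + 1" "z = cyl (L r t y, y)" using z(1) unfolding strand_curve_def by auto
  obtain x where x: "x \<in> P" "z = pos x" using z(2) by blast
  obtain s j where s: "s \<in> {-1..3}" "x = cell s j" using cell_surj[OF x(1)] by blast
  have "y = of_int s" using x(2) y(3) pos_cell[OF s(1), of j] s(2) by (simp add: cyl_pair_eq)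
  then have "s = r \<or> s = r + 1" using y(1,2) by linarith
  then show ?thesis
  proof
    assume "s = r"
    then have "z = pos (cell r (p r t))" using y(3) \<open>y = of_int s\<close> L_ends(1)[of r t] pos_cell[OF h(1)] by simp
    then show ?thesis unfolding strand_edge_def by blast
  next
    assume "s = r + 1"
    then have "z = pos (cell (r + 1) (q r t))" using y(3) \<open>y = of_int s\<close> L_ends(2)[of r t] pos_cell[OF h(2)] by simp
    then show ?thesis unfolding strand_edge_def by blast
  qed
qed

lemma strand_edge_strand_curve: assumes r: "r \<in> {-1..2}" shows "pos ` strand_edge r t \<subseteq> strand_curve r t"
proof -
  have h: "r \<in> {-1..3}" "r + 1 \<in> {-1..3}" using r by auto
  have "pos (cell r (p r t)) = cyl (L r t (of_int r), of_int r)" using L_ends(1)[of r t] pos_cell[OF h(1)] by simp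
  moreover have "pos (cell (r + 1) (q r t)) = cyl (L r t (of_int r + 1), of_int r + 1)" using L_ends(2)[of r t] pos_cell[OF h(2)] by simp
  ultimately show ?thesis unfolding strand_edge_def strand_curve_def by auto
qed

text \<open>Two strands through a common inner point can be lifted so as to meet, and
  \<open>L_strict\<close> then identifies them up to whole turns.\<close>

lemma strand_curve_cross:
  assumes r: "r \<in> {-1..2}" "r' \<in> {-1..2}" and z: "z \<in> strand_curve r t" "z \<in> strand_curve r' t'" "z \<notin> pos ` P"
  shows "strand_edge r t = strand_edge r' t'"
proof -
  have h: "r \<in> {-1..3}" "r + 1 \<in> {-1..3}" using r by auto
  obtain y where y: "of_int r \<le> y" "y \<le> of_int r + 1" "z = cyl (L r t y, y)" using z(1) unfolding strand_curve_def by auto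
  obtain y' where y': "of_int r' \<le> y'" "y' \<le> of_int r' + 1" "z = cyl (L r' t' y', y')" using z(2) unfolding strand_curve_def by auto
  have yy: "y' = y" using y(3) y'(3) by (simp add: cyl_pair_eq)
  have "y \<noteq> of_int r"
  proof
    assume "y = of_int r"
    then have "z = pos (cell r (p r t))" using y(3) L_ends(1)[of r t] pos_cell[OF h(1)] by simp
    then show False using z(3) cell[OF h(1)] by blast
  qed
  moreover have "y \<noteq> of_int r + 1"
  proof
    assume "y = of_int r + 1"
    then have "z = pos (cell (r + 1) (q r t))" using y(3) L_ends(2)[of r t] pos_cell[OF h(2)] by simp
    then show False using z(3) cell[OF h(2)] by blast
  qed
  ultimately have yr: "of_int r < y" "y < of_int r + 1" using y(1,2) by auto
  then have rr: "r' = r" using y'(1,2) yy by linarith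
  have "cyl (L r t y, y) = cyl (L r t' y, y)" using y(3) y'(3) yy rr by simp
  then obtain k :: int where "L r t' y = L r t y + of_int k" unfolding cyl_pair_eq by blast
  then have eq: "L r t' y = L r (t + k * per r) y" using L_shift[OF r(1)] by simp
  have "p r t' = p r (t + k * per r) \<and> q r t' = q r (t + k * per r)"
  proof (cases "t' \<le> t + k * per r")
    case True from L_strict[OF r(1) True yr eq] show ?thesis .
  next
    case False
    then have "t + k * per r \<le> t'" by simp
    from L_strict[OF r(1) this yr eq[symmetric]] show ?thesis by simp
  qed
  then have "strand_edge r t' = strand_edge r t" using strand_curve_shift(2)[OF r(1), of t' t k] pq_shift[OF r(1)] by simp
  then show ?thesis using rr by simp
qed

lemma embedding: "straight_cylinder_embedding P G \<rho> pos crv"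
  unfolding straight_cylinder_embedding_def
proof (intro conjI ballI allI impI)
  show "inj_on pos P"
  proof (rule inj_onI)
    fix x x' assume x: "x \<in> P" "x' \<in> P" "pos x = pos x'"
    obtain r j where r: "r \<in> {-1..3}" "x' = cell r j" using cell_surj[OF x(2)] by blast
    then show "x = x'" using pos_cell_eq[OF r(1) x(1), of j] pos_cell[OF r(1), of j] x(3) by simp
  qed
next
  fix x assume x: "x \<in> P"
  then obtain r j where r: "r \<in> {-1..3}" "x = cell r j" using cell_surj by blast
  show "pos x \<in> cylinder" "snd (pos x) = of_int (\<rho> x)"
    unfolding pos_def by (simp_all add: cyl_range) (simp add: cyl_def)
next
  fix x y assume g: "{x, y} \<in> G"
  then obtain r t where r: "r \<in> {-1..2}" "{x, y} = strand_edge r t" unfolding G_def by blast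
  have h: "r \<in> {-1..3}" "r + 1 \<in> {-1..3}" using r by auto
  let ?a = "(X r (p r t), of_int r :: real)" and ?b = "(X (r + 1) (q r t), of_int r + 1 :: real)"
  have c: "crv {x, y} = cyl ` closed_segment ?a ?b" unfolding r(2) crv_strand_edge[OF r(1)] strand_curve_segment ..
  have ab: "cyl ?a = pos (cell r (p r t))" "cyl ?b = pos (cell (r + 1) (q r t))" using pos_cell[OF h(1)] pos_cell[OF h(2)] by simp_all
  have "x = cell r (p r t) \<and> y = cell (r + 1) (q r t) \<or> x = cell (r + 1) (q r t) \<and> y = cell r (p r t)"
    using r(2) unfolding strand_edge_def doubleton_eq_iff .
  then show "straight_segment (pos x) (pos y) (crv {x, y})"
  proof
    assume "x = cell r (p r t) \<and> y = cell (r + 1) (q r t)"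
    then show ?thesis unfolding straight_segment_def using c ab by blast
  next
    assume e: "x = cell (r + 1) (q r t) \<and> y = cell r (p r t)"
    have "crv {x, y} = cyl ` closed_segment ?b ?a" using c by (simp add: closed_segment_commute)
    then show ?thesis unfolding straight_segment_def using e ab by blast
  qed
next
  fix e assume "e \<in> G"
  then obtain r t where r: "r \<in> {-1..2}" "e = strand_edge r t" unfolding G_def by blast
  show "crv e \<inter> pos ` P = pos ` e"
    unfolding r(2) crv_strand_edge[OF r(1)] using strand_curve_vertex[OF r(1)] strand_edge_strand_curve[OF r(1)] strand_edge_sub[OF r(1)] by blast
next
  fix e e' assume "e \<in> G" "e' \<in> G" and ne: "e \<noteq> e'"
  then obtain r t r' t' where r: "r \<in> {-1..2}" "e = strand_edge r t" "r' \<in> {-1..2}" "e' = strand_edge r' t'" unfolding G_def by blast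
  show "crv e \<inter> crv e' = pos ` (e \<inter> e')"
  proof (intro subset_antisym subsetI)
    fix z assume "z \<in> crv e \<inter> crv e'"
    then have z: "z \<in> strand_curve r t" "z \<in> strand_curve r' t'" using crv_strand_edge r by auto
    have "z \<in> pos ` P" using strand_curve_cross[OF r(1,3) z] ne r by blast
    then obtain x where x: "x \<in> P" "z = pos x" by blast
    have inj: "a = x" if "a \<in> P" "pos a = pos x" for a
    proof -
      obtain s j where s: "s \<in> {-1..3}" "x = cell s j" using cell_surj[OF x(1)] by blast
      then show ?thesis using pos_cell_eq[OF s(1) that(1), of j] pos_cell[OF s(1), of j] that(2) by simp
    qed
    have "pos x \<in> pos ` e" "pos x \<in> pos ` e'"
      using strand_curve_vertex[OF r(1) z(1)] strand_curve_vertex[OF r(3) z(2)] x r(2,4) by auto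
    then have "x \<in> e" "x \<in> e'" using inj strand_edge_sub[OF r(1), of t] strand_edge_sub[OF r(3), of t'] r(2,4) by (smt (verit) imageE subsetD)+
    then show "z \<in> pos ` (e \<inter> e')" using x(2) by blast
  next
    fix z assume "z \<in> pos ` (e \<inter> e')"
    then have "z \<in> pos ` e" "z \<in> pos ` e'" by auto
    then show "z \<in> crv e \<inter> crv e'" using strand_edge_strand_curve[OF r(1)] strand_edge_strand_curve[OF r(3)] crv_strand_edge[OF r(1)] crv_strand_edge[OF r(3)] r(2,4) by blast
  qed
qed

lemma G_sub: "G \<subseteq> K" unfolding G_def strand_edge_def using strand by blast

lemma p_switch: assumes r: "r \<in> {-1..2}" shows "\<exists>t. p r t = j \<and> p r (t + 1) = j + 1"
proof -
  have c: "0 < cnt r" using cnt_pos[of r] r by auto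
  \<comment> \<open>Each turn advances the index by \<open>cnt r\<close> and thus by at least 1, so
    this many turns backward and forward enclose \<open>j\<close>.\<close>
  let ?k = "\<bar>j - p r 0\<bar> + 1"
  have m: "?k * 1 \<le> ?k * cnt r" using c by (intro mult_left_mono) auto
  have s: "p r (0 + (- ?k) * per r) \<le> j" unfolding pq_shift(1)[OF r] using m by (simp add: algebra_simps abs_if split: if_splits)
  have s': "\<not> p r (0 + ?k * per r) \<le> j" unfolding pq_shift(1)[OF r] using m by (simp add: algebra_simps abs_if split: if_splits)
  have "(- ?k) * per r \<le> 0" "0 \<le> ?k * per r" using per(1)[OF r] by (simp_all add: mult_nonpos_nonneg)
  then have "0 + (- ?k) * per r \<le> 0 + ?k * per r" by linarith
  from int_switch[of "\<lambda>t. p r t \<le> j", OF s s' this] obtain t where t: "p r t \<le> j" "\<not> p r (t + 1) \<le> j" by blast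
  have "p r (t + 1) = p r t \<or> p r (t + 1) = p r t + 1" using steps(1)[OF r, of t] by auto
  then show ?thesis using t by (intro exI[of _ t]) linarith
qed

lemma q_switch: assumes r: "r \<in> {-1..2}" shows "\<exists>t. q r t = j \<and> q r (t + 1) = j + 1"
proof -
  have c: "0 < cnt (r + 1)" using cnt_pos[of "r + 1"] r by auto
  let ?k = "\<bar>j - q r 0\<bar> + 1"
  have m: "?k * 1 \<le> ?k * cnt (r + 1)" using c by (intro mult_left_mono) auto
  have s: "q r (0 + (- ?k) * per r) \<le> j" unfolding pq_shift(2)[OF r] using m by (simp add: algebra_simps abs_if split: if_splits)
  have s': "\<not> q r (0 + ?k * per r) \<le> j" unfolding pq_shift(2)[OF r] using m by (simp add: algebra_simps abs_if split: if_splits)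
  have "(- ?k) * per r \<le> 0" "0 \<le> ?k * per r" using per(1)[OF r] by (simp_all add: mult_nonpos_nonneg)
  then have "0 + (- ?k) * per r \<le> 0 + ?k * per r" by linarith
  from int_switch[of "\<lambda>t. q r t \<le> j", OF s s' this] obtain t where t: "q r t \<le> j" "\<not> q r (t + 1) \<le> j" by blast
  have "q r (t + 1) = q r t \<or> q r (t + 1) = q r t + 1" using steps(2)[OF r, of t] by auto
  then show ?thesis using t by (intro exI[of _ t]) linarith
qed

lemma drawing_eq: "pos ` P \<union> (\<Union>e\<in>G. crv e) = \<Union>{strand_curve r t | r t. r \<in> {-1..2}}"
proof (intro subset_antisym subsetI)
  fix z assume "z \<in> pos ` P \<union> (\<Union>e\<in>G. crv e)"
  then consider x where "x \<in> P" "z = pos x" | e where "e \<in> G" "z \<in> crv e" by blast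
  then show "z \<in> \<Union>{strand_curve r t | r t. r \<in> {-1..2}}"
  proof cases
    case (1 x)
    then obtain s j where s: "s \<in> {-1..3}" "x = cell s j" using cell_surj by blast
    have "\<exists>r\<in>{-1..2}. \<exists>t. x \<in> strand_edge r t"
    proof (cases "s = 3")
      case True
      obtain t where "q 2 t = j" using q_switch[of 2 j] by auto
      then show ?thesis using s(2) True unfolding strand_edge_def by (intro bexI[of _ 2] exI[of _ t]) auto
    next
      case False
      then have sr: "s \<in> {-1..2}" using s(1) by auto
      obtain t where "p s t = j" using p_switch[OF sr, of j] by auto
      then show ?thesis using s(2) sr unfolding strand_edge_def by (intro bexI[of _ s] exI[of _ t]) auto
    qed
    then obtain r t where r: "r \<in> {-1..2}" "x \<in> strand_edge r t" by blast
    have "z \<in> strand_curve r t" using strand_edge_strand_curve[OF r(1)] r(2) 1(2) by blast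
    then show ?thesis using r(1) by blast
  next
    case (2 e)
    then obtain r t where r: "r \<in> {-1..2}" "e = strand_edge r t" unfolding G_def by blast
    then show ?thesis using 2(2) crv_strand_edge[OF r(1), of t] by auto
  qed
next
  fix z assume "z \<in> \<Union>{strand_curve r t | r t. r \<in> {-1..2}}"
  then obtain r t where r: "r \<in> {-1..2}" "z \<in> strand_curve r t" by blast
  then show "z \<in> pos ` P \<union> (\<Union>e\<in>G. crv e)" using crv_strand_edge[OF r(1), of t] strand_edge_G[OF r(1), of t] by blast
qed

lemma no_strand_between:
  assumes r: "r \<in> {-1..2}" and y: "of_int r \<le> y" "y \<le> of_int r + 1"
    and x: "L r t y < L r t'' y + of_int k" "L r t'' y + of_int k < L r (t + 1) y"
  shows False
proof -
  let ?w = "t'' + k * per r"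
  have e: "L r ?w y = L r t'' y + of_int k" by (rule L_shift[OF r])
  show False
  proof (cases "?w \<le> t")
    case True from L_mono[OF r True y] show False using x e by linarith
  next
    case False
    then have "t + 1 \<le> ?w" by simp
    from L_mono[OF r this y] show False using x e by linarith
  qed
qed

lemma strand_curve_image: "r \<in> {-1..2} \<Longrightarrow> of_int r \<le> y \<Longrightarrow> y \<le> of_int r + 1 \<Longrightarrow> cyl (L r t y, y) \<in> strand_curve r t"
  unfolding strand_curve_def by (rule image_eqI[of _ _ y]) simp_all

lemma cont_L: "continuous_on A (L r t)" unfolding L_def by (intro continuous_intros)

lemma cont_glued: "L r t m = L r' t' m \<Longrightarrow> continuous_on UNIV (\<lambda>y. if y \<le> m then L r t y else L r' t' y)"
proof -
  assume e: "L r t m = L r' t' m"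
  have "continuous_on ({..m} \<union> {m..}) (\<lambda>y. if y \<le> m then L r t y else L r' t' y)"
    by (rule continuous_on_If) (use e in \<open>auto intro: cont_L\<close>)
  moreover have "{..m} \<union> {m..} = UNIV" by auto
  ultimately show ?thesis by simp
qed

text \<open>The gap between two neighbouring cells on level \<open>s\<close> is bounded by two
  successive strands below and two above. Usually the strands of a pair meet again one level on, and
  the four form a rhombus. The pair below level 0 whose lower ends are successive lifts of the only
  cell on level -1 (\<open>jl\<close>), and likewise such a pair at the top (\<open>ju\<close>),
  does not meet; its region is an unbounded face, whose boundary is still a rhombus because the two
  lifts are the same point of the cylinder.\<close>

lemma gap_face:
  fixes s t t' :: int and x y :: real
  defines "jl \<equiv> p (s - 1) (t + 1) \<noteq> p (s - 1) t" and "ju \<equiv> q s (t' + 1) \<noteq> q s t'"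
  defines "l \<equiv> \<lambda>y. if y \<le> of_int s then L (s - 1) t y else L s t' y"
    and "u \<equiv> \<lambda>y. if y \<le> of_int s then L (s - 1) (t + 1) y else L s (t' + 1) y"
  assumes s: "s \<in> {0..2}" and t: "q (s - 1) (t + 1) = q (s - 1) t + 1"
    and t': "p s t' = q (s - 1) t" "p s (t' + 1) = p s t' + 1"
    and F: "F \<in> components (cylinder - \<Union>{strand_curve r t | r t. r \<in> {-1..2}})" "cyl (x, y) \<in> F"
    and xy: "\<not> jl \<Longrightarrow> of_int s - 1 < y" "\<not> ju \<Longrightarrow> y < of_int s + 1" "l y < x" "x < u y"
  shows "rhombic_face G \<rho> crv F"
proof -
  let ?D = "\<Union>{strand_curve r t | r t. r \<in> {-1..2}}"
  have s1: "s \<in> {-1..2}" "s - 1 \<in> {-1..2}" "s \<in> {-1..3}" "s - 1 \<in> {-1..3}" "s + 1 \<in> {-1..3}" "s - 1 + 1 = s" using s by auto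
  have jl0: "s = 0" if jl
  proof (rule ccontr)
    assume "s \<noteq> 0"
    then have "s - 1 \<in> {0, 1}" using s by auto
    from step_mid[OF this, of t] show False using t that unfolding jl_def by auto
  qed
  have ju2: "s = 2" if ju
  proof (rule ccontr)
    assume "s \<noteq> 2"
    then have "s \<in> {0, 1}" using s by auto
    from step_mid[OF this, of t'] show False using t' that unfolding ju_def by auto
  qed
  have pl: "p (s - 1) (t + 1) = p (s - 1) t + (if jl then 1 else 0)" using steps(1)[OF s1(2), of t] unfolding jl_def by auto
  have qu: "q s (t' + 1) = q s t' + (if ju then 1 else 0)" using steps(2)[OF s1(1), of t'] unfolding ju_def by auto
  have n2: "2 \<le> cnt s" using cnt_mid[OF s] .
  \<comment> \<open>Distance of neighbouring cells on level \<open>s\<close>. Being smaller than 1,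
    it makes an unbounded region wider than 1 beyond its last level.\<close>
  define w where "w = 1 / (of_int (cnt s) :: real)"
  have w: "0 < w" "w \<le> 1/2" unfolding w_def using n2 by (auto simp: field_simps)
  have dX: "X s (j + 1) = X s j + w" for j unfolding X_def w_def by (simp add: add_divide_distrib)
  have dL: "L (s - 1) (t + 1) y - L (s - 1) t y = (y - (of_int s - 1)) * w + (if jl then of_int s - y else 0)" for y
  proof -
    have "X (s - 1) (p (s - 1) (t + 1)) = X (s - 1) (p (s - 1) t) + (if jl then 1 else 0)"
      using pl jl0 cnt_ends(1) by (auto simp: X_def)
    then show ?thesis unfolding L_convex s1(6) t dX by (simp add: algebra_simps)
  qed
  have dU: "L s (t' + 1) y - L s t' y = (of_int s + 1 - y) * w + (if ju then y - of_int s else 0)" for y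
  proof -
    have "X (s + 1) (q s (t' + 1)) = X (s + 1) (q s t') + (if ju then 1 else 0)"
      using qu ju2 cnt_ends(2) by (auto simp: X_def)
    then show ?thesis unfolding L_convex t'(2) dX by (simp add: algebra_simps)
  qed
  have Ls: "L (s - 1) t (of_int s) = L s t' (of_int s)" "L (s - 1) (t + 1) (of_int s) = L s (t' + 1) (of_int s)"
    using L_ends(2)[of "s - 1" t] L_ends(2)[of "s - 1" "t + 1"] L_ends(1)[of s t'] L_ends(1)[of s "t' + 1"] t t' by simp_all
  define J where "J = {y :: real. (\<not> jl \<longrightarrow> of_int s - 1 < y) \<and> (\<not> ju \<longrightarrow> y < of_int s + 1)}"
  define R where "R = {(x :: real, y :: real). y \<in> J \<and> l y < x \<and> x < u y}"
  define Bd where "Bd = cyl ` ((\<lambda>y. (l y, y)) ` {of_int s - 1..of_int s + 1} \<union> (\<lambda>y. (u y, y)) ` {of_int s - 1..of_int s + 1})"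
  have lu: "l y < u y" if "y \<in> J" for y
  proof (cases "y \<le> of_int s")
    case True
    have "0 < (y - (of_int s - 1)) * w + (if jl then of_int s - y else 0)"
    proof (cases jl)
      case False
      then show ?thesis using that w unfolding J_def by simp
    next
      case jl: True
      have "(y - of_int s) * w \<ge> (y - of_int s) * 1" using True w by (intro mult_left_mono_neg) auto
      then show ?thesis using jl w by (simp add: algebra_simps)
    qed
    then show ?thesis using dL[of y] True unfolding l_def u_def by simp
  next
    case False
    have "0 < (of_int s + 1 - y) * w + (if ju then y - of_int s else 0)"
    proof (cases ju)
      case ju: False
      then show ?thesis using that w unfolding J_def by simp
    next
      case ju: True
      have "(of_int s - y) * w \<ge> (of_int s - y) * 1" using False w by (intro mult_left_mono_neg) auto
      then show ?thesis using ju w by (simp add: algebra_simps)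
    qed
    then show ?thesis using dU[of y] False unfolding l_def u_def by simp
  qed
  have Bd: "Bd = strand_curve (s - 1) t \<union> strand_curve s t' \<union> (strand_curve (s - 1) (t + 1) \<union> strand_curve s (t' + 1))"
  proof -
    have "(\<lambda>y. (l y, y)) ` {of_int s - 1..of_int s + 1}
      = (\<lambda>y. (L (s - 1) t y, y)) ` {of_int s - 1..of_int s} \<union> (\<lambda>y. (L s t' y, y)) ` {of_int s..of_int s + 1}"
      unfolding l_def by (rule glued_graph) (use Ls in auto)
    moreover have "(\<lambda>y. (u y, y)) ` {of_int s - 1..of_int s + 1}
      = (\<lambda>y. (L (s - 1) (t + 1) y, y)) ` {of_int s - 1..of_int s} \<union> (\<lambda>y. (L s (t' + 1) y, y)) ` {of_int s..of_int s + 1}"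
      unfolding u_def by (rule glued_graph) (use Ls in auto)
    ultimately show ?thesis unfolding Bd_def strand_curve_def by (simp add: image_Un image_image)
  qed
  \<comment> \<open>No strand runs between two successive ones, and by \<open>jl0\<close> and
    \<open>ju2\<close> the region leaves the two strips next to level \<open>s\<close> only below
    level -1 or above level 3, where nothing is drawn.\<close>
  have disj: "cyl ` R \<inter> ?D = {}"
  proof (rule ccontr)
    assume "cyl ` R \<inter> ?D \<noteq> {}"
    then obtain x y r t'' where a: "y \<in> J" "l y < x" "x < u y" "r \<in> {-1..2}" "cyl (x, y) \<in> strand_curve r t''" unfolding R_def by blast
    from a(5) obtain y' where "of_int r \<le> y'" "y' \<le> of_int r + 1" "cyl (L r t'' y', y') = cyl (x, y)" unfolding strand_curve_def by auto
    moreover from this(3) have "y' = y" unfolding cyl_pair_eq by blast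
    ultimately have y: "of_int r \<le> y" "y \<le> of_int r + 1" and e: "cyl (L r t'' y, y) = cyl (x, y)" by simp_all
    from e obtain k :: int where k: "x = L r t'' y + of_int k" unfolding cyl_pair_eq by blast
    have "r \<noteq> s - 2"
    proof
      assume "r = s - 2"
      then have "y \<le> of_int s - 1" using y by simp
      then have jl using a(1) unfolding J_def by auto
      then show False using jl0 \<open>r = s - 2\<close> a(4) by simp
    qed
    moreover have "r \<noteq> s + 1"
    proof
      assume "r = s + 1"
      then have "of_int s + 1 \<le> y" using y by simp
      then have ju using a(1) unfolding J_def by auto
      then show False using ju2 \<open>r = s + 1\<close> a(4) by simp
    qed
    moreover have "s - 2 \<le> r"
    proof (cases jl)
      case True then show ?thesis using jl0 a(4) by simp
    next
      case False
      then have "real_of_int (s - 2) \<le> real_of_int r" using a(1) y(2) unfolding J_def by simp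
      then show ?thesis by simp
    qed
    moreover have "r \<le> s + 1"
    proof (cases ju)
      case True then show ?thesis using ju2 a(4) by simp
    next
      case False
      then have "real_of_int r \<le> real_of_int (s + 1)" using a(1) y(1) unfolding J_def by simp
      then show ?thesis by simp
    qed
    ultimately have "r = s - 1 \<or> r = s" by linarith
    then show False
    proof
      assume r: "r = s - 1"
      then have "y \<le> of_int s" using y by simp
      then show False using no_strand_between[OF a(4) y, of t t'' k] a(2,3) k r unfolding l_def u_def by simp
    next
      assume r: "r = s"
      have "l y = L s t' y" "u y = L s (t' + 1) y" using y r Ls unfolding l_def u_def by (cases "y = of_int s"; simp)+
      then show False using no_strand_between[OF a(4) y, of t' t'' k] a(2,3) k r by simp
    qed
  qed
  have cl: "closure F - F = Bd"
    unfolding Bd_def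
  proof (rule face_between_graphs[where jl = jl and ju = ju and D = ?D])
    show "of_int s - 1 < of_int s + (1::real)" by simp
    show "continuous_on UNIV l" "continuous_on UNIV u" unfolding l_def u_def by (rule cont_glued[OF Ls(1)], rule cont_glued[OF Ls(2)])
    show "l y < u y" if "y \<in> {y. (\<not> jl \<longrightarrow> of_int s - 1 < y) \<and> (\<not> ju \<longrightarrow> y < of_int s + 1)}" for y
      using lu[of y] that unfolding J_def .
    show "l (of_int s - 1) = u (of_int s - 1)" if "\<not> jl" using dL[of "of_int s - 1"] that unfolding l_def u_def by simp
    show "l (of_int s + 1) = u (of_int s + 1)" if "\<not> ju" using dU[of "of_int s + 1"] that unfolding l_def u_def by simp
    show "1 < u y - l y" if jl "y < of_int s - 1" for y
    proof -
      obtain c where c: "c = y - (of_int s - 1)" by simp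
      have "c * 1 < c * w" using that w c by (intro mult_strict_left_mono_neg) auto
      moreover have "u y - l y = c * w + (1 - c)" using dL[of y] that c unfolding l_def u_def by simp
      ultimately show ?thesis by linarith
    qed
    show "1 < u y - l y" if ju "of_int s + 1 < y" for y
    proof -
      obtain c where c: "c = of_int s + 1 - y" by simp
      have "c * 1 < c * w" using that w c by (intro mult_strict_left_mono_neg) auto
      moreover have "u y - l y = c * w + (1 - c)" using dU[of y] that c unfolding l_def u_def by simp
      ultimately show ?thesis by linarith
    qed
    show "cyl ` {(x, y). y \<in> {y. (\<not> jl \<longrightarrow> of_int s - 1 < y) \<and> (\<not> ju \<longrightarrow> y < of_int s + 1)} \<and> l y < x \<and> x < u y} \<inter> ?D = {}"
      using disj unfolding R_def J_def .
    show "cyl ` ((\<lambda>y. (l y, y)) ` {of_int s - 1..of_int s + 1} \<union> (\<lambda>y. (u y, y)) ` {of_int s - 1..of_int s + 1}) \<subseteq> ?D"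
      using Bd s1(1,2) unfolding Bd_def by blast
    show "F \<in> components (cylinder - ?D)" by (rule F(1))
    have "(x, y) \<in> {(x, y). y \<in> {y. (\<not> jl \<longrightarrow> of_int s - 1 < y) \<and> (\<not> ju \<longrightarrow> y < of_int s + 1)} \<and> l y < x \<and> x < u y}"
      using xy by simp
    then show "F \<inter> cyl ` {(x, y). y \<in> {y. (\<not> jl \<longrightarrow> of_int s - 1 < y) \<and> (\<not> ju \<longrightarrow> y < of_int s + 1)} \<and> l y < x \<and> x < u y} \<noteq> {}"
      using F(2) by blast
  qed
  let ?j = "q (s - 1) t"
  let ?a = "cell s ?j" and ?c = "cell s (?j + 1)" and ?b = "cell (s - 1) (p (s - 1) t)" and ?d = "cell (s + 1) (q s t')"
  \<comment> \<open>If the lower indices differ, they are two lifts of the only cell of that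
    level.\<close>
  have b: "cell (s - 1) (p (s - 1) (t + 1)) = ?b"
  proof (cases jl)
    case True
    then have "cnt (s - 1) = 1" using jl0 cnt_ends by simp
    then show ?thesis unfolding cell_eq[OF s1(4)] by (intro exI[of _ "p (s - 1) (t + 1) - p (s - 1) t"]) simp
  qed (simp add: pl)
  have d: "cell (s + 1) (q s (t' + 1)) = ?d"
  proof (cases ju)
    case True
    then have "cnt (s + 1) = 1" using ju2 cnt_ends by simp
    then show ?thesis unfolding cell_eq[OF s1(5)] by (intro exI[of _ "q s (t' + 1) - q s t'"]) simp
  qed (simp add: qu)
  have E: "strand_edge (s - 1) t = {?a, ?b}" "strand_edge (s - 1) (t + 1) = {?b, ?c}" "strand_edge s t' = {?d, ?a}" "strand_edge s (t' + 1) = {?c, ?d}"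
    unfolding strand_edge_def using b d t t' s1(6) by (simp_all add: insert_commute)
  have ac: "?a \<noteq> ?c"
  proof
    assume "?a = ?c"
    then obtain k where "?j = ?j + 1 + k * cnt s" unfolding cell_eq[OF s1(3)] by blast
    then have "cnt s dvd 1" by (metis add.assoc add_cancel_right_right add.inverse_inverse dvd_minus_iff dvd_triv_right eq_neg_iff_add_eq_0)
    then show False using n2 by simp
  qed
  have rk: "\<rho> ?a = s" "\<rho> ?c = s" "\<rho> ?b = s - 1" "\<rho> ?d = s + 1"
    using cell[OF s1(3)] cell[OF s1(4)] cell[OF s1(5)] by simp_all
  have dist: "distinct [?a, ?b, ?c, ?d]"
  proof -
    have ne: "u \<noteq> v" if "\<rho> u \<noteq> \<rho> v" for u v using that by blast
    have "?a \<noteq> ?b" "?a \<noteq> ?d" by (intro ne; simp only: rk; simp)+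
    moreover have "?b \<noteq> ?c" "?b \<noteq> ?d" by (intro ne; simp only: rk; simp)+
    moreover have "?c \<noteq> ?d" by (intro ne; simp only: rk; simp)
    ultimately
    show ?thesis using ac by simp
  qed
  have "{?a, ?b} \<in> G" "{?b, ?c} \<in> G" "{?c, ?d} \<in> G" "{?d, ?a} \<in> G"
    using strand_edge_G[OF s1(2), of t] strand_edge_G[OF s1(2), of "t + 1"] strand_edge_G[OF s1(1), of t'] strand_edge_G[OF s1(1), of "t' + 1"] unfolding E by simp_all
  moreover have "closure F - F = crv {?a, ?b} \<union> crv {?b, ?c} \<union> crv {?c, ?d} \<union> crv {?d, ?a}"
    unfolding cl Bd E(1)[symmetric] E(2)[symmetric] E(3)[symmetric] E(4)[symmetric] crv_strand_edge[OF s1(1)] crv_strand_edge[OF s1(2)] by blast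
  ultimately show ?thesis unfolding rhombic_face_def using dist rk by blast
qed

lemma strands_around:
  assumes r: "r \<in> {-1..2}" and y: "of_int r \<le> y" "y \<le> of_int r + 1"
  shows "\<exists>t. L r t y \<le> x \<and> x < L r (t + 1) y"
proof -
  let ?k = "\<lfloor>x - L r 0 y\<rfloor>"
  have s: "L r (0 + ?k * per r) y \<le> x" unfolding L_shift[OF r] by linarith
  have s': "\<not> L r (0 + (?k + 1) * per r) y \<le> x" unfolding L_shift[OF r] by simp linarith
  have "?k * per r \<le> (?k + 1) * per r" using per(1)[OF r] by (intro mult_right_mono) auto
  then have "0 + ?k * per r \<le> 0 + (?k + 1) * per r" by simp
  from int_switch[of "\<lambda>t. L r t y \<le> x", OF s s' this] obtain t where "L r t y \<le> x" "\<not> L r (t + 1) y \<le> x" by blast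
  then show ?thesis by (intro exI[of _ t]) auto
qed

lemma upper_gap: assumes s: "s \<in> {0..2}" shows "\<exists>t'. p s t' = j \<and> p s (t' + 1) = p s t' + 1"
proof -
  have "s \<in> {-1..2}" using s by auto
  from p_switch[OF this, of j] show ?thesis by auto
qed

lemma lower_gap: assumes s: "s \<in> {0..2}" shows "\<exists>t. q (s - 1) t = j \<and> q (s - 1) (t + 1) = q (s - 1) t + 1"
proof -
  have "s - 1 \<in> {-1..2}" using s by auto
  from q_switch[OF this, of j] show ?thesis by auto
qed

text \<open>A point of the face is located between two successive strands, which single out one of
  the regions of \<open>gap_face\<close>.\<close>

lemma face_rhombic:
  assumes "F \<in> drawing_faces P G pos crv" shows "rhombic_face G \<rho> crv F"
proof -
  let ?D = "\<Union>{strand_curve r t | r t. r \<in> {-1..2}}"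
  have F: "F \<in> components (cylinder - ?D)" using assms unfolding drawing_faces_def drawing_eq .
  obtain z where z: "z \<in> F" using in_components_nonempty[OF F] by blast
  then have zc: "z \<in> cylinder" "z \<notin> ?D" using in_components_subset[OF F] by auto
  obtain x y where xy: "z = cyl (x, y)" using cylinder_cyl[OF zc(1)] .
  note G = gap_face[OF _ _ _ _ F]
  consider "y < -1" | "3 < y" | "-1 \<le> y" "y \<le> 3" by linarith
  then show ?thesis
  proof cases
    case 1
    have m: "(-1::int) \<in> {-1..2}" by simp
    \<comment> \<open>Below the lowest level, strands with successive lifts of the lower end are
      more than 1 apart, so some lift of the point lies between them.\<close>
    obtain t where t: "p (-1) t = 0" "p (-1) (t + 1) = 0 + 1" using p_switch[OF m, of 0] by blast
    have q1: "q (-1) (t + 1) = q (-1) t + 1" by (rule step_ends(1))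
    obtain t' where t': "p 0 t' = q (-1) t" "p 0 (t' + 1) = p 0 t' + 1" using upper_gap[of 0 "q (-1) t"] by auto
    have n2: "2 \<le> cnt 0" by (rule cnt_mid) simp
    have "L (-1) (t + 1) y - L (-1) t y = - y + (y + 1) / of_int (cnt 0)"
      unfolding L_convex X_def t q1 by (simp add: cnt_ends add_divide_distrib algebra_simps)
    moreover have "(y + 1) * 1 < (y + 1) * (1 / of_int (cnt 0))" using 1 n2 by (intro mult_strict_left_mono_neg) auto
    ultimately have "1 < L (-1) (t + 1) y - L (-1) t y" by simp
    then obtain k :: int where k: "L (-1) t y < x + of_int k" "x + of_int k < L (-1) (t + 1) y" using int_between by blast
    show ?thesis
      by (rule G[of 0 t t' "x + of_int k" y]) (use 1 t t' q1 k z xy cyl_shift[of x k y] in \<open>simp_all\<close>)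
  next
    case 2
    have m: "(2::int) \<in> {-1..2}" by simp
    obtain t' where t': "q 2 t' = 0" "q 2 (t' + 1) = 0 + 1" using q_switch[OF m, of 0] by blast
    have p1: "p 2 (t' + 1) = p 2 t' + 1" by (rule step_ends(2))
    obtain t where t: "q 1 t = p 2 t'" "q 1 (t + 1) = q 1 t + 1" using lower_gap[of 2 "p 2 t'"] by auto
    have n2: "2 \<le> cnt 2" by (rule cnt_mid) simp
    have "L 2 (t' + 1) y - L 2 t' y = (y - 2) + (3 - y) / of_int (cnt 2)"
      unfolding L_convex X_def t' p1 by (simp add: cnt_ends add_divide_distrib algebra_simps)
    moreover have "(3 - y) * 1 < (3 - y) * (1 / of_int (cnt 2))" using 2 n2 by (intro mult_strict_left_mono_neg) auto
    ultimately have "1 < L 2 (t' + 1) y - L 2 t' y" by simp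
    then obtain k :: int where k: "L 2 t' y < x + of_int k" "x + of_int k < L 2 (t' + 1) y" using int_between by blast
    show ?thesis
      by (rule G[of 2 t t' "x + of_int k" y]) (use 2 t t' p1 k z xy cyl_shift[of x k y] in \<open>simp_all\<close>)
  next
    case 3
    define r :: int where "r = min 2 \<lfloor>y\<rfloor>"
    have r: "r \<in> {-1..2}" "of_int r \<le> y" "y \<le> of_int r + 1"
    proof -
      have "-1 \<le> \<lfloor>y\<rfloor>" using 3 by linarith
      then show "r \<in> {-1..2}" unfolding r_def by simp
      show "of_int r \<le> y" unfolding r_def by linarith
      show "y \<le> of_int r + 1" unfolding r_def min_def using 3 by (auto split: if_splits; linarith)
    qed
    obtain t where t: "L r t y \<le> x" "x < L r (t + 1) y" using strands_around[OF r] by blast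
    have "L r t y \<noteq> x"
    proof
      assume "L r t y = x"
      then have "z \<in> strand_curve r t" using strand_curve_image[OF r, of t] xy by simp
      then show False using zc(2) r(1) by blast
    qed
    then have lt: "L r t y < x" using t(1) by simp
    have lower: "p r (t + 1) \<noteq> p r t" if "y = of_int r"
    proof
      assume "p r (t + 1) = p r t"
      then show False using lt t(2) L_ends(1)[of r t] L_ends(1)[of r "t + 1"] that by simp
    qed
    have upper: "q r (t + 1) \<noteq> q r t" if "y = of_int r + 1"
    proof
      assume "q r (t + 1) = q r t"
      then show False using lt t(2) L_ends(2)[of r t] L_ends(2)[of r "t + 1"] that by simp
    qed
    show ?thesis
    \<comment> \<open>If the upper index advances, the point lies in the lower half of a rhombus
      around level \<open>r + 1\<close>; otherwise the lower index advances and the point lies in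
      the upper half of one around level \<open>r\<close>. For \<open>r = -1\<close> the upper index
      always advances, for \<open>r = 2\<close> the lower one.\<close>
    proof (cases "r \<le> 1 \<and> q r (t + 1) = q r t + 1")
      case True
      define s where "s = r + 1"
      have s: "s \<in> {0..2}" "s - 1 = r" using True r(1) unfolding s_def by auto
      obtain t' where t': "p s t' = q r t" "p s (t' + 1) = p s t' + 1" using upper_gap[OF s(1), of "q r t"] by blast
      have ys: "y \<le> of_int s" "of_int s - 1 \<le> y" using r(2,3) unfolding s_def by auto
      have low: "of_int s - 1 < y" if "p r (t + 1) = p r t" using lower that r(2) unfolding s_def by force
      show ?thesis
      proof (rule G[of s t t' x y])
        show "s \<in> {0..2}" by (rule s(1))
        show "q (s - 1) (t + 1) = q (s - 1) t + 1" "p s t' = q (s - 1) t" "p s (t' + 1) = p s t' + 1" using True t' s(2) by simp_all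
        show "cyl (x, y) \<in> F" using z xy by simp
        show "of_int s - 1 < y" if "\<not> p (s - 1) (t + 1) \<noteq> p (s - 1) t" using that low s(2) by simp
        show "y < of_int s + 1" using ys by simp
        show "(if y \<le> of_int s then L (s - 1) t y else L s t' y) < x" using ys s(2) lt by simp
        show "x < (if y \<le> of_int s then L (s - 1) (t + 1) y else L s (t' + 1) y)" using ys s(2) t(2) by simp
      qed
    next
      case False
      have dp: "p r (t + 1) = p r t + 1 \<and> 0 \<le> r"
      proof (cases "r = 2")
        case True then show ?thesis using step_ends(2) by simp
      next
        case r2: False
        then have "q r (t + 1) \<noteq> q r t + 1" using False r(1) by auto
        then have qt: "q r (t + 1) = q r t" using steps(2)[OF r(1), of t] by auto
        have "r \<noteq> -1" using qt step_ends(1) by auto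
        moreover have "p r (t + 1) \<noteq> p r t"
        proof
          assume "p r (t + 1) = p r t"
          then have "L r t y = L r (t + 1) y" unfolding L_def qt by simp
          then show False using lt t(2) by simp
        qed
        ultimately show ?thesis using steps(1)[OF r(1), of t] r(1) by auto
      qed
      then have s: "r \<in> {0..2}" using r(1) by auto
      obtain t0 where t0: "q (r - 1) t0 = p r t" "q (r - 1) (t0 + 1) = q (r - 1) t0 + 1" using lower_gap[OF s, of "p r t"] by blast
      have up: "y < of_int r + 1" if "q r (t + 1) = q r t" using upper that r(3) by force
      have yr: "y \<noteq> of_int r \<or> (L (r - 1) t0 y = L r t y \<and> L (r - 1) (t0 + 1) y = L r (t + 1) y)"
        using L_ends(2)[of "r - 1" t0] L_ends(2)[of "r - 1" "t0 + 1"] L_ends(1)[of r t] L_ends(1)[of r "t + 1"] t0 dp by auto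
      show ?thesis
      proof (rule G[of r t0 t x y])
        show "r \<in> {0..2}" by (rule s)
        show "q (r - 1) (t0 + 1) = q (r - 1) t0 + 1" "p r t = q (r - 1) t0" "p r (t + 1) = p r t + 1" using dp t0 by simp_all
        show "cyl (x, y) \<in> F" using z xy by simp
        show "of_int r - 1 < y" using r(2) by simp
        show "y < of_int r + 1" if "\<not> q r (t + 1) \<noteq> q r t" using that up by simp
        show "(if y \<le> of_int r then L (r - 1) t0 y else L r t y) < x" using yr r(2) lt by auto
        show "x < (if y \<le> of_int r then L (r - 1) (t0 + 1) y else L r (t + 1) y)" using yr r(2) t(2) by auto
      qed
    qed
  qed
qed

end

theorem lattice_strip_rhombic:
  assumes "lattice_strip P (cover_graph P le) \<rho> cell cnt p q per" shows "has_rhombic_strip P le \<rho>"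
proof -
  interpret lattice_strip P "cover_graph P le" \<rho> cell cnt p q per by (rule assms)
  show ?thesis unfolding has_rhombic_strip_def using G_sub embedding face_rhombic by blast
qed

section \<open>Counting along a cyclic sequence\<close>

definition hits :: "(nat \<Rightarrow> 'a) \<Rightarrow> 'a set \<Rightarrow> nat \<Rightarrow> nat" where
  "hits x A i = card {j. j < i \<and> x j \<in> A}"

lemma hits_simps: "hits x A 0 = 0" "hits x A (Suc i) = hits x A i + (if x i \<in> A then 1 else 0)"
proof -
  show "hits x A 0 = 0" by (simp add: hits_def)
  have "{j. j < Suc i \<and> x j \<in> A} = (if x i \<in> A then insert i {j. j < i \<and> x j \<in> A} else {j. j < i \<and> x j \<in> A})"
    by (auto simp: less_Suc_eq)
  then show "hits x A (Suc i) = hits x A i + (if x i \<in> A then 1 else 0)" by (simp add: hits_def)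
qed

text \<open>The extension of \<open>hits x A\<close> to all integers for an
  \<open>m\<close>-periodic sequence: each period adds \<open>hits x A m\<close>.\<close>

definition cum :: "nat \<Rightarrow> (nat \<Rightarrow> 'a) \<Rightarrow> 'a set \<Rightarrow> int \<Rightarrow> int" where
  "cum m x A j = (j div int m) * int (hits x A m) + int (hits x A (nat (j mod int m)))"

lemma cum_period: "m > 0 \<Longrightarrow> cum m x A (j + int m) = cum m x A j + int (hits x A m)"
  by (simp add: cum_def algebra_simps)

lemma cum_step:
  assumes m: "m > 0"
  shows "cum m x A (j + 1) = cum m x A j + (if x (nat (j mod int m)) \<in> A then 1 else 0)"
proof -
  define q r where "q = j div int m" and "r = j mod int m"
  have j: "j = q * int m + r" "0 \<le> r" "r < int m" using m by (simp_all add: q_def r_def)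
  have nr: "nat (r + 1) = Suc (nat r)" using j(2) by simp
  show ?thesis
  proof (cases "r + 1 < int m")
    case True
    have "(j + 1) div int m = q" "(j + 1) mod int m = r + 1"
      using int_div_pos_eq[of "j + 1" "int m" q "r + 1"] int_mod_pos_eq[of "j + 1" "int m" q "r + 1"] j True by (simp_all add: algebra_simps)
    then show ?thesis unfolding cum_def q_def[symmetric] r_def[symmetric] nr by (simp add: nr hits_simps)
  next
    case False
    then have r: "r = int m - 1" using j(3) by simp
    have "j + 1 = (q + 1) * int m" using j(1) r by (simp add: algebra_simps)
    then have "(j + 1) div int m = q + 1" "(j + 1) mod int m = 0" using m by simp_all
    moreover have "nat (r + 1) = m" using r by simp
    ultimately show ?thesis unfolding cum_def q_def[symmetric] r_def[symmetric]
      using nr hits_simps(2)[of x A "nat r"] by (simp add: hits_simps(1) algebra_simps)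
  qed
qed

lemma cum_mod: "m > 0 \<Longrightarrow> cum m x A j mod int (hits x A m) = int (hits x A (nat (j mod int m))) mod int (hits x A m)"
  by (simp add: cum_def)

lemma two_step: fixes t :: int
  obtains "t = 2 * (t div 2)" "(t + 1) div 2 = t div 2" "(t + 1) mod 2 = 1" "t mod 2 = 0"
  | "t = 2 * (t div 2) + 1" "(t + 1) div 2 = t div 2 + 1" "(t + 1) mod 2 = 0" "t mod 2 = 1"
proof (cases "even t")
  case True
  then obtain k where "t = 2 * k" by (rule evenE)
  then show ?thesis using that(1) by simp
next
  case False
  then obtain k where "t = 2 * k + 1" by (rule oddE)
  then show ?thesis using that(2) by simp
qed

lemma div_step: assumes "0 < (c :: int)" shows "(t + 1) div c - t div c \<in> {0, 1}"
proof -
  have "t div c \<le> (t + 1) div c" using assms by (intro zdiv_mono1) auto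
  moreover have "(t + 1) div c \<le> (t + c) div c" using assms by (intro zdiv_mono1) auto
  moreover have "(t + c) div c = t div c + 1" using assms by simp
  ultimately show ?thesis by auto
qed

lemma mod_eq_shift: assumes "0 < (c :: int)" shows "i mod c = j mod c \<longleftrightarrow> (\<exists>k. i = j + k * c)"
proof
  assume "i mod c = j mod c"
  then have "c dvd i - j" by (simp add: mod_eq_dvd_iff)
  then obtain k where "i - j = c * k" by (elim dvdE)
  then have "i = j + k * c" by (simp add: algebra_simps)
  then show "\<exists>k. i = j + k * c" ..
next
  assume "\<exists>k. i = j + k * c"
  then show "i mod c = j mod c" by auto
qed

section \<open>Cover relations between cells\<close>

context
  fixes V :: "complex set" and E :: "complex set set"
  assumes pg: "plane_graph V E" and two: "\<exists>f\<in>plane_faces V E. \<exists>g\<in>plane_faces V E. f \<noteq> g"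
begin

text \<open>With two faces the closure of a face is not the whole plane, so \<open>Top_cell\<close>
  is below no other cell.\<close>

lemma cell_not_UNIV:
  assumes "y \<in> plane_cells V E" "y \<noteq> Top_cell" shows "cell_points y \<noteq> UNIV"
proof (cases y)
  case Bot_cell then show ?thesis by simp
next
  case (Vertex_cell v)
  then show ?thesis by (metis cell_points.simps(2) infinite_UNIV_char_0 finite.emptyI finite.insertI)
next
  case (Edge_cell e)
  then have "e \<in> E" using assms(1) unfolding plane_cells_def by auto
  then have "\<exists>g. arc g \<and> path_image g = e \<and> e \<inter> V = {pathstart g, pathfinish g}" using pg unfolding plane_graph_def by simp
  then obtain g where "arc g" "path_image g = e" by (elim exE conjE)
  then have "compact e" using compact_arc_image[of g] by simp
  then show ?thesis using Edge_cell not_compact_UNIV by auto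
next
  case (Face_cell f)
  then have f: "f \<in> plane_faces V E" using assms(1) unfolding plane_cells_def by auto
  show ?thesis
  proof
    assume "cell_points y = UNIV"
    then have "closure g \<subseteq> closure f" for g using Face_cell by simp
    then have "g = f" if "g \<in> plane_faces V E" for g using face_closure_eq[OF pg that f] by simp
    then show False using two by metis
  qed
next
  case Top_cell then show ?thesis using assms by simp
qed

text \<open>Ranks strictly increase along the order, so no cell fits between ranks that differ by
  1.\<close>

lemma cover_rank_Suc:
  assumes x: "x \<in> plane_cells V E" and y: "y \<in> plane_cells V E" and le: "cell_le x y" and rk: "cell_rank y = cell_rank x + 1"
  shows "{x, y} \<in> cover_graph (plane_cells V E) cell_le"
proof -
  have ne: "x \<noteq> y" using rk by auto
  have "z = x \<or> z = y" if z: "z \<in> plane_cells V E" "cell_le x z" "cell_le z y" for z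
  proof (rule ccontr)
    assume nz: "\<not> (z = x \<or> z = y)"
    have xT: "x \<noteq> Top_cell"
    proof
      assume "x = Top_cell"
      then have "cell_points y = UNIV" using le unfolding cell_le_def by auto
      then show False using cell_not_UNIV[OF y] ne \<open>x = Top_cell\<close> by auto
    qed
    have zT: "z \<noteq> Top_cell"
    proof
      assume "z = Top_cell"
      then have "cell_points y = UNIV" using z(3) unfolding cell_le_def by auto
      then show False using cell_not_UNIV[OF y] nz \<open>z = Top_cell\<close> by auto
    qed
    have "cell_rank x < cell_rank z" using cell_le_rank[OF pg x z(1,2)] nz xT by auto
    moreover have "cell_rank z < cell_rank y" using cell_le_rank[OF pg z(1) y z(3)] nz zT by auto
    ultimately show False using rk by linarith
  qed
  then have "covers (plane_cells V E) cell_le x y" unfolding covers_def using x y ne le by blast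
  then show ?thesis unfolding cover_graph_def by blast
qed

text \<open>A cyclic sequence of all edges determines the strip: \<open>A\<close> contains the edges
  at which the current vertex advances and \<open>D\<close> those at which the current face
  advances, and each edge is joined to the current vertex and face before and after it. Bottom and
  top are joined to all cells of the adjacent level.\<close>

theorem strip_from_sequence:
  fixes x :: "nat \<Rightarrow> complex set" and vf :: "nat \<Rightarrow> complex" and ff :: "nat \<Rightarrow> complex set"
  assumes x: "bij_betw x {..<m} E" and v: "bij_betw vf {..<n} V" and f: "bij_betw ff {..<\<phi>} (plane_faces V E)"
    and cnt: "2 \<le> m" "2 \<le> n" "2 \<le> \<phi>" "hits x A m = n" "hits x D m = \<phi>"
    and vx: "\<And>i. i < m \<Longrightarrow> vf (hits x A i mod n) \<in> x i" "\<And>i. i < m \<Longrightarrow> vf (hits x A (Suc i) mod n) \<in> x i"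
    and fx: "\<And>i. i < m \<Longrightarrow> x i \<subseteq> closure (ff (hits x D i mod \<phi>))" "\<And>i. i < m \<Longrightarrow> x i \<subseteq> closure (ff (hits x D (Suc i) mod \<phi>))"
  shows "has_rhombic_strip (plane_cells V E) cell_le cell_rank"
proof -
  define vc where "vc j = Vertex_cell (vf (nat (j mod int n)))" for j :: int
  define ec where "ec j = Edge_cell (x (nat (j mod int m)))" for j :: int
  define fc where "fc j = Face_cell (ff (nat (j mod int \<phi>)))" for j :: int
  define cell where "cell r j = (if r = -1 then Bot_cell else if r = 0 then vc j else if r = 1 then ec j else if r = 2 then fc j else Top_cell)" for r j :: int
  define cn where "cn r = (if r = 0 then int n else if r = 1 then int m else if r = 2 then int \<phi> else 1)" for r :: int
  \<comment> \<open>Times \<open>2 * i\<close> and \<open>2 * i + 1\<close> belong to the edge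
    \<open>x i\<close>, joined first to the vertex or face before it and then to the one after it;
    if the counter does not advance, the same strand occurs twice. From \<open>2 * i + 1\<close> to
    \<open>2 * i + 2\<close> only the edge changes.\<close>
  let ?VV = "\<lambda>t. cum m x A (t div 2 + t mod 2)" and ?FF = "\<lambda>t. cum m x D (t div 2 + t mod 2)"
  define p where "p r t = (if r = -1 then t div int n else if r = 0 then ?VV t else if r = 1 then t div 2 else t)" for r t :: int
  define q where "q r t = (if r = -1 then t else if r = 0 then t div 2 else if r = 1 then ?FF t else t div int \<phi>)" for r t :: int
  define per where "per r = (if r = -1 then int n else if r = 2 then int \<phi> else 2 * int m)" for r :: int
  have nz: "0 < int n" "0 < int m" "0 < int \<phi>" "m > 0" using cnt by auto
  have rcase: "r = -1 \<or> r = 0 \<or> r = 1 \<or> r = 2" if "r \<in> {-1..2}" for r :: int using that by auto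
  have rcase3: "r = -1 \<or> r = 0 \<or> r = 1 \<or> r = 2 \<or> r = 3" if "r \<in> {-1..3}" for r :: int using that by auto
  have cells: "vc j \<in> plane_cells V E" "ec j \<in> plane_cells V E" "fc j \<in> plane_cells V E" for j
  proof -
    have "nat (j mod int n) < n" "nat (j mod int m) < m" "nat (j mod int \<phi>) < \<phi>" using nz by (simp_all add: nat_less_iff)
    then have "vf (nat (j mod int n)) \<in> V" "x (nat (j mod int m)) \<in> E" "ff (nat (j mod int \<phi>)) \<in> plane_faces V E"
      using x v f by (simp_all add: bij_betw_apply)
    then show "vc j \<in> plane_cells V E" "ec j \<in> plane_cells V E" "fc j \<in> plane_cells V E"
      unfolding plane_cells_def vc_def ec_def fc_def by simp_all
  qed
  have bt: "Bot_cell \<in> plane_cells V E" "Top_cell \<in> plane_cells V E" unfolding plane_cells_def by simp_all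
  have inj: "g (nat (i mod int c)) = g (nat (j mod int c)) \<longleftrightarrow> (\<exists>k. i = j + k * int c)"
    if g: "bij_betw g {..<c} S" and c: "0 < int c" for g :: "nat \<Rightarrow> 'b" and c S i j
  proof -
    have "nat (i mod int c) \<in> {..<c}" "nat (j mod int c) \<in> {..<c}" using c by (simp_all add: nat_less_iff)
    then have "g (nat (i mod int c)) = g (nat (j mod int c)) \<longleftrightarrow> nat (i mod int c) = nat (j mod int c)"
      using bij_betw_imp_inj_on[OF g] by (simp add: inj_on_eq_iff)
    also have "\<dots> \<longleftrightarrow> i mod int c = j mod int c" using c by (simp add: eq_nat_nat_iff)
    finally show ?thesis using mod_eq_shift[OF c] by simp
  qed
  have sur: "\<exists>j. a = g (nat (j mod int c))" if g: "bij_betw g {..<c} S" and a: "a \<in> S" for g :: "nat \<Rightarrow> 'b" and c S a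
  proof -
    obtain i where "i < c" "a = g i" using a bij_betw_imp_surj_on[OF g] by auto
    then show ?thesis by (intro exI[of _ "int i"]) simp
  qed
  have half: "nat ((t div 2) mod int m) < m" for t using nz by (simp add: nat_less_iff)
  have vmod: "vf (nat (?VV t mod int n)) \<in> x (nat ((t div 2) mod int m))" for t
  proof -
    let ?i = "nat ((t div 2) mod int m)"
    consider "t mod 2 = 0" | "t mod 2 = 1" by linarith
    then show ?thesis
    proof cases
      case 1
      have "?VV t mod int n = int (hits x A ?i mod n)" using cum_mod[OF nz(4), of x A "t div 2"] 1 cnt(4) by (simp add: zmod_int)
      then show ?thesis using vx(1)[OF half, of t] by simp
    next
      case 2
      have "?VV t = (t div 2) div int m * int n + int (hits x A (Suc ?i))"
        using cum_step[OF nz(4), of x A "t div 2"] 2 cnt(4) unfolding cum_def by (simp add: hits_simps(2))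
      then have "?VV t mod int n = int (hits x A (Suc ?i) mod n)" by (simp add: zmod_int)
      then show ?thesis using vx(2)[OF half, of t] by simp
    qed
  qed
  have fmod: "x (nat ((t div 2) mod int m)) \<subseteq> closure (ff (nat (?FF t mod int \<phi>)))" for t
  proof -
    let ?i = "nat ((t div 2) mod int m)"
    consider "t mod 2 = 0" | "t mod 2 = 1" by linarith
    then show ?thesis
    proof cases
      case 1
      have "?FF t mod int \<phi> = int (hits x D ?i mod \<phi>)" using cum_mod[OF nz(4), of x D "t div 2"] 1 cnt(5) by (simp add: zmod_int)
      then show ?thesis using fx(1)[OF half, of t] by simp
    next
      case 2
      have "?FF t = (t div 2) div int m * int \<phi> + int (hits x D (Suc ?i))"
        using cum_step[OF nz(4), of x D "t div 2"] 2 cnt(5) unfolding cum_def by (simp add: hits_simps(2))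
      then have "?FF t mod int \<phi> = int (hits x D (Suc ?i) mod \<phi>)" by (simp add: zmod_int)
      then show ?thesis using fx(2)[OF half, of t] by simp
    qed
  qed
  have cumstep: "cum m x B (j + 1) - cum m x B j \<in> {0, 1}" for B j using cum_step[OF nz(4), of x B j] by simp
  have halfstep: "cum m x B ((t + 1) div 2 + (t + 1) mod 2) - cum m x B (t div 2 + t mod 2) \<in> {0, 1}" for B t
    by (cases t rule: two_step) (use cumstep[of B "t div 2"] in simp_all)
  have div2: "(t + 1) div 2 - t div 2 \<in> {0, 1}" for t :: int by (cases t rule: two_step) simp_all
  have excl: "?VV (t + 1) = ?VV t \<or> (t + 1) div 2 = t div 2" "?FF (t + 1) = ?FF t \<or> (t + 1) div 2 = t div 2" for t
    by (cases t rule: two_step; simp)+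
  have cumk: "cum m x B (j + k * int m) = cum m x B j + k * int (hits x B m)" for B j k
    using periodic_int[of "cum m x B" "int m" "int (hits x B m)", OF cum_period[OF nz(4)], of j k] by simp
  have near: "\<bar>cum m x B (t div 2 + t mod 2) - cum m x B (t' div 2 + t' mod 2)\<bar> \<le> 1" if "t div 2 = t' div 2" for t t' B
  proof -
    have "t mod 2 = 0 \<or> t mod 2 = 1" "t' mod 2 = 0 \<or> t' mod 2 = 1" by linarith+
    then show ?thesis using that cumstep[of B "t' div 2"] by (elim disjE) auto
  qed
  \<comment> \<open>This is the assumption \<open>simple\<close>: strands at the same edge have
    counters at most 1 apart, whereas a full turn of the other end would amount to at least
    2.\<close>
  have key: "i = j" if a: "t div 2 = t' div 2 + j * int m"
    and b: "cum m x B (t div 2 + t mod 2) = cum m x B (t' div 2 + t' mod 2) + i * int c" and c: "hits x B m = c" "2 \<le> c" for t t' i j B c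
  proof -
    define u where "u = t' + 2 * (j * int m)"
    have u: "u div 2 = t div 2" "u mod 2 = t' mod 2" unfolding u_def a by simp_all
    have "u div 2 + u mod 2 = (t' div 2 + t' mod 2) + j * int m" unfolding u a by simp
    then have "cum m x B (u div 2 + u mod 2) = cum m x B (t' div 2 + t' mod 2) + j * int c" using cumk c(1) by simp
    then have "cum m x B (t div 2 + t mod 2) - cum m x B (u div 2 + u mod 2) = (i - j) * int c" using b by (simp add: algebra_simps)
    then have "\<bar>(i - j) * int c\<bar> \<le> 1" using near[OF u(1)[symmetric], of B] by simp
    then have "\<bar>i - j\<bar> * int c \<le> 1" by (simp add: abs_mult)
    have "\<bar>i - j\<bar> * 2 \<le> \<bar>i - j\<bar> * int c" using c(2) by (intro mult_left_mono) auto
    also have "\<dots> \<le> 1" by fact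
    finally show ?thesis by presburger
  qed
  have "lattice_strip (plane_cells V E) (cover_graph (plane_cells V E) cell_le) cell_rank cell cn p q per"
  proof
    show "cell r j \<in> plane_cells V E \<and> cell_rank (cell r j) = r" if "r \<in> {-1..3}" for r j
      using rcase3[OF that] cells bt by (elim disjE) (simp_all add: cell_def vc_def ec_def fc_def)
    show "\<exists>r\<in>{-1..3}. \<exists>j. y = cell r j" if "y \<in> plane_cells V E" for y
    proof (cases y)
      case Bot_cell then show ?thesis by (intro bexI[of _ "-1"]) (simp_all add: cell_def)
    next
      case (Vertex_cell w)
      then have "w \<in> V" using that unfolding plane_cells_def by auto
      then obtain j where "w = vf (nat (j mod int n))" using sur[OF v] by blast
      then show ?thesis using Vertex_cell by (intro bexI[of _ 0] exI[of _ j]) (simp_all add: cell_def vc_def)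
    next
      case (Edge_cell w)
      then have "w \<in> E" using that unfolding plane_cells_def by auto
      then obtain j where "w = x (nat (j mod int m))" using sur[OF x] by blast
      then show ?thesis using Edge_cell by (intro bexI[of _ 1] exI[of _ j]) (simp_all add: cell_def ec_def)
    next
      case (Face_cell w)
      then have "w \<in> plane_faces V E" using that unfolding plane_cells_def by auto
      then obtain j where "w = ff (nat (j mod int \<phi>))" using sur[OF f] by blast
      then show ?thesis using Face_cell by (intro bexI[of _ 2] exI[of _ j]) (simp_all add: cell_def fc_def)
    next
      case Top_cell then show ?thesis by (intro bexI[of _ 3]) (simp_all add: cell_def)
    qed
    show "cell r i = cell r j \<longleftrightarrow> (\<exists>k. i = j + k * cn r)" if "r \<in> {-1..3}" for r i j
    proof -
      have one: "\<exists>k. i = j + k * (1 :: int)" by (intro exI[of _ "i - j"]) simp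
      show ?thesis using rcase3[OF that] inj[OF v nz(1), of i j] inj[OF x nz(2), of i j] inj[OF f nz(3), of i j] one
        by (elim disjE) (simp_all add: cell_def cn_def vc_def ec_def fc_def)
    qed
    show "cn (-1) = 1" "cn 3 = 1" by (simp_all add: cn_def)
    show "2 \<le> cn r" if "r \<in> {0..2}" for r
    proof -
      have "r = 0 \<or> r = 1 \<or> r = 2" using that by auto
      then show ?thesis using cnt by (elim disjE) (simp_all add: cn_def)
    qed
    show "{cell r (p r t), cell (r + 1) (q r t)} \<in> cover_graph (plane_cells V E) cell_le" if "r \<in> {-1..2}" for r t
      using rcase[OF that]
    proof (elim disjE)
      assume r: "r = -1"
      have "{Bot_cell, vc t} \<in> cover_graph (plane_cells V E) cell_le"
        by (rule cover_rank_Suc) (simp_all add: cells[unfolded vc_def ec_def fc_def] bt cell_le_def vc_def)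
      then show ?thesis using r by (simp add: cell_def p_def q_def)
    next
      assume r: "r = 0"
      have "{vc (?VV t), ec (t div 2)} \<in> cover_graph (plane_cells V E) cell_le"
        by (rule cover_rank_Suc) (use cells[unfolded vc_def ec_def fc_def] vmod in \<open>simp_all add: cell_le_def vc_def ec_def\<close>)
      then show ?thesis using r by (simp add: cell_def p_def q_def)
    next
      assume r: "r = 1"
      have "{ec (t div 2), fc (?FF t)} \<in> cover_graph (plane_cells V E) cell_le"
        by (rule cover_rank_Suc) (use cells[unfolded vc_def ec_def fc_def] fmod in \<open>simp_all add: cell_le_def fc_def ec_def\<close>)
      then show ?thesis using r by (simp add: cell_def p_def q_def)
    next
      assume r: "r = 2"
      have "{fc t, Top_cell} \<in> cover_graph (plane_cells V E) cell_le"
        by (rule cover_rank_Suc) (simp_all add: cells[unfolded vc_def ec_def fc_def] bt cell_le_def fc_def)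
      then show ?thesis using r by (simp add: cell_def p_def q_def)
    qed
    show "0 < per r" "p r (t + per r) = p r t + cn r" "q r (t + per r) = q r t + cn (r + 1)" if "r \<in> {-1..2}" for r t
    proof -
      have a: "(t + 2 * int m) div 2 = t div 2 + int m" "(t + 2 * int m) mod 2 = t mod 2" by simp_all
      have b: "cum m x B (int m + t div 2 + t mod 2) = cum m x B (t div 2 + t mod 2) + int (hits x B m)" for B
        using cum_period[OF nz(4), of x B "t div 2 + t mod 2"] by (simp add: algebra_simps)
      show "0 < per r" using nz by (simp add: per_def)
      show "p r (t + per r) = p r t + cn r"
        using rcase[OF that] by (elim disjE) (use nz a b[of A] cnt in \<open>simp_all add: p_def per_def cn_def\<close>)
      show "q r (t + per r) = q r t + cn (r + 1)"
        using rcase[OF that] by (elim disjE) (use nz a b[of D] cnt in \<open>simp_all add: q_def per_def cn_def\<close>)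
    qed
    show "p r (t + 1) - p r t \<in> {0, 1}" if "r \<in> {-1..2}" for r t
      using rcase[OF that] by (elim disjE) (use div_step[OF nz(1), of t] halfstep[of A t] div2[of t] in \<open>simp_all add: p_def\<close>)
    show "q r (t + 1) - q r t \<in> {0, 1}" if "r \<in> {-1..2}" for r t
      using rcase[OF that] by (elim disjE) (use div_step[OF nz(3), of t] halfstep[of D t] div2[of t] in \<open>simp_all add: q_def\<close>)
    show "p r (t + 1) = p r t \<or> q r (t + 1) = q r t" if "r \<in> {0, 1}" for r t
    proof -
      have "r = 0 \<or> r = 1" using that by auto
      then show ?thesis by (rule disjE) (use excl[of t] in \<open>simp_all add: p_def q_def disj_commute\<close>)
    qed
    show "q (-1) (t + 1) = q (-1) t + 1" "p 2 (t + 1) = p 2 t + 1" for t by (simp_all add: q_def p_def)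
    show "i = j" if r: "r \<in> {-1..2}" and a: "p r t = p r t' + i * cn r" "q r t = q r t' + j * cn (r + 1)" for r t t' i j
      using rcase[OF r]
    proof (elim disjE)
      assume "r = -1"
      then have "t div int n = t' div int n + i" "t = t' + j * int n" using a by (simp_all add: p_def q_def cn_def)
      then show ?thesis using nz by simp
    next
      assume "r = 0"
      then have "?VV t = ?VV t' + i * int n" "t div 2 = t' div 2 + j * int m" using a by (simp_all add: p_def q_def cn_def)
      then show ?thesis using key[of t t' j A i n] cnt by blast
    next
      assume "r = 1"
      then have "?FF t = ?FF t' + j * int \<phi>" "t div 2 = t' div 2 + i * int m" using a by (simp_all add: p_def q_def cn_def)
      then show ?thesis using key[of t t' i D j \<phi>] cnt by blast
    next
      assume "r = 2"
      then have "t = t' + i * int \<phi>" "t div int \<phi> = t' div int \<phi> + j" using a by (simp_all add: p_def q_def cn_def)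
      then show ?thesis using nz by simp
    qed
  qed
  then show ?thesis by (rule lattice_strip_rhombic)
qed

end

section \<open>Sorting\<close>

lemma sort_by_key:
  fixes key :: "'a \<Rightarrow> nat"
  assumes fin: "finite E" and inj: "inj_on key E"
  obtains x where "bij_betw x {..<card E} E" "\<And>i j. i < card E \<Longrightarrow> j < card E \<Longrightarrow> key (x i) \<le> key (x j) \<longleftrightarrow> i \<le> j"
proof -
  define L where "L = sorted_list_of_set (key ` E)"
  have L: "set L = key ` E" "distinct L" "sorted_wrt (<) L" "length L = card E"
    using fin card_image[OF inj] unfolding L_def by (simp_all add: strict_sorted_list_of_set)
  have b1: "bij_betw ((!) L) {..<card E} (key ` E)" using bij_betw_nth[OF L(2), of "{..<card E}" "key ` E"] L by simp
  have b2: "bij_betw (inv_into E key) (key ` E) E" using inj by (intro bij_betw_inv_into) (simp add: bij_betw_def)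
  let ?x = "inv_into E key \<circ> (!) L"
  have bx: "bij_betw ?x {..<card E} E" by (rule bij_betw_trans[OF b1 b2])
  have kx: "key (?x i) = L ! i" if "i < card E" for i
    using bij_betw_apply[OF b1, of i] that by (simp add: f_inv_into_f)
  have le: "L ! i < L ! j" if "i < j" "j < card E" for i j using sorted_wrt_nth_less[OF L(3), of i j] that L(4) by simp
  have "key (?x i) \<le> key (?x j) \<longleftrightarrow> i \<le> j" if ij: "i < card E" "j < card E" for i j
  proof (cases "i < j")
    case True then show ?thesis using le[of i j] ij kx[of i] kx[of j] by simp
  next
    case False
    then show ?thesis using le[of j i] ij kx[of i] kx[of j] by (cases "i = j") auto
  qed
  with bx show ?thesis using that by blast
qed

lemma hits_sorted:
  assumes x: "bij_betw x {..<m} E" "\<And>i j. i < m \<Longrightarrow> j < m \<Longrightarrow> key (x i) \<le> (key (x j) :: nat) \<longleftrightarrow> i \<le> j"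
    and A: "A \<subseteq> E" and i: "i < m"
  shows "hits x A (Suc i) = card {d \<in> A. key d \<le> key (x i)}"
proof -
  have "x ` {j. j < Suc i \<and> x j \<in> A} = {d \<in> A. key d \<le> key (x i)}"
  proof (intro subset_antisym subsetI)
    fix d assume "d \<in> x ` {j. j < Suc i \<and> x j \<in> A}"
    then obtain j where "j < Suc i" "x j \<in> A" "d = x j" by blast
    then show "d \<in> {d \<in> A. key d \<le> key (x i)}" using x(2)[of j i] i by simp
  next
    fix d assume d: "d \<in> {d \<in> A. key d \<le> key (x i)}"
    then have "d \<in> x ` {..<m}" using A bij_betw_imp_surj_on[OF x(1)] by blast
    then obtain j where j: "j < m" "d = x j" by blast
    then have "j < Suc i" using x(2)[of j i] i d by simp
    then show "d \<in> x ` {j. j < Suc i \<and> x j \<in> A}" using j d by blast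
  qed
  from arg_cong[OF this, of card] show ?thesis unfolding hits_def
  proof (subst (asm) card_image)
    show "inj_on x {j. j < Suc i \<and> x j \<in> A}"
    by (rule inj_on_subset[OF bij_betw_imp_inj_on[OF x(1)]]) (use i in auto)
  qed
qed

lemma hits_all:
  assumes x: "bij_betw x {..<m} E" and A: "A \<subseteq> E" shows "hits x A m = card A"
proof -
  have "x ` {j. j < m \<and> x j \<in> A} = A"
  proof (intro subset_antisym subsetI)
    fix d assume "d \<in> A"
    then have "d \<in> x ` {..<m}" using A bij_betw_imp_surj_on[OF x(1)] by blast
    then show "d \<in> x ` {j. j < m \<and> x j \<in> A}" using \<open>d \<in> A\<close> by blast
  qed blast
  from arg_cong[OF this, of card] show ?thesis unfolding hits_def
  proof (subst (asm) card_image)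
    show "inj_on x {j. j < m \<and> x j \<in> A}"
    by (rule inj_on_subset[OF bij_betw_imp_inj_on[OF x(1)]]) auto
  qed
qed

lemma rank_le_iff:
  fixes key :: "'a \<Rightarrow> nat"
  assumes "finite D" "c \<in> D"
  shows "card {d \<in> D. key d \<le> key c} \<le> card {d \<in> D. key d \<le> y} \<longleftrightarrow> key c \<le> y"
proof
  assume "key c \<le> y"
  then show "card {d \<in> D. key d \<le> key c} \<le> card {d \<in> D. key d \<le> y}" using assms(1) by (intro card_mono) auto
next
  assume le: "card {d \<in> D. key d \<le> key c} \<le> card {d \<in> D. key d \<le> y}"
  show "key c \<le> y"
  proof (rule ccontr)
    assume n: "\<not> key c \<le> y"
    have "{d \<in> D. key d \<le> y} \<subset> {d \<in> D. key d \<le> key c}" using n assms(2) by auto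
    then have "card {d \<in> D. key d \<le> y} < card {d \<in> D. key d \<le> key c}" using assms(1) by (intro psubset_card_mono) auto
    then show False using le by simp
  qed
qed

section \<open>The two regions on both sides of a chord\<close>

context ham_graph
begin

text \<open>\<open>W\<close> is the side of the cycle on which the chord \<open>c\<close> runs;
  \<open>S\<close> is its part along the path \<open>seg i l\<close> and \<open>R\<close> its part
  along the remaining path.\<close>

definition chord_zones :: "complex set \<Rightarrow> nat \<Rightarrow> nat \<Rightarrow> complex set \<Rightarrow> complex set \<Rightarrow> complex set \<Rightarrow> bool" where
  "chord_zones c i l W S R \<longleftrightarrow> S \<inter> R = {} \<and> S \<subseteq> W \<and> R \<subseteq> W \<and> connected S \<and> connected R \<and>
     S \<subseteq> - (rim \<union> c) \<and> R \<subseteq> - (rim \<union> c) \<and> (\<forall>f\<in>faces. f \<subseteq> W \<longrightarrow> f \<subseteq> S \<or> f \<subseteq> R) \<and>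
     closure S \<subseteq> S \<union> seg i l \<union> c \<and> closure R \<subseteq> R \<union> seg (i + l) (n - l) \<union> c \<and>
     (\<exists>f\<in>faces. f \<subseteq> S \<and> c \<subseteq> closure f) \<and> (\<exists>f\<in>faces. f \<subseteq> R \<and> c \<subseteq> closure f)"

lemma chord_zones_exist:
  assumes c: "c \<in> chd" "c \<inter> V = {vx i, vx (i + l)}" and l: "0 < l" "l < n"
    and W: "W \<in> components (- rim)" "c - rim \<subseteq> W"
  shows "\<exists>S R. chord_zones c i l W S R"
proof -
  let ?X = "seg i l" and ?Y = "seg (i + l) (n - l)" and ?a = "vx i" and ?b = "vx (i + l)"
  have th: "theta_curve ?a ?b ?X ?Y c" by (rule chord_theta[OF c l])
  from theta_regions_exist[OF th] obtain R S T where reg: "theta_regions ?X ?Y c R S T" by blast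
  have rim: "rim = ?X \<union> ?Y" using seg_split[of l i] l by simp
  have o: "T \<in> components (- rim)" "R \<union> S \<union> (c - {?a, ?b}) \<in> components (- rim)"
    using theta_regions_other_side[OF th reg] unfolding rim by simp_all
  have ab: "?a \<noteq> ?b"
  proof
    assume "?a = ?b"
    then have "i mod n = (i + l) mod n" unfolding vx_eq .
    then show False using mod_eq_close[of i n "i + l"] l by simp
  qed
  have ci: "c - rim = c - {?a, ?b}" "c - rim \<noteq> {}" using chord_interior[OF c ab] by auto
  have WW: "W = R \<union> S \<union> (c - {?a, ?b})"
    using components_nonoverlap[OF W(1) o(2)] ci W(2) by blast
  note r = reg[unfolded theta_regions_def]
  have dis: "R \<inter> S = {}" "R \<inter> T = {}" "S \<inter> T = {}" "R \<union> S \<union> T = - (?X \<union> ?Y \<union> c)" "connected R" "connected S" using r by simp_all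
  have TW: "T \<inter> W = {}"
  proof -
    have "T \<noteq> W" using WW dis(2,3) r by blast
    then show ?thesis using components_nonoverlap[OF o(1) W(1)] by simp
  qed
  have f: "f \<subseteq> S \<or> f \<subseteq> R" if "f \<in> faces" "f \<subseteq> W" for f
  proof -
    note fp = face_props[OF that(1)]
    have "f \<subseteq> - (?X \<union> ?Y \<union> c)" using fp(3) graph_eq rim c(1) by blast
    from connected_in_theta_region[OF reg fp(1,2) this] have "f \<subseteq> R \<or> f \<subseteq> S \<or> f \<subseteq> T" .
    then show ?thesis using TW that(2) fp(2) by blast
  qed
  \<comment> \<open>With the roles of the arcs exchanged, \<open>S\<close> and \<open>R\<close> are
    sides of the two cycles through \<open>c\<close>, and \<open>cycle_face\<close> finds a face
    along \<open>c\<close> in each.\<close>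
  have th2: "theta_curve ?a ?b ?X c ?Y" using th unfolding theta_curve_def by (simp add: Int_commute)
  have reg2: "theta_regions ?X c ?Y R T S" using r unfolding theta_regions_def by (simp add: Un_ac Int_commute)
  have th3: "theta_curve ?a ?b ?Y c ?X" using th unfolding theta_curve_def by (simp add: Int_commute)
  have reg3: "theta_regions ?Y c ?X S T R" using r unfolding theta_regions_def by (simp add: Un_ac Int_commute)
  have cS: "S \<in> components (- (?X \<union> c))" by (rule theta_regions_other_side(1)[OF th2 reg2])
  have cR: "R \<in> components (- (?Y \<union> c))" by (rule theta_regions_other_side(1)[OF th3 reg3])
  have c2: "c \<inter> V = {vx (i + l), vx (i + l + (n - l))}"
    using c(2) l vx_add_n[of i] by (simp add: insert_commute)
  have l2: "0 < n - l" "n - l < n" using l by auto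
  have fS: "\<exists>f\<in>faces. f \<subseteq> S \<and> c \<subseteq> closure f"
    by (rule cycle_face(1)[OF cycle_chord[OF c l]]) (use cS in \<open>simp_all add: seg_def Un_commute\<close>)
  have fR: "\<exists>f\<in>faces. f \<subseteq> R \<and> c \<subseteq> closure f"
    by (rule cycle_face(1)[OF cycle_chord[OF c(1) c2 l2]]) (use cR in \<open>simp_all add: seg_def Un_commute\<close>)
  note cl = theta_region_closure[OF reg]
  have "chord_zones c i l W S R" unfolding chord_zones_def
  proof (intro conjI fS fR dis(5,6) ballI impI)
    show "S \<inter> R = {}" using dis(1) by blast
    show "S \<subseteq> W" "R \<subseteq> W" using WW by auto
    show "S \<subseteq> - (rim \<union> c)" "R \<subseteq> - (rim \<union> c)" using dis(4) rim by auto
    show "f \<subseteq> S \<or> f \<subseteq> R" if "f \<in> faces" "f \<subseteq> W" for f using f that by blast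
    show "closure S \<subseteq> S \<union> ?X \<union> c" "closure R \<subseteq> R \<union> ?Y \<union> c" using cl(1,2) by auto
  qed
  then show ?thesis by blast
qed

lemma vx_not_in_seg:
  assumes "j < n" "i \<le> n" "i + l \<le> n" "j < i \<or> i + l < j" "\<not> (j = 0 \<and> i + l = n)" shows "vx j \<notin> seg i l"
proof
  assume "vx j \<in> seg i l"
  then have "vx j \<in> vx ` {i..i + l}" using seg_V[of i l] vx_in[of j] by blast
  then obtain t where t: "i \<le> t" "t \<le> i + l" "vx j = vx t" by auto
  then have "j mod n = t mod n" unfolding vx_eq by simp
  then have jt: "j = t mod n" using assms(1) by simp
  show False
  proof (cases "t < n")
    case True then show False using jt t assms(4) by auto
  next
    case False
    then have "t = n" using t assms(3) by simp
    then show False using jt t assms by auto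
  qed
qed

lemma vx_not_in_seg_wrap:
  assumes "i < j" "j < h" "h < n" shows "vx j \<notin> seg h (n - (h - i))"
proof
  assume "vx j \<in> seg h (n - (h - i))"
  then have "vx j \<in> vx ` {h..h + (n - (h - i))}" using seg_V[of h "n - (h - i)"] vx_in[of j] by blast
  then obtain t where t: "h \<le> t" "t \<le> h + (n - (h - i))" "vx j = vx t" by auto
  then have "j mod n = t mod n" unfolding vx_eq by simp
  then have jt: "j = t mod n" using assms by simp
  have tn: "t \<le> n + i" using t assms by auto
  show False
  proof (cases "t < n")
    case True then show False using jt t assms by auto
  next
    case False
    then have "t mod n = t - n" using tn assms by (simp add: mod_if)
    then show False using jt tn False assms by auto
  qed
qed

text \<open>The frontier of either zone contains only one of the two paths between the ends of the
  chord, so a vertex off the chord decides in which zone a face touching it lies.\<close>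

lemma zone_of_vertex:
  assumes z: "chord_zones c i l W S R" and c: "c \<in> chd" "c \<inter> V = {vx i, vx (i + l)}" and l: "0 < l" "i + l < n"
    and f: "f \<in> faces" "f \<subseteq> W" "vx j \<in> closure f" and j: "j < n" "j \<noteq> i" "j \<noteq> i + l"
  shows "f \<subseteq> S \<longleftrightarrow> i < j \<and> j < i + l" "f \<subseteq> R \<longleftrightarrow> \<not> (i < j \<and> j < i + l)"
proof -
  note Z = z[unfolded chord_zones_def]
  have fz: "\<forall>f\<in>faces. f \<subseteq> W \<longrightarrow> f \<subseteq> S \<or> f \<subseteq> R" using Z by (elim conjE)
  have zz: "S \<inter> R = {}" "f \<subseteq> S \<or> f \<subseteq> R" by (insert Z, elim conjE, assumption) (insert fz f, simp)
  have zc: "closure S \<subseteq> S \<union> seg i l \<union> c" "closure R \<subseteq> R \<union> seg (i + l) (n - l) \<union> c"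
    "S \<subseteq> - (rim \<union> c)" "R \<subseteq> - (rim \<union> c)" by (insert Z; elim conjE; assumption)+
  have ne: "f \<noteq> {}" using face_props(2)[OF f(1)] .
  have vr: "vx j \<in> rim" using seg_ends(1)[of n j] n_pos rim_seg[of j] by simp
  have vc: "vx j \<notin> c"
  proof
    assume "vx j \<in> c"
    then have "vx j = vx i \<or> vx j = vx (i + l)" using c(2) vx_in[of j] by blast
    then show False using j l by (auto simp: vx_eq)
  qed
  have "\<not> f \<subseteq> R" if "i < j" "j < i + l"
  proof
    assume "f \<subseteq> R"
    then have "vx j \<in> closure R" using f(3) closure_mono by blast
    then have "vx j \<in> seg (i + l) (n - l)" using zc(2,4) vr vc by blast
    then show False using vx_not_in_seg_wrap[OF that l(2)] by simp
  qed
  moreover have "\<not> f \<subseteq> S" if "\<not> (i < j \<and> j < i + l)"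
  proof
    assume "f \<subseteq> S"
    then have "vx j \<in> closure S" using f(3) closure_mono by blast
    then have "vx j \<in> seg i l" using zc(1,3) vr vc by blast
    moreover have "j < i \<or> i + l < j" using that j by auto
    ultimately show False using vx_not_in_seg[of j i l] j l by auto
  qed
  ultimately show "f \<subseteq> S \<longleftrightarrow> i < j \<and> j < i + l" "f \<subseteq> R \<longleftrightarrow> \<not> (i < j \<and> j < i + l)" using zz(1,2) ne by blast+
qed

end

lemma lex_le: assumes "(u::nat) < B" "v < B" shows "a * B + u \<le> b * B + v \<longleftrightarrow> a < b \<or> a = b \<and> u \<le> v"
proof -
  have "a * B + u < b * B" if "a < b"
  proof -
    have "Suc a * B \<le> b * B" using that by (intro mult_le_mono1) simp
    then show ?thesis using assms by simp
  qed
  moreover have "b * B + v < a * B" if "b < a"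
  proof -
    have "Suc b * B \<le> a * B" using that by (intro mult_le_mono1) simp
    then show ?thesis using assms by simp
  qed
  ultimately show ?thesis by (cases a b rule: linorder_cases) auto
qed

section \<open>The linear order of the edges induced by a split cycle\<close>

text \<open>The cycle is numbered so that \<open>A\<close> consists of the vertices with index below
  \<open>k\<close>; the edges \<open>ce (k - 1)\<close> and \<open>ce (n - 1)\<close> join
  \<open>A\<close> and \<open>B\<close>.\<close>

locale cut_graph = ham_graph +
  fixes k :: nat
  assumes k: "0 < k" "k < n" and cut: "\<And>c. c \<in> chd \<Longrightarrow> \<exists>a<k. \<exists>b\<in>{k..<n}. c \<inter> V = {vx a, vx b}"
begin

definition lo :: "complex set \<Rightarrow> nat" where "lo c = (SOME a. a < k \<and> (\<exists>b\<in>{k..<n}. c \<inter> V = {vx a, vx b}))"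

definition hi :: "complex set \<Rightarrow> nat" where "hi c = (SOME b. b \<in> {k..<n} \<and> c \<inter> V = {vx (lo c), vx b})"

lemma lo_hi: assumes "c \<in> chd" shows "lo c < k" "k \<le> hi c" "hi c < n" "c \<inter> V = {vx (lo c), vx (hi c)}"
proof -
  have "\<exists>a. a < k \<and> (\<exists>b\<in>{k..<n}. c \<inter> V = {vx a, vx b})" using cut[OF assms] by blast
  from someI_ex[OF this] have *: "lo c < k" "\<exists>b. b \<in> {k..<n} \<and> c \<inter> V = {vx (lo c), vx b}" unfolding lo_def[symmetric] by blast+
  from someI_ex[OF *(2)] show "lo c < k" "k \<le> hi c" "hi c < n" "c \<inter> V = {vx (lo c), vx (hi c)}"
    using *(1) unfolding hi_def[symmetric] by auto
qed

lemma vx_inj: "i < n \<Longrightarrow> j < n \<Longrightarrow> vx i = vx j \<longleftrightarrow> i = j" by (simp add: vx_eq)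

lemma chord_span: assumes c: "c \<in> chd" shows "1 < hi c - lo c" "hi c - lo c < n - 1"
proof -
  obtain i l where il: "i < n" "i + l < n" "1 < l" "l < n - 1" "c \<inter> V = {vx i, vx (i + l)}" using chord_ends[OF c] .
  note h = lo_hi[OF c]
  have "{vx i, vx (i + l)} = {vx (lo c), vx (hi c)}" using il(5) h(4) by simp
  then have "vx i = vx (lo c) \<and> vx (i + l) = vx (hi c) \<or> vx i = vx (hi c) \<and> vx (i + l) = vx (lo c)" unfolding doubleton_eq_iff .
  then have "i = lo c \<and> i + l = hi c \<or> i = hi c \<and> i + l = lo c" using vx_inj il h by auto
  then show "1 < hi c - lo c" "hi c - lo c < n - 1" using h il by auto
qed

definition ins :: "complex set \<Rightarrow> bool" where "ins c \<longleftrightarrow> c - rim \<subseteq> inside rim"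

definition side :: "bool \<Rightarrow> complex set" where "side b = (if b then inside rim else outside rim)"

lemma side_comp: "side b \<in> components (- rim)" using components_rim by (simp add: side_def)

lemma side_disjoint: "side True \<inter> side False = {}" using rim_in_out(3) by (simp add: side_def)

lemma chord_side: assumes c: "c \<in> chd" shows "c - rim \<subseteq> side (ins c)" "c - rim \<subseteq> side b \<longleftrightarrow> ins c = b"
proof -
  note h = lo_hi[OF c]
  have ab: "vx (lo c) \<noteq> vx (hi c)" using h vx_inj[of "lo c" "hi c"] by simp
  note ci = chord_interior[OF c h(4) ab]
  have "c - rim \<subseteq> side True \<or> c - rim \<subseteq> side False"
  proof -
    have "c - rim \<subseteq> - rim" by blast
    from exists_component_superset[OF this _ ci(2)] obtain U where "U \<in> components (- rim)" "c - rim \<subseteq> U" using ci(3) by auto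
    then show ?thesis unfolding components_rim side_def by auto
  qed
  moreover have "\<not> (c - rim \<subseteq> side True \<and> c - rim \<subseteq> side False)" using side_disjoint ci(3) by blast
  moreover have "ins c \<longleftrightarrow> c - rim \<subseteq> side True" by (simp add: ins_def side_def)
  ultimately show "c - rim \<subseteq> side (ins c)" "c - rim \<subseteq> side b \<longleftrightarrow> ins c = b" by (cases "ins c"; cases b; simp)+
qed

definition zone :: "complex set \<Rightarrow> complex set \<times> complex set" where
  "zone c = (SOME z. chord_zones c (lo c) (hi c - lo c) (side (ins c)) (fst z) (snd z))"

lemma zone: assumes c: "c \<in> chd"
  shows "chord_zones c (lo c) (hi c - lo c) (side (ins c)) (fst (zone c)) (snd (zone c))"
proof -
  note h = lo_hi[OF c]
  have "lo c + (hi c - lo c) = hi c" using h by simp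
  then have "\<exists>S R. chord_zones c (lo c) (hi c - lo c) (side (ins c)) S R"
    using h side_comp chord_side(1)[OF c] by (intro chord_zones_exist[OF c]) auto
  then have "\<exists>z. chord_zones c (lo c) (hi c - lo c) (side (ins c)) (fst z) (snd z)" by auto
  then show ?thesis unfolding zone_def by (rule someI_ex)
qed

text \<open>Going once around the strip, the chords inside the cycle are passed in the order of their end points
  on \<open>v\<^sub>0, \<dots>, v\<^bsub>k-1\<^esub>\<close>, those outside in the order of their end points on \<open>v\<^sub>k, \<dots>, v\<^bsub>n-1\<^esub>\<close>.
  \<open>after c f\<close> states that the face \<open>f\<close> on the side of \<open>c\<close> is passed after \<open>c\<close>.\<close>

definition after :: "complex set \<Rightarrow> complex set \<Rightarrow> bool" where
  "after c f \<longleftrightarrow> f \<subseteq> (if ins c then fst (zone c) else snd (zone c))"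

text \<open>The end by which the chords on one side are sorted; \<open>trail\<close> is the other
  end and breaks ties.\<close>

definition lead :: "complex set \<Rightarrow> nat" where "lead c = (if ins c then lo c else hi c)"

definition trail :: "complex set \<Rightarrow> nat" where "trail c = (if ins c then hi c else lo c)"

text \<open>A number with two digits in base \<open>4 * n\<close>, the first being an index on the
  cycle. Chords with the same leading vertex come in the order of decreasing other ends, as they are
  swept without crossing. Since \<open>n - trail e\<close> is at most \<open>n\<close>, the digit
  \<open>3 * n\<close> places the edge \<open>ce i\<close> behind all chords led by \<open>i\<close>
  and before those led by \<open>i + 1\<close>.\<close>

definition key :: "complex set \<Rightarrow> nat" where
  "key e = (if e \<in> chd then lead e * (4 * n) + (n - trail e) else (SOME i. i < n \<and> e = ce i) * (4 * n) + 3 * n)"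

lemma ce_not_chd: "ce i \<notin> chd" by (simp add: chd_eq)

lemma ce_eq: "i < n \<Longrightarrow> j < n \<Longrightarrow> ce i = ce j \<longleftrightarrow> i = j" by (simp add: ce_eq_iff)

lemma key_ce: assumes "i < n" shows "key (ce i) = i * (4 * n) + 3 * n"
proof -
  have "(SOME j. j < n \<and> ce i = ce j) = i"
  proof (rule some_equality)
    show "i < n \<and> ce i = ce i" using assms by simp
    show "j = i" if "j < n \<and> ce i = ce j" for j using that assms ce_eq[of i j] by simp
  qed
  then show ?thesis unfolding key_def by (simp add: ce_not_chd)
qed

lemma key_chd: "c \<in> chd \<Longrightarrow> key c = lead c * (4 * n) + (n - trail c)" by (simp add: key_def)

lemma key_le_ce: "i < n \<Longrightarrow> j < n \<Longrightarrow> key (ce i) \<le> key (ce j) \<longleftrightarrow> i \<le> j"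
  unfolding key_ce using lex_le[of "3 * n" "4 * n" "3 * n" i j] n_pos by auto

lemma key_le_chd_ce: "c \<in> chd \<Longrightarrow> i < n \<Longrightarrow> key c \<le> key (ce i) \<longleftrightarrow> lead c \<le> i"
  unfolding key_ce key_chd using lex_le[of "n - trail c" "4 * n" "3 * n" "lead c" i] n_pos by auto

lemma key_le_ce_chd: "c \<in> chd \<Longrightarrow> i < n \<Longrightarrow> key (ce i) \<le> key c \<longleftrightarrow> i < lead c"
  unfolding key_ce key_chd using lex_le[of "3 * n" "4 * n" "n - trail c" i "lead c"] n_pos by auto

lemma trail_less: "c \<in> chd \<Longrightarrow> trail c < n" using lo_hi[of c] by (simp add: trail_def)

lemma lead_less: "c \<in> chd \<Longrightarrow> lead c < n" using lo_hi[of c] by (simp add: lead_def)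

lemma lead_ins: assumes "c \<in> chd" shows "lead c < k \<longleftrightarrow> ins c" using lo_hi[OF assms] by (simp add: lead_def)

lemma key_le_chd: assumes "c \<in> chd" "d \<in> chd"
  shows "key c \<le> key d \<longleftrightarrow> lead c < lead d \<or> lead c = lead d \<and> trail d \<le> trail c"
  unfolding key_chd[OF assms(1)] key_chd[OF assms(2)]
  using lex_le[of "n - trail c" "4 * n" "n - trail d" "lead c" "lead d"] n_pos trail_less[OF assms(1)] trail_less[OF assms(2)] by auto

lemma edge_cases: assumes "e \<in> E" obtains "e \<in> chd" | i where "i < n" "e = ce i"
proof (cases "e \<in> chd")
  case False
  then obtain j where "e = ce j" using assms by (auto simp: chd_eq)
  then show ?thesis using that(2)[of "j mod n"] n_pos by (simp add: ce_mod)
qed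

lemma chord_eqI: assumes "c \<in> chd" "d \<in> chd" "lo c = lo d" "hi c = hi d" shows "c = d"
  using edge_unique[of c d] lo_hi(4)[OF assms(1)] lo_hi(4)[OF assms(2)] assms chdE by simp

lemma lead_eqD: assumes "c \<in> chd" "d \<in> chd" "lead c = lead d" shows "ins c = ins d"
  using lead_ins[OF assms(1)] lead_ins[OF assms(2)] assms(3) by simp

lemma key_inj: "inj_on key E"
proof (rule inj_onI)
  fix e e' assume e: "e \<in> E" "e' \<in> E" and eq: "key e = key e'"
  from e(1) show "e = e'"
  proof (cases rule: edge_cases)
    case c: 1
    from e(2) show ?thesis
    proof (cases rule: edge_cases)
      case d: 1
      have l: "lead e = lead e'" "trail e = trail e'" using eq key_le_chd[OF c d] key_le_chd[OF d c] by auto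
      have "lo e = lo e'" "hi e = hi e'" using l lead_eqD[OF c d l(1)] unfolding lead_def trail_def by (cases "ins e"; simp)+
      then show ?thesis by (rule chord_eqI[OF c d])
    next
      case (2 i) then show ?thesis using eq key_le_chd_ce[OF c 2(1)] key_le_ce_chd[OF c 2(1)] by simp
    qed
  next
    case (2 i)
    from e(2) show ?thesis
    proof (cases rule: edge_cases)
      case 1 then show ?thesis using eq 2 key_le_chd_ce[OF 1 2(1)] key_le_ce_chd[OF 1 2(1)] by simp
    next
      case j: (2 j) then show ?thesis using eq 2 key_le_ce[of i j] key_le_ce[of j i] by simp
    qed
  qed
qed

lemma nested: assumes cd: "c \<in> chd" "d \<in> chd" "ins c = ins d" and lt: "lo c < lo d" shows "hi d \<le> hi c"
proof (rule ccontr)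
  assume n: "\<not> hi d \<le> hi c"
  note h = lo_hi[OF cd(1)] lo_hi[OF cd(2)]
  have e: "c \<inter> V = {vx (lo c), vx (lo c + (hi c - lo c))}" using h by simp
  have e': "d \<inter> V = {vx (lo c + (lo d - lo c)), vx (lo c + (hi d - lo c))}" using h lt n by simp
  show False
    by (rule chord_crossing[OF cd(1) e cd(2) e' _ _ _ _ side_comp[of "ins c"]])
      (use h lt n chord_side(1)[OF cd(1)] chord_side(1)[OF cd(2)] cd(3) in auto)
qed

lemma after_vertex:
  assumes c: "c \<in> chd" and f: "f \<in> faces" "f \<subseteq> side (ins c)" "vx j \<in> closure f" and j: "j < n" "j \<noteq> lo c" "j \<noteq> hi c"
  shows "after c f \<longleftrightarrow> (ins c \<longleftrightarrow> lo c < j \<and> j < hi c)"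
proof -
  note h = lo_hi[OF c]
  have s: "lo c + (hi c - lo c) = hi c" using h by simp
  note z = zone_of_vertex[OF zone[OF c] c, unfolded s, OF h(4) _ h(3) f j]
  have "0 < hi c - lo c" using h by simp
  from z[OF this] show ?thesis unfolding after_def by auto
qed

text \<open>The ends of \<open>d\<close> lie on the boundary of the face, and one of them is not an
  end of \<open>c\<close>; it tells on which side of \<open>c\<close> the face lies. As chords on
  the same side are nested, this agrees with the order of the keys.\<close>

lemma after_chord:
  assumes c: "c \<in> chd" and d: "d \<in> chd" "d \<noteq> c" "ins d = ins c" and f: "f \<in> faces" "f \<subseteq> side (ins c)" "d \<subseteq> closure f"
  shows "after c f \<longleftrightarrow> key c \<le> key d"
proof -
  note h = lo_hi[OF c] lo_hi[OF d(1)]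
  have vd: "vx (lo d) \<in> closure f" "vx (hi d) \<in> closure f" using h(8) f(3) by auto
  note av = after_vertex[OF c f(1,2)]
  consider "lo c < lo d" | "lo d < lo c" | "lo c = lo d" "hi c < hi d" | "lo c = lo d" "hi d < hi c"
    using chord_eqI[OF c d(1)] d(2) by (metis linorder_neqE_nat)
  then show ?thesis
  proof cases
    case 1
    have n: "hi d \<le> hi c" by (rule nested[OF c d(1) d(3)[symmetric] 1])
    have "after c f \<longleftrightarrow> ins c" using av[OF vd(1)] 1 h by simp
    moreover have "key c \<le> key d \<longleftrightarrow> ins c" unfolding key_le_chd[OF c d(1)] using 1 n d(3) h by (auto simp: lead_def trail_def)
    ultimately show ?thesis by simp
  next
    case 2
    have n: "hi c \<le> hi d" by (rule nested[OF d(1) c d(3) 2])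
    have "after c f \<longleftrightarrow> \<not> ins c" using av[OF vd(1)] 2 h by simp
    moreover have "key c \<le> key d \<longleftrightarrow> \<not> ins c" unfolding key_le_chd[OF c d(1)] using 2 n d(3) h by (auto simp: lead_def trail_def)
    ultimately show ?thesis by simp
  next
    case 3
    have "after c f \<longleftrightarrow> \<not> ins c" using av[OF vd(2)] 3 h by simp
    moreover have "key c \<le> key d \<longleftrightarrow> \<not> ins c" unfolding key_le_chd[OF c d(1)] using 3 d(3) h by (auto simp: lead_def trail_def)
    ultimately show ?thesis by simp
  next
    case 4
    have "after c f \<longleftrightarrow> ins c" using av[OF vd(2)] 4 h by simp
    moreover have "key c \<le> key d \<longleftrightarrow> ins c" unfolding key_le_chd[OF c d(1)] using 4 d(3) h by (auto simp: lead_def trail_def)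
    ultimately show ?thesis by simp
  qed
qed

text \<open>One of the two ends of \<open>ce i\<close> is not an end of the chord, because the ends
  of a chord are not consecutive on \<open>C\<close>, and this end decides.\<close>

lemma after_ce_arc:
  assumes c: "c \<in> chd" and i: "i < n" and f: "f \<in> faces" "f \<subseteq> side (ins c)" "ce i \<subseteq> closure f"
  shows "after c f \<longleftrightarrow> (ins c \<longleftrightarrow> lo c \<le> i \<and> i < hi c)"
proof -
  note h = lo_hi[OF c] and sp = chord_span[OF c]
  have v1: "vx i \<in> closure f" using ce(2)[of i] f(3) by auto
  have v2: "vx (Suc i mod n) \<in> closure f" using ce(2)[of i] f(3) unfolding vx_mod by auto
  note a1 = after_vertex[OF c f(1,2) v1 i] and a2 = after_vertex[OF c f(1,2) v2]
  show ?thesis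
  proof (cases "i = lo c \<or> i = hi c")
    case False
    then show ?thesis using a1 by auto
  next
    case True
    show ?thesis
    proof (cases "Suc i = n")
      \<comment> \<open>The edge \<open>ce (n - 1)\<close> ends at vertex 0, which is not an end of
        the chord: joined to \<open>n - 1\<close> it would give an edge of \<open>C\<close>.\<close>
      case True
      then have "Suc i mod n = 0" "i = hi c" using \<open>i = lo c \<or> i = hi c\<close> h by auto
      moreover have "0 < lo c" using sp h True \<open>i = hi c\<close> by auto
      ultimately show ?thesis using a2 n_pos h by auto
    next
      case False
      then have s: "Suc i mod n = Suc i" "Suc i < n" using i by auto
      show ?thesis using a2 True s sp h by auto
    qed
  qed
qed

lemma after_ce:
  assumes c: "c \<in> chd" and i: "i < n" "if ins c then i < k else k - 1 \<le> i"
    and f: "f \<in> faces" "f \<subseteq> side (ins c)" "ce i \<subseteq> closure f"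
  shows "after c f \<longleftrightarrow> key c \<le> key (ce i)"
  unfolding after_ce_arc[OF c i(1) f] key_le_chd_ce[OF c i(1)] using lo_hi[OF c] i by (auto simp: lead_def)

text \<open>At \<open>ce (n - 1)\<close> the strip returns to the inside and a new round begins, so
  none of the inner chords has been passed.\<close>

lemma not_after_last:
  assumes c: "c \<in> chd" "ins c" and f: "f \<in> faces" "f \<subseteq> side True" "ce (n - 1) \<subseteq> closure f" shows "\<not> after c f"
  using after_ce_arc[OF c(1) _ f(1) _ f(3)] c(2) f(2) lo_hi[OF c(1)] n_pos by auto

lemma not_after_zone:
  assumes "c \<in> chd" "f \<in> faces" "f \<subseteq> (if ins c then snd (zone c) else fst (zone c))" shows "\<not> after c f"
proof -
  have "fst (zone c) \<inter> snd (zone c) = {}" using zone[OF assms(1)] unfolding chord_zones_def by (elim conjE)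
  then show ?thesis using assms(3) face_props(2)[OF assms(2)] unfolding after_def by (auto split: if_splits)
qed

lemma chord_faces:
  assumes c: "c \<in> chd"
  shows "\<exists>f\<in>faces. f \<subseteq> side (ins c) \<and> c \<subseteq> closure f \<and> \<not> after c f" "\<exists>f\<in>faces. f \<subseteq> side (ins c) \<and> c \<subseteq> closure f \<and> after c f"
proof -
  let ?S = "fst (zone c)" and ?R = "snd (zone c)"
  have z: "?S \<subseteq> side (ins c)" "?R \<subseteq> side (ins c)" "\<exists>f\<in>faces. f \<subseteq> ?S \<and> c \<subseteq> closure f" "\<exists>f\<in>faces. f \<subseteq> ?R \<and> c \<subseteq> closure f"
    by (insert zone[OF c, unfolded chord_zones_def]; elim conjE; assumption)+
  obtain f g where f: "f \<in> faces" "f \<subseteq> ?S" "c \<subseteq> closure f" and g: "g \<in> faces" "g \<subseteq> ?R" "c \<subseteq> closure g" using z(3,4) by blast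
  have fs: "f \<subseteq> side (ins c)" "g \<subseteq> side (ins c)" using f(2) g(2) z(1,2) by auto
  show "\<exists>f\<in>faces. f \<subseteq> side (ins c) \<and> c \<subseteq> closure f \<and> \<not> after c f"
  proof (cases "ins c")
    case True then show ?thesis using not_after_zone[OF c g(1)] g fs by (intro bexI[OF _ g(1)]) simp
  next
    case False then show ?thesis using not_after_zone[OF c f(1)] f fs by (intro bexI[OF _ f(1)]) simp
  qed
  show "\<exists>f\<in>faces. f \<subseteq> side (ins c) \<and> c \<subseteq> closure f \<and> after c f"
  proof (cases "ins c")
    case True then show ?thesis using f fs by (intro bexI[OF _ f(1)]) (simp add: after_def)
  next
    case False then show ?thesis using g fs by (intro bexI[OF _ g(1)]) (simp add: after_def)
  qed
qed

text \<open>Faces with the same chords before them lie in the same zone of every chord on their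
  side, so \<open>same_faceI\<close> applies.\<close>

lemma face_eqI:
  assumes f: "f \<in> faces" "g \<in> faces" "f \<subseteq> side b" "g \<subseteq> side b"
    and a: "\<And>c. c \<in> chd \<Longrightarrow> ins c = b \<Longrightarrow> after c f \<longleftrightarrow> after c g"
  shows "f = g"
proof (rule same_faceI[OF f(1,2) side_comp[of b] f(3,4)])
  fix c assume c: "c \<in> chd" "c - rim \<subseteq> side b"
  then have b: "ins c = b" using chord_side(2)[OF c(1), of b] by simp
  let ?S = "fst (zone c)" and ?R = "snd (zone c)"
  have z: "connected ?S" "connected ?R" "?S \<subseteq> - (rim \<union> c)" "?R \<subseteq> - (rim \<union> c)"
    "\<forall>f\<in>faces. f \<subseteq> side (ins c) \<longrightarrow> f \<subseteq> ?S \<or> f \<subseteq> ?R"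
    by (insert zone[OF c(1), unfolded chord_zones_def]; elim conjE; assumption)+
  have fg: "f \<subseteq> ?S \<or> f \<subseteq> ?R" "g \<subseteq> ?S \<or> g \<subseteq> ?R" using z(5) f b by auto
  have nf: "\<not> (h \<subseteq> ?S \<and> h \<subseteq> ?R)" if "h \<in> faces" for h
    using not_after_zone[OF c(1) that] unfolding after_def by (cases "ins c") auto
  have "f \<subseteq> ?S \<and> g \<subseteq> ?S \<or> f \<subseteq> ?R \<and> g \<subseteq> ?R"
    using a[OF c(1) b] fg nf[OF f(1)] nf[OF f(2)] unfolding after_def by (cases "ins c") auto
  then show "\<exists>Q. connected Q \<and> Q \<subseteq> - (rim \<union> c) \<and> f \<subseteq> Q \<and> g \<subseteq> Q" using z(1-4) by blast
qed

lemma rim_face: "\<exists>f\<in>faces. f \<subseteq> side b \<and> ce i \<subseteq> closure f"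
proof -
  have "side b \<in> components (- \<Union>(range ce))" using side_comp unfolding rim_def .
  from cycle_face(1)[OF cycle_rim _ this, of "ce i"] show ?thesis by auto
qed

end

section \<open>A Hamiltonian cycle of the dual graph\<close>

context cut_graph
begin

text \<open>The edges crossed by the Hamiltonian cycle of the dual graph: apart from the chords
  these are the two edges of \<open>C\<close> between \<open>A\<close> and \<open>B\<close>.\<close>

definition dual_edges :: "complex set set" where "dual_edges = insert (ce (k - 1)) (insert (ce (n - 1)) chd)"

definition dual_rank :: "complex set \<Rightarrow> nat" where "dual_rank e = card {d \<in> dual_edges. key d \<le> key e}"

lemma dual_edges: "dual_edges \<subseteq> E" "finite dual_edges" "card dual_edges = card chd + 2"
proof -
  show "dual_edges \<subseteq> E" unfolding dual_edges_def using ce(1) chdE by blast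
  show "finite dual_edges" unfolding dual_edges_def using fin_chd by simp
  have "ce (k - 1) \<noteq> ce (n - 1)" using ce_eq[of "k - 1" "n - 1"] k by simp
  then show "card dual_edges = card chd + 2" unfolding dual_edges_def using fin_chd ce_not_chd by simp
qed

lemma dual_rank_le: "d \<in> dual_edges \<Longrightarrow> dual_rank d \<le> dual_rank e \<longleftrightarrow> key d \<le> key e"
  unfolding dual_rank_def by (rule rank_le_iff[OF dual_edges(2)])

lemma dual_rank_less: "d \<in> dual_edges \<Longrightarrow> dual_rank e < dual_rank d \<longleftrightarrow> key e < key d" using dual_rank_le[of d e] by auto

lemma dual_rank_pos: "d \<in> dual_edges \<Longrightarrow> 0 < dual_rank d"
  unfolding dual_rank_def using dual_edges(2) by (subst card_gt_0_iff) auto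

lemma in_dual_edges: "ce (k - 1) \<in> dual_edges" "ce (n - 1) \<in> dual_edges" "c \<in> chd \<Longrightarrow> c \<in> dual_edges" unfolding dual_edges_def by auto

lemma dual_rank_bij: "bij_betw dual_rank dual_edges {1..card dual_edges}"
proof -
  have inj: "inj_on dual_rank dual_edges"
  proof (rule inj_onI)
    fix d e assume d: "d \<in> dual_edges" "e \<in> dual_edges" "dual_rank d = dual_rank e"
    then have "key d = key e" using dual_rank_le[of d e] dual_rank_le[of e d] by auto
    then show "d = e" using key_inj dual_edges(1) d by (meson inj_onD subsetD)
  qed
  have sub: "dual_rank ` dual_edges \<subseteq> {1..card dual_edges}"
  proof
    fix j assume "j \<in> dual_rank ` dual_edges"
    then obtain d where d: "d \<in> dual_edges" "j = dual_rank d" by blast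
    have "dual_rank d \<le> card dual_edges" unfolding dual_rank_def using dual_edges(2) by (intro card_mono) auto
    then show "j \<in> {1..card dual_edges}" using dual_rank_pos[OF d(1)] d(2) by simp
  qed
  have "dual_rank ` dual_edges = {1..card dual_edges}" by (rule card_subset_eq[OF _ sub]) (simp_all add: card_image[OF inj])
  then show ?thesis using inj unfolding bij_betw_def by blast
qed

lemma dual_rank_last: "dual_rank (ce (n - 1)) = card dual_edges"
proof -
  have "key d \<le> key (ce (n - 1))" if "d \<in> dual_edges" for d
  proof (cases "d \<in> chd")
    case True then show ?thesis using key_le_chd_ce[OF True, of "n - 1"] lead_less[OF True] by auto
  next
    case False
    then have "d = ce (k - 1) \<or> d = ce (n - 1)" using that unfolding dual_edges_def by blast
    then show ?thesis using key_le_ce[of "k - 1" "n - 1"] k by auto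
  qed
  then have "{d \<in> dual_edges. key d \<le> key (ce (n - 1))} = dual_edges" by blast
  then show ?thesis unfolding dual_rank_def by simp
qed

text \<open>The \<open>j\<close>-th face of the strip: it lies inside the cycle until the edge \<open>v\<^bsub>k-1\<^esub> v\<^sub>k\<close> is passed, and it
  comes after exactly those chords of its side that are among the first \<open>j\<close> elements of \<open>dual_edges\<close>.\<close>

definition strip_face :: "complex set \<Rightarrow> nat \<Rightarrow> bool" where
  "strip_face f j \<longleftrightarrow> f \<in> faces \<and> f \<subseteq> side (j < dual_rank (ce (k - 1))) \<and>
     (\<forall>c\<in>chd. ins c = (j < dual_rank (ce (k - 1))) \<longrightarrow> (after c f \<longleftrightarrow> dual_rank c \<le> j))"

lemma strip_face_unique: assumes "strip_face f j" "strip_face g j" shows "f = g"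
proof (rule face_eqI[of f g "j < dual_rank (ce (k - 1))"])
  show "f \<in> faces" "g \<in> faces" "f \<subseteq> side (j < dual_rank (ce (k - 1)))" "g \<subseteq> side (j < dual_rank (ce (k - 1)))"
    using assms unfolding strip_face_def by blast+
  show "after c f = after c g" if "c \<in> chd" "ins c = (j < dual_rank (ce (k - 1)))" for c
    using assms that unfolding strip_face_def by simp
qed

lemma dual_rank_ins: assumes "c \<in> chd" shows "dual_rank c < dual_rank (ce (k - 1)) \<longleftrightarrow> ins c" "dual_rank c \<le> dual_rank (ce (k - 1)) \<longleftrightarrow> ins c"
proof -
  have a: "dual_rank c \<le> dual_rank (ce (k - 1)) \<longleftrightarrow> ins c"
    using dual_rank_le[OF in_dual_edges(3)[OF assms], of "ce (k - 1)"] key_le_chd_ce[OF assms, of "k - 1"] lead_ins[OF assms] k by auto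
  have "dual_rank (ce (k - 1)) \<le> dual_rank c \<longleftrightarrow> \<not> ins c"
    using dual_rank_le[OF in_dual_edges(1), of c] key_le_ce_chd[OF assms, of "k - 1"] lead_ins[OF assms] k by auto
  then show "dual_rank c < dual_rank (ce (k - 1)) \<longleftrightarrow> ins c" by auto
  show "dual_rank c \<le> dual_rank (ce (k - 1)) \<longleftrightarrow> ins c" by (rule a)
qed

lemma dual_rank_mid_last: "dual_rank (ce (k - 1)) < dual_rank (ce (n - 1))"
proof -
  have "k - 1 < n" "n - 1 < n" "\<not> n - 1 \<le> k - 1" using k by auto
  then show ?thesis using dual_rank_less[OF in_dual_edges(2), of "ce (k - 1)"] key_le_ce[of "n - 1" "k - 1"] by simp
qed

text \<open>Between the positions \<open>i\<close> and \<open>j\<close> the crossed edge of rank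
  \<open>i + 1\<close> has been passed. If it is \<open>ce (k - 1)\<close>, the side has changed,
  and if it is a chord, the face would lie on both sides of it; the edge \<open>ce (n - 1)\<close>
  is passed only at the end of the round.\<close>

lemma strip_face_distinct:
  assumes "strip_face f i" "strip_face f j" "i < j" "j < card dual_edges" shows False
proof -
  let ?K = "dual_rank (ce (k - 1))"
  have fs: "f \<in> faces" "f \<subseteq> side (i < ?K)" "f \<subseteq> side (j < ?K)"
    "\<forall>c\<in>chd. ins c = (i < ?K) \<longrightarrow> (after c f \<longleftrightarrow> dual_rank c \<le> i)" "\<forall>c\<in>chd. ins c = (j < ?K) \<longrightarrow> (after c f \<longleftrightarrow> dual_rank c \<le> j)"
    using assms(1,2) unfolding strip_face_def by blast+
  have same: "(i < ?K) = (j < ?K)"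
  proof (rule ccontr)
    assume "(i < ?K) \<noteq> (j < ?K)"
    then have "f \<subseteq> side True \<inter> side False" using fs(2,3) by (cases "i < ?K") auto
    then show False using side_disjoint face_props(2)[OF fs(1)] by simp
  qed
  have "Suc i \<in> {1..card dual_edges}" using assms(3,4) by auto
  then have "Suc i \<in> dual_rank ` dual_edges" using bij_betw_imp_surj_on[OF dual_rank_bij] by simp
  then obtain d where d: "d \<in> dual_edges" "dual_rank d = Suc i" by auto
  have "d \<noteq> ce (n - 1)" using d(2) dual_rank_last assms(3,4) by auto
  moreover have "d \<noteq> ce (k - 1)" using d(2) same assms(3) by auto
  ultimately have dc: "d \<in> chd" using d(1) unfolding dual_edges_def by blast
  have "ins d = (i < ?K)"
  proof (cases "i < ?K")
    case True then show ?thesis using dual_rank_ins(2)[OF dc] d(2) by auto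
  next
    case False then show ?thesis using dual_rank_ins(1)[OF dc] d(2) by auto
  qed
  then show False using fs(4,5) dc same d(2) assms(3) by auto
qed

text \<open>The faces on the two sides of a crossed edge are the strip faces before and after it: by
  \<open>after_chord\<close> and \<open>after_ce\<close> they come after exactly the chords of their
  side with smaller keys, up to the edge itself. The \<open>mod\<close> closes the round:
  \<open>ce (n - 1)\<close> is followed by face 0.\<close>

lemma strip_face_before_after:
  assumes e: "e \<in> dual_edges"
  shows "\<exists>f. strip_face f (dual_rank e - 1) \<and> e \<subseteq> closure f" "\<exists>f. strip_face f (dual_rank e mod card dual_edges) \<and> e \<subseteq> closure f"
proof -
  let ?K = "dual_rank (ce (k - 1))"
  have pos: "0 < dual_rank e" by (rule dual_rank_pos[OF e])
  have lt: "dual_rank c \<le> dual_rank e - 1 \<longleftrightarrow> key c < key e" if "c \<in> chd" for c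
  proof -
    have "dual_rank c \<le> dual_rank e - 1 \<longleftrightarrow> dual_rank c < dual_rank e" using pos by auto
    also have "\<dots> \<longleftrightarrow> key c < key e" by (rule dual_rank_less[OF e])
    finally show ?thesis .
  qed
  have le: "dual_rank c \<le> dual_rank e \<longleftrightarrow> key c \<le> key e" if "c \<in> chd" for c using dual_rank_le[OF in_dual_edges(3)[OF that]] .
  have "(\<exists>f. strip_face f (dual_rank e - 1) \<and> e \<subseteq> closure f) \<and> (\<exists>f. strip_face f (dual_rank e mod card dual_edges) \<and> e \<subseteq> closure f)"
  proof (cases "e \<in> chd")
    case True
    have "e \<noteq> ce (n - 1)" using True ce_not_chd by metis
    have "dual_rank e < card dual_edges"
      using dual_rank_less[OF in_dual_edges(2), of e] key_le_ce_chd[OF True, of "n - 1"] lead_less[OF True] dual_rank_last by auto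
    then have md: "dual_rank e mod card dual_edges = dual_rank e" by simp
    have k1: "(dual_rank e - 1 < ?K) = ins e" "(dual_rank e < ?K) = ins e" using dual_rank_ins[OF True] pos by auto
    obtain f where f: "f \<in> faces" "f \<subseteq> side (ins e)" "e \<subseteq> closure f" "\<not> after e f" using chord_faces(1)[OF True] by blast
    obtain g where g: "g \<in> faces" "g \<subseteq> side (ins e)" "e \<subseteq> closure g" "after e g" using chord_faces(2)[OF True] by blast
    have "strip_face f (dual_rank e - 1)" unfolding strip_face_def k1
    proof (intro conjI ballI impI f)
      fix c assume c: "c \<in> chd" "ins c = ins e"
      show "after c f = (dual_rank c \<le> dual_rank e - 1)"
      proof (cases "c = e")
        case True then show ?thesis using f(4) pos by simp
      next
        case False
        have "key c \<noteq> key e" using key_inj False chdE[OF c(1)] chdE[OF \<open>e \<in> chd\<close>] by (meson inj_onD)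
        then show ?thesis using after_chord[OF c(1) True _ _ f(1) _ f(3)] False c(2) f(2) lt[OF c(1)] by auto
      qed
    qed
    moreover have "strip_face g (dual_rank e)" unfolding strip_face_def k1
    proof (intro conjI ballI impI g)
      fix c assume c: "c \<in> chd" "ins c = ins e"
      show "after c g = (dual_rank c \<le> dual_rank e)"
      proof (cases "c = e")
        case True then show ?thesis using g(4) by simp
      next
        case False
        then show ?thesis using after_chord[OF c(1) True _ _ g(1) _ g(3)] c(2) g(2) le[OF c(1)] by auto
      qed
    qed
    ultimately show ?thesis using f(3) g(3) md by auto
  next
    case False
    then consider "e = ce (k - 1)" | "e = ce (n - 1)" using e unfolding dual_edges_def by blast
    then show ?thesis
    proof cases
      case 1
      have kn: "k - 1 < n" using k by simp
      have "dual_rank e < card dual_edges" using dual_rank_mid_last dual_rank_last 1 by simp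
      then have md: "dual_rank e mod card dual_edges = dual_rank e" by simp
      obtain f where f: "f \<in> faces" "f \<subseteq> side True" "ce (k - 1) \<subseteq> closure f" using rim_face by blast
      obtain g where g: "g \<in> faces" "g \<subseteq> side False" "ce (k - 1) \<subseteq> closure g" using rim_face by blast
      have k1: "(dual_rank e - 1 < ?K) = True" "(dual_rank e < ?K) = False" using pos 1 by auto
      have ne: "key c \<noteq> key e" if "c \<in> chd" for c
        using key_le_chd_ce[OF that kn] key_le_ce_chd[OF that kn] 1 by auto
      have "strip_face f (dual_rank e - 1)" unfolding strip_face_def k1
      proof (intro conjI ballI impI f(1,2))
        fix c assume c: "c \<in> chd" "ins c = True"
        show "after c f = (dual_rank c \<le> dual_rank e - 1)"
          using after_ce[OF c(1) kn _ f(1) _ f(3)] c(2) f(2) k lt[OF c(1)] ne[OF c(1)] 1 by auto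
      qed
      moreover have "strip_face g (dual_rank e)" unfolding strip_face_def k1
      proof (intro conjI ballI impI g(1,2))
        fix c assume c: "c \<in> chd" "ins c = False"
        show "after c g = (dual_rank c \<le> dual_rank e)"
          using after_ce[OF c(1) kn _ g(1) _ g(3)] c(2) g(2) k le[OF c(1)] 1 by auto
      qed
      ultimately show ?thesis using f(3) g(3) md 1 by auto
    next
      case 2
      have kn: "n - 1 < n" using n_pos by simp
      have md: "dual_rank e mod card dual_edges = 0" using dual_rank_last 2 by simp
      obtain f where f: "f \<in> faces" "f \<subseteq> side False" "ce (n - 1) \<subseteq> closure f" using rim_face by blast
      obtain g where g: "g \<in> faces" "g \<subseteq> side True" "ce (n - 1) \<subseteq> closure g" using rim_face by blast
      have k1: "(dual_rank e - 1 < ?K) = False" "(0 < ?K) = True" using dual_rank_mid_last dual_rank_pos[OF in_dual_edges(1)] 2 by auto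
      have ne: "key c \<noteq> key e" if "c \<in> chd" for c
        using key_le_chd_ce[OF that kn] key_le_ce_chd[OF that kn] 2 by auto
      have "strip_face f (dual_rank e - 1)" unfolding strip_face_def k1
      proof (intro conjI ballI impI f(1,2))
        fix c assume c: "c \<in> chd" "ins c = False"
        show "after c f = (dual_rank c \<le> dual_rank e - 1)"
          using after_ce[OF c(1) kn _ f(1) _ f(3)] c(2) f(2) k lt[OF c(1)] ne[OF c(1)] 2 by auto
      qed
      moreover have "strip_face g 0" unfolding strip_face_def k1
      proof (intro conjI ballI impI g(1,2))
        fix c assume c: "c \<in> chd" "ins c = True"
        have "\<not> after c g" using not_after_last[OF c(1) _ g] c(2) by simp
        then show "after c g = (dual_rank c \<le> 0)" using dual_rank_pos[OF in_dual_edges(3)[OF c(1)]] by simp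
      qed
      ultimately show ?thesis using f(3) g(3) md 2 by auto
    qed
  qed
  then show "\<exists>f. strip_face f (dual_rank e - 1) \<and> e \<subseteq> closure f" "\<exists>f. strip_face f (dual_rank e mod card dual_edges) \<and> e \<subseteq> closure f" by blast+
qed

text \<open>An edge of \<open>C\<close> that is not crossed touches the strip by the face on one of
  its sides only: inside if it joins vertices of \<open>A\<close>, outside if it joins vertices of
  \<open>B\<close>.\<close>

lemma strip_face_other:
  assumes e: "e \<in> E" "e \<notin> dual_edges" shows "\<exists>f. strip_face f (dual_rank e mod card dual_edges) \<and> e \<subseteq> closure f"
proof -
  let ?K = "dual_rank (ce (k - 1))"
  obtain i where i: "i < n" "e = ce i" using e(1) e(2) in_dual_edges(3) by (cases rule: edge_cases) auto
  have i': "i \<noteq> k - 1" "i \<noteq> n - 1" using e(2) in_dual_edges(1,2) i(2) by auto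
  have le: "dual_rank c \<le> dual_rank e \<longleftrightarrow> key c \<le> key e" if "c \<in> chd" for c using dual_rank_le[OF in_dual_edges(3)[OF that]] .
  have k1: "(dual_rank e < ?K) = (i < k)"
  proof -
    have "k - 1 < n" "k - 1 \<le> i \<longleftrightarrow> \<not> i < k" using k i' by auto
    then show ?thesis using dual_rank_less[OF in_dual_edges(1), of e] key_le_ce[of "k - 1" i] i by (simp add: not_le[symmetric])
  qed
  have "dual_rank e < card dual_edges" using dual_rank_less[OF in_dual_edges(2), of e] key_le_ce[of "n - 1" i] i i' dual_rank_last by auto
  then have md: "dual_rank e mod card dual_edges = dual_rank e" by simp
  obtain f where f: "f \<in> faces" "f \<subseteq> side (i < k)" "ce i \<subseteq> closure f" using rim_face by blast
  have "strip_face f (dual_rank e)" unfolding strip_face_def k1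
  proof (intro conjI ballI impI f(1,2))
    fix c assume c: "c \<in> chd" "ins c = (i < k)"
    show "after c f = (dual_rank c \<le> dual_rank e)"
      using after_ce[OF c(1) i(1) _ f(1) _ f(3)] c(2) f(2) le[OF c(1)] i(2) by (cases "i < k") auto
  qed
  then show ?thesis using f(3) md i(2) by auto
qed

text \<open>Sorting all edges by key gives the sequence for \<open>strip_from_sequence\<close>; the
  edges of \<open>C\<close> advance the vertex and the crossed edges advance the face.\<close>

theorem rhombic_strip: "has_rhombic_strip (plane_cells V E) cell_le cell_rank"
proof -
  let ?m = "card E" and ?\<phi> = "card dual_edges" and ?A = "ce ` {..<n}"
  have \<phi>2: "2 \<le> ?\<phi>" using dual_edges(3) by simp
  obtain x where x: "bij_betw x {..<?m} E" "\<And>i j. i < ?m \<Longrightarrow> j < ?m \<Longrightarrow> key (x i) \<le> key (x j) \<longleftrightarrow> i \<le> j"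
    by (rule sort_by_key[OF fin(2) key_inj]) (rule that; assumption)
  have xE: "x i \<in> E" if "i < ?m" for i using bij_betw_apply[OF x(1)] that by simp
  define ff where "ff j = (THE f. strip_face f j)" for j
  have ffI: "ff j = f" if "strip_face f j" for f j
    unfolding ff_def using that strip_face_unique by (intro the_equality) auto
  have ex: "strip_face (ff j) j" if "j < ?\<phi>" for j
  proof -
    have "Suc j \<in> {1..?\<phi>}" using that by auto
    then have "Suc j \<in> dual_rank ` dual_edges" using bij_betw_imp_surj_on[OF dual_rank_bij] by simp
    then obtain d where d: "d \<in> dual_edges" "dual_rank d = Suc j" by auto
    obtain f where "strip_face f (dual_rank d - 1)" using strip_face_before_after(1)[OF d(1)] by blast
    then show ?thesis using ffI d(2) by simp
  qed
  have inj: "inj_on ff {..<?\<phi>}"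
  proof (rule inj_onI)
    fix i j assume ij: "i \<in> {..<?\<phi>}" "j \<in> {..<?\<phi>}" "ff i = ff j"
    then have p: "strip_face (ff i) i" "strip_face (ff i) j" using ex[of i] ex[of j] by simp_all
    show "i = j" using strip_face_distinct[OF p] strip_face_distinct[OF p(2,1)] ij(1,2) by (cases i j rule: linorder_cases) auto
  qed
  have sub: "ff ` {..<?\<phi>} \<subseteq> faces" using ex unfolding strip_face_def by auto
  \<comment> \<open>There are \<open>card chd + 2\<close> distinct strip faces, and by
    \<open>card_faces_le\<close> no more faces than that.\<close>
  have fb: "bij_betw ff {..<?\<phi>} faces"
  proof -
    have "finite faces" "card faces \<le> ?\<phi>" using card_faces_le dual_edges(3) by simp_all
    moreover have "card (ff ` {..<?\<phi>}) = ?\<phi>" using card_image[OF inj] by simp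
    ultimately have "ff ` {..<?\<phi>} = faces" using sub by (intro card_seteq) auto
    then show ?thesis using inj unfolding bij_betw_def by blast
  qed
  have two: "\<exists>f\<in>faces. \<exists>g\<in>faces. f \<noteq> g"
  proof -
    have "ff 0 \<noteq> ff 1" using inj_onD[OF inj, of 0 1] \<phi>2 by auto
    moreover have "ff 0 \<in> faces" "ff 1 \<in> faces" using sub \<phi>2 by auto
    ultimately show ?thesis by blast
  qed
  have AE: "?A \<subseteq> E" using ce(1) by blast
  have cA: "card ?A = n" using card_image[OF ce_inj[of 0]] by (simp add: lessThan_atLeast0)
  have vb: "bij_betw vx {..<n} V" unfolding bij_betw_def using V_eq(1) vx_inj by (auto simp: inj_on_def)
  have hN: "hits x dual_edges (Suc i) = dual_rank (x i)" if "i < ?m" for i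
    unfolding dual_rank_def by (rule hits_sorted[OF x dual_edges(1) that])
  \<comment> \<open>A chord follows exactly the edges of \<open>C\<close> with index below its
    leading vertex, so the vertex counter stands at an end of the chord.\<close>
  have hA: "hits x ?A (Suc i) = (if x i \<in> chd then lead (x i) else Suc t)" if i: "i < ?m" and t: "x i \<notin> chd \<Longrightarrow> t < n \<and> x i = ce t" for i t
  proof -
    have inj2: "inj_on ce S" if "S \<subseteq> {..<n}" for S
      by (rule inj_on_subset[OF ce_inj[of 0]]) (use that in \<open>simp add: lessThan_atLeast0\<close>)
    have h: "hits x ?A (Suc i) = card {d \<in> ?A. key d \<le> key (x i)}" by (rule hits_sorted[OF x AE i])
    show ?thesis
    proof (cases "x i \<in> chd")
      case True
      have "{d \<in> ?A. key d \<le> key (x i)} = ce ` {..<lead (x i)}" using key_le_ce_chd[OF True] lead_less[OF True] by auto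
      then show ?thesis unfolding h using True card_image[OF inj2[of "{..<lead (x i)}"]] lead_less[OF True] by simp
    next
      case False
      have "{d \<in> ?A. key d \<le> key (x i)} = ce ` {..<Suc t}" using t[OF False] key_le_ce[of _ t] by auto
      moreover have "{..<Suc t} \<subseteq> {..<n}" using t[OF False] by auto
      ultimately show ?thesis unfolding h using False card_image[OF inj2[of "{..<Suc t}"]] by simp
    qed
  qed
  have vA: "vx (hits x ?A i mod n) \<in> x i \<and> vx (hits x ?A (Suc i) mod n) \<in> x i" if i: "i < ?m" for i
  proof (cases "x i \<in> chd")
    case True
    have "hits x ?A (Suc i) = lead (x i)" using hA[OF i, of 0] True by simp
    moreover have "x i \<notin> ?A" using True ce_not_chd by auto
    moreover have "vx (lead (x i)) \<in> x i" using lo_hi(4)[OF True] unfolding lead_def by auto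
    ultimately show ?thesis unfolding vx_mod hits_simps(2)[of x ?A i] by simp
  next
    case False
    have "\<exists>t<n. x i = ce t" by (rule edge_cases[OF xE[OF i]]) (use False in blast)+
    then obtain t where t: "t < n" "x i = ce t" by blast
    have "hits x ?A (Suc i) = Suc t" using hA[OF i, of t] False t by simp
    moreover have "x i \<in> ?A" using t by auto
    moreover have "vx t \<in> x i" "vx (Suc t) \<in> x i" using ce(2)[of t] t(2) by auto
    ultimately show ?thesis unfolding vx_mod hits_simps(2)[of x ?A i] by simp
  qed
  have fA: "x i \<subseteq> closure (ff (hits x dual_edges i mod ?\<phi>)) \<and> x i \<subseteq> closure (ff (hits x dual_edges (Suc i) mod ?\<phi>))" if i: "i < ?m" for i
  proof -
    note h = hN[OF i]
    show ?thesis
    proof (cases "x i \<in> dual_edges")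
      case True
      have h0: "hits x dual_edges i = dual_rank (x i) - 1" using h hits_simps(2)[of x dual_edges i] True by simp
      have lt: "dual_rank (x i) - 1 < ?\<phi>" using bij_betw_apply[OF dual_rank_bij True] by auto
      obtain f where f: "strip_face f (dual_rank (x i) - 1)" "x i \<subseteq> closure f" using strip_face_before_after(1)[OF True] by blast
      obtain g where g: "strip_face g (dual_rank (x i) mod ?\<phi>)" "x i \<subseteq> closure g" using strip_face_before_after(2)[OF True] by blast
      show ?thesis unfolding h h0 using f(2) g(2) ffI[OF f(1)] ffI[OF g(1)] lt by simp
    next
      case False
      have h0: "hits x dual_edges i = dual_rank (x i)" using h hits_simps(2)[of x dual_edges i] False by simp
      obtain g where g: "strip_face g (dual_rank (x i) mod ?\<phi>)" "x i \<subseteq> closure g" using strip_face_other[OF xE[OF i] False] by blast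
      show ?thesis unfolding h h0 using g(2) ffI[OF g(1)] by simp
    qed
  qed
  have m2: "2 \<le> ?m" "2 \<le> n"
  proof -
    have "n \<le> ?m" using card_mono[OF fin(2) AE] cA by simp
    then show "2 \<le> ?m" "2 \<le> n" using n3 by simp_all
  qed
  show ?thesis
    by (rule strip_from_sequence[OF pg two x(1) vb fb m2 \<phi>2, of ?A dual_edges])
      (simp_all only: hits_all[OF x(1) AE] hits_all[OF x(1) dual_edges(1)] cA vA fA)
qed

end

lemma hamiltonian_cycle_rotate:
  assumes "hamiltonian_cycle V E C" shows "hamiltonian_cycle V E (rotate k C)"
  unfolding hamiltonian_cycle_def
proof (intro conjI allI impI)
  have C: "3 \<le> length C" "distinct C" "set C = V" "\<And>i. i < length C \<Longrightarrow> adjacent V E (C ! i) (C ! (Suc i mod length C))"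
    using assms unfolding hamiltonian_cycle_def by auto
  show "3 \<le> length (rotate k C)" "distinct (rotate k C)" "set (rotate k C) = V" using C by simp_all
  fix i assume i: "i < length (rotate k C)"
  let ?n = "length C"
  have n: "0 < ?n" "i < ?n" using C(1) i by auto
  have "rotate k C ! i = C ! ((k + i) mod ?n)" using nth_rotate[of i C k] n by simp
  moreover have "rotate k C ! (Suc i mod ?n) = C ! (Suc ((k + i) mod ?n) mod ?n)"
    using nth_rotate[of "Suc i mod ?n" C k] n by (simp add: mod_simps)
  moreover have "adjacent V E (C ! ((k + i) mod ?n)) (C ! (Suc ((k + i) mod ?n) mod ?n))" by (rule C(4)) (use n in simp)
  ultimately show "adjacent V E (rotate k C ! i) (rotate k C ! (Suc i mod length (rotate k C)))" by simp
qed

theorem splittable_imp_rhombic_strip: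
  assumes pg: "plane_graph V E" and C: "hamiltonian_cycle V E C" and s: "splittable V E C"
  shows "has_rhombic_strip (plane_cells V E) cell_le cell_rank"
proof -
  obtain k A B where AB: "rotate k C = A @ B" "A \<noteq> []" "B \<noteq> []"
    "\<forall>e\<in>chords V E C. \<exists>a\<in>set A. \<exists>b\<in>set B. e \<inter> V = {a, b}" using s unfolding splittable_def by blast
  interpret C: ham_graph V E C using pg C by unfold_locales
  \<comment> \<open>The cycle is rotated so that \<open>A\<close> starts at index 0, as
    \<open>cut_graph\<close> demands.\<close>
  interpret R: ham_graph V E "A @ B" using pg hamiltonian_cycle_rotate[OF C, of k] AB(1) by unfold_locales simp_all
  have chd: "chords V E (A @ B) = chords V E C" using C.chords_rotate[of k] AB(1) by simp
  have n: "R.n = length A + length B" by (simp add: R.n_def)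
  have a: "\<exists>i<length A. a = R.vx i" if "a \<in> set A" for a
  proof -
    obtain i where "i < length A" "a = A ! i" using \<open>a \<in> set A\<close> by (auto simp: in_set_conv_nth)
    then show ?thesis by (intro exI[of _ i]) (simp add: R.vx_def n nth_append)
  qed
  have b: "\<exists>i\<in>{length A..<R.n}. b = R.vx i" if "b \<in> set B" for b
  proof -
    obtain i where "i < length B" "b = B ! i" using \<open>b \<in> set B\<close> by (auto simp: in_set_conv_nth)
    then show ?thesis by (intro bexI[of _ "length A + i"]) (simp_all add: R.vx_def n nth_append)
  qed
  interpret cut_graph V E "A @ B" "length A"
  proof unfold_locales
    show "0 < length A" "length A < R.n" using AB(2,3) n by simp_all
    show "\<exists>a<length A. \<exists>b\<in>{length A..<R.n}. c \<inter> V = {R.vx a, R.vx b}" if c: "c \<in> chords V E (A @ B)" for c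
    proof -
      obtain u w where "u \<in> set A" "w \<in> set B" "c \<inter> V = {u, w}" using AB(4) c chd by blast
      then show ?thesis using a[of u] b[of w] by blast
    qed
  qed
  show ?thesis by (rule rhombic_strip)
qed

section \<open>The characterisation\<close>

theorem theorem14:
  fixes V :: "complex set" and E :: "complex set set"
  assumes "plane_graph V E" and "two_connected V E"
  shows "(has_rhombic_strip (plane_cells V E) cell_le cell_rank \<longleftrightarrow>
            (\<exists>C. hamiltonian_cycle V E C \<and> (splittable V E C \<or> no_three_chords V E C))) \<and>
         (\<forall>C. hamiltonian_cycle V E C \<longrightarrow> (splittable V E C \<longleftrightarrow> no_three_chords V E C))"
proof -
  note pg = assms(1)
  have n: "card V > 2" using assms(2) by (simp add: two_connected_def)
  have eq: "splittable V E C \<longleftrightarrow> no_three_chords V E C" if "hamiltonian_cycle V E C" for C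
  proof -
    interpret ham_graph V E C using pg that by unfold_locales
    show ?thesis by (rule splittable_iff_no_three)
  qed
  show ?thesis using rhombic_strip_imp_splittable[OF pg n] splittable_imp_rhombic_strip[OF pg] eq by blast
qed

end
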